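(* Let $(u_h,\boldsymbol{\sigma}_h)\in V_h\times\boldsymbol{\Sigma}_h$ solve $$A_h(u_h,\boldsymbol{\sigma}_h;v_h,\boldsymbol{\tau}_h)=(f,v_h)_\Omega+\langle g,v_h\rangle_\Gamma\qquad\forall (v_h,\boldsymbol{\tau}_h)\in V_h\times\boldsymbol{\Sigma}_h,$$ and define $M(f,g):=\|f\|_{L^2(\Omega)}+\|g\|_{L^2(\Gamma)}$. Then the following stability estimates hold: $$\|u_h\|_{DG}\lesssim\gamma_1k^{-1}M(f,g),$$ $$\|\boldsymbol{\sigma}_h\|_{L^2(\Omega)}\lesssim\gamma_1k^{-1}\Bigl(1+(\delta+k^{-1})\bigl(\max_{K\in\mathcal{T}_h}h_K^{-1}\bigr)\Bigr)M(f,g).$$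
   Context: $A\lesssim B$ means $A\le CB$ with a constant $C>0$ independent of $h$ and $k$. Let $\Omega\subset\mathbb{R}^d$ ($d=2,3$) be a bounded domain with boundary $\Gamma=\partial\Omega$ and outward unit normal $\mathbf{n}_\Omega$, strictly star-shaped with respect to a point $x_\Omega\in\Omega$, i.e. there is $c_\Omega>0$ with $(x-x_\Omega)\cdot\mathbf{n}_\Omega\ge c_\Omega$ for all $x\in\partial\Omega$. $\mathcal{T}_h$ is a family of partitions of $\Omega$ into triangles/tetrahedra, parameterized by $h>0$ and satisfying the minimal angle condition; $h_K=\operatorname{diam}(K)$, $h=\max_{K}h_K$, $h_e=\operatorname{diam}(e)$ for an edge/face $e$; $\mathcal{E}_h^I$ is the set of interior edges/faces. $k>0$ is the wave number, $\beta,\delta>0$ are given penalty parameters (possibly chosen depending on the mesh), and $f\in L^2(\Omega)$, $g\in L^2(\Gamma)$. All functions are complex-valued. $(u,v)_\Omega=\int_\Omega u\bar v\,dx$, $\langle u,v\rangle_e=\int_e u\bar v\,ds$, $\langle u,v\rangle_\Gamma=\int_\Gamma u\bar v\,ds$ (with dot products for vector functions); $\mathbf{i}=\sqrt{-1}$. $\nabla_h$ is the piecewise gradient, $\nabla_h|_K=\nabla|_K$ for $K\in\mathcal{T}_h$. On an interior edge/face $e$ shared by $K_1,K_2$ with outward unit normals $\mathbf{n}_1,\mathbf{n}_2$: $\{v\}=\frac12(v_1+v_2)$ and $[[v]]=v_1\mathbf{n}_1+v_2\mathbf{n}_2$ for scalar $v$; $\{\mathbf{v}\}=\frac12(\mathbf{v}_1+\mathbf{v}_2)$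 and $[[\mathbf{v}]]=\mathbf{v}_1\cdot\mathbf{n}_1+\mathbf{v}_2\cdot\mathbf{n}_2$ for vector $\mathbf{v}$. $V_h$ is the space of (discontinuous) functions in $L^2(\Omega)$ whose real and imaginary parts restricted to each $K\in\mathcal{T}_h$ are polynomials of degree $\le 1$; $\boldsymbol{\Sigma}_h$ is the space of vector fields in $(L^2(\Omega))^d$ whose real and imaginary parts restricted to each $K$ lie in $(P_1(K))^d$. The sesquilinear form (LDG method #1) is $$A_h(w_h,\boldsymbol{\chi}_h;v_h,\boldsymbol{\tau}_h)=(\boldsymbol{\chi}_h,\nabla_h v_h)_\Omega-k^2(w_h,v_h)_\Omega+\mathbf{i}k\langle w_h,v_h\rangle_\Gamma-\sum_{e\in\mathcal{E}_h^I}\langle\{\nabla_h w_h\}-\mathbf{i}\beta[[w_h]],[[v_h]]\rangle_e$$ $$-\sum_{e\in\mathcal{E}_h^I}\Bigl(\mathbf{i}\delta\langle[[\nabla_h w_h]],[[\boldsymbol{\tau}_h]]\rangle_e-\langle[[w_h]],\{\boldsymbol{\tau}_h\}\rangle_e\Bigr)+(\boldsymbol{\chi}_h,\boldsymbol{\tau}_h)_\Omega-(\nabla_h w_h,\boldsymbol{\tau}_h)_\Omega.$$ Further, $$\gamma_1:=1+k+\sqrt{\frac{\beta}{\delta}}+\max_{e\in\mathcal{E}_h^I}\Bigl(\frac{k^2+1}{\beta h_e}+\frac{1}{h_e^2}+\frac{1}{\beta h_e^3}\Bigr),$$ $$\|w_h\|_{DG}:=\Bigl(k^2\|w_h\|_{L^2(\Omega)}^2+k^2\|w_h\|_{L^2(\Gamma)}^2+c_\Omega\|\nabla_h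 w_h\|_{L^2(\Gamma)}^2+\sum_{K\in\mathcal{T}_h}\|\nabla w_h\|_{L^2(K)}^2\Bigr)^{1/2}.$$ *)

theory Defs
  imports "HOL-Analysis.Analysis"
begin

section \<open>Domain\<close>

text \<open>
  The boundary of \<Omega> has a tangent hyperplane at x, with \<Omega> on the side opposite to n. On a
  polyhedral boundary such an n exists exactly at the points in the relative interior of a flat
  piece, so the inequality below is required wherever the normal is defined.
\<close>
definition outward_unit_normal :: "'a::euclidean_space set \<Rightarrow> 'a \<Rightarrow> 'a \<Rightarrow> bool" where
  "outward_unit_normal \<Omega> x n \<longleftrightarrow> norm n = 1 \<and>
     (\<forall>\<epsilon>>0. \<exists>r>0. \<forall>y\<in>ball x r.
        ((y - x) \<bullet> n < - \<epsilon> * norm (y - x) \<longrightarrow> y \<in> \<Omega>) \<and>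
        ((y - x) \<bullet> n > \<epsilon> * norm (y - x) \<longrightarrow> y \<notin> \<Omega>))"

definition strictly_star_shaped :: "'a::euclidean_space set \<Rightarrow> 'a \<Rightarrow> real \<Rightarrow> bool" where
  "strictly_star_shaped \<Omega> x0 c \<longleftrightarrow> x0 \<in> \<Omega> \<and> c > 0 \<and>
     (\<forall>x\<in>frontier \<Omega>. \<forall>n. outward_unit_normal \<Omega> x n \<longrightarrow> (x - x0) \<bullet> n \<ge> c)"


section \<open>Meshes\<close>

text \<open>
  Conforming simplicial meshes: the elements are closed simplices, and any two of them meet in a
  common (possibly empty) face. The condition on \<Omega> gives \<open>\<Union>\<T> = closure \<Omega>\<close> and in addition excludes slits.
\<close>
definition mesh_of :: "(real^'n) set \<Rightarrow> (real^'n) set set \<Rightarrow> bool" where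
  "mesh_of \<Omega> \<T> \<longleftrightarrow> triangulation \<T> \<and> (\<forall>K\<in>\<T>. int CARD('n) simplex K) \<and> \<Omega> = interior (\<Union>\<T>)"

definition mesh_size :: "'a::euclidean_space set set \<Rightarrow> real" where
  "mesh_size \<T> = Max (diameter ` \<T>)"

definition face_normal :: "'a::euclidean_space set \<Rightarrow> 'a set \<Rightarrow> 'a" where
  "face_normal K e = (THE n. norm n = 1 \<and> (\<forall>x\<in>e. \<forall>y\<in>K. (y - x) \<bullet> n \<le> 0))"

definition vec_angle :: "'a::euclidean_space \<Rightarrow> 'a \<Rightarrow> real" where
  "vec_angle u v = arccos (u \<bullet> v / (norm u * norm v))"

text \<open>
  All angles of the triangles, respectively all face angles and all dihedral angles of the
  tetrahedra, are at least \<theta>. For a triangle the dihedral angles are its ordinary angles.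
\<close>
definition min_angle_ge :: "real \<Rightarrow> 'a::euclidean_space set \<Rightarrow> bool" where
  "min_angle_ge \<theta> K \<longleftrightarrow>
     (\<forall>a b c. a extreme_point_of K \<and> b extreme_point_of K \<and> c extreme_point_of K \<and>
        a \<noteq> b \<and> a \<noteq> c \<and> b \<noteq> c \<longrightarrow> vec_angle (b - a) (c - a) \<ge> \<theta>) \<and>
     (\<forall>F G. F facet_of K \<and> G facet_of K \<and> F \<noteq> G \<longrightarrow>
        pi - vec_angle (face_normal K F) (face_normal K G) \<ge> \<theta>)"

definition minimal_angle_condition :: "'a::euclidean_space set set set \<Rightarrow> bool" where
  "minimal_angle_condition \<FF> \<longleftrightarrow> (\<exists>\<theta>>0. \<forall>\<T>\<in>\<FF>. \<forall>K\<in>\<T>. min_angle_ge \<theta> K)"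

definition adjacent :: "'a::euclidean_space set set \<Rightarrow> 'a set \<Rightarrow> 'a set set" where
  "adjacent \<T> e = {K\<in>\<T>. e facet_of K}"

definition interior_faces :: "'a::euclidean_space set set \<Rightarrow> 'a set set" where
  "interior_faces \<T> = {e. \<exists>K1\<in>\<T>. \<exists>K2\<in>\<T>. K1 \<noteq> K2 \<and> e facet_of K1 \<and> e facet_of K2}"

definition boundary_faces :: "'a::euclidean_space set \<Rightarrow> 'a set set \<Rightarrow> 'a set set" where
  "boundary_faces \<Omega> \<T> = {e. e \<subseteq> frontier \<Omega> \<and> (\<exists>K\<in>\<T>. e facet_of K)}"


section \<open>Integration\<close>

text \<open>
  The surface measure of a flat piece e of codimension one: the surface measure of \<open>A \<subseteq> e\<close> is the
  Lebesgue measure of the right prism of height 1 over A. Neither the sign of the unit normal nor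
  the base point matters. The completion lets every Lebesgue measurable function on e be measurable.
\<close>
definition surface_measure :: "'a::euclidean_space set \<Rightarrow> 'a measure" where
  "surface_measure e =
     (let n = (SOME n. norm n = 1 \<and> (\<forall>x\<in>e. \<forall>y\<in>e. (y - x) \<bullet> n = 0));
          a = (SOME a. a \<in> e)
      in completion (distr (restrict_space lborel {x + t *\<^sub>R n | x t. x \<in> e \<and> t \<in> {0..1}})
                           borel (\<lambda>y. y - ((y - a) \<bullet> n) *\<^sub>R n)))"

definition square_integrable :: "'a measure \<Rightarrow> ('a \<Rightarrow> 'b::euclidean_space) \<Rightarrow> bool" where
  "square_integrable M u \<longleftrightarrow> u \<in> borel_measurable M \<and> integrable M (\<lambda>x. (norm (u x))\<^sup>2)"

definition l2_norm :: "'a measure \<Rightarrow> ('a \<Rightarrow> 'b::euclidean_space) \<Rightarrow> real" where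
  "l2_norm M u = sqrt (LINT x|M. (norm (u x))\<^sup>2)"

definition ip :: "'a measure \<Rightarrow> ('a \<Rightarrow> complex) \<Rightarrow> ('a \<Rightarrow> complex) \<Rightarrow> complex" where
  "ip M u v = (LINT x|M. u x * cnj (v x))"

definition vip :: "'a measure \<Rightarrow> ('a \<Rightarrow> complex^'n) \<Rightarrow> ('a \<Rightarrow> complex^'n) \<Rightarrow> complex" where
  "vip M u v = (LINT x|M. (\<Sum>i\<in>UNIV. u x $ i * cnj (v x $ i)))"

text \<open>\<Gamma> is, up to a null set, the non-overlapping union of the boundary faces of the mesh.\<close>

definition square_integrable_\<Gamma> ::
    "'a::euclidean_space set \<Rightarrow> 'a set set \<Rightarrow> ('a \<Rightarrow> 'b::euclidean_space) \<Rightarrow> bool" where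
  "square_integrable_\<Gamma> \<Omega> \<T> u \<longleftrightarrow> (\<forall>e\<in>boundary_faces \<Omega> \<T>. square_integrable (surface_measure e) u)"

definition l2_norm_\<Gamma> ::
    "'a::euclidean_space set \<Rightarrow> 'a set set \<Rightarrow> ('a \<Rightarrow> 'b::euclidean_space) \<Rightarrow> real" where
  "l2_norm_\<Gamma> \<Omega> \<T> u = sqrt (\<Sum>e\<in>boundary_faces \<Omega> \<T>. (l2_norm (surface_measure e) u)\<^sup>2)"

definition ip_\<Gamma> ::
    "'a::euclidean_space set \<Rightarrow> 'a set set \<Rightarrow> ('a \<Rightarrow> complex) \<Rightarrow> ('a \<Rightarrow> complex) \<Rightarrow> complex" where
  "ip_\<Gamma> \<Omega> \<T> u v = (\<Sum>e\<in>boundary_faces \<Omega> \<T>. ip (surface_measure e) u v)"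


section \<open>Discontinuous piecewise linear functions\<close>

definition P1 :: "('a::euclidean_space \<Rightarrow> real) set" where
  "P1 = {p. \<exists>c b. \<forall>x. p x = c + b \<bullet> x}"

text \<open>
  Values on the element boundaries, a null set, are left unconstrained; membership in
  \<open>L\<^sup>2(\<Omega>)\<close> is then automatic.
\<close>
definition V_h :: "'a::euclidean_space set set \<Rightarrow> ('a \<Rightarrow> complex) set" where
  "V_h \<T> = {v. \<forall>K\<in>\<T>. \<exists>p\<in>P1. \<exists>q\<in>P1. \<forall>x\<in>interior K. Re (v x) = p x \<and> Im (v x) = q x}"

definition \<Sigma>_h :: "(real^'n) set set \<Rightarrow> (real^'n \<Rightarrow> complex^'n) set" where
  "\<Sigma>_h \<T> = {\<tau>. \<forall>i. (\<lambda>x. \<tau> x $ i) \<in> V_h \<T>}"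

text \<open>
  For a function in \<open>V_h \<T>\<close> this is the piecewise gradient: it agrees with the gradient of the
  affine piece on the interior of each element, and is irrelevant elsewhere.
\<close>
definition grad_h :: "(real^'n \<Rightarrow> complex) \<Rightarrow> real^'n \<Rightarrow> complex^'n" where
  "grad_h v x = (\<chi> i. frechet_derivative v (at x) (axis i 1))"

text \<open>
  The trace at a boundary point of an open set S, from inside S. It is used with S the interior of
  an element, and with \<open>S = \<Omega>\<close> for traces on \<Gamma>; the latter limit exists at all points in the
  relative interior of a boundary face, hence almost everywhere on \<Gamma>.
\<close>
definition bdry_trace :: "'a::euclidean_space set \<Rightarrow> ('a \<Rightarrow> 'b::euclidean_space) \<Rightarrow> 'a \<Rightarrow> 'b" where
  "bdry_trace S v x = Lim (at x within S) v"

text \<open>Averages and jumps are used on interior faces only, which have exactly two adjacent elements.\<close>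

definition avg ::
    "'a::euclidean_space set set \<Rightarrow> 'a set \<Rightarrow> ('a \<Rightarrow> 'b::euclidean_space) \<Rightarrow> 'a \<Rightarrow> 'b" where
  "avg \<T> e v x = (1/2) *\<^sub>R (\<Sum>K\<in>adjacent \<T> e. bdry_trace (interior K) v x)"

definition jump ::
    "(real^'n) set set \<Rightarrow> (real^'n) set \<Rightarrow> (real^'n \<Rightarrow> complex) \<Rightarrow> real^'n \<Rightarrow> complex^'n" where
  "jump \<T> e v x = (\<Sum>K\<in>adjacent \<T> e.
     (\<chi> i. bdry_trace (interior K) v x * of_real (face_normal K e $ i)))"

definition njump ::
    "(real^'n) set set \<Rightarrow> (real^'n) set \<Rightarrow> (real^'n \<Rightarrow> complex^'n) \<Rightarrow> real^'n \<Rightarrow> complex" where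
  "njump \<T> e \<tau> x = (\<Sum>K\<in>adjacent \<T> e.
     (\<Sum>i\<in>UNIV. bdry_trace (interior K) \<tau> x $ i * of_real (face_normal K e $ i)))"


section \<open>The LDG method\<close>

definition A_h :: "(real^'n) set \<Rightarrow> (real^'n) set set \<Rightarrow> real \<Rightarrow> real \<Rightarrow> real \<Rightarrow>
    (real^'n \<Rightarrow> complex) \<Rightarrow> (real^'n \<Rightarrow> complex^'n) \<Rightarrow>
    (real^'n \<Rightarrow> complex) \<Rightarrow> (real^'n \<Rightarrow> complex^'n) \<Rightarrow> complex" where
  "A_h \<Omega> \<T> k \<beta> \<delta> w \<chi>' v \<tau> =
     vip (lebesgue_on \<Omega>) \<chi>' (grad_h v)
     - of_real (k\<^sup>2) * ip (lebesgue_on \<Omega>) w v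
     + \<i> * of_real k * ip_\<Gamma> \<Omega> \<T> (bdry_trace \<Omega> w) (bdry_trace \<Omega> v)
     - (\<Sum>e\<in>interior_faces \<T>. vip (surface_measure e)
          (\<lambda>x. avg \<T> e (grad_h w) x - (\<i> * of_real \<beta>) *s jump \<T> e w x) (jump \<T> e v))
     - (\<Sum>e\<in>interior_faces \<T>.
          \<i> * of_real \<delta> * ip (surface_measure e) (njump \<T> e (grad_h w)) (njump \<T> e \<tau>)
          - vip (surface_measure e) (jump \<T> e w) (avg \<T> e \<tau>))
     + vip (lebesgue_on \<Omega>) \<chi>' \<tau>
     - vip (lebesgue_on \<Omega>) (grad_h w) \<tau>"

text \<open>All terms under the maximum are positive; inserting 0 only matters for one-element meshes.\<close>

definition \<gamma>\<^sub>1 :: "'a::euclidean_space set set \<Rightarrow> real \<Rightarrow> real \<Rightarrow> real \<Rightarrow> real" where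
  "\<gamma>\<^sub>1 \<T> k \<beta> \<delta> = 1 + k + sqrt (\<beta> / \<delta>) +
     Max (insert 0 ((\<lambda>e. (k\<^sup>2 + 1) / (\<beta> * diameter e) + 1 / (diameter e)\<^sup>2
                          + 1 / (\<beta> * (diameter e)^3)) ` interior_faces \<T>))"

definition DG_norm ::
    "(real^'n) set \<Rightarrow> real \<Rightarrow> (real^'n) set set \<Rightarrow> real \<Rightarrow> (real^'n \<Rightarrow> complex) \<Rightarrow> real" where
  "DG_norm \<Omega> c\<^sub>\<Omega> \<T> k w = sqrt (
     k\<^sup>2 * (l2_norm (lebesgue_on \<Omega>) w)\<^sup>2
     + k\<^sup>2 * (l2_norm_\<Gamma> \<Omega> \<T> (bdry_trace \<Omega> w))\<^sup>2
     + c\<^sub>\<Omega> * (l2_norm_\<Gamma> \<Omega> \<T> (bdry_trace \<Omega> (grad_h w)))\<^sup>2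
     + (\<Sum>K\<in>\<T>. (l2_norm (lebesgue_on K) (grad_h w))\<^sup>2))"

definition LDG_solution :: "(real^'n) set \<Rightarrow> (real^'n) set set \<Rightarrow> real \<Rightarrow> real \<Rightarrow> real \<Rightarrow>
    (real^'n \<Rightarrow> complex) \<Rightarrow> (real^'n \<Rightarrow> complex) \<Rightarrow>
    (real^'n \<Rightarrow> complex) \<Rightarrow> (real^'n \<Rightarrow> complex^'n) \<Rightarrow> bool" where
  "LDG_solution \<Omega> \<T> k \<beta> \<delta> f g u \<sigma> \<longleftrightarrow> u \<in> V_h \<T> \<and> \<sigma> \<in> \<Sigma>_h \<T> \<and>
     (\<forall>v\<in>V_h \<T>. \<forall>\<tau>\<in>\<Sigma>_h \<T>.
        A_h \<Omega> \<T> k \<beta> \<delta> u \<sigma> v \<tau> = ip (lebesgue_on \<Omega>) f v + ip_\<Gamma> \<Omega> \<T> g (bdry_trace \<Omega> v))"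

definition data_norm :: "(real^'n) set \<Rightarrow> (real^'n) set set \<Rightarrow>
    (real^'n \<Rightarrow> complex) \<Rightarrow> (real^'n \<Rightarrow> complex) \<Rightarrow> real" where
  "data_norm \<Omega> \<T> f g = l2_norm (lebesgue_on \<Omega>) f + l2_norm_\<Gamma> \<Omega> \<T> g"

end

theory Submission
  imports Defs
begin

text \<open>
  Testing with the flux \<open>- grad_h v\<close> eliminates \<open>\<sigma>\<close>. For \<open>v = u\<close> the imaginary part controls the boundary trace
  of \<open>u\<close> and the jumps of \<open>u\<close> and of its normal derivative by the data. For \<open>v(x) = grad_h u \<cdot> (x - x0)\<close>, which is again
  piecewise affine with the gradient of \<open>u\<close>, the real part together with the divergence theorem for
  \<open>|u|\<^sup>2 (x - x0)\<close> and \<open>|grad_h u|\<^sup>2 (x - x0)\<close> on each element is a Rellich identity. It bounds the full norm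
  of \<open>u\<close>, because \<open>(x - x0) \<cdot> n \<ge> c\<close> on the boundary; its face terms are absorbed by trace and inverse inequalities, up to
  jump terms that carry the factor \<open>\<gamma>\<^sub>1\<close>. The flux is then bounded by testing with \<open>(0, \<sigma>)\<close>.

  All functions are affine on simplices, so every integral over an element or a facet reduces to an
  explicit quadrature formula in the vertex values.
\<close>

section \<open>Rank-one perturbations of the identity\<close>

text \<open>The flux \<open>- grad_h v\<close> works because the two volume terms containing
  \<open>\<sigma>\<close> then cancel. The test function \<open>v\<close> of the Rellich step works
  because a piecewise affine \<open>u\<close> differs from it on each element by a constant only:
  \<open>v\<close> is admissible, has the same piecewise gradient, and the \<open>\<delta>\<close>
  term becomes purely imaginary. The obstacle is that jumps are controlled only by the data
  functional F(u), which is itself of order M / k times the unknown norm N. The estimate therefore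
  arrives as N^2 <= C (M^2 + t N) with t = \<open>\<gamma>\<^sub>1\<close> M / k, a quadratic
  inequality that closes because \<open>k \<le> \<gamma>\<^sub>1\<close> gives M <= t. The terms
  under the maximum in \<open>\<gamma>\<^sub>1\<close> answer the coefficients of the squared jump
  on a face after division by \<open>\<beta>\<close>. The angle condition enters only as a bound for
  \<open>norm (gr a) * diameter K\<close>, where \<open>gr a\<close> is the gradient of a
  barycentric coordinate: the trace and inverse inequalities have these gradients as their
  constants.\<close>

lemma det_rank_one:
  fixes g w :: "real^'n"
  shows "det (matrix (\<lambda>x. x + (g \<bullet> x) *\<^sub>R w)) = 1 + g \<bullet> w"
proof (cases "g = 0")
  case True
  then show ?thesis
    using matrix_id_mat_1 det_I by (metis (no_types, lifting) ext add.right_neutral add_0 inner_zero_left id_apply scaleR_zero_left)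
next
  case False
  obtain k :: 'n where True by blast
  \<comment> \<open>The orthogonal map takes a coordinate axis to the direction of \<open>g\<close>.
    In the new frame the map is the identity with one column replaced, and
    \<open>cramer_lemma\<close> reads off its determinant.\<close>
  obtain A where A: "orthogonal_matrix A" "A *v (axis k 1) = (1 / norm g) *\<^sub>R g"
    using orthogonal_matrix_exists_basis[of "(1 / norm g) *\<^sub>R g" k] False by auto
  let ?f = "\<lambda>x. x + (g \<bullet> x) *\<^sub>R w"
  let ?y = "axis k 1 + norm g *\<^sub>R (transpose A *v w)"
  have lin: "linear ?f"
    by (rule linearI) (auto simp: algebra_simps inner_simps)
  have AA: "transpose A ** A = mat 1" "A ** transpose A = mat 1"
    using A by (auto simp: orthogonal_matrix_def)
  have adj: "x \<bullet> (transpose A *v y) = (A *v x) \<bullet> y" for x y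
    by (simp add: transpose_matrix_vector inner_commute[of x] dot_lmul_matrix) (simp add: inner_commute)
  have gA: "g \<bullet> (A *v x) = norm g * x $ k" for x
  proof -
    have "g \<bullet> (A *v x) = norm g * ((A *v axis k 1) \<bullet> (A *v x))"
      using False by (simp add: A(2))
    also have "(A *v axis k 1) \<bullet> (A *v x) = axis k 1 \<bullet> (transpose A *v (A *v x))"
      by (simp only: adj)
    also have "\<dots> = x $ k"
      using AA by (simp add: matrix_vector_mul_assoc inner_axis')
    finally show ?thesis .
  qed
  have fx: "matrix ?f *v x = x + (g \<bullet> x) *\<^sub>R w" for x
    using lin by (simp add: matrix_works)
  have "(transpose A ** matrix ?f ** A) *v x = (\<chi> i j. if j = k then (mat 1 *v ?y) $ i else (mat 1 :: real^'n^'n) $ i $ j) *v x" for x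
  proof -
    have "(transpose A ** matrix ?f ** A) *v x = x + (norm g * x $ k) *\<^sub>R (transpose A *v w)"
      by (simp add: matrix_vector_mul_assoc[symmetric] fx gA matrix_vector_right_distrib
         matrix_vector_mult_scaleR) (simp only: matrix_vector_mul_assoc AA matrix_vector_mul_lid transpose_matrix_vector[symmetric])
    also have "\<dots> = (\<chi> i j. if j = k then ?y $ i else (mat 1 :: real^'n^'n) $ i $ j) *v x"
    proof (rule vec_eq_iff[THEN iffD2], rule allI)
      fix i
      have "(\<Sum>j\<in>UNIV. (if j = k then ?y $ i else if i = j then 1 else 0) * x $ j)
          = (\<Sum>j\<in>UNIV. (if j = k then norm g * (transpose A *v w) $ i * x $ k else 0) + (if i = j then x $ j else 0))"
        by (rule sum.cong) (auto simp: axis_def algebra_simps)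
      then show "(x + (norm g * x $ k) *\<^sub>R (transpose A *v w)) $ i
         = ((\<chi> i j. if j = k then ?y $ i else (mat 1 :: real^'n^'n) $ i $ j) *v x) $ i"
        by (simp add: matrix_vector_mult_def mat_def sum.distrib algebra_simps cong: if_cong)
    qed
    finally show ?thesis by (simp only: matrix_vector_mul_lid)
  qed
  then have eq: "transpose A ** matrix ?f ** A = (\<chi> i j. if j = k then (mat 1 *v ?y) $ i else (mat 1 :: real^'n^'n) $ i $ j)"
    by (simp add: matrix_eq)
  have "det (transpose A ** matrix ?f ** A) = ?y $ k"
    unfolding eq cramer_lemma by simp
  also have "?y $ k = 1 + g \<bullet> w"
  proof -
    have "(transpose A *v w) $ k = axis k 1 \<bullet> (transpose A *v w)"
      by (simp add: inner_axis')
    also have "\<dots> = (A *v axis k 1) \<bullet> w"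
      by (simp only: adj)
    finally show ?thesis using False by (simp add: A(2))
  qed
  moreover have "det (transpose A ** matrix ?f ** A) = det (matrix ?f)"
  proof -
    have "det (transpose A) * det A = 1" using AA(1) by (metis det_mul det_I)
    then show ?thesis by (simp add: det_mul mult.commute)
  qed
  ultimately show ?thesis by simp
qed

text \<open>\<open>lborel\<close> is determined by its values on boxes, and the preimage of a box is
  its image under the inverse map, whose determinant is known. The sort is that of
  \<open>measure_linear_image\<close>.\<close>

lemma lborel_rank_one_wellorder:
  fixes g w :: "real^'m::{finite,wellorder}"
  assumes nz: "1 + g \<bullet> w \<noteq> 0"
  shows "lborel = density (distr lborel borel (\<lambda>x. x + (g \<bullet> x) *\<^sub>R w)) (\<lambda>_. ennreal \<bar>1 + g \<bullet> w\<bar>)"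
proof (rule lborel_eqI)
  let ?T = "\<lambda>x. x + (g \<bullet> x) *\<^sub>R w"
  \<comment> \<open>The Sherman-Morrison inverse of \<open>?T\<close>.\<close>
  let ?S = "\<lambda>x. x + ((- (1 / (1 + g \<bullet> w)) *\<^sub>R g) \<bullet> x) *\<^sub>R w"
  fix l u :: "real^'m::_" assume le: "\<And>b. b \<in> Basis \<Longrightarrow> l \<bullet> b \<le> u \<bullet> b"
  have [measurable]: "?T \<in> borel \<rightarrow>\<^sub>M borel"
    by (intro borel_measurable_continuous_onI continuous_intros)
  have TS: "?T (?S x) = x" "?S (?T x) = x" for x
  proof -
    let ?c = "1 + g \<bullet> w"
    have "?T (?S x) = x + (- (1 / ?c) * (g \<bullet> x) + (g \<bullet> x + - (1 / ?c) * (g \<bullet> x) * (g \<bullet> w))) *\<^sub>R w"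
      by (simp only: inner_add_right inner_scaleR_left inner_scaleR_right scaleR_left_distrib add.assoc)
    also have "- (1 / ?c) * (g \<bullet> x) + (g \<bullet> x + - (1 / ?c) * (g \<bullet> x) * (g \<bullet> w)) = 0"
      using nz by (simp add: field_simps)
    finally show "?T (?S x) = x" by simp
    have "?S (?T x) = x + (g \<bullet> x + (- (1 / ?c) * (g \<bullet> x) + (g \<bullet> x) * (- (1 / ?c) * (g \<bullet> w)))) *\<^sub>R w"
      by (simp only: inner_add_right inner_scaleR_left inner_scaleR_right scaleR_left_distrib add.assoc)
    also have "g \<bullet> x + (- (1 / ?c) * (g \<bullet> x) + (g \<bullet> x) * (- (1 / ?c) * (g \<bullet> w))) = (g \<bullet> x) * (1 - (1 / ?c) * ?c)"
      by (simp only: right_diff_distrib distrib_left) simp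
    also have "\<dots> = 0" using nz by simp
    finally show "?S (?T x) = x" by simp
  qed
  have lin: "linear ?S" by (rule linearI) (auto simp: algebra_simps inner_simps)
  have pre: "?T -` box l u = ?S ` box l u"
  proof (intro set_eqI iffI)
    fix x assume "x \<in> ?T -` box l u"
    then show "x \<in> ?S ` box l u"
      using TS(2)[of x] by (intro image_eqI[of x ?S "?T x"]) (simp_all only: vimage_eq)
  next
    fix x assume "x \<in> ?S ` box l u"
    then obtain y where "x = ?S y" "y \<in> box l u" by blast
    then show "x \<in> ?T -` box l u" using TS(1)[of y] by (simp only: vimage_eq)
  qed
  have "?S ` box l u \<in> lmeasurable"
    by (intro measurable_linear_image lin) auto
  have "emeasure lborel (?T -` box l u) = emeasure lebesgue (?T -` box l u)"
    using measurable_sets[of ?T borel borel "box l u"] by (simp add: vimage_def)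
  also have "\<dots> = ennreal (measure lebesgue (?S ` box l u))"
    unfolding pre using \<open>?S ` box l u \<in> lmeasurable\<close> by (simp add: emeasure_eq_measure2)
  also have "measure lebesgue (?S ` box l u) = \<bar>det (matrix ?S)\<bar> * measure lebesgue (box l u)"
    by (intro measure_linear_image lin) auto
  also have "det (matrix ?S) = 1 / (1 + g \<bullet> w)"
    unfolding det_rank_one using nz by (simp add: field_simps)
  finally have "emeasure lborel (?T -` box l u) = ennreal (\<bar>1 / (1 + g \<bullet> w)\<bar> * measure lebesgue (box l u))" .
  then show "emeasure (density (distr lborel borel ?T) (\<lambda>_. ennreal \<bar>1 + g \<bullet> w\<bar>)) (box l u) = (\<Prod>b\<in>Basis. (u - l) \<bullet> b)"
    using nz le by (simp add: emeasure_density nn_integral_cmult emeasure_distr ennreal_mult'[symmetric])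
qed simp

text \<open>Relabelling coordinates takes boxes to boxes with the same side lengths. It serves to
  carry the rank-one formula from a well-ordered index type to an arbitrary one of the same
  size.\<close>

lemma lborel_reindex:
  fixes b :: "'m::finite \<Rightarrow> 'n::finite"
  assumes "bij b"
  shows "(lborel :: (real^'n) measure) = distr (lborel :: (real^'m) measure) borel (\<lambda>y. \<chi> i. y $ (inv b i))"
proof (rule lborel_eqI)
  let ?p = "\<lambda>y::real^'m. (\<chi> i. y $ (inv b i)) :: real^'n"
  fix l u :: "real^'n" assume le: "\<And>b. b \<in> Basis \<Longrightarrow> l \<bullet> b \<le> u \<bullet> b"
  then have le': "l $ i \<le> u $ i" for i
    by (metis axis_in_Basis_iff cart_eq_inner_axis insert_iff singleton_iff Basis_real_def)
  have [measurable]: "?p \<in> borel \<rightarrow>\<^sub>M borel"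
    by (intro borel_measurable_continuous_onI continuous_intros)
  have ib [simp]: "inv b (b j) = j" "b (inv b i) = i" for i j
    using assms by (auto simp: bij_def surj_f_inv_f)
  have pre: "?p -` box l u = box (\<chi> j. l $ b j) (\<chi> j. u $ b j)"
  proof -
    have "(\<forall>i. l $ i < x $ inv b i \<and> x $ inv b i < u $ i) \<longleftrightarrow> (\<forall>j. l $ b j < x $ j \<and> x $ j < u $ b j)" for x :: "real^'m"
      using ib by metis
    then show ?thesis by (auto simp: mem_box_cart)
  qed
  have prodB: "(\<Prod>b\<in>Basis. x \<bullet> b) = (\<Prod>i\<in>UNIV. x $ i)" for x :: "real^'k"
  proof -
    have "(\<Prod>b\<in>Basis. x \<bullet> b) = (\<Prod>b\<in>(\<lambda>i. axis i 1) ` UNIV. x \<bullet> b)"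
      by (rule prod.cong) (auto simp: Basis_vec_def)
    also have "\<dots> = (\<Prod>i\<in>UNIV. x $ i)"
      by (subst prod.reindex) (auto simp: inj_on_def axis_eq_axis inner_axis)
    finally show ?thesis .
  qed
  have "emeasure (distr lborel borel ?p) (box l u) = emeasure lborel (box ((\<chi> j. l $ b j) :: real^'m) (\<chi> j. u $ b j))"
    by (simp add: emeasure_distr pre)
  also have "\<dots> = (\<Prod>i\<in>UNIV. u $ b i - l $ b i)"
  proof -
    let ?l = "(\<chi> j. l $ b j) :: real^'m" and ?u = "(\<chi> j. u $ b j) :: real^'m"
    have "?l \<bullet> i \<le> ?u \<bullet> i" if i: "i \<in> Basis" for i
    proof -
      obtain k where "i = axis k 1" using i by (auto simp: Basis_vec_def)
      then show ?thesis using le' by (simp add: inner_axis)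
    qed
    then have "emeasure lborel (box ?l ?u) = (\<Prod>i\<in>Basis. (?u - ?l) \<bullet> i)"
      by (rule emeasure_lborel_box)
    then show ?thesis unfolding prodB by simp
  qed
  also have "(\<Prod>i\<in>UNIV. u $ b i - l $ b i) = (\<Prod>i\<in>UNIV. u $ i - l $ i)"
    using assms by (intro prod.reindex_bij_betw) auto
  also have "\<dots> = (\<Prod>b\<in>Basis. (u - l) \<bullet> b)"
    by (simp add: prodB)
  finally show "emeasure (distr lborel borel ?p) (box l u) = (\<Prod>b\<in>Basis. (u - l) \<bullet> b)" .
qed simp

lemma lborel_rank_one_reindex:
  fixes g w :: "real^'n" and b :: "'m::{finite,wellorder} \<Rightarrow> 'n::finite"
  assumes b: "bij b" and nz: "1 + g \<bullet> w \<noteq> 0"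
  shows "lborel = density (distr lborel borel (\<lambda>x. x + (g \<bullet> x) *\<^sub>R w)) (\<lambda>_. ennreal \<bar>1 + g \<bullet> w\<bar>)"
proof -
  let ?p = "\<lambda>y::real^'m::_. (\<chi> i. y $ (inv b i)) :: real^'n"
  let ?q = "\<lambda>y::real^'n. (\<chi> i. y $ (b i)) :: real^'m::_"
  let ?T = "\<lambda>x. x + (g \<bullet> x) *\<^sub>R w" and ?U = "\<lambda>x. x + (?q g \<bullet> x) *\<^sub>R ?q w"
  have [simp]: "inv b (b j) = j" "b (inv b i) = i" for i j
    using b by (auto simp: bij_def surj_f_inv_f)
  have [measurable]: "?p \<in> borel \<rightarrow>\<^sub>M borel" "?T \<in> borel \<rightarrow>\<^sub>M borel" "?U \<in> borel \<rightarrow>\<^sub>M borel"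
    by (intro borel_measurable_continuous_onI continuous_intros)+
  have qi: "?q x \<bullet> y = x \<bullet> ?p y" for x y
  proof -
    have "(\<Sum>i\<in>UNIV. x $ b i * y $ i) = (\<Sum>i\<in>UNIV. x $ b i * y $ inv b (b i))" by simp
    also have "\<dots> = (\<Sum>i\<in>UNIV. x $ i * y $ inv b i)"
      using b by (intro sum.reindex_bij_betw[of b UNIV UNIV "\<lambda>i. x $ i * y $ inv b i"]) auto
    finally show ?thesis by (simp add: inner_vec_def)
  qed
  have pq: "?p (?q x) = x" for x by (simp add: vec_eq_iff)
  have c: "?q g \<bullet> ?q w = g \<bullet> w" by (simp add: qi pq)
  have pU: "?p (?U y) = ?T (?p y)" for y
    by (simp add: qi vec_eq_iff)
  have "density (distr lborel borel ?T) (\<lambda>_. ennreal \<bar>1 + g \<bullet> w\<bar>) =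
      density (distr (distr lborel borel ?p) borel ?T) (\<lambda>_. ennreal \<bar>1 + g \<bullet> w\<bar>)"
    by (subst lborel_reindex[OF b]) simp
  also have "distr (distr lborel borel ?p) borel ?T = distr (distr lborel borel ?U) borel ?p"
  proof -
    have "?T \<circ> ?p = ?p \<circ> ?U" using pU by (auto simp: fun_eq_iff)
    then show ?thesis by (simp add: distr_distr)
  qed
  also have "density (distr (distr lborel borel ?U) borel ?p) (\<lambda>_. ennreal \<bar>1 + g \<bullet> w\<bar>)
     = distr (density (distr lborel borel ?U) (\<lambda>_. ennreal \<bar>1 + g \<bullet> w\<bar>)) borel ?p"
    by (subst density_distr) auto
  also have "\<dots> = distr lborel borel ?p"
    using lborel_rank_one_wellorder[of "?q g" "?q w"] nz by (simp add: c)
  also have "\<dots> = lborel" by (rule lborel_reindex[OF b, symmetric])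
  finally show ?thesis by simp
qed

text \<open>The numeral types \<open>2\<close> and \<open>3\<close> provide the well-ordered index
  type; it is here that the dimension enters the integration theory.\<close>

lemma lborel_rank_one:
  fixes g w :: "real^'n"
  assumes card: "CARD('n) = 2 \<or> CARD('n) = 3" and nz: "1 + g \<bullet> w \<noteq> 0"
  shows "lborel = density (distr lborel borel (\<lambda>x. x + (g \<bullet> x) *\<^sub>R w)) (\<lambda>_. ennreal \<bar>1 + g \<bullet> w\<bar>)"
  using card
proof
  assume "CARD('n) = 2"
  then obtain b :: "2 \<Rightarrow> 'n" where "bij b"
    using finite_same_card_bij[of "UNIV :: 2 set" "UNIV :: 'n set"] by auto
  then show ?thesis using lborel_rank_one_reindex nz by blast
next
  assume "CARD('n) = 3"
  then obtain b :: "3 \<Rightarrow> 'n" where "bij b"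
    using finite_same_card_bij[of "UNIV :: 3 set" "UNIV :: 'n set"] by auto
  then show ?thesis using lborel_rank_one_reindex nz by blast
qed

text \<open>The change of variables behind both the quadrature and the prism volume: points slide
  along a fixed direction \<open>w\<close> by an affine amount. The constant \<open>c\<close> is a
  translation and leaves the Jacobian alone.\<close>

lemma integral_rank_one_affine:
  fixes g w :: "real^'n" and \<phi> :: "real^'n \<Rightarrow> real"
  assumes card: "CARD('n) = 2 \<or> CARD('n) = 3" and nz: "1 + g \<bullet> w \<noteq> 0"
    and [measurable]: "\<phi> \<in> borel_measurable borel"
  shows "(LINT x|lborel. \<phi> x) = \<bar>1 + g \<bullet> w\<bar> * (LINT x|lborel. \<phi> (x + (c + g \<bullet> x) *\<^sub>R w))"
proof -
  let ?T = "\<lambda>x. x + (g \<bullet> x) *\<^sub>R w"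
  have [measurable]: "?T \<in> borel \<rightarrow>\<^sub>M borel"
    by (intro borel_measurable_continuous_onI continuous_intros)
  have "(LINT x|lborel. \<phi> x) = (LINT x|lborel. \<phi> (c *\<^sub>R w + x))"
    by (subst lborel_distr_plus[symmetric, of "c *\<^sub>R w"], subst integral_distr) auto
  also have "\<dots> = (LINT x|density (distr lborel borel ?T) (\<lambda>_. ennreal \<bar>1 + g \<bullet> w\<bar>). \<phi> (c *\<^sub>R w + x))"
    using lborel_rank_one[OF card nz] by metis
  also have "\<dots> = \<bar>1 + g \<bullet> w\<bar> * (LINT x|lborel. \<phi> (c *\<^sub>R w + ?T x))"
    by (subst integral_density) (auto simp: integral_distr)
  finally show ?thesis by (simp add: algebra_simps)
qed

section \<open>Barycentric coordinates\<close>

locale simplex_vertices =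
  fixes C :: "(real^'n) set"
  assumes aff: "\<not> affine_dependent C" and card_C: "card C = Suc CARD('n)"
begin

lemma finite_C [simp]: "finite C"
proof (rule ccontr)
  assume "infinite C"
  then have "card C = 0" by simp
  then show False using card_C by simp
qed

text \<open>By affine independence the other vertices span a hyperplane that misses
  \<open>a\<close>; an affine function vanishing on it is rescaled to be 1 at \<open>a\<close>. The
  pair consists of its constant and its gradient.\<close>

lemma lam_ex:
  assumes a: "a \<in> C"
  shows "\<exists>p :: real \<times> (real^'n). \<forall>b\<in>C. fst p + snd p \<bullet> b = (if b = a then 1 else 0)"
proof -
  have "\<not> affine_dependent (C - {a})"
    using aff by (meson Diff_subset affine_independent_subset)
  then have "aff_dim (C - {a}) = DIM(real^'n) - 1"
    using aff_dim_affine_independent[of "C - {a}"] card_C a by simp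
  then obtain g d where g: "g \<noteq> 0" "affine hull (C - {a}) = {x. g \<bullet> x = d}"
    using aff_dim_eq_hyperplane[of "C - {a}"] by blast
  have "a \<notin> affine hull (C - {a})"
    using aff a by (auto simp: affine_dependent_def)
  then have na: "g \<bullet> a - d \<noteq> 0" using g by auto
  have "g \<bullet> b = d" if "b \<in> C" "b \<noteq> a" for b
    using g hull_subset[of "C - {a}" affine] that by blast
  moreover have "- d / (g \<bullet> a - d) + (1 / (g \<bullet> a - d)) * (g \<bullet> a) = 1"
  proof -
    have "- d / (g \<bullet> a - d) + (1 / (g \<bullet> a - d)) * (g \<bullet> a) = (g \<bullet> a - d) / (g \<bullet> a - d)"
      by (simp only: diff_divide_distrib) simp
    then show ?thesis using na by simp
  qed
  ultimately have "\<forall>b\<in>C. - d / (g \<bullet> a - d) + ((1 / (g \<bullet> a - d)) *\<^sub>R g) \<bullet> b = (if b = a then 1 else 0)"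
    by simp
  then show ?thesis by (intro exI[of _ "(- d / (g \<bullet> a - d), (1 / (g \<bullet> a - d)) *\<^sub>R g)"]) simp
qed

definition coef :: "real^'n \<Rightarrow> real \<times> (real^'n)" where
  "coef a = (SOME p. \<forall>b\<in>C. fst p + snd p \<bullet> b = (if b = a then 1 else 0))"

definition gr :: "real^'n \<Rightarrow> real^'n" where "gr a = snd (coef a)"

text \<open>The barycentric coordinate of the vertex \<open>a\<close>, extended to the whole space
  as an affine function with gradient \<open>gr a\<close>.\<close>

definition lam :: "real^'n \<Rightarrow> real^'n \<Rightarrow> real" where "lam a x = fst (coef a) + gr a \<bullet> x"

lemma lam_vertex:
  assumes "a \<in> C" "b \<in> C" shows "lam a b = (if b = a then 1 else 0)"
proof -
  have "\<forall>b\<in>C. fst (coef a) + snd (coef a) \<bullet> b = (if b = a then 1 else 0)"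
    unfolding coef_def by (rule someI_ex) (rule lam_ex[OF assms(1)])
  then show ?thesis using assms(2) unfolding lam_def gr_def by blast
qed

lemma lam_diff: "lam a x - lam a y = gr a \<bullet> (x - y)"
  by (simp add: lam_def inner_diff_right)

lemma lam_add: "lam a (x + v) = lam a x + gr a \<bullet> v"
  by (simp add: lam_def inner_add_right)

lemma lam_barycentre:
  assumes "sum u S = 1" "finite S"
  shows "lam a (\<Sum>b\<in>S. u b *\<^sub>R b) = (\<Sum>b\<in>S. u b * lam a b)"
proof -
  have "lam a (\<Sum>b\<in>S. u b *\<^sub>R b) = fst (coef a) * sum u S + (\<Sum>b\<in>S. u b * (gr a \<bullet> b))"
    using assms by (simp add: lam_def inner_sum_right)
  then show ?thesis
    by (simp add: lam_def sum_distrib_right sum.distrib distrib_left mult.commute)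
qed

lemma affine_hull_C: "affine hull C = UNIV"
proof -
  have "aff_dim C = DIM(real^'n)"
    using aff_dim_affine_independent[OF aff] card_C by simp
  then show ?thesis using aff_dim_eq_full by blast
qed

lemma barycentric:
  shows "(\<Sum>a\<in>C. lam a x) = 1" and "(\<Sum>a\<in>C. lam a x *\<^sub>R a) = x"
proof -
  have "x \<in> affine hull C" by (simp add: affine_hull_C)
  then obtain u where u: "sum u C = 1" "(\<Sum>v\<in>C. u v *\<^sub>R v) = x"
    by (auto simp: affine_hull_finite)
  have "lam a x = u a" if "a \<in> C" for a
  proof -
    have "lam a x = (\<Sum>b\<in>C. u b * lam a b)" using lam_barycentre[OF u(1)] u(2) by simp
    also have "\<dots> = (\<Sum>b\<in>C. if b = a then u b else 0)"
      using that by (intro sum.cong) (auto simp: lam_vertex)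
    finally show ?thesis using that by simp
  qed
  then show "(\<Sum>a\<in>C. lam a x) = 1" "(\<Sum>a\<in>C. lam a x *\<^sub>R a) = x"
    using u by simp_all
qed

lemma sum_gr_inner: "(\<Sum>a\<in>C. gr a \<bullet> v) = 0"
proof -
  have "(\<Sum>a\<in>C. gr a \<bullet> v) = (\<Sum>a\<in>C. lam a v - lam a 0)"
    by (simp add: lam_def)
  then show ?thesis using barycentric(1) by (simp add: sum_subtractf)
qed

lemma sum_gr: "(\<Sum>a\<in>C. gr a) = 0"
proof -
  have "(\<Sum>a\<in>C. gr a) \<bullet> (\<Sum>a\<in>C. gr a) = 0"
    by (subst inner_sum_left) (rule sum_gr_inner)
  then show ?thesis by (simp only: inner_eq_zero_iff)
qed

lemma gr_expand: "(\<Sum>a\<in>C. (gr a \<bullet> v) *\<^sub>R a) = v"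
proof -
  have "(\<Sum>a\<in>C. (gr a \<bullet> v) *\<^sub>R a) = (\<Sum>a\<in>C. lam a v *\<^sub>R a - lam a 0 *\<^sub>R a)"
    by (intro sum.cong) (simp_all add: lam_def scaleR_left_distrib)
  then show ?thesis using barycentric(2) by (simp add: sum_subtractf)
qed

lemma gr_vertex_diff: "a \<in> C \<Longrightarrow> b \<in> C \<Longrightarrow> c \<in> C \<Longrightarrow>
    gr a \<bullet> (b - c) = (if b = a then 1 else 0) - (if c = a then 1 else 0)"
  by (simp only: lam_diff[symmetric] lam_vertex)

lemma other_vertex:
  assumes "a \<in> C" obtains b where "b \<in> C" "b \<noteq> a"
proof -
  have "card (C - {a}) = CARD('n)" using assms card_C by simp
  then have "C - {a} \<noteq> {}" by (metis card.empty zero_less_card_finite less_irrefl)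
  then show ?thesis using that by blast
qed

lemma gr_nonzero: "a \<in> C \<Longrightarrow> gr a \<noteq> 0"
proof
  assume a: "a \<in> C" "gr a = 0"
  obtain b where "b \<in> C" "b \<noteq> a" using other_vertex a(1) by blast
  then show False using gr_vertex_diff[OF a(1) a(1), of b] a by simp
qed

lemma hull_eq: "convex hull C = {x. \<forall>a\<in>C. lam a x \<ge> 0}"
proof (intro set_eqI iffI)
  fix x assume "x \<in> convex hull C"
  then obtain u where u: "\<forall>a\<in>C. 0 \<le> u a" "sum u C = 1" "(\<Sum>a\<in>C. u a *\<^sub>R a) = x"
    by (auto simp: convex_hull_finite)
  show "x \<in> {x. \<forall>a\<in>C. lam a x \<ge> 0}"
    using u lam_barycentre[OF u(2)] by (auto simp: lam_vertex intro!: sum_nonneg)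
next
  fix x assume "x \<in> {x. \<forall>a\<in>C. lam a x \<ge> 0}"
  then show "x \<in> convex hull C"
    using barycentric[of x] by (auto simp: convex_hull_finite intro!: exI[of _ "\<lambda>a. lam a x"])
qed

lemma facet_eq:
  assumes a: "a \<in> C"
  shows "convex hull (C - {a}) = {x. lam a x = 0 \<and> (\<forall>b\<in>C. lam b x \<ge> 0)}"
proof (intro set_eqI iffI)
  fix x assume "x \<in> convex hull (C - {a})"
  then obtain u where u: "\<forall>b\<in>C-{a}. 0 \<le> u b" "sum u (C-{a}) = 1" "(\<Sum>b\<in>C-{a}. u b *\<^sub>R b) = x"
    by (auto simp: convex_hull_finite)
  show "x \<in> {x. lam a x = 0 \<and> (\<forall>b\<in>C. lam b x \<ge> 0)}"
    using u(1) lam_barycentre[OF u(2)] a unfolding u(3)[symmetric]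
    by (auto simp: lam_vertex intro!: sum_nonneg sum.neutral mult_nonneg_nonneg)
next
  fix x assume "x \<in> {x. lam a x = 0 \<and> (\<forall>b\<in>C. lam b x \<ge> 0)}"
  then have x: "lam a x = 0" "\<forall>b\<in>C. lam b x \<ge> 0" by auto
  have "(\<Sum>b\<in>C-{a}. lam b x) = 1" "(\<Sum>b\<in>C-{a}. lam b x *\<^sub>R b) = x"
    using barycentric[of x] a x by (simp_all add: sum.remove[OF finite_C a])
  then show "x \<in> convex hull (C - {a})"
    using x by (auto simp: convex_hull_finite intro!: exI[of _ "\<lambda>a. lam a x"])
qed

lemma continuous_lam [continuous_intros]: "continuous_on S (lam a)"
proof -
  have "continuous_on S (\<lambda>x. fst (coef a) + gr a \<bullet> x)" by (intro continuous_intros)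
  moreover have "lam a = (\<lambda>x. fst (coef a) + gr a \<bullet> x)" by (rule ext) (rule lam_def)
  ultimately show ?thesis by (simp only:)
qed

lemma interior_hull: "interior (convex hull C) = {x. \<forall>a\<in>C. lam a x > 0}"
proof (rule interior_unique)
  show "{x. \<forall>a\<in>C. lam a x > 0} \<subseteq> convex hull C"
    by (auto simp: hull_eq intro: less_imp_le)
  have "{x. \<forall>a\<in>C. lam a x > 0} = (\<Inter>a\<in>C. {x. lam a x > 0})" by auto
  also have "open \<dots>"
    by (intro open_INT finite_C ballI open_Collect_less continuous_intros continuous_lam)
  finally show "open {x. \<forall>a\<in>C. lam a x > 0}" .
  fix T assume T: "T \<subseteq> convex hull C" "open T"
  show "T \<subseteq> {x. \<forall>a\<in>C. lam a x > 0}"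
  proof (clarsimp, rule ccontr)
    fix x a assume xa: "x \<in> T" "a \<in> C" "\<not> lam a x > 0"
    obtain e where e: "e > 0" "ball x e \<subseteq> T" using T xa open_contains_ball by blast
    \<comment> \<open>A point of the open set with a nonpositive coordinate would leave the hull
      when pushed slightly against the gradient of that coordinate.\<close>
    let ?y = "x - (e / 2 / norm (gr a)) *\<^sub>R gr a"
    have ng: "norm (gr a) > 0" using gr_nonzero xa by simp
    have "?y \<in> ball x e" using e ng by (simp add: dist_norm)
    then have "lam a ?y \<ge> 0" using e T hull_eq xa by blast
    moreover have "lam a ?y = lam a x - (e / 2 / norm (gr a)) * (gr a \<bullet> gr a)"
      by (simp add: lam_def inner_diff_right)
    moreover have "(e / 2 / norm (gr a)) * (gr a \<bullet> gr a) > 0" using e ng by (simp add: gr_nonzero xa)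
    ultimately show False using xa by linarith
  qed
qed

lemma interior_hull_nonempty: "interior (convex hull C) \<noteq> {}"
proof -
  let ?N = "real (card C)"
  have N: "?N > 0" using card_C by simp
  let ?x = "\<Sum>b\<in>C. (1 / ?N) *\<^sub>R b"
  have "lam a ?x = 1 / ?N" if "a \<in> C" for a
  proof -
    have "lam a ?x = (\<Sum>b\<in>C. 1 / ?N * lam a b)" using N by (intro lam_barycentre) auto
    also have "\<dots> = (\<Sum>b\<in>C. if b = a then 1 / ?N else 0)"
      using that by (intro sum.cong) (auto simp: lam_vertex)
    finally show ?thesis using that by simp
  qed
  then have "?x \<in> interior (convex hull C)" using N by (simp add: interior_hull)
  then show ?thesis by blast
qed

lemma closure_interior_hull: "closure (interior (convex hull C)) = convex hull C"
proof -
  have "closed (convex hull C)" by (simp add: compact_imp_closed finite_imp_compact_convex_hull)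
  then show ?thesis
    using convex_closure_interior[OF convex_convex_hull interior_hull_nonempty] by (simp only: closure_closed)
qed

lemma compact_hull: "compact (convex hull C)"
  by (simp add: finite_imp_compact_convex_hull)

text \<open>Uniqueness of the normal direction of the facet opposite \<open>a\<close>: expanding a
  test vector by \<open>gr_expand\<close> leaves only the term at \<open>a\<close>. Every vector
  specified by orthogonality to a facet is recognised through this lemma.\<close>

lemma normal_multiple_gr:
  assumes a: "a \<in> C" and p: "p \<in> C" "p \<noteq> a" and q: "\<And>b. b \<in> C \<Longrightarrow> b \<noteq> a \<Longrightarrow> q \<bullet> (b - p) = 0"
  shows "q = (q \<bullet> (a - p)) *\<^sub>R gr a"
proof (rule vector_eq_ldot[THEN iffD1], rule allI)
  fix v
  have "v \<bullet> q = (\<Sum>b\<in>C. (gr b \<bullet> v) * (q \<bullet> b))"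
  proof -
    have "v \<bullet> q = (\<Sum>a\<in>C. (gr a \<bullet> v) *\<^sub>R a) \<bullet> q" by (simp add: gr_expand)
    then show ?thesis by (simp only: inner_sum_left inner_scaleR_left inner_commute[of q])
  qed
  also have "\<dots> = (\<Sum>b\<in>C. (gr b \<bullet> v) * (q \<bullet> (b - p)) + (gr b \<bullet> v) * (q \<bullet> p))"
    by (intro sum.cong) (simp_all add: inner_diff_right algebra_simps)
  also have "\<dots> = (\<Sum>b\<in>C. (gr b \<bullet> v) * (q \<bullet> (b - p)))"
    by (simp add: sum.distrib sum_distrib_right[symmetric] sum_gr_inner)
  also have "\<dots> = (\<Sum>b\<in>C. if b = a then (gr a \<bullet> v) * (q \<bullet> (a - p)) else 0)"
    using q by (intro sum.cong) auto
  also have "\<dots> = v \<bullet> ((q \<bullet> (a - p)) *\<^sub>R gr a)"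
    using a by (simp add: inner_commute)
  finally show "v \<bullet> q = v \<bullet> ((q \<bullet> (a - p)) *\<^sub>R gr a)" .
qed

end

section \<open>Quadrature on simplices\<close>

lemma null_hyperplane:
  fixes g :: "real^'n"
  assumes "g \<noteq> 0"
  shows "AE x in lborel. g \<bullet> x \<noteq> d"
proof -
  have "negligible {x. g \<bullet> x = d}" using assms by (simp add: negligible_hyperplane)
  then have "{x. g \<bullet> x = d} \<in> null_sets lebesgue" by (simp add: negligible_iff_null_sets)
  moreover have "{x. g \<bullet> x = d} \<in> sets lborel" by (simp add: closed_hyperplane)
  ultimately have "{x. g \<bullet> x = d} \<in> null_sets lborel" by (simp add: null_sets_completion_iff)
  from AE_not_in[OF this] show ?thesis by simp
qed

text \<open>The hyperplane where the two coordinates agree cuts \<open>S\<close> into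
  \<open>?A\<close> and \<open>?B\<close>. Halving one coordinate and adding that half to the other
  maps \<open>S\<close> onto the corresponding part with Jacobian 1/2. \<open>Q\<close> collects the
  conditions that do not change along \<open>w\<close>.\<close>

lemma integral_bisect:
  fixes \<phi> :: "real^'n \<Rightarrow> real" and gi gj w :: "real^'n"
  assumes card: "CARD('n) = 2 \<or> CARD('n) = 3"
    and S: "S = {x. ci + gi \<bullet> x \<ge> 0 \<and> cj + gj \<bullet> x \<ge> 0 \<and> Q x}" "compact S"
    and Q: "\<And>x s. Q (x + s *\<^sub>R w) \<longleftrightarrow> Q x"
    and g: "gi \<bullet> w = -1" "gj \<bullet> w = 1"
    and \<phi>: "continuous_on UNIV \<phi>"
  shows "(LINT x|lborel. indicator S x * \<phi> x) =
     ((LINT x|lborel. indicator S x * \<phi> (x - ((cj + gj \<bullet> x) / 2) *\<^sub>R w)) +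
      (LINT x|lborel. indicator S x * \<phi> (x + ((ci + gi \<bullet> x) / 2) *\<^sub>R w))) / 2"
proof -
  let ?A = "S \<inter> {x. cj + gj \<bullet> x \<le> ci + gi \<bullet> x}" and ?B = "S \<inter> {x. ci + gi \<bullet> x \<le> cj + gj \<bullet> x}"
  have cA: "compact ?A" by (intro compact_Int_closed S(2) closed_Collect_le continuous_intros)
  have cB: "compact ?B" by (intro compact_Int_closed S(2) closed_Collect_le continuous_intros)
  have [measurable]: "\<phi> \<in> borel_measurable borel" using \<phi> by (rule borel_measurable_continuous_onI)
  have [measurable]: "?A \<in> sets borel" "?B \<in> sets borel" "S \<in> sets borel"
    using cA cB S(2) by (auto intro: borel_compact)
  have inA: "integrable lborel (\<lambda>x. indicator ?A x * \<phi> x)"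
    using borel_integrable_compact[OF cA continuous_on_subset[OF \<phi>]] by simp
  have inB: "integrable lborel (\<lambda>x. indicator ?B x * \<phi> x)"
    using borel_integrable_compact[OF cB continuous_on_subset[OF \<phi>]] by simp
  have "gi - gj \<noteq> 0" using g by (metis eq_iff_diff_eq_0 one_neq_neg_one)
  have "(LINT x|lborel. indicator S x * \<phi> x) = (LINT x|lborel. indicator ?A x * \<phi> x + indicator ?B x * \<phi> x)"
  proof (rule integral_cong_AE)
    show "AE x in lborel. indicator S x * \<phi> x = indicator ?A x * \<phi> x + indicator ?B x * \<phi> x"
      using null_hyperplane[OF \<open>gi - gj \<noteq> 0\<close>, of "cj - ci"]
      by eventually_elim (auto simp: indicator_def inner_diff_left)
  qed auto
  also have "\<dots> = (LINT x|lborel. indicator ?A x * \<phi> x) + (LINT x|lborel. indicator ?B x * \<phi> x)"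
    using inA inB by (rule Bochner_Integration.integral_add)
  also have "(LINT x|lborel. indicator ?A x * \<phi> x) =
     1/2 * (LINT x|lborel. indicator S x * \<phi> (x - ((cj + gj \<bullet> x) / 2) *\<^sub>R w))"
  proof -
    let ?T = "\<lambda>x. x + (- cj / 2 + ((-1/2) *\<^sub>R gj) \<bullet> x) *\<^sub>R w"
    have T: "?T x = x - ((cj + gj \<bullet> x) / 2) *\<^sub>R w" for x
    proof -
      have "- cj / 2 + ((-1/2) *\<^sub>R gj) \<bullet> x = - ((cj + gj \<bullet> x) / 2)" by (simp add: add_divide_distrib)
      then show ?thesis by (simp only: scaleR_minus_left) simp
    qed
    have ind: "indicator ?A (?T x) = (indicator S x :: real)" for x
    proof -
      have "Q (?T x) = Q x" by (rule Q)
      moreover have e: "cj + gj \<bullet> ?T x = (cj + gj \<bullet> x) / 2" "ci + gi \<bullet> ?T x = (ci + gi \<bullet> x) + (cj + gj \<bullet> x) / 2"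
        unfolding inner_add_right inner_scaleR_right g by (simp_all add: field_simps)
      ultimately have "?T x \<in> ?A \<longleftrightarrow> x \<in> S"
        unfolding S Int_iff mem_Collect_eq e by auto
      then show ?thesis by (simp add: indicator_def)
    qed
    have "(LINT x|lborel. indicator ?A x * \<phi> x) = \<bar>1 + ((-1/2) *\<^sub>R gj) \<bullet> w\<bar> * (LINT x|lborel. indicator ?A (?T x) * \<phi> (?T x))"
      using g by (intro integral_rank_one_affine[OF card]) auto
    also have "\<bar>1 + ((-1/2) *\<^sub>R gj) \<bullet> w\<bar> = 1/2" using g by simp
    finally show ?thesis unfolding ind unfolding T by simp
  qed
  also have "(LINT x|lborel. indicator ?B x * \<phi> x) =
     1/2 * (LINT x|lborel. indicator S x * \<phi> (x + ((ci + gi \<bullet> x) / 2) *\<^sub>R w))"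
  proof -
    let ?T = "\<lambda>x. x + (ci / 2 + ((1/2) *\<^sub>R gi) \<bullet> x) *\<^sub>R w"
    have T: "?T x = x + ((ci + gi \<bullet> x) / 2) *\<^sub>R w" for x
    proof -
      have "ci / 2 + ((1/2) *\<^sub>R gi) \<bullet> x = (ci + gi \<bullet> x) / 2" by (simp add: add_divide_distrib)
      then show ?thesis by (simp only:)
    qed
    have ind: "indicator ?B (?T x) = (indicator S x :: real)" for x
    proof -
      have "Q (?T x) = Q x" by (rule Q)
      moreover have e: "ci + gi \<bullet> ?T x = (ci + gi \<bullet> x) / 2" "cj + gj \<bullet> ?T x = (cj + gj \<bullet> x) + (ci + gi \<bullet> x) / 2"
        unfolding inner_add_right inner_scaleR_right g by (simp_all add: field_simps)
      ultimately have "?T x \<in> ?B \<longleftrightarrow> x \<in> S"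
        unfolding S Int_iff mem_Collect_eq e by auto
      then show ?thesis by (simp add: indicator_def)
    qed
    have "(LINT x|lborel. indicator ?B x * \<phi> x) = \<bar>1 + ((1/2) *\<^sub>R gi) \<bullet> w\<bar> * (LINT x|lborel. indicator ?B (?T x) * \<phi> (?T x))"
      using g by (intro integral_rank_one_affine[OF card]) auto
    also have "\<bar>1 + ((1/2) *\<^sub>R gi) \<bullet> w\<bar> = 1/2" using g by simp
    finally show ?thesis unfolding ind unfolding T by simp
  qed
  finally show ?thesis by simp
qed

text \<open>Bisecting an edge of a simplex by the hyperplane on which the two barycentric coordinates agree gives
  two affine images of the simplex itself. Hence both moments solve linear equations.
  The condition \<open>Q\<close> admits the prism over a facet as S, with J the vertices of the facet.\<close>

lemma simplex_quadrature:
  fixes J :: "(real^'n) set" and c :: "real^'n \<Rightarrow> real" and g :: "real^'n \<Rightarrow> real^'n"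
  defines "l \<equiv> \<lambda>j x. c j + g j \<bullet> x"
  assumes card: "CARD('n) = 2 \<or> CARD('n) = 3" and J: "finite J"
    and S: "S = {x. (\<forall>j\<in>J. l j x \<ge> 0) \<and> Q x}" "compact S"
    and Q: "\<And>i j x s. i \<in> J \<Longrightarrow> j \<in> J \<Longrightarrow> Q (x + s *\<^sub>R (j - i)) \<longleftrightarrow> Q x"
    and g: "\<And>k i j. k \<in> J \<Longrightarrow> i \<in> J \<Longrightarrow> j \<in> J \<Longrightarrow> g k \<bullet> (j - i) = (if j = k then 1 else 0) - (if i = k then 1 else 0)"
    and sum1: "\<And>x. (\<Sum>j\<in>J. l j x) = 1"
    and ij: "i \<in> J" "j \<in> J"
  shows "(LINT x|lborel. indicator S x * (l i x * l j x)) =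
     (if i = j then 2 else 1) * measure lborel S / (real (card J) * (real (card J) + 1))"
proof -
  define A where "A i j = (LINT x|lborel. indicator S x * (l i x * l j x))" for i j
  have cl: "continuous_on T (l j)" for T j
    unfolding l_def by (intro continuous_intros)
  have int: "integrable lborel (\<lambda>x. indicator S x * (l i x * l j x))" for i j
    using borel_integrable_compact[OF S(2) continuous_on_mult[OF cl[of _ i] cl[of _ j]]] by simp
  have shift: "l k (x + s *\<^sub>R (j - i)) = l k x + s * ((if j = k then 1 else 0) - (if i = k then 1 else 0))"
    if "k \<in> J" "i \<in> J" "j \<in> J" for k i j x s
    using g[OF that] by (simp add: l_def inner_add_right)
  have pair: "A i j = A i i / 2 \<and> A j j = A i i" if ij: "i \<in> J" "j \<in> J" "i \<noteq> j" for i j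
  proof -
    \<comment> \<open>The other coordinates are constant along the edge from \<open>i\<close> to
      \<open>j\<close>, so they can join the invariant condition.\<close>
    define Q' where "Q' x \<longleftrightarrow> (\<forall>k\<in>J-{i,j}. l k x \<ge> 0) \<and> Q x" for x
    have S': "S = {x. c i + g i \<bullet> x \<ge> 0 \<and> c j + g j \<bullet> x \<ge> 0 \<and> Q' x}"
      using ij unfolding S(1) Q'_def l_def by auto
    have Q'': "Q' (x + s *\<^sub>R (j - i)) \<longleftrightarrow> Q' x" for x s
      unfolding Q'_def using Q[OF ij(1,2)] ij shift by auto
    have gi: "g i \<bullet> (j - i) = -1" "g j \<bullet> (j - i) = 1" using g ij by auto
    have sh1: "l i (x - (l j x / 2) *\<^sub>R (j - i)) = l i x + l j x / 2"
         "l j (x - (l j x / 2) *\<^sub>R (j - i)) = l j x / 2"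
         "l i (x + (l i x / 2) *\<^sub>R (j - i)) = l i x / 2"
         "l j (x + (l i x / 2) *\<^sub>R (j - i)) = l j x + l i x / 2" for x
      using shift[OF ij(1) ij(1,2), of x "- (l j x / 2)"] shift[OF ij(2) ij(1,2), of x "- (l j x / 2)"]
        shift[OF ij(1) ij(1,2), of x "l i x / 2"] shift[OF ij(2) ij(1,2), of x "l i x / 2"] ij
      by (simp_all)
    have bis: "(LINT x|lborel. indicator S x * \<phi> x) =
       ((LINT x|lborel. indicator S x * \<phi> (x - (l j x / 2) *\<^sub>R (j - i))) +
        (LINT x|lborel. indicator S x * \<phi> (x + (l i x / 2) *\<^sub>R (j - i)))) / 2" if "continuous_on UNIV \<phi>" for \<phi> :: "real^'n \<Rightarrow> real"
      unfolding l_def by (rule integral_bisect[where Q = Q', OF card S' S(2) _ gi that]) (rule Q'')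
    have "A i j = ((LINT x|lborel. indicator S x * ((l i x + l j x / 2) * (l j x / 2))) +
        (LINT x|lborel. indicator S x * ((l i x / 2) * (l j x + l i x / 2)))) / 2"
      unfolding A_def by (subst bis) (auto intro!: continuous_on_mult cl simp only: sh1)
    also have "(LINT x|lborel. indicator S x * ((l i x + l j x / 2) * (l j x / 2))) =
       (LINT x|lborel. (1/2) * (indicator S x * (l i x * l j x)) + (1/4) * (indicator S x * (l j x * l j x)))"
      by (intro Bochner_Integration.integral_cong refl) (simp add: algebra_simps)
    also have "\<dots> = A i j / 2 + A j j / 4"
      unfolding A_def by (subst Bochner_Integration.integral_add) (auto intro!: int)
    also have "(LINT x|lborel. indicator S x * ((l i x / 2) * (l j x + l i x / 2))) =
       (LINT x|lborel. (1/2) * (indicator S x * (l i x * l j x)) + (1/4) * (indicator S x * (l i x * l i x)))"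
      by (intro Bochner_Integration.integral_cong refl) (simp add: algebra_simps)
    also have "\<dots> = A i j / 2 + A i i / 4"
      unfolding A_def by (subst Bochner_Integration.integral_add) (auto intro!: int)
    finally have 1: "A i j = (A i j / 2 + A j j / 4 + (A i j / 2 + A i i / 4)) / 2" .
    have "A i i = ((LINT x|lborel. indicator S x * ((l i x + l j x / 2) * (l i x + l j x / 2))) +
        (LINT x|lborel. indicator S x * ((l i x / 2) * (l i x / 2)))) / 2"
      unfolding A_def by (subst bis) (auto intro!: continuous_on_mult cl simp only: sh1)
    also have "(LINT x|lborel. indicator S x * ((l i x + l j x / 2) * (l i x + l j x / 2))) =
       (LINT x|lborel. (indicator S x * (l i x * l i x) + indicator S x * (l i x * l j x)) + (1/4) * (indicator S x * (l j x * l j x)))"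
      by (intro Bochner_Integration.integral_cong refl) (simp add: algebra_simps)
    also have "\<dots> = (LINT x|lborel. indicator S x * (l i x * l i x) + indicator S x * (l i x * l j x)) + A j j / 4"
      unfolding A_def by (subst Bochner_Integration.integral_add) (auto intro!: int Bochner_Integration.integrable_add)
    also have "(LINT x|lborel. indicator S x * (l i x * l i x) + indicator S x * (l i x * l j x)) = A i i + A i j"
      unfolding A_def by (rule Bochner_Integration.integral_add) (rule int)+
    also have "(LINT x|lborel. indicator S x * ((l i x / 2) * (l i x / 2))) = (LINT x|lborel. (1/4) * (indicator S x * (l i x * l i x)))"
      by (intro Bochner_Integration.integral_cong refl) (simp add: algebra_simps)
    also have "\<dots> = A i i / 4" unfolding A_def by simp
    finally have 2: "A i i = (A i i + A i j + A j j / 4 + A i i / 4) / 2" .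
    \<comment> \<open>Inserting 1 into 2 turns it into \<open>A i i / 2 = A j j / 2\<close>.\<close>
    from 1 2 have "A j j = A i i" by (simp add: field_simps)
    with 1 show ?thesis by (simp add: field_simps)
  qed
  let ?N = "real (card J)"
  have N: "?N > 0" using ij J by (auto simp: card_gt_0_iff)
  have Aij: "A k k' = (if k = k' then A i i else A i i / 2)" if "k \<in> J" "k' \<in> J" for k k'
  proof (cases "k = k'")
    case True then show ?thesis using pair[of i k] ij that by (cases "i = k") auto
  next
    case False
    then have "A k k' = A k k / 2" using pair[of k k'] that by auto
    moreover have "A k k = A i i" using pair[of i k] ij that by (cases "i = k") auto
    ultimately show ?thesis using False by simp
  qed
  \<comment> \<open>The bisections determine the moments up to one common factor. It is fixed by
    integrating the square of the sum of all coordinates, which is 1.\<close>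
  have "measure lborel S = (LINT x|lborel. indicator S x)"
    using S(2) by simp
  also have "\<dots> = (LINT x|lborel. (\<Sum>k\<in>J. \<Sum>k'\<in>J. indicator S x * (l k x * l k' x)))"
  proof (intro Bochner_Integration.integral_cong refl)
    fix x
    have "(\<Sum>k\<in>J. \<Sum>k'\<in>J. indicator S x * (l k x * l k' x)) = indicator S x * ((\<Sum>k\<in>J. l k x) * (\<Sum>k\<in>J. l k x))"
      unfolding sum_product by (simp add: sum_distrib_left)
    then show "indicator S x = (\<Sum>k\<in>J. \<Sum>k'\<in>J. indicator S x * (l k x * l k' x))"
      by (simp add: sum1)
  qed
  also have "\<dots> = (\<Sum>k\<in>J. \<Sum>k'\<in>J. A k k')"
    unfolding A_def by (subst Bochner_Integration.integral_sum | intro Bochner_Integration.integrable_sum int sum.cong refl)+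
  also have "\<dots> = (\<Sum>k\<in>J. \<Sum>k'\<in>J. A i i / 2 + (if k' = k then A i i / 2 else 0))"
    by (intro sum.cong refl) (auto simp: Aij)
  also have "\<dots> = (\<Sum>k\<in>J. ?N * (A i i / 2) + A i i / 2)"
    using J by (intro sum.cong refl) (simp add: sum.distrib)
  also have "\<dots> = ?N * (?N + 1) * (A i i / 2)"
    by (simp add: algebra_simps)
  finally have m: "measure lborel S = ?N * (?N + 1) * (A i i / 2)" .
  have "?N * (?N + 1) \<noteq> 0" using N by (metis add_pos_pos less_irrefl mult_pos_pos zero_less_one)
  moreover have "x = 2 * (M * (x / 2)) / M" if "M \<noteq> 0" for x M :: real
    using that by simp
  ultimately have "A i i = 2 * measure lborel S / (?N * (?N + 1))"
    unfolding m by blast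
  with Aij[OF ij] show ?thesis unfolding A_def[symmetric] by (cases "i = j") simp_all
qed

text \<open>The mass matrix of linear elements: the diagonal weight 2 of
  \<open>simplex_quadrature\<close> is split as 1 + 1, one part giving the diagonal sum and the
  other completing the product of the two full sums.\<close>

lemma simplex_quadrature_inner:
  fixes J :: "(real^'n) set" and c :: "real^'n \<Rightarrow> real" and g :: "real^'n \<Rightarrow> real^'n"
    and P R :: "real^'n \<Rightarrow> 'b::euclidean_space"
  defines "l \<equiv> \<lambda>j x. c j + g j \<bullet> x"
  assumes card: "CARD('n) = 2 \<or> CARD('n) = 3" and J: "finite J"
    and S: "S = {x. (\<forall>j\<in>J. l j x \<ge> 0) \<and> Q x}" "compact S"
    and Q: "\<And>i j x s. i \<in> J \<Longrightarrow> j \<in> J \<Longrightarrow> Q (x + s *\<^sub>R (j - i)) \<longleftrightarrow> Q x"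
    and g: "\<And>k i j. k \<in> J \<Longrightarrow> i \<in> J \<Longrightarrow> j \<in> J \<Longrightarrow> g k \<bullet> (j - i) = (if j = k then 1 else 0) - (if i = k then 1 else 0)"
    and sum1: "\<And>x. (\<Sum>j\<in>J. l j x) = 1"
  shows "(LINT x|lborel. indicator S x * ((\<Sum>j\<in>J. l j x *\<^sub>R P j) \<bullet> (\<Sum>j\<in>J. l j x *\<^sub>R R j))) =
     measure lborel S / (real (card J) * (real (card J) + 1)) * ((\<Sum>j\<in>J. P j \<bullet> R j) + (\<Sum>j\<in>J. P j) \<bullet> (\<Sum>j\<in>J. R j))"
    (is "?L = ?m * ?R")
proof -
  have cl: "continuous_on T (l j)" for T j
    unfolding l_def by (intro continuous_intros)
  have int: "integrable lborel (\<lambda>x. indicator S x * (l i x * l j x))" for i j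
    using borel_integrable_compact[OF S(2) continuous_on_mult[OF cl[of _ i] cl[of _ j]]] by simp
  have "?L = (LINT x|lborel. (\<Sum>i\<in>J. \<Sum>j\<in>J. (P i \<bullet> R j) * (indicator S x * (l i x * l j x))))"
    by (intro Bochner_Integration.integral_cong refl)
       (subst sum.swap, simp add: inner_sum_left inner_sum_right sum_distrib_left mult_ac)
  also have "\<dots> = (\<Sum>i\<in>J. \<Sum>j\<in>J. (P i \<bullet> R j) * (LINT x|lborel. indicator S x * (l i x * l j x)))"
    by (simp add: Bochner_Integration.integral_sum int Bochner_Integration.integrable_sum)
  also have "\<dots> = (\<Sum>i\<in>J. \<Sum>j\<in>J. ?m * (P i \<bullet> R j) + (if j = i then ?m * (P i \<bullet> R i) else 0))"
    using simplex_quadrature[OF card J S[unfolded l_def] Q g sum1[unfolded l_def]]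
    unfolding l_def by (intro sum.cong refl) auto
  also have "\<dots> = (\<Sum>i\<in>J. \<Sum>j\<in>J. ?m * (P i \<bullet> R j)) + (\<Sum>i\<in>J. ?m * (P i \<bullet> R i))"
    using J by (simp add: sum.distrib)
  also have "\<dots> = ?m * ?R"
    by (simp add: sum_distrib_left inner_sum_left inner_sum_right distrib_left)
       (rule sum.swap)
  finally show ?thesis .
qed

section \<open>Surface measure of a facet\<close>

context simplex_vertices
begin

text \<open>Orthogonal projection onto the hyperplane through the facet opposite
  \<open>a\<close>.\<close>

definition proj :: "real^'n \<Rightarrow> real^'n \<Rightarrow> real^'n" where
  "proj a y = y - (lam a y / (gr a \<bullet> gr a)) *\<^sub>R gr a"

text \<open>The right prism of height 1 over the facet opposite \<open>a\<close>, on the side given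
  by the sign \<open>s\<close>. Both signs are kept because the normal in
  \<open>surface_measure\<close> is an arbitrary choice.\<close>

definition prism :: "real^'n \<Rightarrow> real \<Rightarrow> (real^'n) set" where
  "prism a s = {y. (\<forall>j\<in>C-{a}. lam j (proj a y) \<ge> 0) \<and> 0 \<le> s * lam a y / norm (gr a) \<and> s * lam a y / norm (gr a) \<le> 1}"

lemma lam_scale: "lam b (y - r *\<^sub>R v) = lam b y - r * (gr b \<bullet> v)"
  by (simp add: lam_def inner_diff_right)

lemma lam_proj: "lam j (proj a y) = lam j y - lam a y * (gr j \<bullet> gr a) / (gr a \<bullet> gr a)"
  unfolding proj_def lam_scale by simp

lemma lam_proj_self: "a \<in> C \<Longrightarrow> lam a (proj a y) = 0"
  using gr_nonzero by (simp add: lam_proj)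

text \<open>After the projection the coordinates are still affine, in the form of a constant plus an
  inner product that \<open>simplex_quadrature\<close> expects.\<close>

lemma lam_proj_affine:
  "lam j (proj a y) = (fst (coef j) - fst (coef a) * ((gr j \<bullet> gr a) / (gr a \<bullet> gr a)))
      + (gr j - ((gr j \<bullet> gr a) / (gr a \<bullet> gr a)) *\<^sub>R gr a) \<bullet> y"
  unfolding lam_proj by (simp add: lam_def inner_diff_left algebra_simps add_divide_distrib)

lemma continuous_proj: "continuous_on S (proj a)"
proof -
  have "continuous_on S (\<lambda>y. y - (lam a y / (gr a \<bullet> gr a)) *\<^sub>R gr a)"
    by (cases "gr a = 0") (auto intro!: continuous_intros continuous_lam)
  moreover have "proj a = (\<lambda>y. y - (lam a y / (gr a \<bullet> gr a)) *\<^sub>R gr a)" by (rule ext) (rule proj_def)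
  ultimately show ?thesis by (simp only:)
qed

lemma prism_eq:
  assumes a: "a \<in> C" and s: "s * s = 1" and n: "n = (s / norm (gr a)) *\<^sub>R gr a"
  shows "{x + t *\<^sub>R n | x t. x \<in> convex hull (C - {a}) \<and> t \<in> {0..1}} = prism a s"
proof (intro set_eqI iffI)
  have ng: "norm (gr a) > 0" using gr_nonzero[OF a] by simp
  have gg: "gr a \<bullet> gr a = norm (gr a) * norm (gr a)" by (simp add: power2_norm_eq_inner[symmetric] power2_eq_square)
  {
    fix y assume "y \<in> {x + t *\<^sub>R n | x t. x \<in> convex hull (C - {a}) \<and> t \<in> {0..1}}"
    then obtain x t where y: "y = x + t *\<^sub>R n" "lam a x = 0" "\<forall>b\<in>C. lam b x \<ge> 0" "0 \<le> t" "t \<le> 1"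
      by (auto simp: facet_eq[OF a])
    have la: "lam a y = t * s * norm (gr a)"
      using ng unfolding y(1) lam_add n by (simp add: y(2) gg)
    have "proj a y = y - (t * s * norm (gr a) / (gr a \<bullet> gr a)) *\<^sub>R gr a"
      unfolding proj_def la ..
    also have "\<dots> = x"
      unfolding y(1) n using ng by (simp add: gg)
    finally have "proj a y = x" .
    have "s * lam a y / norm (gr a) = t * (s * s)" unfolding la using ng by simp
    with \<open>proj a y = x\<close> show "y \<in> prism a s"
      using y s by (simp add: prism_def)
  }
  fix y assume "y \<in> prism a s"
  then have y: "\<forall>j\<in>C-{a}. lam j (proj a y) \<ge> 0" "0 \<le> s * lam a y / norm (gr a)" "s * lam a y / norm (gr a) \<le> 1"
    by (auto simp: prism_def)
  have "proj a y \<in> convex hull (C - {a})"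
    using y(1) lam_proj_self[OF a] by (auto simp: facet_eq[OF a])
  moreover have "y = proj a y + (s * lam a y / norm (gr a)) *\<^sub>R n"
    unfolding n proj_def using s by (simp add: gg)
  ultimately show "y \<in> {x + t *\<^sub>R n | x t. x \<in> convex hull (C - {a}) \<and> t \<in> {0..1}}"
    using y by (simp only: mem_Collect_eq atLeastAtMost_iff) blast
qed

lemma compact_prism:
  assumes a: "a \<in> C" and s: "s * s = 1"
  shows "compact (prism a s)"
proof -
  define n where "n = (s / norm (gr a)) *\<^sub>R gr a"
  have "compact ((\<lambda>(x, t). x + t *\<^sub>R n) ` ((convex hull (C - {a})) \<times> {0..1}))"
    unfolding case_prod_unfold
    by (intro compact_continuous_image compact_Times finite_imp_compact_convex_hull continuous_intros) auto
  also have "(\<lambda>(x, t). x + t *\<^sub>R n) ` ((convex hull (C - {a})) \<times> {0..1}) =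
      {x + t *\<^sub>R n | x t. x \<in> convex hull (C - {a}) \<and> t \<in> {0..1}}"
    unfolding image_def by (rule Collect_cong) (metis (no_types, lifting) SigmaE SigmaI case_prod_conv)
  finally show ?thesis using prism_eq[OF a s n_def] by simp
qed

end

section \<open>Volumes and integrals of the simplex and of the prisms over its facets\<close>

locale simplex23 = simplex_vertices C for C :: "(real^'n) set" +
  assumes card23: "CARD('n) = 2 \<or> CARD('n) = 3"
begin

abbreviation vol :: real where "vol \<equiv> measure lborel (convex hull C)"

lemma integral_hull_inner:
  fixes P R :: "real^'n \<Rightarrow> 'b::euclidean_space"
  shows "(LINT x|lborel. indicator (convex hull C) x * ((\<Sum>j\<in>C. lam j x *\<^sub>R P j) \<bullet> (\<Sum>j\<in>C. lam j x *\<^sub>R R j))) =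
     vol / ((real CARD('n) + 1) * (real CARD('n) + 2)) * ((\<Sum>j\<in>C. P j \<bullet> R j) + (\<Sum>j\<in>C. P j) \<bullet> (\<Sum>j\<in>C. R j))"
proof -
  have "(LINT x|lborel. indicator (convex hull C) x * ((\<Sum>j\<in>C. (fst (coef j) + gr j \<bullet> x) *\<^sub>R P j) \<bullet> (\<Sum>j\<in>C. (fst (coef j) + gr j \<bullet> x) *\<^sub>R R j))) =
     vol / (real (card C) * (real (card C) + 1)) * ((\<Sum>j\<in>C. P j \<bullet> R j) + (\<Sum>j\<in>C. P j) \<bullet> (\<Sum>j\<in>C. R j))"
  proof (rule simplex_quadrature_inner[where Q = "\<lambda>_. True", OF card23 finite_C])
    show "convex hull C = {x. (\<forall>j\<in>C. 0 \<le> fst (coef j) + gr j \<bullet> x) \<and> True}"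
      by (simp add: hull_eq lam_def)
    show "compact (convex hull C)" by (rule compact_hull)
    show "gr k \<bullet> (j - i) = (if j = k then 1 else 0) - (if i = k then 1 else 0)" if "k \<in> C" "i \<in> C" "j \<in> C" for i j k
      using gr_vertex_diff that by simp
    show "(\<Sum>j\<in>C. fst (coef j) + gr j \<bullet> x) = 1" for x
      using barycentric(1) by (simp add: lam_def)
  qed simp
  then show ?thesis by (simp add: lam_def card_C algebra_simps)
qed

lemma integral_prism_inner:
  fixes P R :: "real^'n \<Rightarrow> 'b::euclidean_space"
  assumes a: "a \<in> C" and s: "s * s = 1"
  shows "(LINT x|lborel. indicator (prism a s) x * ((\<Sum>j\<in>C-{a}. lam j (proj a x) *\<^sub>R P j) \<bullet> (\<Sum>j\<in>C-{a}. lam j (proj a x) *\<^sub>R R j))) =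
     measure lborel (prism a s) / (real CARD('n) * (real CARD('n) + 1)) * ((\<Sum>j\<in>C-{a}. P j \<bullet> R j) + (\<Sum>j\<in>C-{a}. P j) \<bullet> (\<Sum>j\<in>C-{a}. R j))"
proof -
  let ?Q = "\<lambda>y. 0 \<le> s * lam a y / norm (gr a) \<and> s * lam a y / norm (gr a) \<le> 1"
  have crd: "card (C - {a}) = CARD('n)" using a card_C by simp
  show ?thesis
    unfolding lam_proj_affine crd[symmetric]
  proof (rule simplex_quadrature_inner[where Q = ?Q, OF card23])
    show "prism a s = {x. (\<forall>j\<in>C-{a}. 0 \<le> fst (coef j) - fst (coef a) * (gr j \<bullet> gr a / (gr a \<bullet> gr a)) +
            (gr j - (gr j \<bullet> gr a / (gr a \<bullet> gr a)) *\<^sub>R gr a) \<bullet> x) \<and> ?Q x}"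
      unfolding prism_def lam_proj_affine ..
    show "compact (prism a s)" by (rule compact_prism[OF a s])
    have ga: "gr a \<bullet> (j - i) = 0" if "i \<in> C - {a}" "j \<in> C - {a}" for i j
      using that a gr_vertex_diff[of a j i] by auto
    show "?Q (x + r *\<^sub>R (j - i)) = ?Q x" if "i \<in> C - {a}" "j \<in> C - {a}" for i j x r
      using ga[OF that] by (simp add: lam_add)
    show "(gr k - (gr k \<bullet> gr a / (gr a \<bullet> gr a)) *\<^sub>R gr a) \<bullet> (j - i) = (if j = k then 1 else 0) - (if i = k then 1 else 0)"
      if "k \<in> C - {a}" "i \<in> C - {a}" "j \<in> C - {a}" for i j k
      using gr_vertex_diff[of k j i] ga[OF that(2,3)] that
      by (simp only: inner_diff_left[of "gr k"] inner_scaleR_left) simp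
    show "(\<Sum>j\<in>C - {a}. fst (coef j) - fst (coef a) * (gr j \<bullet> gr a / (gr a \<bullet> gr a)) +
            (gr j - (gr j \<bullet> gr a / (gr a \<bullet> gr a)) *\<^sub>R gr a) \<bullet> x) = 1" for x
      using barycentric(1)[of "proj a x"] lam_proj_self[OF a, of x] a
      unfolding lam_proj_affine[symmetric] by (simp add: sum.remove[OF finite_C a])
  qed simp
qed

text \<open>A vertical shear lowers the layer \<open>E\<close> to the wedge \<open>G\<close>
  standing on the facet with height \<open>lam j\<close>, and tilting the normal direction into the
  edge from \<open>j\<close> to \<open>a\<close> turns \<open>G\<close> into the simplex. So each
  layer has the same measure, whatever \<open>J\<close> is.\<close>

lemma measure_staircase_step:
  assumes a: "a \<in> C" and s: "s * s = 1" and j: "j \<in> C - {a}" and J: "J \<subseteq> C - {a}"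
  defines "t \<equiv> \<lambda>y. s * lam a y / norm (gr a)"
  defines "E \<equiv> {y. (\<forall>i\<in>C-{a}. lam i (proj a y) \<ge> 0) \<and>
       (\<Sum>i\<in>J. lam i (proj a y)) \<le> t y \<and> t y \<le> (\<Sum>i\<in>J. lam i (proj a y)) + lam j (proj a y)}"
  shows "(LINT y|lborel. indicator E y) = norm (gr a) * vol"
proof -
  define n where "n = (s / norm (gr a)) *\<^sub>R gr a"
  have ng: "norm (gr a) > 0" using gr_nonzero[OF a] by simp
  have gg: "gr a \<bullet> gr a = norm (gr a) * norm (gr a)" by (simp add: power2_norm_eq_inner[symmetric] power2_eq_square)
  have gan: "gr a \<bullet> n = s * norm (gr a)" using ng by (simp add: n_def gg)
  have t_aff: "t y = s * fst (coef a) / norm (gr a) + n \<bullet> y" for y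
    using ng by (simp add: t_def n_def lam_def field_simps)
  have t_add: "t (y + v) = t y + n \<bullet> v" for y v
    by (simp add: t_aff inner_add_right)
  have nn: "n \<bullet> n = 1" using ng s by (simp add: n_def gg)
  have lamt: "lam a y = t y * (s * norm (gr a))" for y
    using ng s by (simp add: t_def)
  have pr: "lam i (proj a y) = lam i y - t y * (gr i \<bullet> n)" for i y
    using ng s by (simp add: lam_proj lamt n_def gg)
  have prn: "lam i (proj a (y + r *\<^sub>R n)) = lam i (proj a y)" for i y r
    unfolding pr lam_add t_add by (simp add: nn algebra_simps)
  define G where "G = {y. (\<forall>i\<in>C-{a}. lam i (proj a y) \<ge> 0) \<and> 0 \<le> t y \<and> t y \<le> lam j (proj a y)}"
  have cproj: "continuous_on A (\<lambda>y. lam i (proj a y))" for A i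
    unfolding lam_proj_affine by (intro continuous_intros)
  have ct: "continuous_on A t" for A
  proof -
    have "t = (\<lambda>y. s * fst (coef a) / norm (gr a) + n \<bullet> y)" using t_aff by (rule ext)
    then show ?thesis by (simp only:) (intro continuous_intros)
  qed
  have cl: "closed {y. (\<forall>i\<in>C-{a}. lam i (proj a y) \<ge> 0)}"
  proof -
    have "closed (\<Inter>i\<in>C-{a}. {y. 0 \<le> lam i (proj a y)})"
      by (intro closed_INT ballI closed_Collect_le cproj continuous_intros)
    moreover have "(\<Inter>i\<in>C-{a}. {y. 0 \<le> lam i (proj a y)}) = {y. (\<forall>i\<in>C-{a}. lam i (proj a y) \<ge> 0)}" by auto
    ultimately show ?thesis by simp
  qed
  have "closed E" unfolding E_def
    by (intro closed_Collect_conj cl closed_Collect_le continuous_intros cproj ct)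
  then have [measurable]: "E \<in> sets borel" by (rule borel_closed)
  have "closed G" unfolding G_def
    by (intro closed_Collect_conj cl closed_Collect_le continuous_intros cproj ct)
  then have [measurable]: "G \<in> sets borel" by (rule borel_closed)
  have [measurable]: "convex hull C \<in> sets borel" using compact_hull by (rule borel_compact)
  let ?r = "\<lambda>i. (gr i \<bullet> gr a) / (gr a \<bullet> gr a)"
  let ?c0 = "\<Sum>i\<in>J. fst (coef i) - fst (coef a) * ?r i" and ?g = "\<Sum>i\<in>J. gr i - ?r i *\<^sub>R gr a"
  have sum_aff: "(\<Sum>i\<in>J. lam i (proj a y)) = ?c0 + ?g \<bullet> y" for y
    unfolding lam_proj_affine by (simp only: sum.distrib inner_sum_left)
  have gn: "?g \<bullet> n = 0"
  proof -
    have "(gr i - ?r i *\<^sub>R gr a) \<bullet> n = 0" for i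
      using ng by (simp add: n_def inner_diff_left gg)
    then show ?thesis by (simp only: inner_sum_left) simp
  qed
  \<comment> \<open>The amount of the shear is constant along \<open>n\<close>, so its Jacobian is
    1.\<close>
  have "(LINT y|lborel. indicator E y) = \<bar>1 + ?g \<bullet> n\<bar> * (LINT y|lborel. indicator E (y + (?c0 + ?g \<bullet> y) *\<^sub>R n))"
    by (rule integral_rank_one_affine[OF card23]) (use gn in auto)
  also have "\<dots> = (LINT y|lborel. indicator E (y + (?c0 + ?g \<bullet> y) *\<^sub>R n))"
    unfolding gn by simp
  also have "(\<lambda>y. indicator E (y + (?c0 + ?g \<bullet> y) *\<^sub>R n) :: real) = indicator G"
  proof
    fix y
    have "y + (?c0 + ?g \<bullet> y) *\<^sub>R n \<in> E \<longleftrightarrow> y \<in> G"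
      unfolding E_def G_def mem_Collect_eq sum_aff[symmetric] prn t_add by (simp add: nn)
    then show "indicator E (y + (?c0 + ?g \<bullet> y) *\<^sub>R n) = (indicator G y :: real)" by (simp add: indicator_def)
  qed
  finally have EG: "(LINT y|lborel. indicator E y) = (LINT y|lborel. indicator G y :: real)" .
  \<comment> \<open>Adding \<open>t y\<close> times this vector replaces a displacement along the
    normal by one along the edge \<open>a - j\<close>: \<open>t\<close> becomes the coordinate of
    \<open>a\<close> and is subtracted from that of \<open>j\<close>.\<close>
  let ?w = "a - j - n"
  have gaj: "gr a \<bullet> (a - j) = 1" using gr_vertex_diff[OF a a, of j] j by auto
  then have det: "1 + n \<bullet> ?w = s / norm (gr a)"
  proof -
    have "n \<bullet> (a - j) = (s / norm (gr a)) * (gr a \<bullet> (a - j))" by (simp only: n_def inner_scaleR_left)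
    then show ?thesis using gaj nn by (simp add: inner_diff_right[of n "a - j"])
  qed
  have s0: "\<bar>s\<bar> = 1" using s by (metis abs_mult abs_one abs_ge_zero mult_cancel_left1 mult.commute abs_mult_self_eq power2_eq_1_iff power2_eq_square abs_minus_cancel)
  have "(LINT y|lborel. indicator (convex hull C) y :: real) = \<bar>1 + n \<bullet> ?w\<bar> *
      (LINT y|lborel. indicator (convex hull C) (y + (s * fst (coef a) / norm (gr a) + n \<bullet> y) *\<^sub>R ?w))"
    by (rule integral_rank_one_affine[OF card23]) (use s0 ng det in auto)
  also have "(\<lambda>y. indicator (convex hull C) (y + (s * fst (coef a) / norm (gr a) + n \<bullet> y) *\<^sub>R ?w) :: real) = indicator G"
  proof
    fix y
    let ?L = "y + t y *\<^sub>R ?w"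
    have lamL: "lam i ?L = lam i y + t y * (gr i \<bullet> (a - j) - gr i \<bullet> n)" for i
      by (simp only: lam_add inner_scaleR_right inner_diff_right[of _ "a - j" n])
    have 1: "lam a ?L = t y"
      unfolding lamL gaj gan lamt[of y] by (simp add: algebra_simps)
    have "gr j \<bullet> (a - j) = -1" using gr_vertex_diff[of j a j] a j by auto
    then have 2: "lam j ?L = lam j (proj a y) - t y"
      unfolding lamL pr by (simp only:) (simp add: algebra_simps)
    have 3: "lam i ?L = lam i (proj a y)" if "i \<in> C" "i \<noteq> a" "i \<noteq> j" for i
    proof -
      have "gr i \<bullet> (a - j) = 0" using gr_vertex_diff[of i a j] a j that by simp
      then show ?thesis unfolding lamL pr by (simp only:) simp
    qed
    have "?L \<in> convex hull C \<longleftrightarrow> y \<in> G"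
    proof -
      have "?L \<in> convex hull C \<longleftrightarrow> lam a ?L \<ge> 0 \<and> lam j ?L \<ge> 0 \<and> (\<forall>i\<in>C-{a}-{j}. lam i ?L \<ge> 0)"
        using a j by (auto simp: hull_eq)
      also have "\<dots> \<longleftrightarrow> 0 \<le> t y \<and> t y \<le> lam j (proj a y) \<and> (\<forall>i\<in>C-{a}-{j}. lam i (proj a y) \<ge> 0)"
        using 1 2 3 by auto
      also have "\<dots> \<longleftrightarrow> y \<in> G" unfolding G_def using j by auto
      finally show ?thesis .
    qed
    then show "indicator (convex hull C) (y + (s * fst (coef a) / norm (gr a) + n \<bullet> y) *\<^sub>R ?w) = (indicator G y :: real)"
      unfolding t_aff[symmetric] by (simp add: indicator_def)
  qed
  finally have "vol = (1 / norm (gr a)) * (LINT y|lborel. indicator G y)"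
    using s0 compact_hull by (simp add: det)
  then show ?thesis using ng EG by (simp add: field_simps)
qed

text \<open>The formula volume = area * height / dimension, with \<open>1 / norm (gr a)\<close> as
  height. The partial sums of the projected coordinates cut the prism into one staircase layer per
  vertex of the facet, and all layers have equal measure.\<close>

lemma measure_prism:
  assumes a: "a \<in> C" and s: "s * s = 1"
  shows "measure lborel (prism a s) = real CARD('n) * (norm (gr a) * vol)"
proof -
  define t where "t y = s * lam a y / norm (gr a)" for y
  define n where "n = (s / norm (gr a)) *\<^sub>R gr a"
  have ng: "norm (gr a) > 0" using gr_nonzero[OF a] by simp
  have gg: "gr a \<bullet> gr a = norm (gr a) * norm (gr a)" by (simp add: power2_norm_eq_inner[symmetric] power2_eq_square)
  have nn: "n \<bullet> n = 1" using ng s by (simp add: n_def gg)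
  have t_aff: "t y = s * fst (coef a) / norm (gr a) + n \<bullet> y" for y
    using ng by (simp add: t_def n_def lam_def field_simps)
  have cproj: "continuous_on A (\<lambda>y. lam i (proj a y))" for A i
    unfolding lam_proj_affine by (intro continuous_intros)
  have ct: "continuous_on A t" for A
  proof -
    have "t = (\<lambda>y. s * fst (coef a) / norm (gr a) + n \<bullet> y)" using t_aff by (rule ext)
    then show ?thesis by (simp only:) (intro continuous_intros)
  qed
  have sum_aff: "\<exists>c g. (\<forall>y. (\<Sum>i\<in>J. lam i (proj a y)) = c + g \<bullet> y) \<and> g \<bullet> n = 0" for J
  proof (intro exI conjI allI)
    let ?r = "\<lambda>i. (gr i \<bullet> gr a) / (gr a \<bullet> gr a)"
    show "(\<Sum>i\<in>J. lam i (proj a y)) = (\<Sum>i\<in>J. fst (coef i) - fst (coef a) * ?r i) + (\<Sum>i\<in>J. gr i - ?r i *\<^sub>R gr a) \<bullet> y" for y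
      unfolding lam_proj_affine by (simp only: sum.distrib inner_sum_left)
    have "(gr i - ?r i *\<^sub>R gr a) \<bullet> n = 0" for i
      using ng by (simp add: n_def inner_diff_left gg)
    then show "(\<Sum>i\<in>J. gr i - ?r i *\<^sub>R gr a) \<bullet> n = 0" by (simp only: inner_sum_left) simp
  qed
  \<comment> \<open>Neighbouring layers meet in the graph of an affine function over the facet.
    Along \<open>n\<close> the difference of the two sides has slope 1, so this graph is a genuine
    hyperplane.\<close>
  have null: "AE y in lborel. t y \<noteq> (\<Sum>i\<in>J. lam i (proj a y))" for J
  proof -
    obtain c g where cg: "\<forall>y. (\<Sum>i\<in>J. lam i (proj a y)) = c + g \<bullet> y" "g \<bullet> n = 0" using sum_aff by blast
    have "(n - g) \<bullet> n = 1" using nn cg(2) by (simp add: inner_diff_left)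
    then have "n - g \<noteq> 0" by auto
    from null_hyperplane[OF this, of "c - s * fst (coef a) / norm (gr a)"]
    show ?thesis by eventually_elim (auto simp: cg(1) t_aff inner_diff_left)
  qed
  have sum_le: "(\<Sum>i\<in>J. lam i (proj a y)) \<le> 1" if "J \<subseteq> C - {a}" "\<forall>i\<in>C-{a}. lam i (proj a y) \<ge> 0" for J y
  proof -
    have "(\<Sum>i\<in>J. lam i (proj a y)) \<le> (\<Sum>i\<in>C-{a}. lam i (proj a y))"
      using that by (intro sum_mono2) auto
    also have "\<dots> = 1"
      using barycentric(1)[of "proj a y"] lam_proj_self[OF a, of y] by (simp add: sum.remove[OF finite_C a])
    finally show ?thesis .
  qed
  have sum_ge: "0 \<le> (\<Sum>i\<in>J. lam i (proj a y))" if "J \<subseteq> C - {a}" "\<forall>i\<in>C-{a}. lam i (proj a y) \<ge> 0" for J y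
    using that by (intro sum_nonneg) auto
  define L where "L lo hi = {y. (\<forall>i\<in>C-{a}. lam i (proj a y) \<ge> 0) \<and> lo y \<le> t y \<and> t y \<le> hi y}" for lo hi :: "real^'n \<Rightarrow> real"
  have cL: "compact (L lo hi)" if c: "continuous_on UNIV lo" "continuous_on UNIV hi" and
      le: "\<And>y. \<forall>i\<in>C-{a}. lam i (proj a y) \<ge> 0 \<Longrightarrow> 0 \<le> lo y \<and> hi y \<le> 1" for lo hi
  proof -
    have "L lo hi = prism a s \<inter> ({y. lo y \<le> t y} \<inter> {y. t y \<le> hi y})"
      unfolding L_def prism_def t_def[symmetric] by (auto dest: le)
    then show ?thesis
      by (simp only:) (intro compact_Int_closed compact_prism[OF a s] closed_Int closed_Collect_le c ct)
  qed
  define S where "S J y = (\<Sum>i\<in>J. lam i (proj a y))" for J y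
  have cS: "continuous_on A (S J)" for A J
  proof -
    have "continuous_on A (\<lambda>y. (\<Sum>i\<in>J. lam i (proj a y)))" by (intro continuous_on_sum cproj)
    moreover have "S J = (\<lambda>y. (\<Sum>i\<in>J. lam i (proj a y)))" by (rule ext) (rule S_def)
    ultimately show ?thesis by (simp only:)
  qed
  have int: "integrable lborel (indicator X :: _ \<Rightarrow> real)" if "compact X" for X :: "(real^'n) set"
    using borel_integrable_compact[OF that, of "\<lambda>_. 1::real"] by simp
  \<comment> \<open>Induction over the vertices already used: the part of the prism below the
    partial sum over \<open>J\<close>.\<close>
  have "(LINT y|lborel. indicator (L (\<lambda>_. 0) (S J)) y) = real (card J) * (norm (gr a) * vol)" if J: "J \<subseteq> C - {a}" for J
  proof -
    have "finite J" using J finite_C finite_subset[of J C] by blast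
    then show ?thesis using J
    proof (induction J)
      case empty
      have "(LINT y|lborel. indicator (L (\<lambda>_. 0) (S {})) y :: real) = (LINT y|(lborel :: (real^'n) measure). 0)"
      proof (rule integral_cong_AE)
        have "compact (L (\<lambda>_. 0) (S {}))" by (rule cL) (auto simp: S_def)
        then show "(indicator (L (\<lambda>_. 0) (S {})) :: _ \<Rightarrow> real) \<in> borel_measurable lborel"
          using int borel_measurable_integrable by blast
        show "AE y in lborel. indicator (L (\<lambda>_. 0) (S {})) y = (0::real)"
          using null[of "{}"] by eventually_elim (auto simp: L_def S_def indicator_def)
      qed simp
      then show ?case by simp
    next
      case (insert j J)
      have j: "j \<in> C - {a}" and J: "J \<subseteq> C - {a}" using insert by auto
      have S_ins: "S (insert j J) y = S J y + lam j (proj a y)" for y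
        using insert by (simp add: S_def)
      have c1: "compact (L (\<lambda>_. 0) (S (insert j J)))"
        using sum_le[OF insert.prems] by (intro cL cS) (auto simp: S_def)
      have c2: "compact (L (\<lambda>_. 0) (S J))"
        using sum_le[OF J] by (intro cL cS) (auto simp: S_def)
      have c3: "compact (L (S J) (S (insert j J)))"
        using sum_le[OF insert.prems] sum_ge[OF J] by (intro cL cS) (auto simp: S_def)
      have "(LINT y|lborel. indicator (L (\<lambda>_. 0) (S (insert j J))) y :: real) =
          (LINT y|lborel. indicator (L (\<lambda>_. 0) (S J)) y + indicator (L (S J) (S (insert j J))) y)"
      proof (rule integral_cong_AE)
        show "AE y in lborel. indicator (L (\<lambda>_. 0) (S (insert j J))) y =
            indicator (L (\<lambda>_. 0) (S J)) y + (indicator (L (S J) (S (insert j J))) y :: real)"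
          using null[of J]
        proof eventually_elim
          case (elim y)
          show ?case
          proof (cases "\<forall>i\<in>C-{a}. lam i (proj a y) \<ge> 0")
            case True
            then have "0 \<le> S J y" "S J y \<le> S (insert j J) y" using sum_ge[OF J] j by (auto simp: S_def[of J] S_ins)
            then show ?thesis using elim True by (auto simp: L_def indicator_def S_def[of J])
          qed (auto simp: L_def indicator_def)
        qed
      qed (use c1 c2 c3 int borel_measurable_integrable in \<open>auto intro!: borel_measurable_add\<close>)
      also have "\<dots> = (LINT y|lborel. indicator (L (\<lambda>_. 0) (S J)) y) + (LINT y|lborel. indicator (L (S J) (S (insert j J))) y)"
        by (intro Bochner_Integration.integral_add int c2 c3)
      also have "(LINT y|lborel. indicator (L (S J) (S (insert j J))) y) = norm (gr a) * vol"
        using measure_staircase_step[OF a s j J] by (simp only: L_def S_ins) (simp only: S_def t_def)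
      also have "(LINT y|lborel. indicator (L (\<lambda>_. 0) (S J)) y) = real (card J) * (norm (gr a) * vol)"
        using insert.IH J by simp
      finally show ?case using insert by (simp add: algebra_simps)
    qed
  qed
  from this[of "C - {a}"] have "(LINT y|lborel. indicator (L (\<lambda>_. 0) (S (C - {a}))) y) = real CARD('n) * (norm (gr a) * vol)"
    using a card_C by simp
  also have "L (\<lambda>_. 0) (S (C - {a})) = prism a s"
  proof -
    have "S (C - {a}) y = 1" for y
      using barycentric(1)[of "proj a y"] lam_proj_self[OF a, of y] by (simp add: S_def sum.remove[OF finite_C a])
    then show ?thesis by (simp add: L_def prism_def t_def)
  qed
  finally show ?thesis using compact_prism[OF a s] by simp
qed

text \<open>Normal and base point in \<open>surface_measure\<close> are Hilbert choices.
  Orthogonality to the facet fixes the normal up to the sign \<open>s\<close>, and any base point in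
  the facet yields the same projection.\<close>

lemma surface_measure_eq:
  assumes a: "a \<in> C"
  shows "\<exists>s. s * s = 1 \<and> surface_measure (convex hull (C - {a})) =
     completion (distr (restrict_space lborel (prism a s)) borel (proj a))"
proof -
  let ?e = "convex hull (C - {a})"
  have ng: "norm (gr a) > 0" using gr_nonzero[OF a] by simp
  have gg: "gr a \<bullet> gr a = norm (gr a) * norm (gr a)" by (simp add: power2_norm_eq_inner[symmetric] power2_eq_square)
  obtain p where p: "p \<in> C" "p \<noteq> a" using other_vertex[OF a] by blast
  then have pe: "p \<in> ?e" by (simp add: hull_inc)
  let ?P = "\<lambda>n. norm n = 1 \<and> (\<forall>x\<in>?e. \<forall>y\<in>?e. (y - x) \<bullet> n = 0)"
  define n where "n = (SOME n. ?P n)"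
  define x0 where "x0 = (SOME x. x \<in> ?e)"
  have "?P ((1 / norm (gr a)) *\<^sub>R gr a)"
  proof (intro conjI ballI)
    fix x y assume "x \<in> ?e" "y \<in> ?e"
    then have "gr a \<bullet> (y - x) = 0" unfolding lam_diff[symmetric] facet_eq[OF a] by simp
    then show "(y - x) \<bullet> ((1 / norm (gr a)) *\<^sub>R gr a) = 0" by (simp add: inner_commute)
  qed (use ng in simp)
  then have Pn: "?P n" unfolding n_def by (rule someI)
  have x0: "x0 \<in> ?e" unfolding x0_def using pe by (rule someI)
  define s where "s = (n \<bullet> (a - p)) * norm (gr a)"
  have "n = (n \<bullet> (a - p)) *\<^sub>R gr a"
  proof (rule normal_multiple_gr[OF a p])
    fix b assume "b \<in> C" "b \<noteq> a"
    then have "b \<in> ?e" by (simp add: hull_inc)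
    then show "n \<bullet> (b - p) = 0" using Pn pe by (simp add: inner_commute)
  qed
  then have n: "n = (s / norm (gr a)) *\<^sub>R gr a" unfolding s_def using ng by simp
  have "norm n = \<bar>s\<bar>" unfolding n using ng by simp
  then have "\<bar>s\<bar> = 1" using Pn by simp
  then have s: "s * s = 1" by (metis abs_mult_self_eq mult_1)
  have pr: "(\<lambda>y. y - ((y - x0) \<bullet> n) *\<^sub>R n) = proj a"
  proof
    fix y
    have "lam a x0 = 0" using x0 by (simp add: facet_eq[OF a])
    then have "gr a \<bullet> (y - x0) = lam a y" using lam_diff[of a y x0] by simp
    then have "(y - x0) \<bullet> gr a = lam a y" by (simp add: inner_commute)
    then have "((y - x0) \<bullet> n) *\<^sub>R n = (s * s * lam a y / (gr a \<bullet> gr a)) *\<^sub>R gr a"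
      by (simp add: n gg)
    then show "y - ((y - x0) \<bullet> n) *\<^sub>R n = proj a y" by (simp add: proj_def s)
  qed
  have "surface_measure ?e = completion (distr (restrict_space lborel {x + t *\<^sub>R n | x t. x \<in> ?e \<and> t \<in> {0..1}})
                           borel (\<lambda>y. y - ((y - x0) \<bullet> n) *\<^sub>R n))"
    unfolding surface_measure_def n_def x0_def Let_def ..
  then show ?thesis unfolding pr prism_eq[OF a s n] using s by blast
qed

lemma
  fixes \<phi> :: "real^'n \<Rightarrow> 'b::euclidean_space"
  assumes a: "a \<in> C" and s: "s * s = 1" and \<phi>: "continuous_on UNIV \<phi>"
  defines "M \<equiv> completion (distr (restrict_space lborel (prism a s)) borel (proj a))"
  shows integrable_prism: "integrable M \<phi>"
    and integral_prism: "(LINT x|M. \<phi> x) = (LINT y|lborel. indicator (prism a s) y *\<^sub>R \<phi> (proj a y))"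
proof -
  have [measurable]: "\<phi> \<in> borel_measurable borel" using \<phi> by (rule borel_measurable_continuous_onI)
  have pb: "prism a s \<in> sets borel" using compact_prism[OF a s] by (rule borel_compact)
  have "proj a \<in> borel_measurable borel" using continuous_proj by (rule borel_measurable_continuous_onI)
  then have [measurable]: "proj a \<in> restrict_space lborel (prism a s) \<rightarrow>\<^sub>M borel"
    by (intro measurable_restrict_space1) simp
  have "continuous_on UNIV (\<lambda>y. \<phi> (proj a y))"
    using continuous_on_compose2[OF \<phi> continuous_proj] by blast
  then have "integrable lborel (\<lambda>y. indicator (prism a s) y *\<^sub>R \<phi> (proj a y))"
    by (intro borel_integrable_compact compact_prism[OF a s]) (rule continuous_on_subset, auto)
  then have "integrable (restrict_space lborel (prism a s)) (\<lambda>y. \<phi> (proj a y))"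
    using pb by (simp add: integrable_restrict_space)
  then show "integrable M \<phi>"
    unfolding M_def by (simp add: integrable_completion integrable_distr_eq)
  have "(LINT x|M. \<phi> x) = (LINT y|restrict_space lborel (prism a s). \<phi> (proj a y))"
    unfolding M_def by (simp add: integral_completion integral_distr)
  then show "(LINT x|M. \<phi> x) = (LINT y|lborel. indicator (prism a s) y *\<^sub>R \<phi> (proj a y))"
    using pb by (simp add: integral_restrict_space)
qed

lemma integrable_surface:
  fixes \<phi> :: "real^'n \<Rightarrow> 'b::euclidean_space"
  assumes "a \<in> C" "continuous_on UNIV \<phi>"
  shows "integrable (surface_measure (convex hull (C - {a}))) \<phi>"
  using surface_measure_eq[OF assms(1)] integrable_prism[OF assms(1) _ assms(2)] by metis

text \<open>Almost every point of a facet is relatively interior. The exceptional points pull back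
  to finitely many hyperplanes in the prism.\<close>

lemma AE_surface:
  assumes a: "a \<in> C"
  shows "AE x in surface_measure (convex hull (C - {a})). lam a x = 0 \<and> (\<forall>j\<in>C-{a}. lam j x > 0)"
proof -
  obtain s where s: "s * s = 1" and eq: "surface_measure (convex hull (C - {a})) =
     completion (distr (restrict_space lborel (prism a s)) borel (proj a))"
    using surface_measure_eq[OF a] by blast
  let ?P = "\<lambda>x. lam a x = 0 \<and> (\<forall>j\<in>C-{a}. lam j x > 0)"
  have pb: "prism a s \<in> sets borel" using compact_prism[OF a s] by (rule borel_compact)
  have "proj a \<in> borel_measurable borel" using continuous_proj by (rule borel_measurable_continuous_onI)
  then have [measurable]: "proj a \<in> restrict_space lborel (prism a s) \<rightarrow>\<^sub>M borel"
    by (intro measurable_restrict_space1) simp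
  have [measurable]: "lam b \<in> borel_measurable borel" for b
    using continuous_lam by (rule borel_measurable_continuous_onI)
  have [measurable]: "Measurable.pred borel ?P" by measurable
  have "AE y in lborel. lam j (proj a y) \<noteq> 0" if j: "j \<in> C - {a}" for j
  proof -
    \<comment> \<open>A second vertex of the facet shows that the projected coordinate of
      \<open>j\<close> is not constant, so that its zero set is a hyperplane.\<close>
    have "card (C - {a}) \<ge> 2" using card_C card23 a by auto
    then obtain i where i: "i \<in> C - {a}" "i \<noteq> j"
      by (metis card_le_Suc0_iff_eq finite_C finite_Diff not_less_eq_eq numeral_2_eq_2)
    let ?g = "gr j - ((gr j \<bullet> gr a) / (gr a \<bullet> gr a)) *\<^sub>R gr a"
    have "gr a \<bullet> (j - i) = 0" using gr_vertex_diff[of a j i] a i j by auto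
    then have "?g \<bullet> (j - i) = 1"
      using gr_vertex_diff[of j j i] i j by (simp only: inner_diff_left[of "gr j"] inner_scaleR_left) simp
    then have "?g \<noteq> 0" by (metis inner_zero_left zero_neq_one)
    from null_hyperplane[OF this, of "- (fst (coef j) - fst (coef a) * ((gr j \<bullet> gr a) / (gr a \<bullet> gr a)))"]
    show ?thesis unfolding lam_proj_affine by eventually_elim linarith
  qed
  then have "AE y in lborel. \<forall>j\<in>C-{a}. lam j (proj a y) \<noteq> 0"
    by (intro AE_finite_allI) auto
  then have "AE y in lborel. y \<in> prism a s \<longrightarrow> ?P (proj a y)"
    by eventually_elim (auto simp: prism_def lam_proj_self[OF a] less_le)
  then have "AE y in restrict_space lborel (prism a s). ?P (proj a y)"
    by (rule AE_restrict_space_iff[THEN iffD2, rotated]) (use pb in simp)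
  then have "AE x in distr (restrict_space lborel (prism a s)) borel (proj a). ?P x"
    by (subst AE_distr_iff) auto
  then show ?thesis unfolding eq by (rule AE_completion)
qed

lemma integral_surface_inner:
  fixes P R :: "real^'n \<Rightarrow> 'b::euclidean_space"
  assumes a: "a \<in> C"
  shows "(LINT x|surface_measure (convex hull (C - {a})). (\<Sum>j\<in>C-{a}. lam j x *\<^sub>R P j) \<bullet> (\<Sum>j\<in>C-{a}. lam j x *\<^sub>R R j)) =
     norm (gr a) * vol / (real CARD('n) + 1) * ((\<Sum>j\<in>C-{a}. P j \<bullet> R j) + (\<Sum>j\<in>C-{a}. P j) \<bullet> (\<Sum>j\<in>C-{a}. R j))"
proof -
  obtain s where s: "s * s = 1" and eq: "surface_measure (convex hull (C - {a})) =
     completion (distr (restrict_space lborel (prism a s)) borel (proj a))"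
    using surface_measure_eq[OF a] by blast
  show ?thesis
    unfolding eq
    by (subst integral_prism[OF a s])
       (auto simp: integral_prism_inner[OF a s] measure_prism[OF a s] intro!: continuous_intros continuous_lam)
qed

lemma vol_pos: "vol > 0"
proof -
  have "\<not> negligible (convex hull C)"
    using interior_hull_nonempty open_not_negligible[OF open_interior] negligible_subset[OF _ interior_subset]
    by blast
  then have "measure lebesgue (convex hull C) \<noteq> 0"
    using compact_hull by (metis negligible_iff_measure lmeasurable_compact)
  then show ?thesis using compact_hull by (simp add: compact_imp_closed zero_less_measure_iff)
qed

end

section \<open>Minimal angles and heights\<close>

lemma vec_angle_ge_imp:
  assumes "vec_angle u v \<ge> \<theta>" "0 \<le> \<theta>"
  shows "u \<bullet> v \<le> cos \<theta> * (norm u * norm v)"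
proof (cases "norm u * norm v = 0")
  case True then show ?thesis by auto
next
  case False
  let ?y = "u \<bullet> v / (norm u * norm v)"
  have pos: "norm u * norm v > 0" using False by (simp add: less_le)
  have "\<bar>u \<bullet> v\<bar> \<le> norm u * norm v" by (rule Cauchy_Schwarz_ineq2)
  then have "\<bar>?y\<bar> \<le> 1" using pos by (simp add: abs_divide del: abs_mult)
  then have y: "-1 \<le> ?y" "?y \<le> 1" by linarith+
  have "?y = cos (arccos ?y)" using y by simp
  also have "\<dots> \<le> cos \<theta>"
    using assms y arccos_ubound[of ?y] unfolding vec_angle_def by (intro cos_monotone_0_pi_le) auto
  finally show ?thesis using pos by (simp add: divide_le_eq)
qed

lemma vec_angle_le_imp:
  assumes "pi - vec_angle u v \<ge> \<theta>" "0 \<le> \<theta>" "norm u = 1" "norm v = 1"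
  shows "u \<bullet> v \<ge> - cos \<theta>"
proof -
  have "\<bar>u \<bullet> v\<bar> \<le> 1" using Cauchy_Schwarz_ineq2[of u v] assms by simp
  then have y: "-1 \<le> u \<bullet> v" "u \<bullet> v \<le> 1" by linarith+
  have ang: "arccos (u \<bullet> v) \<le> pi - \<theta>" using assms by (simp add: vec_angle_def)
  have "- cos \<theta> = cos (pi - \<theta>)" by simp
  also have "\<dots> \<le> cos (arccos (u \<bullet> v))"
    using ang arccos_lbound[of "u \<bullet> v"] y assms by (intro cos_monotone_0_pi_le) auto
  finally show ?thesis using y by simp
qed

lemma min_angle_ge_mono:
  assumes "min_angle_ge \<theta> K" "\<theta>' \<le> \<theta>"
  shows "min_angle_ge \<theta>' K"
proof -
  have le: "x \<ge> \<theta>'" if "x \<ge> \<theta>" for x using that assms(2) by simp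
  show ?thesis
    unfolding min_angle_ge_def
    by (intro conjI allI impI le) (use assms(1) in \<open>simp_all add: min_angle_ge_def\<close>)
qed

text \<open>The law of cosines with the square completed: the side opposite the angle is at least
  the sine of the minimal angle times an adjacent side.\<close>

lemma triangle_side_le:
  fixes x y :: "'a::real_inner"
  assumes "x \<bullet> y \<le> c * (norm x * norm y)" "s\<^sup>2 = 1 - c\<^sup>2" "s \<ge> 0"
  shows "s * norm x \<le> norm (x - y)"
proof -
  have "(s * norm x)\<^sup>2 \<le> (s * norm x)\<^sup>2 + (norm y - c * norm x)\<^sup>2" by simp
  also have "\<dots> = (norm x)\<^sup>2 + (norm y)\<^sup>2 - 2 * (c * (norm x * norm y))"
    by (simp add: power_mult_distrib power2_diff assms(2) algebra_simps)
  also have "\<dots> \<le> (norm x)\<^sup>2 + (norm y)\<^sup>2 - 2 * (x \<bullet> y)" using assms(1) by simp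
  also have "\<dots> = (norm (x - y))\<^sup>2"
    by (simp add: power2_norm_eq_inner inner_diff_left inner_diff_right inner_commute)
  finally show ?thesis by (rule power2_le_imp_le) simp
qed

text \<open>The right-hand side is four times the squared area, so this bounds the height over the
  side \<open>y\<close>. A base angle gives the bound only if it is not obtuse; at least one of the
  two is not, and the area expression is the same seen from either end.\<close>

lemma triangle_height_ge:
  fixes x y :: "'a::real_inner"
  assumes 1: "x \<bullet> y \<le> c * (norm x * norm y)"
    and 2: "(x - y) \<bullet> (- y) \<le> c * (norm (x - y) * norm y)"
    and s: "s\<^sup>2 = 1 - c\<^sup>2" "c \<ge> 0" and L: "L \<ge> 0" "L \<le> norm x" "L \<le> norm (x - y)"
  shows "(s * L)\<^sup>2 * (norm y)\<^sup>2 \<le> (norm x)\<^sup>2 * (norm y)\<^sup>2 - (x \<bullet> y)\<^sup>2"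
proof -
  have key: "(s * L)\<^sup>2 * (norm y)\<^sup>2 \<le> (norm z)\<^sup>2 * (norm y)\<^sup>2 - p\<^sup>2"
    if "0 \<le> p" "p \<le> c * (norm z * norm y)" "L \<le> norm z" for z :: 'a and p
  proof -
    have "p\<^sup>2 \<le> (c * (norm z * norm y))\<^sup>2" using that by (intro power_mono)
    then have "(norm z)\<^sup>2 * (norm y)\<^sup>2 - p\<^sup>2 \<ge> s\<^sup>2 * ((norm z)\<^sup>2 * (norm y)\<^sup>2)"
      by (simp add: power_mult_distrib s(1) algebra_simps)
    moreover have "s\<^sup>2 * ((norm z)\<^sup>2 * (norm y)\<^sup>2) \<ge> s\<^sup>2 * (L\<^sup>2 * (norm y)\<^sup>2)"
      using that L by (intro mult_left_mono mult_right_mono power_mono) auto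
    ultimately show ?thesis by (simp add: power_mult_distrib mult.assoc)
  qed
  show ?thesis
  proof (cases "x \<bullet> y \<ge> 0")
    case True then show ?thesis using key[of "x \<bullet> y" x] 1 L by simp
  next
    case False
    have e: "(x - y) \<bullet> (- y) = (norm y)\<^sup>2 - x \<bullet> y"
      by (simp add: power2_norm_eq_inner inner_diff_left)
    have "(norm (x - y))\<^sup>2 * (norm y)\<^sup>2 - ((x - y) \<bullet> (- y))\<^sup>2 = (norm x)\<^sup>2 * (norm y)\<^sup>2 - (x \<bullet> y)\<^sup>2"
      unfolding e by (simp add: power2_norm_eq_inner inner_diff_left inner_diff_right inner_commute)
        (simp add: power2_eq_square algebra_simps)
    moreover have "0 \<le> (x - y) \<bullet> (- y)" unfolding e using False zero_le_power2[of "norm y"] by linarith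
    ultimately show ?thesis using key[of "(x - y) \<bullet> (- y)" "x - y"] 2 L by simp
  qed
qed

section \<open>Facet normals, and heights from the angle condition\<close>

context simplex23
begin

text \<open>The outward unit normal of the facet opposite \<open>a\<close>; the sign is negative
  because \<open>lam a\<close> grows into the simplex.\<close>

definition nrm :: "real^'n \<Rightarrow> real^'n" where "nrm a = - (1 / norm (gr a)) *\<^sub>R gr a"

lemma norm_nrm: "a \<in> C \<Longrightarrow> norm (nrm a) = 1"
  using gr_nonzero by (simp add: nrm_def)

lemma extreme_point_iff: "x extreme_point_of (convex hull C) \<longleftrightarrow> x \<in> C"
  by (rule extreme_point_of_convex_hull_affine_independent[OF aff])

lemma facet_iff: "F facet_of (convex hull C) \<longleftrightarrow> (\<exists>a\<in>C. F = convex hull (C - {a}))"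
  using facet_of_convex_hull_affine_independent_alt[OF aff, of F] card_C card23 by auto

text \<open>Shows that the definite description in \<open>face_normal\<close> is proper: exchanging
  two points of the facet forces orthogonality to it, and the vertex \<open>a\<close> determines the
  sign.\<close>

lemma face_normal_eq:
  assumes a: "a \<in> C"
  shows "face_normal (convex hull C) (convex hull (C - {a})) = nrm a"
  unfolding face_normal_def
proof (rule the_equality)
  let ?e = "convex hull (C - {a})"
  have ng: "norm (gr a) > 0" using gr_nonzero[OF a] by simp
  show "norm (nrm a) = 1 \<and> (\<forall>x\<in>?e. \<forall>y\<in>convex hull C. (y - x) \<bullet> nrm a \<le> 0)"
  proof (intro conjI ballI norm_nrm[OF a])
    fix x y assume "x \<in> ?e" "y \<in> convex hull C"
    then have "gr a \<bullet> (y - x) \<ge> 0" unfolding lam_diff[symmetric] facet_eq[OF a] hull_eq using a by simp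
    then show "(y - x) \<bullet> nrm a \<le> 0" using ng by (simp add: nrm_def inner_commute)
  qed
  fix n assume n: "norm n = 1 \<and> (\<forall>x\<in>?e. \<forall>y\<in>convex hull C. (y - x) \<bullet> n \<le> 0)"
  obtain p where p: "p \<in> C" "p \<noteq> a" using other_vertex[OF a] by blast
  have pe: "p \<in> ?e" "a \<in> convex hull C" using p a by (auto simp: hull_inc)
  have "n = (n \<bullet> (a - p)) *\<^sub>R gr a"
  proof (rule normal_multiple_gr[OF a p])
    fix b assume "b \<in> C" "b \<noteq> a"
    then have "b \<in> ?e" "b \<in> convex hull C" "p \<in> convex hull C" using p by (auto simp: hull_inc)
    then have "(b - p) \<bullet> n \<le> 0" "(p - b) \<bullet> n \<le> 0" using n pe by blast+
    then show "n \<bullet> (b - p) = 0" by (simp add: inner_diff_left inner_diff_right inner_commute)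
  qed
  then obtain r where r: "n = r *\<^sub>R gr a" "r = n \<bullet> (a - p)" by blast
  have "r \<le> 0" using n pe r(2) by (metis inner_commute)
  moreover have "\<bar>r\<bar> * norm (gr a) = 1" using n r(1) by (metis norm_scaleR)
  ultimately have rr: "r = - (1 / norm (gr a))" using ng by (simp add: field_simps)
  show "n = nrm a" unfolding r(1) rr nrm_def ..
qed

lemma inner_zero_if_constant:
  assumes "p \<in> C" "\<And>b. b \<in> C \<Longrightarrow> q \<bullet> (b - p) = 0"
  shows "q = 0"
proof -
  obtain a where a: "a \<in> C" "a \<noteq> p" using other_vertex[OF assms(1)] by blast
  have "q = (q \<bullet> (a - p)) *\<^sub>R gr a"
    using a assms by (intro normal_multiple_gr) auto
  then show ?thesis using assms(2)[OF a(1)] by simp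
qed

text \<open>The reciprocal of \<open>norm (gr a)\<close> is the height over the facet opposite
  \<open>a\<close>. In a triangle the angles bound it directly. In a tetrahedron face angles alone
  allow flat elements: they bound only the part of \<open>gr a\<close> tangential to each face
  through \<open>a\<close>, and the dihedral angles must exclude that \<open>gr a\<close> is nearly
  normal to all of these faces. Of the exponent 4, two factors compare edges, one bounds heights in
  the faces and one comes from the dihedral argument.\<close>

lemma gr_norm_le:
  assumes ang: "min_angle_ge \<theta> (convex hull C)" and \<theta>: "0 < \<theta>" "\<theta> \<le> pi/2"
    and a: "a \<in> C" and uv: "u \<in> C" "v \<in> C" "u \<noteq> v"
  shows "norm (gr a) * (sin \<theta> ^ 4 * norm (u - v)) \<le> 1"
proof -
  define s c where "s = sin \<theta>" and "c = cos \<theta>"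
  have s0: "s > 0" unfolding s_def using \<theta> by (intro sin_gt_zero) auto
  have c0: "c \<ge> 0" unfolding c_def using \<theta> by (intro cos_ge_zero) auto
  have sc: "s\<^sup>2 = 1 - c\<^sup>2" unfolding s_def c_def by (simp add: sin_squared_eq)
  have s1: "s \<le> 1" unfolding s_def by simp
  have face: "(q - p) \<bullet> (r - p) \<le> c * (norm (q - p) * norm (r - p))"
    if "p \<in> C" "q \<in> C" "r \<in> C" "p \<noteq> q" "p \<noteq> r" "q \<noteq> r" for p q r
  proof -
    have "vec_angle (q - p) (r - p) \<ge> \<theta>"
      using ang that unfolding min_angle_ge_def extreme_point_iff by auto
    then show ?thesis unfolding c_def using \<theta> by (intro vec_angle_ge_imp) auto
  qed
  have dih: "nrm p \<bullet> nrm q \<ge> - c" if "p \<in> C" "q \<in> C" "p \<noteq> q" for p q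
  proof -
    have ne: "convex hull (C - {p}) \<noteq> convex hull (C - {q})"
    proof
      assume "convex hull (C - {p}) = convex hull (C - {q})"
      moreover have "p \<in> convex hull (C - {q})" using that by (simp add: hull_inc)
      ultimately have "p \<in> convex hull (C - {p})" by simp
      then show False using facet_eq[OF that(1)] lam_vertex[OF that(1,1)] by simp
    qed
    have "pi - vec_angle (face_normal (convex hull C) (convex hull (C - {p}))) (face_normal (convex hull C) (convex hull (C - {q}))) \<ge> \<theta>"
    proof -
      have "convex hull (C - {p}) facet_of convex hull C" "convex hull (C - {q}) facet_of convex hull C"
        using that facet_iff by blast+
      then show ?thesis using ang ne unfolding min_angle_ge_def by (elim conjE allE[of _ "convex hull (C - {p})"] allE[of _ "convex hull (C - {q})"]) blast
    qed
    then show ?thesis unfolding c_def face_normal_eq[OF that(1)] face_normal_eq[OF that(2)]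
      using \<theta> that norm_nrm by (intro vec_angle_le_imp) auto
  qed
  have adj: "s * norm (p - q) \<le> norm (q - r)"
    if "p \<in> C" "q \<in> C" "r \<in> C" "p \<noteq> q" "p \<noteq> r" "q \<noteq> r" for p q r
  proof -
    have "s * norm (q - p) \<le> norm ((q - p) - (r - p))"
      using face[OF that] sc s0 by (intro triangle_side_le) auto
    then show ?thesis by (simp add: norm_minus_commute)
  qed
  \<comment> \<open>Edges with a common vertex are comparable up to the factor \<open>s\<close>, and
    an edge disjoint from the one joining \<open>u\<close> and \<open>v\<close> is reached in two
    such comparisons. Hence \<open>L\<close> is below every edge length.\<close>
  define L where "L = s\<^sup>2 * norm (u - v)"
  have L0: "L > 0" unfolding L_def using s0 uv by simp
  have edge: "L \<le> norm (p - q)" if pq: "p \<in> C" "q \<in> C" "p \<noteq> q" for p q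
  proof -
    have s2: "s\<^sup>2 * r \<le> s * r" "s * r \<le> r" if "r \<ge> 0" for r
      using s0 s1 that by (auto simp: power2_eq_square mult.assoc intro: mult_left_le_one_le mult_nonneg_nonneg)
    have one: "L \<le> norm (x - y)" if "x \<in> C" "y \<in> C" "x \<noteq> y" "x = u \<or> x = v" for x y
    proof -
      define w where "w = (if x = u then v else u)"
      have w: "w \<in> C" "w \<noteq> x" "norm (u - v) = norm (w - x)"
        using that uv by (auto simp: w_def norm_minus_commute)
      show ?thesis
      proof (cases "w = y")
        case True
        then have "norm (x - y) = norm (u - v)" using w by (simp add: norm_minus_commute)
        then show ?thesis using s2[of "norm (u - v)"] unfolding L_def by simp
      next
        case False
        then have "s * norm (w - x) \<le> norm (x - y)" using w that by (intro adj) auto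
        then show ?thesis using s2(1)[of "norm (u - v)"] w(3) unfolding L_def by simp
      qed
    qed
    show ?thesis
    proof (cases "p = u \<or> p = v \<or> q = u \<or> q = v")
      case True
      then show ?thesis using one[of p q] one[of q p] pq by (auto simp: norm_minus_commute)
    next
      case False
      then have "s * norm (v - u) \<le> norm (u - p)" using uv pq by (intro adj) auto
      moreover have "s * norm (u - p) \<le> norm (p - q)" using False uv pq by (intro adj) auto
      ultimately have "s * (s * norm (v - u)) \<le> norm (p - q)" using s0 by (meson mult_left_mono less_imp_le order_trans)
      then show ?thesis unfolding L_def by (simp add: power2_eq_square norm_minus_commute mult.assoc)
    qed
  qed
  \<comment> \<open>The gradient of the barycentric coordinate of \<open>a\<close> within the plane
    of the triangle \<open>a\<close>, \<open>b\<close>, \<open>d\<close>: the height vector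
    \<open>z\<close> over the side from \<open>b\<close> to \<open>d\<close>, divided by its squared
    length.\<close>
  define P where "P b d = (let x = a - b; y = d - b; z = x - ((x \<bullet> y) / (y \<bullet> y)) *\<^sub>R y in (1 / (z \<bullet> z)) *\<^sub>R z)" for b d
  have P: "P b d \<bullet> (a - b) = 1 \<and> P b d \<bullet> (d - b) = 0 \<and> norm (P b d) \<le> 1 / (s * L) \<and>
       (\<forall>w. w \<bullet> (a - b) = 0 \<longrightarrow> w \<bullet> (d - b) = 0 \<longrightarrow> P b d \<bullet> w = 0)"
    if bd: "b \<in> C" "d \<in> C" "a \<noteq> b" "a \<noteq> d" "b \<noteq> d" for b d
  proof -
    define x y where "x = a - b" and "y = d - b"
    define z where "z = x - ((x \<bullet> y) / (y \<bullet> y)) *\<^sub>R y"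
    have Pz: "P b d = (1 / (z \<bullet> z)) *\<^sub>R z" by (simp add: P_def x_def y_def z_def Let_def)
    have y0: "y \<bullet> y > 0" using bd by (simp add: y_def)
    have zy: "z \<bullet> y = 0" using y0 by (simp add: z_def inner_diff_left)
    have zx: "z \<bullet> x = z \<bullet> z"
    proof -
      have "z \<bullet> z = z \<bullet> x - ((x \<bullet> y) / (y \<bullet> y)) * (z \<bullet> y)"
        by (subst (2) z_def) (simp only: inner_diff_right inner_scaleR_right)
      then show ?thesis using zy by simp
    qed
    have "z \<bullet> x = x \<bullet> x - (x \<bullet> y)\<^sup>2 / (y \<bullet> y)"
    proof -
      have "z \<bullet> x = x \<bullet> x - ((x \<bullet> y) / (y \<bullet> y)) * (y \<bullet> x)"
        by (simp only: z_def inner_diff_left inner_scaleR_left)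
      then show ?thesis by (simp add: inner_commute[of y x] power2_eq_square)
    qed
    then have zz: "z \<bullet> z = x \<bullet> x - (x \<bullet> y)\<^sup>2 / (y \<bullet> y)" using zx by simp
    have "(s * L)\<^sup>2 * (norm y)\<^sup>2 \<le> (norm x)\<^sup>2 * (norm y)\<^sup>2 - (x \<bullet> y)\<^sup>2"
    proof (rule triangle_height_ge[OF _ _ sc c0])
      show "x \<bullet> y \<le> c * (norm x * norm y)" unfolding x_def y_def using face[of b a d] bd a by auto
      have "(a - d) \<bullet> (b - d) \<le> c * (norm (a - d) * norm (b - d))" using face[of d a b] bd a by auto
      moreover have "x - y = a - d" "- y = b - d" "norm y = norm (b - d)"
        by (simp_all add: x_def y_def norm_minus_commute)
      ultimately show "(x - y) \<bullet> (- y) \<le> c * (norm (x - y) * norm y)"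
        by (simp only:)
      show "0 \<le> L" using L0 by simp
      show "L \<le> norm x" "L \<le> norm (x - y)" using edge[of a b] edge[of a d] a bd by (auto simp: x_def y_def)
    qed
    then have "(s * L)\<^sup>2 * (y \<bullet> y) \<le> (x \<bullet> x) * (y \<bullet> y) - (x \<bullet> y)\<^sup>2"
      by (simp add: power2_norm_eq_inner)
    then have "((s * L)\<^sup>2 * (y \<bullet> y)) / (y \<bullet> y) \<le> ((x \<bullet> x) * (y \<bullet> y) - (x \<bullet> y)\<^sup>2) / (y \<bullet> y)"
      using y0 by (intro divide_right_mono) auto
    then have zL: "(s * L)\<^sup>2 \<le> z \<bullet> z" unfolding zz using y0 by (simp add: diff_divide_distrib)
    have sL: "s * L > 0" using s0 L0 by simp
    then have z0: "z \<bullet> z > 0" using zL by (meson less_le_trans zero_less_power)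
    have nz: "norm z \<ge> s * L" using zL sL by (metis norm_eq_sqrt_inner real_le_rsqrt)
    have "norm (P b d) = 1 / norm z"
      unfolding Pz using z0 by (simp add: power2_norm_eq_inner[symmetric] power2_eq_square)
    also have "\<dots> \<le> 1 / (s * L)" using nz sL by (intro frac_le) auto
    finally have "norm (P b d) \<le> 1 / (s * L)" .
    moreover have "P b d \<bullet> x = 1" "P b d \<bullet> y = 0" using zx zy z0 unfolding Pz by auto
    moreover have "P b d \<bullet> w = 0" if "w \<bullet> x = 0" "w \<bullet> y = 0" for w
    proof -
      have "x \<bullet> w = 0" "y \<bullet> w = 0" using that by (simp_all add: inner_commute)
      then have "z \<bullet> w = 0" by (simp add: z_def inner_diff_left)
      then show ?thesis by (simp add: Pz)
    qed
    ultimately show ?thesis unfolding x_def y_def by blast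
  qed
  have "card C \<ge> 3" using card_C card23 by auto
  have sL: "s * L > 0" using s0 L0 by simp
  have gr_a: "gr a \<bullet> (p - q) = (if p = a then 1 else 0) - (if q = a then 1 else 0)" if "p \<in> C" "q \<in> C" for p q
    using gr_vertex_diff a that by simp
  have main: "norm (gr a) \<le> 1 / (s * L * s)"
    using card23
  proof
    assume 2: "CARD('n) = 2"
    obtain b where b: "b \<in> C" "b \<noteq> a" using other_vertex[OF a] by blast
    have "card (C - {a} - {b}) = 1" using 2 card_C a b by simp
    then obtain d where d: "C - {a} - {b} = {d}" by (auto simp: card_1_singleton_iff)
    then have d': "d \<in> C" "d \<noteq> a" "d \<noteq> b" and Ceq: "C = {a, b, d}" using a b by auto
    note Pd = P[OF b(1) d'(1) b(2)[symmetric] d'(2)[symmetric] d'(3)[symmetric]]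
    have "gr a - P b d = 0"
    proof (rule inner_zero_if_constant[OF b(1)])
      fix q assume "q \<in> C"
      then consider "q = a" | "q = b" | "q = d" using Ceq by blast
      then show "(gr a - P b d) \<bullet> (q - b) = 0"
        using Pd gr_a[of q b] a b d' by cases (auto simp: inner_diff_left[of "gr a"])
    qed
    then have "norm (gr a) \<le> 1 / (s * L)" using Pd by simp
    also have "\<dots> \<le> 1 / (s * L * s)" 
    proof (rule frac_le)
      show "s * L * s \<le> s * L" using mult_left_le[OF s1] sL by simp
      show "0 < s * L * s" using mult_pos_pos[OF sL s0] .
    qed auto
    finally show ?thesis .
  next
    assume 3: "CARD('n) = 3"
    \<comment> \<open>On the face opposite \<open>f\<close> the tangential part of
      \<open>gr a\<close> is \<open>P b d\<close>, while \<open>gr f\<close> is normal to that face.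
      The left side is thus the product of the squared norms of \<open>P b d\<close> and
      \<open>gr f\<close>.\<close>
    have f_ineq: "(norm (gr a))\<^sup>2 * (norm (gr f))\<^sup>2 - (gr a \<bullet> gr f)\<^sup>2 \<le> (1 / (s * L))\<^sup>2 * (norm (gr f))\<^sup>2"
      if f: "f \<in> C" "f \<noteq> a" for f
    proof -
      have "card (C - {a} - {f}) = 2" using 3 card_C a f by simp
      then obtain b d where bd: "C - {a} - {f} = {b, d}" "b \<noteq> d" by (auto simp: card_2_iff)
      then have bd': "b \<in> C" "d \<in> C" "a \<noteq> b" "a \<noteq> d" "b \<noteq> f" "d \<noteq> f" and Ceq: "C = {a, b, d, f}" using a f by auto
      note Pd = P[OF bd'(1-4) bd(2)]
      let ?q = "gr a - P b d"
      have q: "?q = (?q \<bullet> (f - b)) *\<^sub>R gr f"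
      proof (rule normal_multiple_gr[OF f(1) bd'(1) bd'(5)])
        fix q assume "q \<in> C" "q \<noteq> f"
        then consider "q = a" | "q = b" | "q = d" using Ceq by blast
        then show "?q \<bullet> (q - b) = 0"
          using Pd gr_a[of q b] a bd' by cases (auto simp: inner_diff_left[of "gr a"])
      qed
      have "gr f \<bullet> (a - b) = 0" "gr f \<bullet> (d - b) = 0"
        using gr_vertex_diff[of f a b] gr_vertex_diff[of f d b] a f bd' by auto
      then have Pf: "P b d \<bullet> gr f = 0" using Pd by blast
      then have Pf': "gr f \<bullet> P b d = 0" by (simp only: inner_commute)
      define r where "r = ?q \<bullet> (f - b)"
      have ga: "gr a = P b d + r *\<^sub>R gr f" using q unfolding r_def by (metis diff_add_cancel add.commute)
      have "(norm (gr a))\<^sup>2 = (norm (P b d))\<^sup>2 + r\<^sup>2 * (norm (gr f))\<^sup>2"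
        unfolding ga power2_norm_eq_inner using Pf Pf'
        by (simp add: inner_add_left inner_add_right power2_eq_square)
      moreover have "gr a \<bullet> gr f = r * (norm (gr f))\<^sup>2"
        unfolding ga using Pf by (simp add: power2_norm_eq_inner inner_add_left)
      ultimately have "(norm (gr a))\<^sup>2 * (norm (gr f))\<^sup>2 - (gr a \<bullet> gr f)\<^sup>2 = (norm (P b d))\<^sup>2 * (norm (gr f))\<^sup>2"
        by (simp add: power2_eq_square algebra_simps)
      also have "\<dots> \<le> (1 / (s * L))\<^sup>2 * (norm (gr f))\<^sup>2"
        using Pd by (intro mult_right_mono power_mono) auto
      finally show ?thesis .
    qed
    show ?thesis
    proof (rule ccontr)
      assume "\<not> norm (gr a) \<le> 1 / (s * L * s)"
      then have "s * (1 / (s * L * s)) < s * norm (gr a)"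
        using s0 by (intro mult_strict_left_mono) auto
      moreover have "s * (1 / (s * L * s)) = 1 / (s * L)" using s0 by simp
      ultimately have "1 / (s * L) < s * norm (gr a)" by (simp only:)
      then have big: "(1 / (s * L))\<^sup>2 < s\<^sup>2 * (norm (gr a))\<^sup>2"
        using sL by (simp only: power_mult_distrib[symmetric]) (intro power_strict_mono, auto)
      \<comment> \<open>If \<open>gr a\<close> is too long, its tangential part on this face is
        relatively small, so its product with \<open>gr f\<close> exceeds \<open>c\<close> times the
        norms in absolute value. The dihedral angle forbids the negative sign.\<close>
      have pos: "gr a \<bullet> gr f > 0" if f: "f \<in> C - {a}" for f
      proof (rule ccontr)
        assume neg: "\<not> gr a \<bullet> gr f > 0"
        have nf: "norm (gr f) > 0" "norm (gr a) > 0" using gr_nonzero f a by auto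
        have "nrm a \<bullet> nrm f = (gr a \<bullet> gr f) / (norm (gr a) * norm (gr f))" by (simp add: nrm_def)
        then have "(gr a \<bullet> gr f) / (norm (gr a) * norm (gr f)) \<ge> - c" using dih[of a f] a f by auto
        then have "gr a \<bullet> gr f \<ge> - c * (norm (gr a) * norm (gr f))" using nf by (simp add: le_divide_eq)
        then have "\<bar>gr a \<bullet> gr f\<bar> \<le> c * (norm (gr a) * norm (gr f))" using neg by simp
        then have "\<bar>gr a \<bullet> gr f\<bar>\<^sup>2 \<le> (c * (norm (gr a) * norm (gr f)))\<^sup>2" by (intro power_mono) auto
        then have "(gr a \<bullet> gr f)\<^sup>2 \<le> c\<^sup>2 * ((norm (gr a))\<^sup>2 * (norm (gr f))\<^sup>2)"
          by (simp add: power_mult_distrib)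
        moreover have "(1 / (s * L))\<^sup>2 * (norm (gr f))\<^sup>2 < s\<^sup>2 * (norm (gr a))\<^sup>2 * (norm (gr f))\<^sup>2"
          using big nf by (intro mult_strict_right_mono) auto
        ultimately show False using f_ineq[of f] f unfolding sc by (simp add: algebra_simps)
      qed
      \<comment> \<open>The gradients sum to zero, so \<open>gr a\<close> cannot have a positive
        product with every one of the others.\<close>
      have "0 = gr a \<bullet> (\<Sum>f\<in>C. gr f)" by (simp add: sum_gr)
      also have "\<dots> = gr a \<bullet> gr a + (\<Sum>f\<in>C-{a}. gr a \<bullet> gr f)"
        by (simp add: sum.remove[OF finite_C a] inner_add_right inner_sum_right)
      also have "\<dots> > 0" using pos gr_nonzero[OF a] by (intro add_pos_nonneg sum_nonneg) (auto intro: less_imp_le)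
      finally show False by simp
    qed
  qed
  have "s * L * s = s ^ 4 * norm (u - v)" unfolding L_def by (simp add: power2_eq_square power4_eq_xxxx)
  moreover have "norm (gr a) * (s * L * s) \<le> 1"
    using main pos_le_divide_eq[OF mult_pos_pos[OF sL s0]] by blast
  ultimately show ?thesis unfolding s_def[symmetric] by (simp only:)
qed

text \<open>Distances within a simplex are dominated by those between vertices, so the edge bound
  passes to the diameter.\<close>

lemma gr_norm_diameter:
  assumes "min_angle_ge \<theta> (convex hull C)" and "0 < \<theta>" "\<theta> \<le> pi/2" and a: "a \<in> C"
  shows "norm (gr a) * (sin \<theta> ^ 4 * diameter (convex hull C)) \<le> 1"
proof -
  have s0: "sin \<theta> > 0" using assms by (intro sin_gt_zero) auto
  have ng: "norm (gr a) > 0" using gr_nonzero[OF a] by simp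
  have "diameter (convex hull C) \<le> 1 / (norm (gr a) * sin \<theta> ^ 4)"
  proof (rule diameter_le)
    fix x y assume xy: "x \<in> convex hull C" "y \<in> convex hull C"
    obtain u v where uv: "u \<in> C" "v \<in> C" "norm (x - y) \<le> norm (u - v)"
      using simplex_extremal_le_exists[OF finite_C xy] by blast
    have "norm (u - v) \<le> 1 / (norm (gr a) * sin \<theta> ^ 4)"
    proof (cases "u = v")
      case True then show ?thesis using s0 ng by simp
    next
      case False
      from gr_norm_le[OF assms uv(1,2) False] show ?thesis
        using s0 ng by (simp add: le_divide_eq mult_ac)
    qed
    then show "norm (x - y) \<le> 1 / (norm (gr a) * sin \<theta> ^ 4)" using uv by simp
  qed (use s0 ng in auto)
  then show ?thesis using s0 ng by (simp add: le_divide_eq mult_ac)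
qed

end

section \<open>Affine functions on a simplex\<close>

definition affine_fun :: "('a::real_vector \<Rightarrow> 'b::real_vector) \<Rightarrow> bool" where
  "affine_fun p \<longleftrightarrow> (\<exists>c L. linear L \<and> p = (\<lambda>x. c + L x))"

lemma affine_fun_diff: "affine_fun p \<Longrightarrow> affine_fun q \<Longrightarrow> affine_fun (\<lambda>x. p x - q x)"
proof -
  assume "affine_fun p" "affine_fun q"
  then obtain c L d M where pq: "linear L" "p = (\<lambda>x. c + L x)" "linear M" "q = (\<lambda>x. d + M x)"
    unfolding affine_fun_def by blast
  then have "linear (\<lambda>x. L x - M x)" by (intro linear_compose_sub)
  moreover have "(\<lambda>x. p x - q x) = (\<lambda>x. (c - d) + (L x - M x))" using pq by auto
  ultimately show ?thesis unfolding affine_fun_def by (intro exI conjI)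
qed

lemma affine_fun_const: "affine_fun (\<lambda>x. c)"
proof -
  have "linear (\<lambda>x. 0)" by (rule linearI) auto
  then show ?thesis unfolding affine_fun_def by (intro exI[of _ c] exI[of _ "\<lambda>x. 0"]) auto
qed

lemma affine_fun_continuous:
  fixes p :: "'a::euclidean_space \<Rightarrow> 'b::real_normed_vector"
  assumes "affine_fun p" shows "continuous_on S p"
proof -
  obtain c L where "linear L" "p = (\<lambda>x. c + L x)" using assms unfolding affine_fun_def by blast
  moreover then have "continuous_on S L" by (simp add: linear_continuous_on linear_conv_bounded_linear)
  ultimately show ?thesis by (auto intro: continuous_intros)
qed

text \<open>Bilinear, without conjugation, so that \<open>cdot (gradc p)\<close> is the derivative
  of an affine \<open>p\<close>.\<close>

definition cdot :: "complex^'n \<Rightarrow> real^'n \<Rightarrow> complex" where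
  "cdot G x = (\<Sum>i\<in>UNIV. G $ i * of_real (x $ i))"

definition cvec :: "real^'n \<Rightarrow> complex^'n" where "cvec x = (\<chi> i. of_real (x $ i))"

text \<open>Difference quotients along the unit vectors; for an affine function they are the exact
  gradient.\<close>

definition gradc :: "(real^'n \<Rightarrow> complex) \<Rightarrow> complex^'n" where
  "gradc p = (\<chi> i. p (axis i 1) - p 0)"

text \<open>For a unit vector \<open>n\<close>, the part of \<open>H\<close> tangential to the
  hyperplane with normal \<open>n\<close>.\<close>

definition tang :: "real^'n \<Rightarrow> complex^'n \<Rightarrow> complex^'n" where
  "tang n H = H - cdot H n *s cvec n"

lemma cdot_diff_left: "cdot (G - H) x = cdot G x - cdot H x"
  and cdot_add_right: "cdot G (x + y) = cdot G x + cdot G y"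
  and cdot_diff_right: "cdot G (x - y) = cdot G x - cdot G y"
  and cdot_scale_left: "cdot (z *s G) x = z * cdot G x"
  by (simp_all add: cdot_def sum.distrib sum_subtractf algebra_simps sum_distrib_left sum_negf)

lemma cdot_scaleR_right: "cdot G (r *\<^sub>R x) = r *\<^sub>R cdot G x"
proof -
  have "G $ i * of_real ((r *\<^sub>R x) $ i) = r *\<^sub>R (G $ i * of_real (x $ i))" for i
    by (simp only: vector_scaleR_component) (simp add: scaleR_conv_of_real)
  then show ?thesis by (simp only: cdot_def scaleR_sum_right)
qed

lemma linear_cdot: "linear (cdot G)"
  by (rule linearI) (simp_all add: cdot_add_right cdot_scaleR_right)

lemma norm_cvec: "norm (cvec x) = norm x"
  by (simp add: norm_vec_def cvec_def)

lemma norm_vector_scale: "norm (z *s (G :: complex^'n)) = norm z * norm G"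
proof -
  have "norm (z *s G) = L2_set (\<lambda>i. norm z * norm (G $ i)) UNIV"
    by (simp add: norm_vec_def norm_mult)
  also have "\<dots> = norm z * norm G"
    unfolding norm_vec_def by (rule L2_set_right_distrib[symmetric]) simp
  finally show ?thesis .
qed

lemma norm_cdot_le: "norm (cdot G x) \<le> norm G * norm x"
proof -
  have "norm (cdot G x) \<le> (\<Sum>i\<in>UNIV. \<bar>norm (G $ i)\<bar> * \<bar>norm (x $ i)\<bar>)"
    unfolding cdot_def by (rule order_trans[OF norm_sum]) (simp add: norm_mult)
  also have "\<dots> \<le> norm G * norm x"
    unfolding norm_vec_def by (rule L2_set_mult_ineq)
  finally show ?thesis .
qed

lemma affine_fun_gradc:
  fixes p :: "real^'n \<Rightarrow> complex"
  assumes "affine_fun p"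
  shows "p x = p y + cdot (gradc p) (x - y)"
proof -
  obtain c L where L: "linear L" "p = (\<lambda>x. c + L x)" using assms unfolding affine_fun_def by blast
  have Lc: "L z = cdot (gradc p) z" for z
  proof -
    have "L z = L (\<Sum>i\<in>UNIV. (z $ i) *\<^sub>R axis i 1)"
      using basis_expansion[of z] by (simp add: scalar_mult_eq_scaleR)
    also have "\<dots> = (\<Sum>i\<in>UNIV. (z $ i) *\<^sub>R L (axis i 1))"
      using L(1) by (simp add: linear_sum linear_scale)
    finally show ?thesis using L linear_0[OF L(1)]
      by (simp add: cdot_def gradc_def scaleR_conv_of_real mult.commute)
  qed
  have "p x = p y + L (x - y)" using L by (simp add: linear_diff)
  then show ?thesis unfolding Lc .
qed

lemma gradc_diff: "gradc (\<lambda>x. p x - q x) = gradc p - gradc q"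
  by (simp add: gradc_def vec_eq_iff)

lemma
  fixes \<phi> :: "'a::euclidean_space \<Rightarrow> 'b::euclidean_space"
  assumes K: "compact K" and \<phi>: "continuous_on UNIV \<phi>"
  shows lebesgue_on_compact_integral: "(LINT x|lebesgue_on K. \<phi> x) = (LINT x|lborel. indicator K x *\<^sub>R \<phi> x)"
    and lebesgue_on_compact_integrable: "integrable (lebesgue_on K) \<phi>"
proof -
  have [measurable]: "\<phi> \<in> borel_measurable borel" using \<phi> by (rule borel_measurable_continuous_onI)
  have [measurable]: "K \<in> sets borel" using K by (rule borel_compact)
  have K': "K \<inter> space lebesgue \<in> sets lebesgue" by simp
  have i: "integrable lborel (\<lambda>x. indicator K x *\<^sub>R \<phi> x)"
    by (intro borel_integrable_compact K continuous_on_subset[OF \<phi>]) simp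
  show "(LINT x|lebesgue_on K. \<phi> x) = (LINT x|lborel. indicator K x *\<^sub>R \<phi> x)"
    by (subst integral_restrict_space[OF K'], subst integral_completion) simp_all
  show "integrable (lebesgue_on K) \<phi>"
    unfolding integrable_restrict_space[OF K'] by (subst integrable_completion) (simp_all add: i)
qed

section \<open>Trace, inverse and divergence formulas in terms of vertex values\<close>

context simplex23
begin

lemma affine_expand:
  assumes "affine_fun p" shows "p x = (\<Sum>j\<in>C. lam j x *\<^sub>R p j)"
proof -
  obtain c L where L: "linear L" "p = (\<lambda>x. c + L x)" using assms unfolding affine_fun_def by blast
  have "(\<Sum>j\<in>C. lam j x *\<^sub>R p j) = (\<Sum>j\<in>C. lam j x) *\<^sub>R c + L (\<Sum>j\<in>C. lam j x *\<^sub>R j)"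
    using L by (simp add: scaleR_right_distrib sum.distrib scaleR_left.sum linear_sum linear_scale)
  then show ?thesis using L by (simp add: barycentric)
qed

lemma facet_inner:
  fixes p q :: "real^'n \<Rightarrow> 'b::euclidean_space"
  assumes a: "a \<in> C" and p: "affine_fun p" and q: "affine_fun q"
  shows "(LINT x|surface_measure (convex hull (C - {a})). p x \<bullet> q x) =
    norm (gr a) * vol / (real CARD('n) + 1) * ((\<Sum>j\<in>C-{a}. p j \<bullet> q j) + (\<Sum>j\<in>C-{a}. p j) \<bullet> (\<Sum>j\<in>C-{a}. q j))"
proof -
  have "(LINT x|surface_measure (convex hull (C - {a})). p x \<bullet> q x) =
     (LINT x|surface_measure (convex hull (C - {a})). (\<Sum>j\<in>C-{a}. lam j x *\<^sub>R p j) \<bullet> (\<Sum>j\<in>C-{a}. lam j x *\<^sub>R q j))"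
  proof (rule integral_cong_AE)
    show "(\<lambda>x. p x \<bullet> q x) \<in> borel_measurable (surface_measure (convex hull (C - {a})))"
      by (intro borel_measurable_integrable integrable_surface[OF a] continuous_intros affine_fun_continuous[OF p] affine_fun_continuous[OF q])
    show "(\<lambda>x. (\<Sum>j\<in>C-{a}. lam j x *\<^sub>R p j) \<bullet> (\<Sum>j\<in>C-{a}. lam j x *\<^sub>R q j))
        \<in> borel_measurable (surface_measure (convex hull (C - {a})))"
      by (intro borel_measurable_integrable integrable_surface[OF a] continuous_intros continuous_lam)
    show "AE x in surface_measure (convex hull (C - {a})). p x \<bullet> q x =
        (\<Sum>j\<in>C-{a}. lam j x *\<^sub>R p j) \<bullet> (\<Sum>j\<in>C-{a}. lam j x *\<^sub>R q j)"
      using AE_surface[OF a]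
    proof eventually_elim
      case (elim x)
      then have "p x = (\<Sum>j\<in>C-{a}. lam j x *\<^sub>R p j)" "q x = (\<Sum>j\<in>C-{a}. lam j x *\<^sub>R q j)"
        using affine_expand[OF p, of x] affine_expand[OF q, of x] by (simp_all add: sum.remove[OF finite_C a])
      then show ?case by (simp only:)
    qed
  qed
  then show ?thesis by (simp only: integral_surface_inner[OF a])
qed

lemma hull_inner:
  fixes p q :: "real^'n \<Rightarrow> 'b::euclidean_space"
  assumes p: "affine_fun p" and q: "affine_fun q"
  shows "(LINT x|lebesgue_on (convex hull C). p x \<bullet> q x) =
    vol / ((real CARD('n) + 1) * (real CARD('n) + 2)) * ((\<Sum>j\<in>C. p j \<bullet> q j) + (\<Sum>j\<in>C. p j) \<bullet> (\<Sum>j\<in>C. q j))"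
proof -
  have "(LINT x|lebesgue_on (convex hull C). p x \<bullet> q x) = (LINT x|lborel. indicator (convex hull C) x * (p x \<bullet> q x))"
    by (subst lebesgue_on_compact_integral[OF compact_hull])
       (auto intro!: continuous_intros affine_fun_continuous[OF p] affine_fun_continuous[OF q])
  also have "\<dots> = (LINT x|lborel. indicator (convex hull C) x * ((\<Sum>j\<in>C. lam j x *\<^sub>R p j) \<bullet> (\<Sum>j\<in>C. lam j x *\<^sub>R q j)))"
    by (simp only: affine_expand[OF p, symmetric] affine_expand[OF q, symmetric])
  finally show ?thesis by (simp only: integral_hull_inner)
qed

text \<open>Compare both mass matrices with the sum of squares of the vertex values on the facet:
  the facet form is at most \<open>norm (gr a) * vol\<close> times it, the element form at least
  \<open>vol / ((d+1) * (d+2))\<close> times it. The constant is (d+1)(d+2), at most 20 for d =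
  3.\<close>

lemma trace_inequality:
  fixes p :: "real^'n \<Rightarrow> 'b::euclidean_space"
  assumes a: "a \<in> C" and p: "affine_fun p"
  shows "(LINT x|surface_measure (convex hull (C - {a})). (norm (p x))\<^sup>2) \<le>
     20 * norm (gr a) * (LINT x|lebesgue_on (convex hull C). (norm (p x))\<^sup>2)"
proof -
  let ?d = "real CARD('n)" and ?S = "\<Sum>j\<in>C-{a}. (norm (p j))\<^sup>2"
  have d: "?d > 0" "(?d + 1) * (?d + 2) \<le> 20" using card23 by auto
  have S0: "?S \<ge> 0" by (intro sum_nonneg) auto
  have "(norm (\<Sum>j\<in>C-{a}. p j))\<^sup>2 \<le> (\<Sum>j\<in>C-{a}. norm (p j))\<^sup>2"
    by (intro power_mono norm_sum) auto
  also have "\<dots> \<le> (\<Sum>j\<in>C-{a}. 1\<^sup>2) * ?S"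
    using Cauchy_Schwarz_ineq_sum[of "\<lambda>_. 1" "\<lambda>j. norm (p j)" "C - {a}"] by simp
  also have "(\<Sum>j\<in>C-{a}. (1::real)\<^sup>2) = ?d" using a card_C by simp
  finally have "?S + (norm (\<Sum>j\<in>C-{a}. p j))\<^sup>2 \<le> (?d + 1) * ?S" by (simp add: algebra_simps)
  then have "norm (gr a) * vol / (?d + 1) * (?S + (norm (\<Sum>j\<in>C-{a}. p j))\<^sup>2) \<le> norm (gr a) * vol / (?d + 1) * ((?d + 1) * ?S)"
    using vol_pos d by (intro mult_left_mono) auto
  also have "\<dots> = norm (gr a) * vol * ?S" using d by simp
  finally have 1: "(LINT x|surface_measure (convex hull (C - {a})). (norm (p x))\<^sup>2) \<le> norm (gr a) * vol * ?S"
    using facet_inner[OF a p p] by (simp only: power2_norm_eq_inner)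
  have "?S \<le> (\<Sum>j\<in>C. (norm (p j))\<^sup>2)" by (intro sum_mono2) auto
  then have "?S \<le> (\<Sum>j\<in>C. (norm (p j))\<^sup>2) + (norm (\<Sum>j\<in>C. p j))\<^sup>2" by (simp add: add_increasing2)
  then have "vol / ((?d + 1) * (?d + 2)) * ?S \<le> vol / ((?d + 1) * (?d + 2)) * ((\<Sum>j\<in>C. (norm (p j))\<^sup>2) + (norm (\<Sum>j\<in>C. p j))\<^sup>2)"
    using vol_pos d by (intro mult_left_mono) auto
  also have "\<dots> = (LINT x|lebesgue_on (convex hull C). (norm (p x))\<^sup>2)"
    using hull_inner[OF p p] by (simp only: power2_norm_eq_inner)
  finally have 2: "vol / ((?d + 1) * (?d + 2)) * ?S \<le> (LINT x|lebesgue_on (convex hull C). (norm (p x))\<^sup>2)" .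
  have "vol * ?S = ((?d + 1) * (?d + 2)) * (vol / ((?d + 1) * (?d + 2)) * ?S)" using d by simp
  also have "\<dots> \<le> 20 * (vol / ((?d + 1) * (?d + 2)) * ?S)"
    using d vol_pos S0 by (intro mult_right_mono) auto
  also have "\<dots> \<le> 20 * (LINT x|lebesgue_on (convex hull C). (norm (p x))\<^sup>2)" using 2 by simp
  finally have "norm (gr a) * (vol * ?S) \<le> norm (gr a) * (20 * (LINT x|lebesgue_on (convex hull C). (norm (p x))\<^sup>2))"
    by (intro mult_left_mono) auto
  then show ?thesis using 1 by (simp add: mult_ac)
qed

text \<open>Since \<open>gr a\<close> is normal to the facet, the tangential gradient depends only
  on the vertex values on the facet, and these are controlled by the facet integral. The full
  gradient would also involve the value at \<open>a\<close>. The constant is d^2 (d+1), at most 36: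
  one factor d from Cauchy-Schwarz, one from the area of the facet, and d+1 from its mass
  matrix.\<close>

lemma inverse_inequality:
  fixes p :: "real^'n \<Rightarrow> complex"
  assumes a: "a \<in> C" and p: "affine_fun p" and B: "\<And>j. j \<in> C \<Longrightarrow> norm (gr j) \<le> B"
  shows "(LINT x|surface_measure (convex hull (C - {a})). (norm (tang (nrm a) (gradc p)))\<^sup>2) \<le>
     36 * B\<^sup>2 * (LINT x|surface_measure (convex hull (C - {a})). (norm (p x))\<^sup>2)"
proof -
  let ?d = "real CARD('n)" and ?S = "\<Sum>j\<in>C-{a}. (norm (p j))\<^sup>2" and ?n = "nrm a"
  have d: "?d > 0" "?d\<^sup>2 * (?d + 1) \<le> 36" using card23 by auto
  have S0: "?S \<ge> 0" by (intro sum_nonneg) auto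
  have cC: "real (card (C - {a})) = ?d" using a card_C by simp
  have H: "gradc p = (\<Sum>j\<in>C. p j *s cvec (gr j))"
  proof -
    have "p (axis i 1) - p 0 = (\<Sum>j\<in>C. p j * of_real (gr j $ i))" for i
    proof -
      have "p (axis i 1) - p 0 = (\<Sum>j\<in>C. (lam j (axis i 1) - lam j 0) *\<^sub>R p j)"
        using affine_expand[OF p, of "axis i 1"] affine_expand[OF p, of 0] by (simp add: scaleR_left_diff_distrib sum_subtractf)
      also have "\<dots> = (\<Sum>j\<in>C. (gr j $ i) *\<^sub>R p j)" by (simp add: lam_diff inner_axis)
      finally show ?thesis by (simp add: scaleR_conv_of_real mult.commute)
    qed
    then show ?thesis by (simp add: gradc_def vec_eq_iff cvec_def sum_component)
  qed
  have tg: "tang ?n (gradc p) = (\<Sum>j\<in>C. p j *s cvec (gr j - (gr j \<bullet> ?n) *\<^sub>R ?n))"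
  proof -
    have cc: "cdot (cvec v) w = of_real (v \<bullet> w)" for v w :: "real^'n"
      by (simp add: cdot_def cvec_def inner_vec_def)
    have "cdot (gradc p) ?n = (\<Sum>j\<in>C. p j * of_real (gr j \<bullet> ?n))"
    proof -
      have "cdot (\<Sum>j\<in>C. p j *s cvec (gr j)) ?n = (\<Sum>j\<in>C. cdot (p j *s cvec (gr j)) ?n)"
        unfolding cdot_def by (simp add: sum_component sum_distrib_right) (rule sum.swap)
      then show ?thesis unfolding H by (simp add: cdot_scale_left cc)
    qed
    then show ?thesis unfolding tang_def
      by (simp add: H vec_eq_iff cvec_def sum_component right_diff_distrib sum_subtractf sum_distrib_right mult.assoc)
  qed
  have nn: "?n \<bullet> ?n = 1" by (simp only: power2_norm_eq_inner[symmetric] norm_nrm[OF a]) simp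
  have "gr a - (gr a \<bullet> ?n) *\<^sub>R ?n = 0"
  proof -
    have "gr a \<bullet> gr a = norm (gr a) * norm (gr a)" by (simp add: power2_norm_eq_inner[symmetric] power2_eq_square)
    then show ?thesis using gr_nonzero[OF a] by (simp add: nrm_def)
  qed
  then have tg': "tang ?n (gradc p) = (\<Sum>j\<in>C-{a}. p j *s cvec (gr j - (gr j \<bullet> ?n) *\<^sub>R ?n))"
    unfolding tg by (simp add: sum.remove[OF finite_C a] vec_eq_iff cvec_def)
  have small: "norm (gr j - (gr j \<bullet> ?n) *\<^sub>R ?n) \<le> norm (gr j)" for j
  proof (rule power2_le_imp_le)
    have "(norm (gr j - (gr j \<bullet> ?n) *\<^sub>R ?n))\<^sup>2 = (norm (gr j))\<^sup>2 - (gr j \<bullet> ?n)\<^sup>2"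
      unfolding power2_norm_eq_inner using nn
      by (simp add: inner_diff_left inner_diff_right power2_eq_square inner_commute[of ?n "gr j"])
    then show "(norm (gr j - (gr j \<bullet> ?n) *\<^sub>R ?n))\<^sup>2 \<le> (norm (gr j))\<^sup>2" by simp
  qed simp
  have "norm (tang ?n (gradc p)) \<le> (\<Sum>j\<in>C-{a}. norm (p j) * B)"
    unfolding tg'
  proof (rule order_trans[OF norm_sum], rule sum_mono)
    fix j assume "j \<in> C - {a}"
    then show "norm (p j *s cvec (gr j - (gr j \<bullet> ?n) *\<^sub>R ?n)) \<le> norm (p j) * B"
      unfolding norm_vector_scale norm_cvec using small[of j] B[of j] by (intro mult_left_mono) auto
  qed
  then have "(norm (tang ?n (gradc p)))\<^sup>2 \<le> (\<Sum>j\<in>C-{a}. norm (p j) * B)\<^sup>2" by (intro power_mono) auto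
  also have "\<dots> \<le> (\<Sum>j\<in>C-{a}. (norm (p j))\<^sup>2) * (\<Sum>j\<in>C-{a}. B\<^sup>2)"
    by (rule Cauchy_Schwarz_ineq_sum)
  also have "\<dots> = ?d * B\<^sup>2 * ?S" using cC by simp
  finally have T: "(norm (tang ?n (gradc p)))\<^sup>2 \<le> ?d * B\<^sup>2 * ?S" .
  have one: "(LINT x|surface_measure (convex hull (C - {a})). 1) = norm (gr a) * vol * ?d"
  proof -
    have "(LINT x|surface_measure (convex hull (C - {a})). 1) = norm (gr a) * vol / (?d + 1) * (?d + ?d * ?d)"
      using facet_inner[OF a affine_fun_const[of "1::real"] affine_fun_const[of "1::real"]] cC by simp
    also have "\<dots> = norm (gr a) * vol * ?d" using d by (simp add: field_simps)
    finally show ?thesis .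
  qed
  have Jge: "norm (gr a) * vol / (?d + 1) * ?S \<le> (LINT x|surface_measure (convex hull (C - {a})). (norm (p x))\<^sup>2)"
  proof -
    have "norm (gr a) * vol / (?d + 1) * ?S \<le> norm (gr a) * vol / (?d + 1) * (?S + (norm (\<Sum>j\<in>C-{a}. p j))\<^sup>2)"
      using vol_pos d by (intro mult_left_mono) auto
    then show ?thesis using facet_inner[OF a p p] by (simp only: power2_norm_eq_inner)
  qed
  have "(LINT x|surface_measure (convex hull (C - {a})). (norm (tang ?n (gradc p)))\<^sup>2) =
      (norm (tang ?n (gradc p)))\<^sup>2 * (LINT x|surface_measure (convex hull (C - {a})). 1)"
    by simp
  also have "\<dots> \<le> (?d * B\<^sup>2 * ?S) * (norm (gr a) * vol * ?d)"
    unfolding one using T vol_pos by (intro mult_right_mono) auto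
  also have "\<dots> = (?d\<^sup>2 * (?d + 1)) * (B\<^sup>2 * (norm (gr a) * vol / (?d + 1) * ?S))"
    using d by (simp add: field_simps power2_eq_square)
  also have "\<dots> \<le> 36 * (B\<^sup>2 * (norm (gr a) * vol / (?d + 1) * ?S))"
    using d S0 vol_pos by (intro mult_right_mono) auto
  also have "\<dots> \<le> 36 * (B\<^sup>2 * (LINT x|surface_measure (convex hull (C - {a})). (norm (p x))\<^sup>2))"
    using Jge by (intro mult_left_mono) auto
  finally show ?thesis by (simp only: mult.assoc)
qed

text \<open>The divergence theorem for the field
  \<open>(norm (p x))\<^sup>2 *\<^sub>R (x - x0)\<close>: as \<open>p\<close> is affine,
  \<open>p x - p x0\<close> is its derivative in the direction \<open>x - x0\<close>. Both sides are
  evaluated by quadrature and agree as quadratic forms in the vertex values.\<close>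

lemma divergence_identity:
  fixes p :: "real^'n \<Rightarrow> 'b::euclidean_space"
  assumes p: "affine_fun p"
  shows "(LINT x|lebesgue_on (convex hull C). real CARD('n) * (norm (p x))\<^sup>2 + 2 * (p x \<bullet> (p x - p x0))) =
     (\<Sum>a\<in>C. LINT x|surface_measure (convex hull (C - {a})). ((x - x0) \<bullet> nrm a) * (norm (p x))\<^sup>2)"
proof -
  let ?d = "real CARD('n)" and ?Q = "\<Sum>j\<in>C. (norm (p j))\<^sup>2" and ?P = "\<Sum>j\<in>C. p j"
  let ?m = "vol / (?d + 1)"
  have d: "?d > 0" using card23 by auto
  have cC: "real (card C) = ?d + 1" using card_C by simp
  have "(LINT x|lebesgue_on (convex hull C). ?d * (norm (p x))\<^sup>2 + 2 * (p x \<bullet> (p x - p x0))) =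
     (LINT x|lebesgue_on (convex hull C). (?d + 2) * (p x \<bullet> p x) - 2 * (p x \<bullet> p x0))"
    by (simp add: power2_norm_eq_inner inner_diff_right algebra_simps)
  also have "\<dots> = (?d + 2) * (LINT x|lebesgue_on (convex hull C). p x \<bullet> p x) - 2 * (LINT x|lebesgue_on (convex hull C). p x \<bullet> p x0)"
    by (subst Bochner_Integration.integral_diff)
       (auto intro!: lebesgue_on_compact_integrable compact_hull continuous_intros affine_fun_continuous[OF p])
  also have "(LINT x|lebesgue_on (convex hull C). p x \<bullet> p x) = ?m / (?d + 2) * (?Q + (norm ?P)\<^sup>2)"
    unfolding hull_inner[OF p p] by (simp add: power2_norm_eq_inner)
  also have "(LINT x|lebesgue_on (convex hull C). p x \<bullet> p x0) = ?m * (?P \<bullet> p x0)"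
  proof -
    have "(\<Sum>j\<in>C. p x0) = (?d + 1) *\<^sub>R p x0" using cC by (simp add: scaleR_conv_of_real sum_constant_scaleR)
    then have "(LINT x|lebesgue_on (convex hull C). p x \<bullet> p x0) = ?m / (?d + 2) * (?P \<bullet> p x0 + (?d + 1) * (?P \<bullet> p x0))"
      using hull_inner[OF p affine_fun_const[of "p x0"]] by (simp add: inner_sum_left[symmetric])
    also have "?P \<bullet> p x0 + (?d + 1) * (?P \<bullet> p x0) = (?d + 2) * (?P \<bullet> p x0)" by (simp add: algebra_simps)
    finally show ?thesis using d by simp
  qed
  also have "(?d + 2) * (?m / (?d + 2) * (?Q + (norm ?P)\<^sup>2)) - 2 * (?m * (?P \<bullet> p x0)) = ?m * (?Q + (norm ?P)\<^sup>2 - 2 * (?P \<bullet> p x0))"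
  proof -
    have "(?d + 2) * (?m / (?d + 2) * X) = ?m * X" for X using d by simp
    moreover have "m * X - 2 * (m * b) = m * (X - 2 * b)" for m X b :: real by (simp add: algebra_simps)
    ultimately show ?thesis by (simp only:)
  qed
  finally have lhs: "(LINT x|lebesgue_on (convex hull C). ?d * (norm (p x))\<^sup>2 + 2 * (p x \<bullet> (p x - p x0))) =
      ?m * (?Q + (norm ?P)\<^sup>2 - 2 * (?P \<bullet> p x0))" .
  \<comment> \<open>On the facet \<open>(x - x0) \<bullet> nrm a\<close> is the constant
    \<open>lam a x0 / norm (gr a)\<close>, which cancels the gradient norm in the facet mass matrix.
    Summed over \<open>a\<close>, the weights \<open>lam a x0\<close> reproduce 1 and
    \<open>p x0\<close>.\<close>
  have face: "(LINT x|surface_measure (convex hull (C - {a})). ((x - x0) \<bullet> nrm a) * (norm (p x))\<^sup>2) =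
     ?m * (lam a x0 * (?Q + (norm ?P)\<^sup>2) - 2 * (?P \<bullet> (lam a x0 *\<^sub>R p a)))" if a: "a \<in> C" for a
  proof -
    have ng: "norm (gr a) > 0" using gr_nonzero[OF a] by simp
    have "(LINT x|surface_measure (convex hull (C - {a})). ((x - x0) \<bullet> nrm a) * (norm (p x))\<^sup>2) =
       (LINT x|surface_measure (convex hull (C - {a})). (lam a x0 / norm (gr a)) * (p x \<bullet> p x))"
    proof (rule integral_cong_AE)
      show "(\<lambda>x. ((x - x0) \<bullet> nrm a) * (norm (p x))\<^sup>2) \<in> borel_measurable (surface_measure (convex hull (C - {a})))"
        "(\<lambda>x. (lam a x0 / norm (gr a)) * (p x \<bullet> p x)) \<in> borel_measurable (surface_measure (convex hull (C - {a})))"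
        by (intro borel_measurable_integrable integrable_surface[OF a] continuous_intros affine_fun_continuous[OF p])+
      show "AE x in surface_measure (convex hull (C - {a})). ((x - x0) \<bullet> nrm a) * (norm (p x))\<^sup>2 = (lam a x0 / norm (gr a)) * (p x \<bullet> p x)"
        using AE_surface[OF a]
      proof eventually_elim
        case (elim x)
        have "gr a \<bullet> (x - x0) = - lam a x0" using elim by (simp add: lam_diff[symmetric])
        then have "(x - x0) \<bullet> gr a = - lam a x0" by (simp only: inner_commute)
        then have "(x - x0) \<bullet> nrm a = lam a x0 / norm (gr a)" by (simp add: nrm_def)
        then show ?case by (simp only: power2_norm_eq_inner)
      qed
    qed
    also have "\<dots> = (lam a x0 / norm (gr a)) * (LINT x|surface_measure (convex hull (C - {a})). p x \<bullet> p x)"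
      by simp
    also have "\<dots> = ?m * lam a x0 * ((\<Sum>j\<in>C-{a}. p j \<bullet> p j) + (\<Sum>j\<in>C-{a}. p j) \<bullet> (\<Sum>j\<in>C-{a}. p j))"
      unfolding facet_inner[OF a p p] using ng by simp
    also have "(\<Sum>j\<in>C-{a}. p j \<bullet> p j) = ?Q - p a \<bullet> p a"
      by (simp add: power2_norm_eq_inner sum.remove[OF finite_C a])
    also have "(\<Sum>j\<in>C-{a}. p j) = ?P - p a"
      by (simp add: sum.remove[OF finite_C a])
    also have "?Q - p a \<bullet> p a + (?P - p a) \<bullet> (?P - p a) = ?Q + (norm ?P)\<^sup>2 - 2 * (?P \<bullet> p a)"
      by (simp only: power2_norm_eq_inner inner_diff_left inner_diff_right inner_commute[of "p a" ?P])
    finally show ?thesis by (simp add: algebra_simps)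
  qed
  have "(\<Sum>a\<in>C. LINT x|surface_measure (convex hull (C - {a})). ((x - x0) \<bullet> nrm a) * (norm (p x))\<^sup>2) =
     (\<Sum>a\<in>C. ?m * (lam a x0 * (?Q + (norm ?P)\<^sup>2) - 2 * (?P \<bullet> (lam a x0 *\<^sub>R p a))))"
    by (rule sum.cong) (simp_all only: face)
  also have "\<dots> = ?m * ((\<Sum>a\<in>C. lam a x0) * (?Q + (norm ?P)\<^sup>2) - 2 * (?P \<bullet> (\<Sum>a\<in>C. lam a x0 *\<^sub>R p a)))"
    by (simp only: sum_distrib_left[symmetric] sum_subtractf sum_distrib_right[symmetric] inner_sum_right[symmetric])
  also have "\<dots> = ?m * (?Q + (norm ?P)\<^sup>2 - 2 * (?P \<bullet> p x0))"
    using affine_expand[OF p, of x0] by (simp add: barycentric)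
  finally show ?thesis using lhs by simp
qed

end

section \<open>Simplicial meshes\<close>

text \<open>Discrete functions are arbitrary on element boundaries, and traces are known only at
  relatively interior points of faces. Their measurability rests on completeness of the
  measure.\<close>

lemma borel_measurable_completion_AE:
  fixes f g :: "'a \<Rightarrow> 'b::topological_space"
  assumes g: "g \<in> borel_measurable (completion M)" and ae: "AE x in completion M. f x = g x"
  shows "f \<in> borel_measurable (completion M)"
proof (rule measurableI)
  fix A :: "'b set" assume A: "A \<in> sets borel"
  let ?N = "{x \<in> space (completion M). f x \<noteq> g x}"
  have N: "?N \<in> null_sets (completion M)" using ae by (simp only: completion.AE_iff_null_sets)
  have "f -` A \<inter> ?N \<in> null_sets (completion M)" by (rule null_sets_completion_subset[OF _ N]) blast
  moreover have "g -` A \<inter> space (completion M) - ?N \<in> sets (completion M)"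
    using measurable_sets[OF g A] N by (intro sets.Diff) auto
  moreover have "f -` A \<inter> space (completion M) = (g -` A \<inter> space (completion M) - ?N) \<union> (f -` A \<inter> ?N)" by auto
  ultimately show "f -` A \<inter> space (completion M) \<in> sets (completion M)" by (simp only: sets.Un null_setsD2)
qed simp

lemma
  fixes f g :: "'a \<Rightarrow> 'b::{banach, second_countable_topology}"
  assumes g: "integrable (completion M) g" and ae: "AE x in completion M. f x = g x"
  shows integrable_completion_AE: "integrable (completion M) f"
    and integral_completion_AE: "(LINT x|completion M. f x) = (LINT x|completion M. g x)"
proof -
  have m: "f \<in> borel_measurable (completion M)"
    using borel_measurable_completion_AE[OF borel_measurable_integrable[OF g] ae] .
  have ae': "AE x in completion M. g x = f x" using ae by eventually_elim simp
  show "integrable (completion M) f"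
    using integrable_cong_AE_imp[OF g m ae'] .
  show "(LINT x|completion M. f x) = (LINT x|completion M. g x)"
    by (rule integral_cong_AE[OF m borel_measurable_integrable[OF g] ae])
qed

context simplex23
begin

lemma rel_interior_facet:
  assumes a: "a \<in> C"
  shows "rel_interior (convex hull (C - {a})) = {x. lam a x = 0 \<and> (\<forall>j\<in>C-{a}. lam j x > 0)}"
proof -
  have "\<not> affine_dependent (C - {a})" using aff by (meson Diff_subset affine_independent_subset)
  note ex = rel_interior_convex_hull_explicit[OF this]
  show ?thesis
  proof (intro set_eqI iffI)
    fix x assume "x \<in> rel_interior (convex hull (C - {a}))"
    then obtain u where u: "\<forall>b\<in>C-{a}. 0 < u b" "sum u (C-{a}) = 1" "(\<Sum>b\<in>C-{a}. u b *\<^sub>R b) = x"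
      unfolding ex by blast
    have l: "lam c x = (\<Sum>b\<in>C-{a}. if b = c then u b else 0)" if "c \<in> C" for c
      unfolding u(3)[symmetric] lam_barycentre[OF u(2) finite_Diff[OF finite_C]]
      using that by (intro sum.cong) (auto simp: lam_vertex)
    show "x \<in> {x. lam a x = 0 \<and> (\<forall>j\<in>C-{a}. lam j x > 0)}"
      using u(1) a l by (auto simp: sum.delta)
  next
    fix x assume "x \<in> {x. lam a x = 0 \<and> (\<forall>j\<in>C-{a}. lam j x > 0)}"
    then have x: "lam a x = 0" "\<forall>b\<in>C-{a}. lam b x > 0" by auto
    have "(\<Sum>b\<in>C-{a}. lam b x) = 1" "(\<Sum>b\<in>C-{a}. lam b x *\<^sub>R b) = x"
      using barycentric[of x] a x by (simp_all add: sum.remove[OF finite_C a])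
    then show "x \<in> rel_interior (convex hull (C - {a}))" unfolding ex
      using x(2) by (intro CollectI exI[of _ "\<lambda>b. lam b x"]) simp
  qed
qed

lemma inner_nrm: "a \<in> C \<Longrightarrow> lam a x = 0 \<Longrightarrow> (y - x) \<bullet> nrm a = - lam a y / norm (gr a)"
  using lam_diff[of a y x] by (simp add: nrm_def inner_commute[of _ "gr a"])

text \<open>Near a relatively interior point of the facet all other coordinates stay positive, so
  there the simplex coincides with a half-space.\<close>

lemma facet_side:
  assumes a: "a \<in> C" and x: "x \<in> rel_interior (convex hull (C - {a}))"
  shows "\<exists>r>0. \<forall>y\<in>ball x r. (y \<in> convex hull C \<longleftrightarrow> (y - x) \<bullet> nrm a \<le> 0) \<and> (y \<in> interior (convex hull C) \<longleftrightarrow> (y - x) \<bullet> nrm a < 0)"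
proof -
  have x': "lam a x = 0" "\<forall>j\<in>C-{a}. lam j x > 0" using x by (auto simp: rel_interior_facet[OF a])
  have "open (\<Inter>j\<in>C-{a}. {y. lam j y > 0})"
    by (intro open_INT finite_Diff finite_C ballI open_Collect_less continuous_intros continuous_lam)
  moreover have "x \<in> (\<Inter>j\<in>C-{a}. {y. lam j y > 0})" using x' by auto
  ultimately obtain r where r: "r > 0" "ball x r \<subseteq> (\<Inter>j\<in>C-{a}. {y. lam j y > 0})"
    using open_contains_ball by blast
  show ?thesis
  proof (intro exI conjI ballI)
    fix y assume "y \<in> ball x r"
    then have y: "\<forall>j\<in>C-{a}. lam j y > 0" using r by auto
    have ng: "norm (gr a) > 0" using gr_nonzero[OF a] by simp
    have s: "(y - x) \<bullet> nrm a \<le> 0 \<longleftrightarrow> lam a y \<ge> 0" "(y - x) \<bullet> nrm a < 0 \<longleftrightarrow> lam a y > 0"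
      unfolding inner_nrm[OF a x'(1)] using ng by (simp_all add: divide_le_0_iff divide_less_0_iff zero_le_divide_iff zero_less_divide_iff)
    show "y \<in> convex hull C \<longleftrightarrow> (y - x) \<bullet> nrm a \<le> 0"
      unfolding s hull_eq using y a by (auto intro: less_imp_le)
    show "y \<in> interior (convex hull C) \<longleftrightarrow> (y - x) \<bullet> nrm a < 0"
      unfolding s interior_hull using y a by auto
  qed (rule r(1))
qed

lemma facet_orthogonal:
  assumes a: "a \<in> C" and "x \<in> convex hull (C - {a})" "y \<in> convex hull (C - {a})"
  shows "(y - x) \<bullet> nrm a = 0"
  using assms inner_nrm[OF a] by (simp add: facet_eq)

lemma unit_normal_pm:
  assumes a: "a \<in> C" and n: "norm n = 1" "\<And>x y. x \<in> convex hull (C - {a}) \<Longrightarrow> y \<in> convex hull (C - {a}) \<Longrightarrow> (y - x) \<bullet> n = 0"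
  shows "n = nrm a \<or> n = - nrm a"
proof -
  have ng: "norm (gr a) > 0" using gr_nonzero[OF a] by simp
  obtain p where p: "p \<in> C" "p \<noteq> a" using other_vertex[OF a] by blast
  define r where "r = n \<bullet> (a - p)"
  have "n = r *\<^sub>R gr a" unfolding r_def
  proof (rule normal_multiple_gr[OF a p])
    fix b assume "b \<in> C" "b \<noteq> a"
    then have "(b - p) \<bullet> n = 0" using n p by (auto simp: hull_inc)
    then show "n \<bullet> (b - p) = 0" by (simp only: inner_commute)
  qed
  moreover from this have "\<bar>r\<bar> * norm (gr a) = 1" using n(1) by (metis norm_scaleR)
  then have "r = 1 / norm (gr a) \<or> r = - (1 / norm (gr a))" using ng by (auto simp: field_simps abs_if split: if_splits)
  ultimately show ?thesis by (auto simp: nrm_def)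
qed

end

text \<open>A point in the closure of an open set is a limit point of it, so the filter behind
  \<open>Lim\<close> is nontrivial and the limit unique.\<close>

lemma bdry_trace_eq:
  fixes v p :: "'a::euclidean_space \<Rightarrow> 'b::euclidean_space"
  assumes "x \<in> closure S" "open S" "\<And>y. y \<in> S \<Longrightarrow> v y = p y" "continuous_on UNIV p"
  shows "bdry_trace S v x = p x"
proof -
  have "x islimpt S"
    using assms(1,2) by (metis closure_def UnE interior_limit_point interior_open mem_Collect_eq)
  then have nt: "\<not> trivial_limit (at x within S)" by (simp add: trivial_limit_within)
  have "(p \<longlongrightarrow> p x) (at x within S)"
    using assms(4) by (simp add: continuous_on_def) (metis UNIV_I at_le filterlim_mono order_refl subset_UNIV)
  moreover have "\<forall>\<^sub>F y in at x within S. p y = v y"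
    using assms(3) by (auto simp: eventually_at_filter)
  ultimately have "(v \<longlongrightarrow> p x) (at x within S)" by (rule Lim_transform_eventually)
  then show ?thesis unfolding bdry_trace_def using nt by (intro tendsto_Lim)
qed

section \<open>Incidence and local geometry of a conforming mesh\<close>

locale simplicial_mesh =
  fixes \<Omega> :: "(real^'n) set" and \<T> :: "(real^'n) set set"
  assumes card23: "CARD('n) = 2 \<or> CARD('n) = 3" and mesh: "mesh_of \<Omega> \<T>"
begin

text \<open>The mesh holds its elements as point sets; extreme points recover the vertex set needed
  to instantiate \<open>simplex23\<close>.\<close>

definition V :: "(real^'n) set \<Rightarrow> (real^'n) set" where "V K = {x. x extreme_point_of K}"

lemma finite_\<T>: "finite \<T>"
  using mesh by (simp add: mesh_of_def triangulation_def)

lemma element: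
  assumes "K \<in> \<T>" shows "simplex23 (V K)" and "convex hull (V K) = K"
proof -
  obtain C where C: "\<not> affine_dependent C" "int (card C) = int CARD('n) + 1" "K = convex hull C"
    using mesh assms unfolding mesh_of_def simplex_def by blast
  have "V K = C" unfolding V_def C(3) by (auto simp: extreme_point_of_convex_hull_affine_independent[OF C(1)])
  moreover have "card C = Suc CARD('n)" using C(2) by linarith
  ultimately show "simplex23 (V K)" "convex hull (V K) = K"
    using C card23 by (auto simp: simplex23_def simplex_vertices_def simplex23_axioms_def)
qed

lemma \<Omega>_eq: "\<Omega> = interior (\<Union>\<T>)" using mesh by (simp add: mesh_of_def)

lemma open_\<Omega>: "open \<Omega>" by (simp add: \<Omega>_eq)

lemma compact_element: "K \<in> \<T> \<Longrightarrow> compact K"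
  using element simplex_vertices.compact_hull[of "V K"] by (metis simplex23_def)

lemma convex_element: "K \<in> \<T> \<Longrightarrow> convex K"
  using element(2) convex_convex_hull by metis

lemma interior_subset_\<Omega>: "K \<in> \<T> \<Longrightarrow> interior K \<subseteq> \<Omega>"
  unfolding \<Omega>_eq by (intro interior_mono) blast

lemma \<Omega>_subset: "\<Omega> \<subseteq> \<Union>\<T>" unfolding \<Omega>_eq by (rule interior_subset)

lemma closure_interior_element: "K \<in> \<T> \<Longrightarrow> closure (interior K) = K"
  using element simplex_vertices.closure_interior_hull[of "V K"] by (metis simplex23_def)

lemma element_subset_closure: "K \<in> \<T> \<Longrightarrow> K \<subseteq> closure \<Omega>"
  using closure_interior_element closure_mono interior_subset_\<Omega> by metis

lemma aff_dim_element: "K \<in> \<T> \<Longrightarrow> aff_dim K = int CARD('n)"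
  using mesh by (auto simp: mesh_of_def dest: aff_dim_simplex)

lemma face_Int: "K \<in> \<T> \<Longrightarrow> K' \<in> \<T> \<Longrightarrow> (K \<inter> K') face_of K"
  using mesh by (simp add: mesh_of_def triangulation_def)

text \<open>Otherwise \<open>K\<close> would be a proper face of \<open>K'\<close> and hence of
  lower dimension.\<close>

lemma Int_proper:
  assumes K: "K \<in> \<T>" "K' \<in> \<T>" "K \<noteq> K'" shows "K \<inter> K' \<noteq> K"
proof
  assume "K \<inter> K' = K"
  then have "K face_of K'" using face_Int[OF K(2,1)] by (simp add: Int_commute)
  then have "aff_dim K < aff_dim K'" using K convex_element by (intro face_of_aff_dim_lt) auto
  then show False using K aff_dim_element by simp
qed

lemma disjoint_interior:
  assumes K: "K \<in> \<T>" "K' \<in> \<T>" "K \<noteq> K'" shows "interior K \<inter> K' = {}"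
  using face_of_disjoint_interior[OF face_Int[OF K(1,2)] Int_proper[OF K]] interior_subset by blast

lemma facet_vertex:
  assumes "K \<in> \<T>" "e facet_of K"
  obtains a where "a \<in> V K" "e = convex hull (V K - {a})"
  using simplex23.facet_iff[OF element(1)[OF assms(1)], of e] element(2)[OF assms(1)] assms(2) by auto

lemma facet_normal:
  assumes K: "K \<in> \<T>" "e facet_of K"
  shows "norm (face_normal K e) = 1"
    and "x \<in> e \<Longrightarrow> y \<in> e \<Longrightarrow> (y - x) \<bullet> face_normal K e = 0"
    and "x \<in> rel_interior e \<Longrightarrow> \<exists>r>0. \<forall>y\<in>ball x r. (y \<in> K \<longleftrightarrow> (y - x) \<bullet> face_normal K e \<le> 0) \<and> (y \<in> interior K \<longleftrightarrow> (y - x) \<bullet> face_normal K e < 0)"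
    and "norm n = 1 \<Longrightarrow> (\<And>x y. x \<in> e \<Longrightarrow> y \<in> e \<Longrightarrow> (y - x) \<bullet> n = 0) \<Longrightarrow> n = face_normal K e \<or> n = - face_normal K e"
proof -
  interpret simplex23 "V K" using element K by blast
  obtain a where a: "a \<in> V K" "e = convex hull (V K - {a})" using facet_vertex[OF K] .
  note [simp] = element(2)[OF K(1)]
  have n: "face_normal K e = nrm a" using face_normal_eq[OF a(1)] a(2) by simp
  show "norm (face_normal K e) = 1" using n norm_nrm a by simp
  show "x \<in> e \<Longrightarrow> y \<in> e \<Longrightarrow> (y - x) \<bullet> face_normal K e = 0"
    unfolding n using facet_orthogonal[OF a(1)] a(2) by simp
  show "x \<in> rel_interior e \<Longrightarrow> \<exists>r>0. \<forall>y\<in>ball x r. (y \<in> K \<longleftrightarrow> (y - x) \<bullet> face_normal K e \<le> 0) \<and> (y \<in> interior K \<longleftrightarrow> (y - x) \<bullet> face_normal K e < 0)"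
    unfolding n using facet_side[OF a(1)] a(2) by simp
  show "norm n = 1 \<Longrightarrow> (\<And>x y. x \<in> e \<Longrightarrow> y \<in> e \<Longrightarrow> (y - x) \<bullet> n = 0) \<Longrightarrow> n = face_normal K e \<or> n = - face_normal K e"
    unfolding n using unit_normal_pm[OF a(1)] a(2) by simp
qed

lemma facet_convex: "K \<in> \<T> \<Longrightarrow> e facet_of K \<Longrightarrow> convex e"
  by (metis convex_convex_hull facet_vertex)

lemma facet_rel_interior:
  assumes "K \<in> \<T>" "e facet_of K" obtains x where "x \<in> rel_interior e"
  using rel_interior_eq_empty[OF facet_convex[OF assms]] assms(2) by (auto simp: facet_of_def)

text \<open>The two normals agree up to sign. If they were equal, a point just below the facet would
  be interior to both elements.\<close>

lemma opposite_normals: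
  assumes K: "K \<in> \<T>" "e facet_of K" and K': "K' \<in> \<T>" "e facet_of K'" and ne: "K \<noteq> K'"
  shows "face_normal K' e = - face_normal K e"
proof -
  have "face_normal K' e = face_normal K e \<or> face_normal K' e = - face_normal K e"
    using facet_normal(4)[OF K] facet_normal(1,2)[OF K'] by blast
  moreover have "face_normal K' e \<noteq> face_normal K e"
  proof
    assume eq: "face_normal K' e = face_normal K e"
    let ?n = "face_normal K e"
    obtain x where x: "x \<in> rel_interior e" using facet_rel_interior[OF K] .
    obtain r where r: "r > 0" "\<forall>y\<in>ball x r. y \<in> interior K \<longleftrightarrow> (y - x) \<bullet> ?n < 0"
      using facet_normal(3)[OF K x] by blast
    obtain r' where r': "r' > 0" "\<forall>y\<in>ball x r'. y \<in> interior K' \<longleftrightarrow> (y - x) \<bullet> ?n < 0"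
      using facet_normal(3)[OF K' x] unfolding eq by blast
    let ?y = "x - (min r r' / 2) *\<^sub>R ?n"
    have "?n \<bullet> ?n = 1" by (simp only: power2_norm_eq_inner[symmetric] facet_normal(1)[OF K]) simp
    then have "(?y - x) \<bullet> ?n < 0" using r r' by simp
    moreover have "?y \<in> ball x r" "?y \<in> ball x r'" using r r' facet_normal(1)[OF K] by (auto simp: dist_norm)
    ultimately have "?y \<in> interior K" "?y \<in> interior K'" using r r' by blast+
    then show False using disjoint_interior[OF K(1) K'(1) ne] interior_subset by blast
  qed
  ultimately show ?thesis by blast
qed

text \<open>Three elements at one facet would have pairwise opposite normals, which is impossible
  for nonzero vectors.\<close>

lemma interior_face_adjacent:
  assumes "e \<in> interior_faces \<T>"
  obtains K K' where "K \<in> \<T>" "K' \<in> \<T>" "K \<noteq> K'" "e facet_of K" "e facet_of K'" "adjacent \<T> e = {K, K'}"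
proof -
  obtain K K' where K: "K \<in> \<T>" "K' \<in> \<T>" "K \<noteq> K'" "e facet_of K" "e facet_of K'"
    using assms unfolding interior_faces_def by blast
  have "L = K \<or> L = K'" if L: "L \<in> \<T>" "e facet_of L" for L
  proof (rule ccontr)
    assume "\<not> (L = K \<or> L = K')"
    then have "face_normal K' e = - face_normal K e" "face_normal L e = - face_normal K e" "face_normal L e = - face_normal K' e"
      using opposite_normals K L by blast+
    then have "face_normal K e + face_normal K e = 0" by (metis add.inverse_inverse add.right_inverse)
    then have "face_normal K e = 0" by (simp add: scaleR_2[symmetric])
    then show False using facet_normal(1)[OF K(1,4)] by simp
  qed
  then have "adjacent \<T> e = {K, K'}" using K by (auto simp: adjacent_def)
  with K show ?thesis using that by blast
qed

text \<open>Conformity at work: \<open>K \<inter> K'\<close> is a face of \<open>K\<close> meeting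
  the relative interior of \<open>e\<close>, so it contains \<open>e\<close>; being a proper face it
  has no larger dimension, so it equals \<open>e\<close>.\<close>

lemma facet_neighbour:
  assumes K: "K \<in> \<T>" "e facet_of K" and x: "x \<in> rel_interior e" and K': "K' \<in> \<T>" "x \<in> K'" "K' \<noteq> K"
  shows "e facet_of K'"
proof -
  have eK: "e face_of K" "e \<subseteq> K" using facet_of_imp_face_of[OF K(2)] facet_of_imp_subset[OF K(2)] by auto
  have xe: "x \<in> e" using x rel_interior_subset by blast
  have f: "(K \<inter> K') face_of K" "(K \<inter> K') face_of K'"
    using face_Int[OF K(1) K'(1)] face_Int[OF K'(1) K(1)] by (auto simp: Int_commute)
  have sub: "e \<subseteq> K \<inter> K'" using x xe eK K' by (intro subset_of_face_of[OF f(1) eK(2)]) blast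
  have "e face_of (K \<inter> K')" using face_of_subset[OF eK(1) sub] by blast
  moreover have "aff_dim (K \<inter> K') < aff_dim K"
    using Int_proper[OF K(1) K'(1)] K'(3) face_of_aff_dim_lt[OF convex_element[OF K(1)] f(1)] by blast
  moreover have "aff_dim e = aff_dim K - 1" using K by (simp add: facet_of_def)
  moreover have "convex (K \<inter> K')" using convex_element K K' by (simp add: convex_Int)
  ultimately have "e = K \<inter> K'" using face_of_aff_dim_lt[of "K \<inter> K'" e] by fastforce
  then have "e face_of K'" using f by simp
  then show ?thesis using K K' aff_dim_element by (auto simp: facet_of_def)
qed

text \<open>By \<open>facet_neighbour\<close> all other elements stay away from \<open>x\<close>, so
  near \<open>x\<close> the domain looks like the single element \<open>K\<close>. Outward normals
  and traces from inside the domain are identified this way.\<close>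

lemma facet_boundary_local:
  assumes K: "K \<in> \<T>" "e facet_of K" and b: "e \<notin> interior_faces \<T>" and x: "x \<in> rel_interior e"
  obtains r where "r > 0" "\<And>y. y \<in> ball x r \<Longrightarrow> y \<in> \<Union>\<T> \<longleftrightarrow> (y - x) \<bullet> face_normal K e \<le> 0"
      "\<And>y. y \<in> ball x r \<Longrightarrow> y \<in> interior K \<longleftrightarrow> (y - x) \<bullet> face_normal K e < 0"
      "\<And>y. y \<in> ball x r \<Longrightarrow> y \<in> \<Omega> \<longleftrightarrow> y \<in> interior K"
proof -
  obtain r where r: "r > 0" "\<forall>y\<in>ball x r. (y \<in> K \<longleftrightarrow> (y - x) \<bullet> face_normal K e \<le> 0) \<and> (y \<in> interior K \<longleftrightarrow> (y - x) \<bullet> face_normal K e < 0)"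
    using facet_normal(3)[OF K x] by blast
  have "x \<notin> \<Union>(\<T> - {K})"
    using facet_neighbour[OF K x] K b unfolding interior_faces_def by blast
  moreover have "closed (\<Union>(\<T> - {K}))"
    using finite_\<T> compact_element by (intro closed_Union) (auto intro: compact_imp_closed)
  ultimately obtain r' where r': "r' > 0" "ball x r' \<inter> \<Union>(\<T> - {K}) = {}"
    by (metis Compl_iff disjoint_eq_subset_Compl open_Compl open_contains_ball)
  define R where "R = min r r'"
  have R: "R > 0" "ball x R \<subseteq> ball x r" "ball x R \<subseteq> ball x r'" using r(1) r'(1) by (auto simp: R_def)
  have UK: "y \<in> \<Union>\<T> \<longleftrightarrow> y \<in> K" if "y \<in> ball x R" for y using that R r' K by blast
  have "y \<in> \<Omega> \<longleftrightarrow> y \<in> interior K" if "y \<in> ball x R" for y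
  proof
    assume "y \<in> \<Omega>"
    moreover have "open (\<Omega> \<inter> ball x R)" using open_\<Omega> by blast
    moreover have "\<Omega> \<inter> ball x R \<subseteq> K" using UK \<Omega>_subset by blast
    ultimately show "y \<in> interior K" using that interior_maximal by blast
  qed (use interior_subset_\<Omega> K in blast)
  then show ?thesis using that[of R] R r UK by blast
qed

text \<open>The two opposite half-balls at a shared facet fill a ball, whose centre is then in
  \<open>\<Omega>\<close>. At a facet of a single element \<open>\<Omega>\<close> is locally an open
  half-ball, which misses the relative interior and, \<open>\<Omega>\<close> being open, the whole
  facet.\<close>

lemma boundary_face_iff: "e \<in> boundary_faces \<Omega> \<T> \<longleftrightarrow> (\<exists>K\<in>\<T>. e facet_of K) \<and> e \<notin> interior_faces \<T>"
proof (intro iffI conjI)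
  assume "e \<in> boundary_faces \<Omega> \<T>"
  then have e: "\<exists>K\<in>\<T>. e facet_of K" "e \<subseteq> frontier \<Omega>" by (auto simp: boundary_faces_def)
  then show "\<exists>K\<in>\<T>. e facet_of K" by blast
  show "e \<notin> interior_faces \<T>"
  proof
    assume "e \<in> interior_faces \<T>"
    then obtain K K' where K: "K \<in> \<T>" "K' \<in> \<T>" "K \<noteq> K'" "e facet_of K" "e facet_of K'"
      by (rule interior_face_adjacent)
    obtain x where x: "x \<in> rel_interior e" using facet_rel_interior[OF K(1,4)] .
    obtain r where r: "r > 0" "\<forall>y\<in>ball x r. y \<in> K \<longleftrightarrow> (y - x) \<bullet> face_normal K e \<le> 0"
      using facet_normal(3)[OF K(1,4) x] by blast
    obtain r' where r': "r' > 0" "\<forall>y\<in>ball x r'. y \<in> K' \<longleftrightarrow> (y - x) \<bullet> face_normal K' e \<le> 0"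
      using facet_normal(3)[OF K(2,5) x] by blast
    have "ball x (min r r') \<subseteq> \<Union>\<T>"
    proof
      fix y assume y: "y \<in> ball x (min r r')"
      have "(y - x) \<bullet> face_normal K e \<le> 0 \<or> (y - x) \<bullet> face_normal K' e \<le> 0"
        unfolding opposite_normals[OF K(1,4,2,5,3)] by auto
      then have "y \<in> K \<or> y \<in> K'" using y r(2) r'(2) by auto
      then show "y \<in> \<Union>\<T>" using K by blast
    qed
    then have "ball x (min r r') \<subseteq> \<Omega>" unfolding \<Omega>_eq by (intro interior_maximal) auto
    then have "x \<in> \<Omega>" using r r' by (meson centre_in_ball min_less_iff_conj subsetD)
    moreover have "x \<in> frontier \<Omega>" using e x rel_interior_subset by blast
    ultimately show False using open_\<Omega> by (simp add: frontier_def interior_open)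
  qed
next
  assume "(\<exists>K\<in>\<T>. e facet_of K) \<and> e \<notin> interior_faces \<T>"
  then obtain K where K: "K \<in> \<T>" "e facet_of K" "e \<notin> interior_faces \<T>" by blast
  have "rel_interior e \<inter> \<Omega> = {}"
  proof (rule ccontr)
    assume "rel_interior e \<inter> \<Omega> \<noteq> {}"
    then obtain x where x: "x \<in> rel_interior e" "x \<in> \<Omega>" by blast
    obtain r where r: "r > 0" "\<And>y. y \<in> ball x r \<Longrightarrow> y \<in> interior K \<longleftrightarrow> (y - x) \<bullet> face_normal K e < 0"
      "\<And>y. y \<in> ball x r \<Longrightarrow> y \<in> \<Omega> \<longleftrightarrow> y \<in> interior K"
      using facet_boundary_local[OF K x(1)] by metis
    then show False using x(2) r(2,3)[of x] r(1) by simp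
  qed
  then have "\<Omega> \<inter> closure (rel_interior e) = {}"
    using open_Int_closure_eq_empty[OF open_\<Omega>] by blast
  then have "\<Omega> \<inter> e = {}"
    using convex_closure_rel_interior[OF facet_convex[OF K(1,2)]] closure_subset by blast
  moreover have "e \<subseteq> closure \<Omega>" using K facet_of_imp_subset element_subset_closure by blast
  ultimately show "e \<in> boundary_faces \<Omega> \<T>"
    using K open_\<Omega> by (auto simp: boundary_faces_def frontier_def interior_open)
qed

lemma boundary_face_adjacent:
  assumes "e \<in> boundary_faces \<Omega> \<T>"
  obtains K where "K \<in> \<T>" "e facet_of K" "adjacent \<T> e = {K}"
proof -
  obtain K where K: "K \<in> \<T>" "e facet_of K" "e \<notin> interior_faces \<T>" using assms boundary_face_iff by blast
  then have "adjacent \<T> e = {K}" by (auto simp: adjacent_def interior_faces_def)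
  with K show ?thesis using that by blast
qed

lemma outward_normal:
  assumes K: "K \<in> \<T>" "e facet_of K" and b: "e \<notin> interior_faces \<T>" and x: "x \<in> rel_interior e"
  shows "outward_unit_normal \<Omega> x (face_normal K e)"
proof -
  obtain r where r: "r > 0" "\<And>y. y \<in> ball x r \<Longrightarrow> y \<in> interior K \<longleftrightarrow> (y - x) \<bullet> face_normal K e < 0"
      "\<And>y. y \<in> ball x r \<Longrightarrow> y \<in> \<Omega> \<longleftrightarrow> y \<in> interior K"
    using facet_boundary_local[OF K b x] by metis
  show ?thesis unfolding outward_unit_normal_def
  proof (intro conjI allI impI facet_normal(1)[OF K])
    fix \<epsilon> :: real assume "\<epsilon> > 0"
    then have "\<epsilon> * norm (y - x) \<ge> 0" for y by simp
    then show "\<exists>r>0. \<forall>y\<in>ball x r. ((y - x) \<bullet> face_normal K e < - \<epsilon> * norm (y - x) \<longrightarrow> y \<in> \<Omega>) \<and>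
        (\<epsilon> * norm (y - x) < (y - x) \<bullet> face_normal K e \<longrightarrow> y \<notin> \<Omega>)"
      using r by (intro exI[of _ r]) (smt (verit) mult_minus_left)
  qed
qed

text \<open>Star-shapedness is applied at one relatively interior point \<open>z\<close>, where the
  outward normal is known to exist. Along the facet
  \<open>(x - x0) \<bullet> face_normal K e\<close> is constant, which gives the bound at the
  remaining points.\<close>

lemma star_shaped_normal:
  assumes st: "strictly_star_shaped \<Omega> x0 c" and K: "K \<in> \<T>" "e facet_of K" and b: "e \<notin> interior_faces \<T>" and x: "x \<in> e"
  shows "(x - x0) \<bullet> face_normal K e \<ge> c"
proof -
  obtain z where z: "z \<in> rel_interior e" using facet_rel_interior[OF K] .
  have ze: "z \<in> e" using z rel_interior_subset by blast
  moreover have "e \<subseteq> frontier \<Omega>" using boundary_face_iff K b unfolding boundary_faces_def by blast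
  ultimately have "(z - x0) \<bullet> face_normal K e \<ge> c"
    using st outward_normal[OF K b z] unfolding strictly_star_shaped_def by blast
  moreover have "(x - z) \<bullet> face_normal K e = 0" using facet_normal(2)[OF K ze x] .
  ultimately show ?thesis by (simp add: inner_diff_left)
qed

end

section \<open>Piecewise affine functions\<close>

lemma gradc_has_derivative:
  fixes p :: "real^'n \<Rightarrow> complex"
  assumes "affine_fun p"
  shows "(p has_derivative cdot (gradc p)) (at x)"
proof -
  have "bounded_linear (cdot (gradc p))" using linear_cdot by (simp add: linear_conv_bounded_linear)
  then have "((\<lambda>y. (p x - cdot (gradc p) x) + cdot (gradc p) y) has_derivative (\<lambda>h. 0 + cdot (gradc p) h)) (at x)"
    by (intro has_derivative_add has_derivative_const bounded_linear_imp_has_derivative)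
  moreover have "p x - cdot (gradc p) x + cdot (gradc p) y = p y" for y
    using affine_fun_gradc[OF assms, of y x] by (simp add: cdot_diff_right)
  ultimately have "(p has_derivative (\<lambda>h. 0 + cdot (gradc p) h)) (at x)"
    by (simp only:)
  then show ?thesis by simp
qed

lemma cdot_axis: "cdot G (axis i 1) = G $ i"
  by (simp add: cdot_def axis_def if_distrib cong: if_cong)

lemma grad_h_eq:
  fixes p :: "real^'n \<Rightarrow> complex"
  assumes "affine_fun p" "open S" "x \<in> S" "\<And>y. y \<in> S \<Longrightarrow> v y = p y"
  shows "grad_h v x = gradc p"
proof -
  have "(v has_derivative cdot (gradc p)) (at x)"
    using has_derivative_transform_within_open[OF gradc_has_derivative[OF assms(1)] assms(2,3)] assms(4) by metis
  then have "frechet_derivative v (at x) = cdot (gradc p)" by (rule frechet_derivative_at[symmetric])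
  then show ?thesis by (simp add: grad_h_def cdot_axis vec_eq_iff)
qed

context simplicial_mesh
begin

lemma facet_integrable:
  fixes f g :: "real^'n \<Rightarrow> 'b::euclidean_space"
  assumes K: "K \<in> \<T>" "e facet_of K" and g: "continuous_on UNIV g" and fg: "\<And>x. x \<in> rel_interior e \<Longrightarrow> f x = g x"
  shows "integrable (surface_measure e) f" and "(LINT x|surface_measure e. f x) = (LINT x|surface_measure e. g x)"
proof -
  interpret simplex23 "V K" using element K by blast
  obtain a where a: "a \<in> V K" "e = convex hull (V K - {a})" using facet_vertex[OF K] .
  obtain s where s: "surface_measure e = completion (distr (restrict_space lborel (prism a s)) borel (proj a))"
    using surface_measure_eq[OF a(1)] a(2) by blast
  have ig: "integrable (surface_measure e) g" using integrable_surface[OF a(1) g] a(2) by simp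
  have "AE x in surface_measure e. x \<in> rel_interior e"
    using AE_surface[OF a(1)] unfolding a(2) rel_interior_facet[OF a(1)] mem_Collect_eq .
  then have ae: "AE x in surface_measure e. f x = g x"
    by eventually_elim (rule fg)
  show "integrable (surface_measure e) f"
    using integrable_completion_AE[of _ g f] ig ae unfolding s by blast
  show "(LINT x|surface_measure e. f x) = (LINT x|surface_measure e. g x)"
    using integral_completion_AE[of _ g f] ig ae unfolding s by blast
qed

lemma AE_element_interior: "K \<in> \<T> \<Longrightarrow> AE x in lebesgue. x \<in> K \<longrightarrow> x \<in> interior K"
proof -
  assume K: "K \<in> \<T>"
  have "frontier K \<in> null_sets lebesgue"
    using negligible_convex_frontier[OF convex_element[OF K]] by (simp add: negligible_iff_null_sets)
  then have "AE x in lebesgue. x \<notin> frontier K" by (rule AE_not_in)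
  then show "AE x in lebesgue. x \<in> K \<longrightarrow> x \<in> interior K"
    using closure_closed[OF compact_imp_closed[OF compact_element[OF K]]] by eventually_elim (use closure_subset in \<open>auto simp: frontier_def\<close>)
qed

lemma element_indicator_integrable:
  fixes g :: "real^'n \<Rightarrow> 'b::euclidean_space"
  assumes "K \<in> \<T>" "continuous_on UNIV g"
  shows "integrable lebesgue (\<lambda>x. indicator K x *\<^sub>R g x)"
proof -
  have K: "K \<inter> space lebesgue \<in> sets lebesgue" using compact_element[OF assms(1)] by (simp add: borel_compact)
  show ?thesis
    using lebesgue_on_compact_integrable[OF compact_element[OF assms(1)] assms(2)]
    unfolding integrable_restrict_space[OF K] .
qed

text \<open>Element frontiers are negligible, so almost every point lies in the interior of exactly
  one element or outside all of them, and the sum of indicators selects the right piece.\<close>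

lemma
  fixes \<phi> :: "real^'n \<Rightarrow> 'b::euclidean_space" and \<psi> :: "(real^'n) set \<Rightarrow> real^'n \<Rightarrow> 'b"
  assumes c: "\<And>K. K \<in> \<T> \<Longrightarrow> continuous_on UNIV (\<psi> K)" and eq: "\<And>K x. K \<in> \<T> \<Longrightarrow> x \<in> interior K \<Longrightarrow> \<phi> x = \<psi> K x"
  shows domain_integrable: "integrable (lebesgue_on \<Omega>) \<phi>"
    and domain_integral: "(LINT x|lebesgue_on \<Omega>. \<phi> x) = (\<Sum>K\<in>\<T>. LINT x|lebesgue_on K. \<psi> K x)"
    and element_integral: "K \<in> \<T> \<Longrightarrow> (LINT x|lebesgue_on K. \<phi> x) = (LINT x|lebesgue_on K. \<psi> K x)"
proof -
  have O: "\<Omega> \<inter> space lebesgue \<in> sets lebesgue" using open_\<Omega> by (simp add: borel_open)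
  have Ks: "K \<inter> space lebesgue \<in> sets lebesgue" if "K \<in> \<T>" for K
    using compact_element[OF that] by (simp add: borel_compact)
  let ?g = "\<lambda>x. \<Sum>K\<in>\<T>. indicator K x *\<^sub>R \<psi> K x"
  have ig: "integrable lebesgue ?g"
    by (intro Bochner_Integration.integrable_sum element_indicator_integrable c)
  have "AE x in lebesgue. \<forall>K\<in>\<T>. x \<in> K \<longrightarrow> x \<in> interior K"
    using AE_element_interior finite_\<T> by (intro AE_finite_allI)
  then have ae: "AE x in lebesgue. indicator \<Omega> x *\<^sub>R \<phi> x = ?g x"
  proof eventually_elim
    case (elim x)
    show ?case
    proof (cases "x \<in> \<Omega>")
      case True
      then obtain K where K: "K \<in> \<T>" "x \<in> interior K" using \<Omega>_subset elim by blast
      then have "?g x = (\<Sum>L\<in>\<T>. if L = K then \<psi> K x else 0)"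
        using disjoint_interior[OF K(1)] interior_subset by (intro sum.cong) (auto simp: indicator_def)
      then show ?thesis using K eq True finite_\<T> by simp
    next
      case False
      then have "x \<notin> L" if "L \<in> \<T>" for L using elim that interior_subset_\<Omega> by blast
      then show ?thesis using False by simp
    qed
  qed
  show "integrable (lebesgue_on \<Omega>) \<phi>"
    unfolding integrable_restrict_space[OF O] by (rule integrable_completion_AE[OF ig ae])
  have "(LINT x|lebesgue_on \<Omega>. \<phi> x) = (LINT x|lebesgue. ?g x)"
    unfolding integral_restrict_space[OF O] by (rule integral_completion_AE[OF ig ae])
  also have "\<dots> = (\<Sum>K\<in>\<T>. LINT x|lebesgue. indicator K x *\<^sub>R \<psi> K x)"
    by (intro Bochner_Integration.integral_sum element_indicator_integrable c)
  also have "\<dots> = (\<Sum>K\<in>\<T>. LINT x|lebesgue_on K. \<psi> K x)"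
    by (intro sum.cong refl) (simp add: integral_restrict_space[OF Ks])
  finally show "(LINT x|lebesgue_on \<Omega>. \<phi> x) = (\<Sum>K\<in>\<T>. LINT x|lebesgue_on K. \<psi> K x)" .
  assume K: "K \<in> \<T>"
  have "AE x in lebesgue. indicator K x *\<^sub>R \<phi> x = indicator K x *\<^sub>R \<psi> K x"
    using AE_element_interior[OF K] by eventually_elim (use eq K in \<open>auto simp: indicator_def\<close>)
  then show "(LINT x|lebesgue_on K. \<phi> x) = (LINT x|lebesgue_on K. \<psi> K x)"
    unfolding integral_restrict_space[OF Ks[OF K]]
    by (intro integral_completion_AE element_indicator_integrable[OF K] c K)
qed

text \<open>Each \<open>p K\<close> is affine on the whole space, so the trace from \<open>K\<close>
  at a point of its boundary is just a value of \<open>p K\<close>, and jumps are differences of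
  affine functions.\<close>

definition pieces :: "(real^'n \<Rightarrow> 'b::euclidean_space) \<Rightarrow> ((real^'n) set \<Rightarrow> real^'n \<Rightarrow> 'b) \<Rightarrow> bool" where
  "pieces v p \<longleftrightarrow> (\<forall>K\<in>\<T>. affine_fun (p K) \<and> (\<forall>x\<in>interior K. v x = p K x))"

lemma pieces_affine: "pieces v p \<Longrightarrow> K \<in> \<T> \<Longrightarrow> affine_fun (p K)"
  and pieces_eq: "pieces v p \<Longrightarrow> K \<in> \<T> \<Longrightarrow> x \<in> interior K \<Longrightarrow> v x = p K x"
  by (auto simp: pieces_def)

lemma pieces_continuous: "pieces v p \<Longrightarrow> K \<in> \<T> \<Longrightarrow> continuous_on S (p K)"
  by (intro affine_fun_continuous pieces_affine)

lemma P1_linear: "p \<in> P1 \<Longrightarrow> \<exists>c L. linear L \<and> p = (\<lambda>x. c + L x)"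
proof -
  assume "p \<in> P1"
  then obtain c b where "\<forall>x. p x = c + b \<bullet> x" unfolding P1_def by blast
  moreover have "linear (\<lambda>x. b \<bullet> x)" by (simp add: bounded_linear.linear bounded_linear_inner_right)
  ultimately show ?thesis by (intro exI[of _ c] exI[of _ "\<lambda>x. b \<bullet> x"]) auto
qed

lemma V_h_pieces: "v \<in> V_h \<T> \<longleftrightarrow> (\<exists>p. pieces v p)"
proof
  assume "v \<in> V_h \<T>"
  have "\<exists>p. affine_fun p \<and> (\<forall>x\<in>interior K. v x = p x)" if K: "K \<in> \<T>" for K
  proof -
    obtain p q where pq: "p \<in> P1" "q \<in> P1" "\<forall>x\<in>interior K. Re (v x) = p x \<and> Im (v x) = q x"
      using \<open>v \<in> V_h \<T>\<close> K unfolding V_h_def by blast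
    obtain c L where L: "linear L" "p = (\<lambda>x. c + L x)" using P1_linear[OF pq(1)] by blast
    obtain d M where M: "linear M" "q = (\<lambda>x. d + M x)" using P1_linear[OF pq(2)] by blast
    have "linear (\<lambda>x. Complex (L x) (M x))"
      using L(1) M(1) by (intro linearI) (auto simp: linear_add linear_scale complex_eq_iff)
    moreover have "(\<lambda>x. Complex (p x) (q x)) = (\<lambda>x. Complex c d + Complex (L x) (M x))"
      using L M by (simp add: fun_eq_iff complex_eq_iff)
    ultimately have "affine_fun (\<lambda>x. Complex (p x) (q x))" unfolding affine_fun_def by blast
    then show ?thesis using pq(3) by (intro exI[of _ "\<lambda>x. Complex (p x) (q x)"]) (auto simp: complex_eq_iff)
  qed
  then have "\<forall>K\<in>\<T>. \<exists>p. affine_fun p \<and> (\<forall>x\<in>interior K. v x = p x)" by blast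
  from bchoice[OF this] show "\<exists>p. pieces v p" unfolding pieces_def .
next
  assume "\<exists>p. pieces v p"
  then obtain p where p: "pieces v p" by blast
  have "\<exists>P\<in>P1. \<exists>Q\<in>P1. \<forall>x\<in>interior K. Re (v x) = P x \<and> Im (v x) = Q x" if K: "K \<in> \<T>" for K
  proof -
    obtain c L where L: "linear L" "p K = (\<lambda>x. c + L x)" using pieces_affine[OF p K] unfolding affine_fun_def by blast
    have lin: "linear (\<lambda>x. Re (L x))" "linear (\<lambda>x. Im (L x))"
      using L(1) by (auto intro!: linearI simp: linear_add linear_scale)
    have rep: "f x = adjoint f 1 \<bullet> x" if "linear f" for f :: "real^'n \<Rightarrow> real" and x
      using adjoint_works[OF that, of x 1] by (simp add: inner_commute)
    have P: "(\<lambda>x. Re (p K x)) \<in> P1" "(\<lambda>x. Im (p K x)) \<in> P1"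
    proof -
      have "Re (p K x) = Re c + adjoint (\<lambda>x. Re (L x)) 1 \<bullet> x" "Im (p K x) = Im c + adjoint (\<lambda>x. Im (L x)) 1 \<bullet> x" for x
        unfolding L(2) plus_complex.simps rep[OF lin(1), of x, symmetric] rep[OF lin(2), of x, symmetric] by (rule refl)+
      then show "(\<lambda>x. Re (p K x)) \<in> P1" "(\<lambda>x. Im (p K x)) \<in> P1" unfolding P1_def by blast+
    qed
    show ?thesis by (intro bexI[OF _ P(1)] bexI[OF _ P(2)] ballI) (simp add: pieces_eq[OF p K])
  qed
  then show "v \<in> V_h \<T>" unfolding V_h_def by blast
qed

lemma \<Sigma>_h_pieces: "\<tau> \<in> \<Sigma>_h \<T> \<longleftrightarrow> (\<exists>t. pieces \<tau> t)"
proof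
  assume "\<tau> \<in> \<Sigma>_h \<T>"
  then have "\<forall>i. \<exists>p. pieces (\<lambda>x. \<tau> x $ i) p" by (simp add: \<Sigma>_h_def V_h_pieces)
  then obtain p where p: "\<And>i. pieces (\<lambda>x. \<tau> x $ i) (p i)" by metis
  have "affine_fun (\<lambda>x. \<chi> i. p i K x)" if K: "K \<in> \<T>" for K
  proof -
    have "\<forall>i. \<exists>c L. linear L \<and> p i K = (\<lambda>x. c + L x)" using pieces_affine[OF p K] unfolding affine_fun_def by blast
    then obtain c L where L: "\<And>i. linear (L i)" "\<And>i. p i K = (\<lambda>x. c i + L i x)" by metis
    have "linear (\<lambda>x. \<chi> i. L i x)" using L(1) by (intro linearI) (auto simp: vec_eq_iff linear_add linear_scale)
    moreover have "(\<lambda>x. \<chi> i. p i K x) = (\<lambda>x. (\<chi> i. c i) + (\<chi> i. L i x))" using L(2) by (auto simp: vec_eq_iff)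
    ultimately show ?thesis unfolding affine_fun_def by blast
  qed
  moreover have "\<tau> x = (\<chi> i. p i K x)" if "K \<in> \<T>" "x \<in> interior K" for K x
    using pieces_eq[OF p that] by (simp add: vec_eq_iff)
  ultimately have "pieces \<tau> (\<lambda>K x. \<chi> i. p i K x)" by (simp add: pieces_def)
  then show "\<exists>t. pieces \<tau> t" by blast
next
  assume "\<exists>t. pieces \<tau> t"
  then obtain t where t: "pieces \<tau> t" by blast
  have "pieces (\<lambda>x. \<tau> x $ i) (\<lambda>K x. t K x $ i)" for i
    unfolding pieces_def
  proof (intro ballI conjI)
    fix K assume K: "K \<in> \<T>"
    obtain c L where L: "linear L" "t K = (\<lambda>x. c + L x)" using pieces_affine[OF t K] unfolding affine_fun_def by blast
    have "linear (\<lambda>x. L x $ i)" using L(1) by (intro linearI) (auto simp: linear_add linear_scale)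
    then show "affine_fun (\<lambda>x. t K x $ i)" unfolding affine_fun_def L(2) by (intro exI[of _ "c $ i"] exI[of _ "\<lambda>x. L x $ i"]) auto
    fix x assume "x \<in> interior K" then show "\<tau> x $ i = t K x $ i" using pieces_eq[OF t K] by simp
  qed
  then show "\<tau> \<in> \<Sigma>_h \<T>" unfolding \<Sigma>_h_def V_h_pieces by blast
qed

lemma pieces_grad:
  assumes "pieces v p" shows "pieces (grad_h v) (\<lambda>K x. gradc (p K))"
  unfolding pieces_def
proof (intro ballI conjI affine_fun_const)
  fix K x assume K: "K \<in> \<T>" "x \<in> interior K"
  show "grad_h v x = gradc (p K)"
    by (rule grad_h_eq[OF pieces_affine[OF assms K(1)] open_interior K(2)]) (rule pieces_eq[OF assms K(1)])
qed

lemma trace_element: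
  assumes "pieces v p" "K \<in> \<T>" "x \<in> K"
  shows "bdry_trace (interior K) v x = p K x"
proof (rule bdry_trace_eq)
  show "x \<in> closure (interior K)" using closure_interior_element[OF assms(2)] assms(3) by simp
  show "v y = p K y" if "y \<in> interior K" for y using pieces_eq[OF assms(1,2) that] .
  show "continuous_on UNIV (p K)" using pieces_continuous[OF assms(1,2)] .
qed simp

text \<open>An arbitrary ordering of the elements at a face. On a boundary face \<open>kp e\<close>
  is the only one and \<open>km e\<close> has no meaning; \<open>nv e\<close> points out of
  \<open>kp e\<close>.\<close>

definition kp :: "(real^'n) set \<Rightarrow> (real^'n) set" where "kp e = (SOME K. K \<in> adjacent \<T> e)"
definition km :: "(real^'n) set \<Rightarrow> (real^'n) set" where "km e = (SOME K. K \<in> adjacent \<T> e - {kp e})"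
definition nv :: "(real^'n) set \<Rightarrow> real^'n" where "nv e = face_normal (kp e) e"

lemma boundary_faceD:
  assumes "e \<in> boundary_faces \<Omega> \<T>"
  shows "kp e \<in> \<T>" "e facet_of kp e" "adjacent \<T> e = {kp e}"
proof -
  obtain K where K: "K \<in> \<T>" "e facet_of K" "adjacent \<T> e = {K}" using boundary_face_adjacent[OF assms] .
  then have "kp e = K" by (simp add: kp_def)
  with K show "kp e \<in> \<T>" "e facet_of kp e" "adjacent \<T> e = {kp e}" by auto
qed

lemma interior_faceD:
  assumes "e \<in> interior_faces \<T>"
  shows "kp e \<in> \<T>" "km e \<in> \<T>" "kp e \<noteq> km e" "e facet_of kp e" "e facet_of km e" "adjacent \<T> e = {kp e, km e}"
    "face_normal (km e) e = - nv e"
proof -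
  obtain K K' where K: "K \<in> \<T>" "K' \<in> \<T>" "K \<noteq> K'" "e facet_of K" "e facet_of K'" "adjacent \<T> e = {K, K'}"
    using interior_face_adjacent[OF assms] .
  have 1: "kp e \<in> adjacent \<T> e" unfolding kp_def some_in_eq using K(6) by blast
  have "adjacent \<T> e - {kp e} \<noteq> {}" using K(3) unfolding K(6) by (cases "kp e = K") auto
  then have 2: "km e \<in> adjacent \<T> e - {kp e}" unfolding km_def some_in_eq .
  show a: "kp e \<in> \<T>" "km e \<in> \<T>" "kp e \<noteq> km e" "e facet_of kp e" "e facet_of km e"
    using 1 2 by (auto simp: adjacent_def)
  show "adjacent \<T> e = {kp e, km e}" using 1 2 K(6) by auto
  show "face_normal (km e) e = - nv e" unfolding nv_def using opposite_normals a by blast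
qed

text \<open>Near a relatively interior point of a boundary face, \<open>\<Omega>\<close> and the
  interior of its only element coincide, so both traces are limits along the same filter.\<close>

lemma trace_boundary:
  assumes p: "pieces v p" and e: "e \<in> boundary_faces \<Omega> \<T>" and x: "x \<in> rel_interior e"
  shows "bdry_trace \<Omega> v x = p (kp e) x"
proof -
  note K = boundary_faceD[OF e]
  have ni: "e \<notin> interior_faces \<T>" using e boundary_face_iff by blast
  obtain r where r: "r > 0" "\<And>y. y \<in> ball x r \<Longrightarrow> y \<in> \<Omega> \<longleftrightarrow> y \<in> interior (kp e)"
    using facet_boundary_local[OF K(1,2) ni x] by metis
  have "at x within \<Omega> = at x within interior (kp e)"
    by (rule at_within_nhd[of x "ball x r"]) (use r in auto)
  then have "bdry_trace \<Omega> v x = bdry_trace (interior (kp e)) v x" by (simp add: bdry_trace_def)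
  moreover have "x \<in> kp e" using x rel_interior_subset facet_of_imp_subset[OF K(2)] by blast
  ultimately show ?thesis using trace_element[OF p K(1)] by simp
qed

lemma finite_interior_faces: "finite (interior_faces \<T>)"
  and finite_boundary_faces: "finite (boundary_faces \<Omega> \<T>)"
proof -
  have "finite (\<Union>K\<in>\<T>. {e. e facet_of K})"
    using finite_\<T> mesh by (intro finite_UN_I finite_polytope_facets simplex_imp_polytope) (auto simp: mesh_of_def)
  moreover have "interior_faces \<T> \<subseteq> (\<Union>K\<in>\<T>. {e. e facet_of K})" "boundary_faces \<Omega> \<T> \<subseteq> (\<Union>K\<in>\<T>. {e. e facet_of K})"
    by (auto simp: interior_faces_def boundary_faces_def)
  ultimately show "finite (interior_faces \<T>)" "finite (boundary_faces \<Omega> \<T>)" by (auto intro: finite_subset)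
qed

text \<open>Double counting of the incidences between elements and facets: a boundary face occurs
  once, an interior face twice.\<close>

lemma sum_faces:
  fixes f :: "(real^'n) set \<Rightarrow> (real^'n) set \<Rightarrow> real"
  shows "(\<Sum>K\<in>\<T>. \<Sum>a\<in>V K. f K (convex hull (V K - {a}))) =
    (\<Sum>e\<in>boundary_faces \<Omega> \<T>. f (kp e) e) + (\<Sum>e\<in>interior_faces \<T>. f (kp e) e + f (km e) e)"
proof -
  let ?E = "boundary_faces \<Omega> \<T> \<union> interior_faces \<T>"
  have E: "?E = {e. \<exists>K\<in>\<T>. e facet_of K}"
  proof -
    have "interior_faces \<T> \<subseteq> {e. \<exists>K\<in>\<T>. e facet_of K}" unfolding interior_faces_def by blast
    then show ?thesis using boundary_face_iff by blast
  qed
  have "(\<Sum>a\<in>V K. f K (convex hull (V K - {a}))) = (\<Sum>e | e \<in> ?E \<and> e facet_of K. f K e)" if K: "K \<in> \<T>" for K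
  proof -
    interpret simplex23 "V K" using element K by blast
    have "bij_betw (\<lambda>a. convex hull (V K - {a})) (V K) {e. e \<in> ?E \<and> e facet_of K}"
    proof (rule bij_betw_imageI)
      show "inj_on (\<lambda>a. convex hull (V K - {a})) (V K)"
      proof (rule inj_onI, rule ccontr)
        fix a b assume ab: "a \<in> V K" "b \<in> V K" "convex hull (V K - {a}) = convex hull (V K - {b})" "a \<noteq> b"
        then have "a \<in> convex hull (V K - {b})" by (simp add: hull_inc)
        then have "a \<in> convex hull (V K - {a})" using ab by simp
        then show False using facet_eq[OF ab(1)] lam_vertex[OF ab(1,1)] by simp
      qed
      show "(\<lambda>a. convex hull (V K - {a})) ` V K = {e. e \<in> ?E \<and> e facet_of K}"
        using facet_iff element(2)[OF K] K unfolding E by auto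
    qed
    then show ?thesis by (rule sum.reindex_bij_betw)
  qed
  then have "(\<Sum>K\<in>\<T>. \<Sum>a\<in>V K. f K (convex hull (V K - {a}))) = (\<Sum>K\<in>\<T>. \<Sum>e | e \<in> ?E \<and> e facet_of K. f K e)"
    by (intro sum.cong) auto
  also have "\<dots> = (\<Sum>e\<in>?E. \<Sum>K | K \<in> \<T> \<and> e facet_of K. f K e)"
    using finite_\<T> finite_interior_faces finite_boundary_faces by (intro sum.swap_restrict) auto
  also have "\<dots> = (\<Sum>e\<in>?E. \<Sum>K\<in>adjacent \<T> e. f K e)" by (simp add: adjacent_def)
  also have "\<dots> = (\<Sum>e\<in>boundary_faces \<Omega> \<T>. \<Sum>K\<in>adjacent \<T> e. f K e) + (\<Sum>e\<in>interior_faces \<T>. \<Sum>K\<in>adjacent \<T> e. f K e)"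
    using finite_interior_faces finite_boundary_faces boundary_face_iff by (intro sum.union_disjoint) auto
  also have "(\<Sum>e\<in>boundary_faces \<Omega> \<T>. \<Sum>K\<in>adjacent \<T> e. f K e) = (\<Sum>e\<in>boundary_faces \<Omega> \<T>. f (kp e) e)"
    by (intro sum.cong refl) (simp add: boundary_faceD(3))
  also have "(\<Sum>e\<in>interior_faces \<T>. \<Sum>K\<in>adjacent \<T> e. f K e) = (\<Sum>e\<in>interior_faces \<T>. f (kp e) e + f (km e) e)"
    by (intro sum.cong refl) (simp add: interior_faceD(3,6))
  finally show ?thesis .
qed

end

section \<open>The sesquilinear form\<close>

definition hip :: "complex^'n \<Rightarrow> complex^'n \<Rightarrow> complex" where
  "hip a b = (\<Sum>i\<in>UNIV. a $ i * cnj (b $ i))"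

lemma Re_hip: "Re (hip a b) = a \<bullet> b"
  by (simp add: hip_def inner_vec_def inner_complex_def)

lemma Re_mult_cnj: "Re (a * cnj b) = a \<bullet> b"
  by (simp add: inner_complex_def)

lemma Im_hip_self: "Im (hip a a) = 0"
  by (simp add: hip_def)

lemma continuous_on_cdot [continuous_intros]:
  "continuous_on S f \<Longrightarrow> continuous_on S g \<Longrightarrow> continuous_on S (\<lambda>x. cdot (f x) (g x))"
  unfolding cdot_def by (intro continuous_intros)

lemma continuous_on_hip [continuous_intros]:
  "continuous_on S f \<Longrightarrow> continuous_on S g \<Longrightarrow> continuous_on S (\<lambda>x. hip (f x) (g x))"
  unfolding hip_def by (intro continuous_intros)

text \<open>The optimal weight is \<open>c = b / a\<close>. Shifting both numbers by a small
  positive \<open>d\<close> covers the case that one of them vanishes.\<close>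

lemma le_mult_if_le_Young:
  fixes x a b :: real
  assumes a: "a \<ge> 0" and b: "b \<ge> 0" and le: "\<And>c. c > 0 \<Longrightarrow> x \<le> (c * a\<^sup>2 + b\<^sup>2 / c) / 2"
  shows "x \<le> a * b"
proof (rule field_le_epsilon)
  fix e :: real assume e: "e > 0"
  define d where "d = e / (a + b + 1)"
  have d: "d > 0" unfolding d_def using e a b by simp
  have "x \<le> ((b + d) / (a + d) * a\<^sup>2 + b\<^sup>2 / ((b + d) / (a + d))) / 2"
    using d a b by (intro le) auto
  also have "(b + d) / (a + d) * a\<^sup>2 \<le> (b + d) * a"
  proof -
    have "a / (a + d) \<le> 1" using a d by simp
    then have "(b + d) * a * (a / (a + d)) \<le> (b + d) * a * 1" using a b d by (intro mult_left_mono) auto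
    then show ?thesis by (simp add: power2_eq_square mult_ac)
  qed
  also have "b\<^sup>2 / ((b + d) / (a + d)) \<le> (a + d) * b"
  proof -
    have "b / (b + d) \<le> 1" using b d by simp
    then have "(a + d) * b * (b / (b + d)) \<le> (a + d) * b * 1" using a b d by (intro mult_left_mono) auto
    then show ?thesis by (simp add: power2_eq_square mult_ac)
  qed
  finally have "x \<le> a * b + d * (a + b) / 2" by (simp add: algebra_simps add_divide_distrib)
  also have "d * (a + b) / 2 \<le> d * (a + b + 1)" using d a b by (simp add: algebra_simps)
  also have "d * (a + b + 1) = e" unfolding d_def using a b by simp
  finally show "x \<le> a * b + e" by simp
qed

lemma l2_norm_nonneg: "l2_norm M u \<ge> 0"
  unfolding l2_norm_def by (simp add: Bochner_Integration.integral_nonneg)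

lemma l2_norm_power2: "(l2_norm M u)\<^sup>2 = (LINT x|M. (norm (u x))\<^sup>2)"
  unfolding l2_norm_def by (simp add: Bochner_Integration.integral_nonneg)

text \<open>The Cauchy-Schwarz inequality, obtained from the weighted pointwise inequality with all
  weights \<open>c\<close>.\<close>

lemma ip_le:
  assumes "integrable M (\<lambda>x. (norm (f x))\<^sup>2)" "integrable M (\<lambda>x. (norm (v x))\<^sup>2)"
  shows "norm (ip M f v) \<le> l2_norm M f * l2_norm M v"
proof (rule le_mult_if_le_Young[OF l2_norm_nonneg l2_norm_nonneg])
  fix c :: real assume c: "c > 0"
  let ?w = "\<lambda>x. (c * (norm (f x))\<^sup>2 + (norm (v x))\<^sup>2 / c) / 2"
  have w: "integrable M ?w" using assms by simp
  have le: "norm (f x * cnj (v x)) \<le> ?w x" for x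
  proof -
    have "0 \<le> (c * norm (f x) - norm (v x))\<^sup>2 / c" using c by simp
    also have "\<dots> = c * (norm (f x))\<^sup>2 + (norm (v x))\<^sup>2 / c - 2 * (norm (f x) * norm (v x))"
      using c by (simp add: power2_eq_square field_simps)
    finally show ?thesis by (simp add: norm_mult)
  qed
  have "norm (ip M f v) \<le> (LINT x|M. ?w x)"
  proof (cases "integrable M (\<lambda>x. f x * cnj (v x))")
    case True
    have "(LINT x|M. norm (f x * cnj (v x))) \<le> (LINT x|M. ?w x)"
      by (rule Bochner_Integration.integral_mono[OF integrable_norm[OF True] w le])
    then show ?thesis unfolding ip_def using Bochner_Integration.integral_norm_bound[of M "\<lambda>x. f x * cnj (v x)"] by linarith
  next
    \<comment> \<open>The Bochner integral of a function that is not integrable is 0 by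
      convention.\<close>
    case False
    then have "ip M f v = 0" unfolding ip_def by (rule not_integrable_integral_eq)
    then show ?thesis using c by (simp add: Bochner_Integration.integral_nonneg)
  qed
  also have "(LINT x|M. ?w x) = (c * (l2_norm M f)\<^sup>2 + (l2_norm M v)\<^sup>2 / c) / 2"
    using assms by (simp add: l2_norm_power2)
  finally show "norm (ip M f v) \<le> (c * (l2_norm M f)\<^sup>2 + (l2_norm M v)\<^sup>2 / c) / 2" .
qed

lemma ip_\<Gamma>_le:
  assumes "\<And>e. e \<in> boundary_faces \<Omega> \<T> \<Longrightarrow> integrable (surface_measure e) (\<lambda>x. (norm (f x))\<^sup>2)"
      "\<And>e. e \<in> boundary_faces \<Omega> \<T> \<Longrightarrow> integrable (surface_measure e) (\<lambda>x. (norm (v x))\<^sup>2)"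
  shows "norm (ip_\<Gamma> \<Omega> \<T> f v) \<le> l2_norm_\<Gamma> \<Omega> \<T> f * l2_norm_\<Gamma> \<Omega> \<T> v"
proof -
  have "norm (ip_\<Gamma> \<Omega> \<T> f v) \<le> (\<Sum>e\<in>boundary_faces \<Omega> \<T>. \<bar>l2_norm (surface_measure e) f\<bar> * \<bar>l2_norm (surface_measure e) v\<bar>)"
    unfolding ip_\<Gamma>_def
    by (rule order_trans[OF norm_sum], rule sum_mono)
       (simp only: abs_of_nonneg[OF l2_norm_nonneg] ip_le[OF assms])
  also have "\<dots> \<le> L2_set (\<lambda>e. l2_norm (surface_measure e) f) (boundary_faces \<Omega> \<T>) * L2_set (\<lambda>e. l2_norm (surface_measure e) v) (boundary_faces \<Omega> \<T>)"
    by (rule L2_set_mult_ineq)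
  finally show ?thesis by (simp add: L2_set_def l2_norm_\<Gamma>_def)
qed

section \<open>The sesquilinear form as integrals of affine pieces\<close>

context simplicial_mesh
begin

text \<open>The integrands depend on the element or face, so each summand may use affine extensions
  instead of the discrete function, and only continuous functions are integrated.\<close>

definition EI :: "((real^'n) set \<Rightarrow> real^'n \<Rightarrow> 'b::euclidean_space) \<Rightarrow> 'b" where
  "EI \<phi> = (\<Sum>K\<in>\<T>. LINT x|lebesgue_on K. \<phi> K x)"

definition BI :: "((real^'n) set \<Rightarrow> real^'n \<Rightarrow> 'b::euclidean_space) \<Rightarrow> 'b" where
  "BI \<phi> = (\<Sum>e\<in>boundary_faces \<Omega> \<T>. LINT x|surface_measure e. \<phi> e x)"

definition FI :: "((real^'n) set \<Rightarrow> real^'n \<Rightarrow> 'b::euclidean_space) \<Rightarrow> 'b" where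
  "FI \<phi> = (\<Sum>e\<in>interior_faces \<T>. LINT x|surface_measure e. \<phi> e x)"

lemma facet_integrable_cont:
  fixes g :: "real^'n \<Rightarrow> 'b::euclidean_space"
  shows "e \<in> interior_faces \<T> \<union> boundary_faces \<Omega> \<T> \<Longrightarrow> continuous_on UNIV g \<Longrightarrow> integrable (surface_measure e) g"
  using facet_integrable(1)[of "kp e" e g g] interior_faceD boundary_faceD by blast

lemma facet_integral_cong:
  fixes f g :: "real^'n \<Rightarrow> 'b::euclidean_space"
  assumes e: "e \<in> interior_faces \<T> \<union> boundary_faces \<Omega> \<T>" and g: "continuous_on UNIV g" "\<And>x. x \<in> rel_interior e \<Longrightarrow> f x = g x"
  shows "(LINT x|surface_measure e. f x) = (LINT x|surface_measure e. g x)"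
  using facet_integrable(2)[OF _ _ g, of "kp e"] e interior_faceD boundary_faceD by blast

lemma element_integrable_cont:
  fixes g :: "real^'n \<Rightarrow> 'b::euclidean_space"
  shows "K \<in> \<T> \<Longrightarrow> continuous_on UNIV g \<Longrightarrow> integrable (lebesgue_on K) g"
  by (intro lebesgue_on_compact_integrable compact_element)

lemma
  fixes \<phi> :: "(real^'n) set \<Rightarrow> real^'n \<Rightarrow> 'b::euclidean_space"
  assumes T: "bounded_linear T"
  shows EI_linear: "(\<And>K. K \<in> \<T> \<Longrightarrow> continuous_on UNIV (\<phi> K)) \<Longrightarrow> T (EI \<phi>) = EI (\<lambda>K x. T (\<phi> K x))"
    and BI_linear: "(\<And>e. e \<in> boundary_faces \<Omega> \<T> \<Longrightarrow> continuous_on UNIV (\<phi> e)) \<Longrightarrow> T (BI \<phi>) = BI (\<lambda>e x. T (\<phi> e x))"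
    and FI_linear: "(\<And>e. e \<in> interior_faces \<T> \<Longrightarrow> continuous_on UNIV (\<phi> e)) \<Longrightarrow> T (FI \<phi>) = FI (\<lambda>e x. T (\<phi> e x))"
  unfolding EI_def BI_def FI_def linear_sum[OF bounded_linear.linear[OF T]]
  by (intro sum.cong refl integral_bounded_linear[OF T, symmetric] element_integrable_cont facet_integrable_cont; blast)+

lemma EI_add: "(\<And>K. K \<in> \<T> \<Longrightarrow> continuous_on UNIV (\<phi> K)) \<Longrightarrow> (\<And>K. K \<in> \<T> \<Longrightarrow> continuous_on UNIV (\<psi> K)) \<Longrightarrow>
    EI (\<lambda>K x. \<phi> K x + \<psi> K x) = EI \<phi> + EI \<psi>"
  by (simp add: EI_def Bochner_Integration.integral_add element_integrable_cont sum.distrib)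

lemma FI_add: "(\<And>e. e \<in> interior_faces \<T> \<Longrightarrow> continuous_on UNIV (\<phi> e)) \<Longrightarrow> (\<And>e. e \<in> interior_faces \<T> \<Longrightarrow> continuous_on UNIV (\<psi> e)) \<Longrightarrow>
    FI (\<lambda>e x. \<phi> e x + \<psi> e x) = FI \<phi> + FI \<psi>"
  by (simp add: FI_def Bochner_Integration.integral_add facet_integrable_cont sum.distrib)

text \<open>The difference without a normal; \<open>jump\<close> and \<open>njump\<close> arise from
  it by multiplication with \<open>nv e\<close>.\<close>

definition jp :: "((real^'n) set \<Rightarrow> real^'n \<Rightarrow> 'b::euclidean_space) \<Rightarrow> (real^'n) set \<Rightarrow> real^'n \<Rightarrow> 'b" where
  "jp p e x = p (kp e) x - p (km e) x"

definition av :: "((real^'n) set \<Rightarrow> real^'n \<Rightarrow> 'b::euclidean_space) \<Rightarrow> (real^'n) set \<Rightarrow> real^'n \<Rightarrow> 'b" where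
  "av p e x = (1/2) *\<^sub>R (p (kp e) x + p (km e) x)"

lemma continuous_jp: "pieces v p \<Longrightarrow> e \<in> interior_faces \<T> \<Longrightarrow> continuous_on S (jp p e)"
  and continuous_av: "pieces v p \<Longrightarrow> e \<in> interior_faces \<T> \<Longrightarrow> continuous_on S (av p e)"
proof -
  assume p: "pieces v p" and e: "e \<in> interior_faces \<T>"
  have "continuous_on S (\<lambda>x. p (kp e) x - p (km e) x)" "continuous_on S (\<lambda>x. (1/2) *\<^sub>R (p (kp e) x + p (km e) x))"
    using pieces_continuous[OF p interior_faceD(1)[OF e]] pieces_continuous[OF p interior_faceD(2)[OF e]]
    by (auto intro!: continuous_intros)
  moreover have "jp p e = (\<lambda>x. p (kp e) x - p (km e) x)" "av p e = (\<lambda>x. (1/2) *\<^sub>R (p (kp e) x + p (km e) x))"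
    by (auto simp: jp_def av_def)
  ultimately show "continuous_on S (jp p e)" "continuous_on S (av p e)" by (simp_all only:)
qed

lemma interior_face_mem: "e \<in> interior_faces \<T> \<Longrightarrow> x \<in> rel_interior e \<Longrightarrow> x \<in> kp e \<and> x \<in> km e"
  using rel_interior_subset facet_of_imp_subset interior_faceD(4,5) by blast

lemma avg_eq:
  assumes p: "pieces v p" and e: "e \<in> interior_faces \<T>" and x: "x \<in> rel_interior e"
  shows "avg \<T> e v x = av p e x"
  unfolding avg_def av_def interior_faceD(6)[OF e]
  using interior_faceD(3)[OF e] trace_element[OF p interior_faceD(1)[OF e]] trace_element[OF p interior_faceD(2)[OF e]]
    interior_face_mem[OF e x] by simp

lemma jump_eq:
  assumes p: "pieces v p" and e: "e \<in> interior_faces \<T>" and x: "x \<in> rel_interior e"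
  shows "jump \<T> e v x = jp p e x *s cvec (nv e)"
  unfolding jump_def jp_def interior_faceD(6)[OF e]
  using interior_faceD(3,7)[OF e] trace_element[OF p interior_faceD(1)[OF e]] trace_element[OF p interior_faceD(2)[OF e]]
    interior_face_mem[OF e x] by (simp add: nv_def[symmetric] vec_eq_iff cvec_def algebra_simps)

lemma njump_eq:
  assumes p: "pieces v p" and e: "e \<in> interior_faces \<T>" and x: "x \<in> rel_interior e"
  shows "njump \<T> e v x = cdot (jp p e x) (nv e)"
  unfolding njump_def jp_def interior_faceD(6)[OF e]
  using interior_faceD(3,7)[OF e] trace_element[OF p interior_faceD(1)[OF e]] trace_element[OF p interior_faceD(2)[OF e]]
    interior_face_mem[OF e x] by (simp add: nv_def[symmetric] cdot_def sum_subtractf[symmetric] sum_negf[symmetric] sum.distrib[symmetric] algebra_simps)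

lemma nv_unit: "e \<in> interior_faces \<T> \<Longrightarrow> nv e \<bullet> nv e = 1"
  using facet_normal(1)[OF interior_faceD(1,4)] by (simp add: power2_norm_eq_inner[symmetric] nv_def)

lemma vip_domain:
  assumes s: "pieces X s" and t: "pieces \<tau> t"
  shows "vip (lebesgue_on \<Omega>) X \<tau> = EI (\<lambda>K x. hip (s K x) (t K x))"
  unfolding vip_def EI_def hip_def[symmetric]
  by (rule domain_integral) (auto intro!: continuous_intros pieces_continuous[OF s] pieces_continuous[OF t] simp: pieces_eq[OF s] pieces_eq[OF t])

lemma ip_domain:
  assumes p: "pieces w p" and q: "pieces v q"
  shows "ip (lebesgue_on \<Omega>) w v = EI (\<lambda>K x. p K x * cnj (q K x))"
  unfolding ip_def EI_def
  by (rule domain_integral) (auto intro!: continuous_intros pieces_continuous[OF p] pieces_continuous[OF q] simp: pieces_eq[OF p] pieces_eq[OF q])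

lemma ip_boundary:
  assumes p: "pieces w p" and q: "pieces v q"
  shows "ip_\<Gamma> \<Omega> \<T> (bdry_trace \<Omega> w) (bdry_trace \<Omega> v) = BI (\<lambda>e x. p (kp e) x * cnj (q (kp e) x))"
  unfolding ip_\<Gamma>_def ip_def BI_def
  by (intro sum.cong refl facet_integral_cong)
     (auto intro!: continuous_intros pieces_continuous[OF p] pieces_continuous[OF q] boundary_faceD(1)
       simp: trace_boundary[OF p] trace_boundary[OF q])

text \<open>Traces become values of affine pieces and the vector jumps become scalars times
  \<open>nv e\<close>; the unit length of the normal reduces the products of vector jumps to
  products of scalars.\<close>

lemma A_h_eq:
  assumes p: "pieces w p" and s: "pieces X s" and q: "pieces v q" and t: "pieces \<tau> t"
  shows "A_h \<Omega> \<T> k \<beta> \<delta> w X v \<tau> =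
     EI (\<lambda>K x. hip (s K x) (gradc (q K))) - of_real (k\<^sup>2) * EI (\<lambda>K x. p K x * cnj (q K x))
     + \<i> * of_real k * BI (\<lambda>e x. p (kp e) x * cnj (q (kp e) x))
     - FI (\<lambda>e x. (cdot (av (\<lambda>K x. gradc (p K)) e x) (nv e) - \<i> * of_real \<beta> * jp p e x) * cnj (jp q e x))
     - (\<i> * of_real \<delta> * FI (\<lambda>e x. cdot (jp (\<lambda>K x. gradc (p K)) e x) (nv e) * cnj (cdot (jp t e x) (nv e)))
        - FI (\<lambda>e x. jp p e x * cnj (cdot (av t e x) (nv e))))
     + EI (\<lambda>K x. hip (s K x) (t K x)) - EI (\<lambda>K x. hip (gradc (p K)) (t K x))"
proof -
  note gp = pieces_grad[OF p] and gq = pieces_grad[OF q]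
  have nn: "(\<Sum>i\<in>UNIV. of_real (nv e $ i) * of_real (nv e $ i)) = (1::complex)" if "e \<in> interior_faces \<T>" for e
    using nv_unit[OF that] by (simp add: inner_vec_def of_real_mult[symmetric] of_real_sum[symmetric] del: of_real_mult of_real_sum)
  have h1: "(\<Sum>i\<in>UNIV. (G - (\<i> * of_real \<beta>) *s (j *s cvec n)) $ i * cnj ((j' *s cvec n) $ i)) = (cdot G n - \<i> * of_real \<beta> * j) * cnj j'"
    if "(\<Sum>i\<in>UNIV. of_real (n $ i) * of_real (n $ i)) = (1::complex)" for G :: "complex^'n" and j j' n
  proof -
    have "(\<Sum>i\<in>UNIV. (G - (\<i> * of_real \<beta>) *s (j *s cvec n)) $ i * cnj ((j' *s cvec n) $ i)) =
      (\<Sum>i\<in>UNIV. (G $ i * of_real (n $ i)) * cnj j' - (\<i> * of_real \<beta> * j * cnj j') * (of_real (n $ i) * of_real (n $ i)))"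
      by (intro sum.cong refl) (simp add: cvec_def algebra_simps)
    also have "\<dots> = cdot G n * cnj j' - (\<i> * of_real \<beta> * j * cnj j') * 1"
      unfolding sum_subtractf sum_distrib_right[symmetric] sum_distrib_left[symmetric] cdot_def that ..
    finally show ?thesis by (simp add: algebra_simps)
  qed
  have h2: "(\<Sum>i\<in>UNIV. (j *s cvec n) $ i * cnj (G $ i)) = j * cnj (cdot G n)" for G :: "complex^'n" and j n
    by (simp add: cvec_def cdot_def sum_distrib_left mult_ac)
  have f1: "vip (surface_measure e) (\<lambda>x. avg \<T> e (grad_h w) x - (\<i> * of_real \<beta>) *s jump \<T> e w x) (jump \<T> e v) =
      (LINT x|surface_measure e. (cdot (av (\<lambda>K x. gradc (p K)) e x) (nv e) - \<i> * of_real \<beta> * jp p e x) * cnj (jp q e x))"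
    if e: "e \<in> interior_faces \<T>" for e
    unfolding vip_def
  proof (rule facet_integral_cong)
    show "continuous_on UNIV (\<lambda>x. (cdot (av (\<lambda>K x. gradc (p K)) e x) (nv e) - \<i> * of_real \<beta> * jp p e x) * cnj (jp q e x))"
      by (intro continuous_intros continuous_av[OF gp e] continuous_jp[OF p e] continuous_jp[OF q e])
  qed (use e in \<open>simp_all only: UnI1 avg_eq[OF gp] jump_eq[OF p] jump_eq[OF q] h1[OF nn]\<close>)
  have f2: "ip (surface_measure e) (njump \<T> e (grad_h w)) (njump \<T> e \<tau>) =
      (LINT x|surface_measure e. cdot (jp (\<lambda>K x. gradc (p K)) e x) (nv e) * cnj (cdot (jp t e x) (nv e)))"
    if e: "e \<in> interior_faces \<T>" for e
    unfolding ip_def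
  proof (rule facet_integral_cong)
    show "continuous_on UNIV (\<lambda>x. cdot (jp (\<lambda>K x. gradc (p K)) e x) (nv e) * cnj (cdot (jp t e x) (nv e)))"
      by (intro continuous_intros continuous_jp[OF gp e] continuous_jp[OF t e])
  qed (use e in \<open>simp_all only: UnI1 njump_eq[OF gp] njump_eq[OF t]\<close>)
  have f3: "vip (surface_measure e) (jump \<T> e w) (avg \<T> e \<tau>) =
      (LINT x|surface_measure e. jp p e x * cnj (cdot (av t e x) (nv e)))"
    if e: "e \<in> interior_faces \<T>" for e
    unfolding vip_def
  proof (rule facet_integral_cong)
    show "continuous_on UNIV (\<lambda>x. jp p e x * cnj (cdot (av t e x) (nv e)))"
      by (intro continuous_intros continuous_jp[OF p e] continuous_av[OF t e])
  qed (use e in \<open>simp_all only: UnI1 avg_eq[OF t] jump_eq[OF p] h2\<close>)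
  have F1: "(\<Sum>e\<in>interior_faces \<T>. vip (surface_measure e) (\<lambda>x. avg \<T> e (grad_h w) x - (\<i> * of_real \<beta>) *s jump \<T> e w x) (jump \<T> e v))
     = FI (\<lambda>e x. (cdot (av (\<lambda>K x. gradc (p K)) e x) (nv e) - \<i> * of_real \<beta> * jp p e x) * cnj (jp q e x))"
    unfolding FI_def by (rule sum.cong) (simp_all only: f1)
  have F2: "(\<Sum>e\<in>interior_faces \<T>. \<i> * of_real \<delta> * ip (surface_measure e) (njump \<T> e (grad_h w)) (njump \<T> e \<tau>) - vip (surface_measure e) (jump \<T> e w) (avg \<T> e \<tau>))
     = \<i> * of_real \<delta> * FI (\<lambda>e x. cdot (jp (\<lambda>K x. gradc (p K)) e x) (nv e) * cnj (cdot (jp t e x) (nv e)))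
        - FI (\<lambda>e x. jp p e x * cnj (cdot (av t e x) (nv e)))"
    unfolding FI_def sum_distrib_left sum_subtractf[symmetric] by (rule sum.cong) (simp_all only: f2 f3)
  show ?thesis
    unfolding A_h_def F1 F2 vip_domain[OF s gq] ip_domain[OF p q] ip_boundary[OF p q] vip_domain[OF s t] vip_domain[OF gp t] ..
qed

lemma
  assumes p: "pieces v p"
  shows l2_norm_domain: "(l2_norm (lebesgue_on \<Omega>) v)\<^sup>2 = EI (\<lambda>K x. (norm (p K x))\<^sup>2)"
    and integrable_domain: "integrable (lebesgue_on \<Omega>) (\<lambda>x. (norm (v x))\<^sup>2)"
    and l2_norm_element: "(\<Sum>K\<in>\<T>. (l2_norm (lebesgue_on K) v)\<^sup>2) = EI (\<lambda>K x. (norm (p K x))\<^sup>2)"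
proof -
  have c: "continuous_on UNIV (\<lambda>x. (norm (p K x))\<^sup>2)" if "K \<in> \<T>" for K
    using pieces_continuous[OF p that] by (intro continuous_intros)
  have e: "(norm (v x))\<^sup>2 = (norm (p K x))\<^sup>2" if "K \<in> \<T>" "x \<in> interior K" for K x
    using pieces_eq[OF p that] by simp
  show "(l2_norm (lebesgue_on \<Omega>) v)\<^sup>2 = EI (\<lambda>K x. (norm (p K x))\<^sup>2)"
    unfolding l2_norm_power2 EI_def by (rule domain_integral[OF c e])
  show "integrable (lebesgue_on \<Omega>) (\<lambda>x. (norm (v x))\<^sup>2)" by (rule domain_integrable[OF c e])
  show "(\<Sum>K\<in>\<T>. (l2_norm (lebesgue_on K) v)\<^sup>2) = EI (\<lambda>K x. (norm (p K x))\<^sup>2)"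
    unfolding l2_norm_power2 EI_def by (rule sum.cong[OF refl], rule element_integral[OF c e])
qed

lemma
  assumes p: "pieces v p"
  shows l2_norm_boundary: "(l2_norm_\<Gamma> \<Omega> \<T> (bdry_trace \<Omega> v))\<^sup>2 = BI (\<lambda>e x. (norm (p (kp e) x))\<^sup>2)"
    and integrable_boundary: "e \<in> boundary_faces \<Omega> \<T> \<Longrightarrow> integrable (surface_measure e) (\<lambda>x. (norm (bdry_trace \<Omega> v x))\<^sup>2)"
proof -
  have c: "continuous_on UNIV (\<lambda>x. (norm (p (kp e) x))\<^sup>2)" if "e \<in> boundary_faces \<Omega> \<T>" for e
    using pieces_continuous[OF p boundary_faceD(1)[OF that]] by (intro continuous_intros)
  have e: "(norm (bdry_trace \<Omega> v x))\<^sup>2 = (norm (p (kp e) x))\<^sup>2" if "e \<in> boundary_faces \<Omega> \<T>" "x \<in> rel_interior e" for e x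
    using trace_boundary[OF p that] by simp
  have "(l2_norm_\<Gamma> \<Omega> \<T> (bdry_trace \<Omega> v))\<^sup>2 = (\<Sum>e\<in>boundary_faces \<Omega> \<T>. (l2_norm (surface_measure e) (bdry_trace \<Omega> v))\<^sup>2)"
    by (simp add: l2_norm_\<Gamma>_def sum_nonneg)
  also have "\<dots> = BI (\<lambda>e x. (norm (p (kp e) x))\<^sup>2)"
    unfolding l2_norm_power2 BI_def by (rule sum.cong[OF refl], rule facet_integral_cong[OF _ c e]) auto
  finally show "(l2_norm_\<Gamma> \<Omega> \<T> (bdry_trace \<Omega> v))\<^sup>2 = BI (\<lambda>e x. (norm (p (kp e) x))\<^sup>2)" .
  show "integrable (surface_measure e) (\<lambda>x. (norm (bdry_trace \<Omega> v x))\<^sup>2)" if "e \<in> boundary_faces \<Omega> \<T>"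
    by (rule facet_integrable(1)[OF boundary_faceD(1,2)[OF that] c[OF that] e[OF that]])
qed

end

section \<open>Face terms\<close>

lemma tang_decomp: "cdot H v = cdot H n * of_real (n \<bullet> v) + cdot (tang n H) v"
  unfolding tang_def by (simp add: cdot_diff_left cdot_scale_left) (simp add: cdot_def cvec_def inner_vec_def)

lemma inner_scaled_cvec: "G \<bullet> (z *s cvec n) = cdot G n \<bullet> z"
proof -
  have "hip G (z *s cvec n) = cdot G n * cnj z"
    unfolding hip_def cdot_def cvec_def sum_distrib_right by (intro sum.cong refl) simp
  then show ?thesis by (metis Re_hip Re_mult_cnj)
qed

lemma inner_tang_decomp: "G \<bullet> H = cdot G n \<bullet> cdot H n + G \<bullet> tang n H"
proof -
  have "H = cdot H n *s cvec n + tang n H" by (simp add: tang_def)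
  then have "G \<bullet> H = G \<bullet> (cdot H n *s cvec n) + G \<bullet> tang n H" by (metis inner_add_right)
  then show ?thesis by (simp add: inner_scaled_cvec)
qed

lemma Young: fixes x y :: real assumes "e > 0" shows "x * y \<le> e * x\<^sup>2 / 2 + y\<^sup>2 / (2 * e)"
proof -
  have "0 \<le> (e * x - y)\<^sup>2 / (2 * e)" using assms by simp
  also have "\<dots> = e * x\<^sup>2 / 2 + y\<^sup>2 / (2 * e) - x * y"
    using assms by (simp add: power2_eq_square field_simps)
  finally show ?thesis by simp
qed

lemma sum_power2_le: fixes x y :: real shows "(x + y)\<^sup>2 \<le> 2 * (x\<^sup>2 + y\<^sup>2)"
  using zero_le_power2[of "x - y"] by (simp add: power2_eq_square algebra_simps)

lemma norm_diff_squares_le: "\<bar>(norm a)\<^sup>2 - (norm b)\<^sup>2\<bar> \<le> (norm a + norm b) * norm (a - b)"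
proof -
  have "\<bar>(norm a)\<^sup>2 - (norm b)\<^sup>2\<bar> = (norm a + norm b) * \<bar>norm a - norm b\<bar>"
    by (simp add: power2_eq_square square_diff_square_factored abs_mult)
  also have "\<dots> \<le> (norm a + norm b) * norm (a - b)"
    by (intro mult_left_mono norm_triangle_ineq3) auto
  finally show ?thesis .
qed

text \<open>The normal components of the gradient jump cancel between the last two terms of the left-hand side;
  the remaining tangential part is controlled by the jump of the function itself.\<close>

lemma face_pointwise:
  fixes p1 p2 :: complex and G1 G2 :: "complex^'n" and n v :: "real^'n"
  assumes n: "norm n = 1" and v: "norm v \<le> R" and h: "h > 0" and \<eta>: "\<eta> > 0" and \<beta>: "\<beta> > 0" and \<delta>: "\<delta> > 0" and d: "0 \<le> d"
  defines "H \<equiv> G1 - G2" and "Ga \<equiv> (1/2) *\<^sub>R (G1 + G2)" and "J \<equiv> p1 - p2"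
  shows "k\<^sup>2 * ((v \<bullet> n) * ((norm p1)\<^sup>2 - (norm p2)\<^sup>2)) + 2 * d * (cdot Ga n \<bullet> J) + 2 * \<beta> * Im (J * cnj (cdot H v))
      + (2 * (cdot Ga n \<bullet> cdot H v) - (v \<bullet> n) * ((norm G1)\<^sup>2 - (norm G2)\<^sup>2))
    \<le> \<eta> * h * (k\<^sup>2 * ((norm p1)\<^sup>2 + (norm p2)\<^sup>2)) + \<eta> * h * ((norm G1)\<^sup>2 + (norm G2)\<^sup>2)
      + (k\<^sup>2 * R\<^sup>2 / (2 * \<eta> * h) + d\<^sup>2 / (\<eta> * h) + R * sqrt (\<beta> / \<delta>) * \<beta> + \<beta> * R / h) * (norm J)\<^sup>2
      + R * sqrt (\<beta> / \<delta>) * \<delta> * (norm (cdot H n))\<^sup>2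
      + (4 * R\<^sup>2 / (\<eta> * h) + \<beta> * R * h) * (norm (tang n H))\<^sup>2"
proof -
  let ?T = "tang n H" and ?N = "cdot H n"
  have R: "R \<ge> 0" using v norm_ge_zero order_trans by blast
  have \<eta>h: "\<eta> * h > 0" using \<eta> h by simp
  have vn: "\<bar>v \<bullet> n\<bar> \<le> R" using Cauchy_Schwarz_ineq2[of v n] n v by simp
  have cdn: "norm (cdot Ga n) \<le> norm Ga" using norm_cdot_le[of Ga n] n by simp
  have Ga2: "(norm Ga)\<^sup>2 \<le> ((norm G1)\<^sup>2 + (norm G2)\<^sup>2) / 2"
  proof -
    have "norm Ga \<le> (norm G1 + norm G2) / 2" unfolding Ga_def using norm_triangle_ineq[of G1 G2] by simp
    then have "(norm Ga)\<^sup>2 \<le> ((norm G1 + norm G2) / 2)\<^sup>2" by (intro power_mono) auto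
    also have "\<dots> \<le> ((norm G1)\<^sup>2 + (norm G2)\<^sup>2) / 2" using sum_power2_le[of "norm G1" "norm G2"] by (simp add: power_divide)
    finally show ?thesis .
  qed
  \<comment> \<open>In this and the other estimates that leave \<open>p1\<close>, \<open>p2\<close>,
    \<open>G1\<close> or \<open>G2\<close> behind, the weight is \<open>\<eta> * h\<close>: the
    trace inequality will later cost a factor 1 / h, and a multiple of \<open>\<eta>\<close>
    remains.\<close>
  have t1: "k\<^sup>2 * ((v \<bullet> n) * ((norm p1)\<^sup>2 - (norm p2)\<^sup>2)) \<le> \<eta> * h * (k\<^sup>2 * ((norm p1)\<^sup>2 + (norm p2)\<^sup>2)) + k\<^sup>2 * R\<^sup>2 / (2 * \<eta> * h) * (norm J)\<^sup>2"
  proof -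
    have "(v \<bullet> n) * ((norm p1)\<^sup>2 - (norm p2)\<^sup>2) \<le> \<bar>v \<bullet> n\<bar> * \<bar>(norm p1)\<^sup>2 - (norm p2)\<^sup>2\<bar>"
      by (metis abs_ge_self abs_mult)
    also have "\<dots> \<le> R * ((norm p1 + norm p2) * norm J)"
      unfolding J_def using vn norm_diff_squares_le R by (intro mult_mono) auto
    also have "\<dots> = (norm p1 + norm p2) * (R * norm J)" by simp
    also have "\<dots> \<le> (\<eta> * h) * (norm p1 + norm p2)\<^sup>2 / 2 + (R * norm J)\<^sup>2 / (2 * (\<eta> * h))"
      by (rule Young[OF \<eta>h])
    also have "\<dots> \<le> \<eta> * h * ((norm p1)\<^sup>2 + (norm p2)\<^sup>2) + R\<^sup>2 * (norm J)\<^sup>2 / (2 * \<eta> * h)"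
      using mult_left_mono[OF sum_power2_le[of "norm p1" "norm p2"], of "\<eta> * h / 2"] \<eta>h
      by (simp add: power_mult_distrib mult.assoc mult.commute[of 2])
    finally have "k\<^sup>2 * ((v \<bullet> n) * ((norm p1)\<^sup>2 - (norm p2)\<^sup>2)) \<le> k\<^sup>2 * (\<eta> * h * ((norm p1)\<^sup>2 + (norm p2)\<^sup>2) + R\<^sup>2 * (norm J)\<^sup>2 / (2 * \<eta> * h))"
      by (intro mult_left_mono) auto
    then show ?thesis by (simp add: algebra_simps)
  qed
  have t3: "2 * d * (cdot Ga n \<bullet> J) \<le> \<eta> * h * (norm Ga)\<^sup>2 + d\<^sup>2 / (\<eta> * h) * (norm J)\<^sup>2"
  proof -
    have "cdot Ga n \<bullet> J \<le> norm Ga * norm J"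
      using norm_cauchy_schwarz[of "cdot Ga n" J] mult_right_mono[OF cdn norm_ge_zero[of J]] by linarith
    then have "2 * d * (cdot Ga n \<bullet> J) \<le> 2 * d * (norm Ga * norm J)" using d by (intro mult_left_mono) auto
    also have "\<dots> = norm Ga * (2 * d * norm J)" by simp
    also have "\<dots> \<le> (2 * (\<eta> * h)) * (norm Ga)\<^sup>2 / 2 + (2 * d * norm J)\<^sup>2 / (2 * (2 * (\<eta> * h)))"
      using \<eta>h by (intro Young) auto
    also have "\<dots> = \<eta> * h * (norm Ga)\<^sup>2 + d\<^sup>2 / (\<eta> * h) * (norm J)\<^sup>2"
      using \<eta>h by (simp add: power_mult_distrib)
    finally show ?thesis .
  qed
  have t4: "2 * \<beta> * Im (J * cnj (cdot H v)) \<le> R * sqrt (\<beta> / \<delta>) * \<beta> * (norm J)\<^sup>2 + R * sqrt (\<beta> / \<delta>) * \<delta> * (norm ?N)\<^sup>2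
      + \<beta> * R / h * (norm J)\<^sup>2 + \<beta> * R * h * (norm ?T)\<^sup>2"
  proof -
    have "norm (cdot H v) \<le> norm ?N * R + norm ?T * R"
    proof -
      have "norm (cdot H v) \<le> norm (?N * of_real (n \<bullet> v)) + norm (cdot ?T v)"
        by (subst tang_decomp[of H v n]) (rule norm_triangle_ineq)
      also have "norm (?N * of_real (n \<bullet> v)) \<le> norm ?N * R"
        using vn by (simp add: norm_mult inner_commute mult_left_mono)
      also have "norm (cdot ?T v) \<le> norm ?T * R"
        using norm_cdot_le[of ?T v] mult_left_mono[OF v norm_ge_zero[of ?T]] by linarith
      finally show ?thesis by simp
    qed
    then have "norm J * norm (cdot H v) \<le> norm J * (norm ?N * R + norm ?T * R)" by (intro mult_left_mono) auto
    moreover have "Im (J * cnj (cdot H v)) \<le> norm J * norm (cdot H v)"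
      using abs_Im_le_cmod[of "J * cnj (cdot H v)"] by (simp add: norm_mult)
    ultimately have "2 * \<beta> * Im (J * cnj (cdot H v)) \<le> 2 * \<beta> * (norm J * (norm ?N * R + norm ?T * R))"
      using \<beta> by (intro mult_left_mono) auto
    also have "\<dots> = R * (2 * \<beta> * (norm J * norm ?N)) + R * (2 * \<beta> * (norm J * norm ?T))" by (simp add: algebra_simps)
    \<comment> \<open>The jumps are available only in the combinations
      \<open>\<beta> * (norm J)\<^sup>2\<close> and \<open>\<delta> * (norm ?N)\<^sup>2\<close>.
      Splitting the product symmetrically between them produces the factor
      \<open>sqrt (\<beta> / \<delta>)\<close> found in \<open>\<gamma>\<^sub>1\<close>.\<close>
    also have "2 * \<beta> * (norm J * norm ?N) \<le> sqrt (\<beta> / \<delta>) * (\<beta> * (norm J)\<^sup>2 + \<delta> * (norm ?N)\<^sup>2)"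
    proof -
      have "2 * (sqrt \<beta> * norm J) * (sqrt \<delta> * norm ?N) \<le> (sqrt \<beta> * norm J)\<^sup>2 + (sqrt \<delta> * norm ?N)\<^sup>2"
        using zero_le_power2[of "sqrt \<beta> * norm J - sqrt \<delta> * norm ?N"] by (simp add: power2_diff)
      then have "sqrt (\<beta> / \<delta>) * (2 * (sqrt \<beta> * norm J) * (sqrt \<delta> * norm ?N)) \<le> sqrt (\<beta> / \<delta>) * (\<beta> * (norm J)\<^sup>2 + \<delta> * (norm ?N)\<^sup>2)"
        using \<beta> \<delta> by (intro mult_left_mono) (auto simp: power_mult_distrib)
      moreover have "sqrt (\<beta> / \<delta>) * (2 * (sqrt \<beta> * norm J) * (sqrt \<delta> * norm ?N)) = 2 * \<beta> * (norm J * norm ?N)"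
        using \<beta> \<delta> by (simp add: real_sqrt_divide)
      ultimately show ?thesis by simp
    qed
    also have "2 * \<beta> * (norm J * norm ?T) \<le> \<beta> * ((norm J)\<^sup>2 / h + h * (norm ?T)\<^sup>2)"
    proof -
      have "norm ?T * norm J \<le> h * (norm ?T)\<^sup>2 / 2 + (norm J)\<^sup>2 / (2 * h)" by (rule Young[OF h])
      then have "2 * (norm J * norm ?T) \<le> (norm J)\<^sup>2 / h + h * (norm ?T)\<^sup>2" by (simp add: mult.commute)
      then show ?thesis using \<beta> by (simp add: mult.assoc)
    qed
    finally have "2 * \<beta> * Im (J * cnj (cdot H v)) \<le> R * (sqrt (\<beta> / \<delta>) * (\<beta> * (norm J)\<^sup>2 + \<delta> * (norm ?N)\<^sup>2)) + R * (\<beta> * ((norm J)\<^sup>2 / h + h * (norm ?T)\<^sup>2))"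
      using R by (simp add: mult_left_mono)
    then show ?thesis by (simp add: algebra_simps)
  qed
  have t2: "2 * (cdot Ga n \<bullet> cdot H v) - (v \<bullet> n) * ((norm G1)\<^sup>2 - (norm G2)\<^sup>2) \<le> \<eta> * h * (norm Ga)\<^sup>2 + 4 * R\<^sup>2 / (\<eta> * h) * (norm ?T)\<^sup>2"
  proof -
    have sq: "(norm G1)\<^sup>2 - (norm G2)\<^sup>2 = 2 * (Ga \<bullet> H)"
      unfolding Ga_def H_def power2_norm_eq_inner
      by (simp add: inner_diff_right inner_add_left inner_commute[of G2 G1] add_divide_distrib)
    have "cdot Ga n \<bullet> cdot H v = (v \<bullet> n) * (cdot Ga n \<bullet> ?N) + cdot Ga n \<bullet> cdot ?T v"
    proof -
      have "?N * of_real (n \<bullet> v) = (v \<bullet> n) *\<^sub>R ?N" by (simp add: scaleR_conv_of_real inner_commute mult.commute)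
      then show ?thesis by (subst tang_decomp[of H v n]) (simp add: inner_add_right)
    qed
    \<comment> \<open>Both terms contain the product of \<open>cdot Ga n\<close> with
      \<open>?N\<close>, with the same factor; it cancels and every remaining product involves
      \<open>?T\<close>.\<close>
    then have "2 * (cdot Ga n \<bullet> cdot H v) - (v \<bullet> n) * ((norm G1)\<^sup>2 - (norm G2)\<^sup>2) =
        2 * (cdot Ga n \<bullet> cdot ?T v) - 2 * ((v \<bullet> n) * (Ga \<bullet> ?T))"
      unfolding sq inner_tang_decomp[of Ga H n] by (simp add: algebra_simps)
    also have "\<dots> \<le> 2 * (norm Ga * (norm ?T * R)) + 2 * (R * (norm Ga * norm ?T))"
    proof -
      have "cdot Ga n \<bullet> cdot ?T v \<le> norm (cdot Ga n) * norm (cdot ?T v)" by (rule norm_cauchy_schwarz)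
      also have "\<dots> \<le> norm Ga * (norm ?T * R)"
        using cdn norm_cdot_le[of ?T v] mult_left_mono[OF v norm_ge_zero[of ?T]] by (intro mult_mono) auto
      finally have 1: "cdot Ga n \<bullet> cdot ?T v \<le> norm Ga * (norm ?T * R)" .
      have "\<bar>(v \<bullet> n) * (Ga \<bullet> ?T)\<bar> \<le> R * (norm Ga * norm ?T)"
        unfolding abs_mult using vn Cauchy_Schwarz_ineq2[of Ga ?T] R by (intro mult_mono) auto
      then show ?thesis using 1 by linarith
    qed
    also have "\<dots> = norm Ga * (4 * R * norm ?T)" by simp
    also have "\<dots> \<le> (2 * (\<eta> * h)) * (norm Ga)\<^sup>2 / 2 + (4 * R * norm ?T)\<^sup>2 / (2 * (2 * (\<eta> * h)))"
      using \<eta>h by (intro Young) auto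
    also have "\<dots> = \<eta> * h * (norm Ga)\<^sup>2 + 4 * R\<^sup>2 / (\<eta> * h) * (norm ?T)\<^sup>2"
      using \<eta>h by (simp add: power_mult_distrib)
    finally show ?thesis .
  qed
  have "2 * (\<eta> * h * (norm Ga)\<^sup>2) \<le> \<eta> * h * ((norm G1)\<^sup>2 + (norm G2)\<^sup>2)"
    using mult_left_mono[OF Ga2, of "\<eta> * h"] \<eta>h by simp
  with t1 t2 t3 t4 show ?thesis by (simp add: distrib_right add_divide_distrib)
qed

section \<open>Divergence identity on the mesh, and the form tested with gradients\<close>

context simplicial_mesh
begin

lemma AE_facet: "K \<in> \<T> \<Longrightarrow> e facet_of K \<Longrightarrow> AE x in surface_measure e. x \<in> rel_interior e"
proof -
  assume K: "K \<in> \<T>" "e facet_of K"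
  interpret simplex23 "V K" using element K by blast
  obtain a where a: "a \<in> V K" "e = convex hull (V K - {a})" using facet_vertex[OF K] .
  show ?thesis using AE_surface[OF a(1)] unfolding a(2) rel_interior_facet[OF a(1)] mem_Collect_eq .
qed

lemma facet_integral_mono:
  fixes f g :: "real^'n \<Rightarrow> real"
  assumes K: "K \<in> \<T>" "e facet_of K" and c: "continuous_on UNIV f" "continuous_on UNIV g"
    and le: "\<And>x. x \<in> rel_interior e \<Longrightarrow> f x \<le> g x"
  shows "(LINT x|surface_measure e. f x) \<le> (LINT x|surface_measure e. g x)"
proof (rule integral_mono_AE)
  show "integrable (surface_measure e) f" "integrable (surface_measure e) g"
    using facet_integrable(1)[OF K c(1)] facet_integrable(1)[OF K c(2)] by auto
  show "AE x in surface_measure e. f x \<le> g x" using AE_facet[OF K] by eventually_elim (rule le)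
qed

lemma BI_mono:
  fixes \<phi> \<psi> :: "(real^'n) set \<Rightarrow> real^'n \<Rightarrow> real"
  assumes "\<And>e. e \<in> boundary_faces \<Omega> \<T> \<Longrightarrow> continuous_on UNIV (\<phi> e)" "\<And>e. e \<in> boundary_faces \<Omega> \<T> \<Longrightarrow> continuous_on UNIV (\<psi> e)"
    "\<And>e x. e \<in> boundary_faces \<Omega> \<T> \<Longrightarrow> x \<in> rel_interior e \<Longrightarrow> \<phi> e x \<le> \<psi> e x"
  shows "BI \<phi> \<le> BI \<psi>"
  unfolding BI_def
proof (rule sum_mono)
  fix e assume e: "e \<in> boundary_faces \<Omega> \<T>"
  show "(LINT x|surface_measure e. \<phi> e x) \<le> (LINT x|surface_measure e. \<psi> e x)"
    by (rule facet_integral_mono[OF boundary_faceD(1,2)[OF e] assms(1)[OF e] assms(2)[OF e]]) (rule assms(3)[OF e])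
qed

lemma EI_mono:
  fixes \<phi> \<psi> :: "(real^'n) set \<Rightarrow> real^'n \<Rightarrow> real"
  assumes "\<And>K. K \<in> \<T> \<Longrightarrow> continuous_on UNIV (\<phi> K)" "\<And>K. K \<in> \<T> \<Longrightarrow> continuous_on UNIV (\<psi> K)"
    "\<And>K x. K \<in> \<T> \<Longrightarrow> x \<in> K \<Longrightarrow> \<phi> K x \<le> \<psi> K x"
  shows "EI \<phi> \<le> EI \<psi>"
  unfolding EI_def
  by (intro sum_mono Bochner_Integration.integral_mono element_integrable_cont assms) auto

lemma EI_nonneg: "(\<And>K x. \<phi> K x \<ge> 0) \<Longrightarrow> EI \<phi> \<ge> (0::real)"
  and BI_nonneg: "(\<And>K x. \<phi> K x \<ge> 0) \<Longrightarrow> BI \<phi> \<ge> (0::real)"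
  and FI_nonneg: "(\<And>K x. \<phi> K x \<ge> 0) \<Longrightarrow> FI \<phi> \<ge> (0::real)"
  unfolding EI_def BI_def FI_def by (auto intro!: sum_nonneg Bochner_Integration.integral_nonneg)

text \<open>Sum of \<open>divergence_identity\<close> over the elements. At an interior face the two
  outward normals are opposite, so a difference of squares is left.\<close>

lemma mesh_divergence:
  fixes P :: "(real^'n) set \<Rightarrow> real^'n \<Rightarrow> 'b::euclidean_space"
  assumes P: "\<And>K. K \<in> \<T> \<Longrightarrow> affine_fun (P K)"
  shows "EI (\<lambda>K x. real CARD('n) * (norm (P K x))\<^sup>2 + 2 * (P K x \<bullet> (P K x - P K x0))) =
     BI (\<lambda>e x. ((x - x0) \<bullet> nv e) * (norm (P (kp e) x))\<^sup>2) +
     FI (\<lambda>e x. ((x - x0) \<bullet> nv e) * ((norm (P (kp e) x))\<^sup>2 - (norm (P (km e) x))\<^sup>2))"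
proof -
  let ?f = "\<lambda>K e. LINT x|surface_measure e. ((x - x0) \<bullet> face_normal K e) * (norm (P K x))\<^sup>2"
  have "(LINT x|lebesgue_on K. real CARD('n) * (norm (P K x))\<^sup>2 + 2 * (P K x \<bullet> (P K x - P K x0))) =
     (\<Sum>a\<in>V K. ?f K (convex hull (V K - {a})))" if K: "K \<in> \<T>" for K
  proof -
    interpret simplex23 "V K" using element K by blast
    show ?thesis
      using divergence_identity[OF P[OF K], of x0] face_normal_eq unfolding element(2)[OF K] by simp
  qed
  then have "EI (\<lambda>K x. real CARD('n) * (norm (P K x))\<^sup>2 + 2 * (P K x \<bullet> (P K x - P K x0))) =
      (\<Sum>K\<in>\<T>. \<Sum>a\<in>V K. ?f K (convex hull (V K - {a})))" unfolding EI_def by simp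
  also have "\<dots> = (\<Sum>e\<in>boundary_faces \<Omega> \<T>. ?f (kp e) e) + (\<Sum>e\<in>interior_faces \<T>. ?f (kp e) e + ?f (km e) e)"
    by (rule sum_faces)
  also have "(\<Sum>e\<in>boundary_faces \<Omega> \<T>. ?f (kp e) e) = BI (\<lambda>e x. ((x - x0) \<bullet> nv e) * (norm (P (kp e) x))\<^sup>2)"
    by (simp add: BI_def nv_def)
  also have "(\<Sum>e\<in>interior_faces \<T>. ?f (kp e) e + ?f (km e) e) =
      FI (\<lambda>e x. ((x - x0) \<bullet> nv e) * ((norm (P (kp e) x))\<^sup>2 - (norm (P (km e) x))\<^sup>2))"
    unfolding FI_def
  proof (rule sum.cong[OF refl])
    fix e assume e: "e \<in> interior_faces \<T>"
    note D = interior_faceD[OF e]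
    have "?f (kp e) e + ?f (km e) e = (LINT x|surface_measure e. ((x - x0) \<bullet> nv e) * (norm (P (kp e) x))\<^sup>2 + ((x - x0) \<bullet> face_normal (km e) e) * (norm (P (km e) x))\<^sup>2)"
      unfolding nv_def
      by (rule Bochner_Integration.integral_add[symmetric])
         (use e in \<open>auto intro!: facet_integrable_cont continuous_intros affine_fun_continuous[OF P[OF D(1)]] affine_fun_continuous[OF P[OF D(2)]]\<close>)
    then show "?f (kp e) e + ?f (km e) e = (LINT x|surface_measure e. ((x - x0) \<bullet> nv e) * ((norm (P (kp e) x))\<^sup>2 - (norm (P (km e) x))\<^sup>2))"
      unfolding D(7) by (simp add: algebra_simps)
  qed
  finally show ?thesis .
qed

text \<open>An element has at most four facets and is counted once for each of them.\<close>

lemma sum_faces_le: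
  fixes f :: "(real^'n) set \<Rightarrow> real"
  assumes "\<And>K. K \<in> \<T> \<Longrightarrow> f K \<ge> 0"
  shows "(\<Sum>e\<in>interior_faces \<T>. f (kp e) + f (km e)) \<le> 4 * (\<Sum>K\<in>\<T>. f K)"
proof -
  have "(\<Sum>e\<in>boundary_faces \<Omega> \<T>. f (kp e)) \<ge> 0" using boundary_faceD assms by (intro sum_nonneg) auto
  then have "(\<Sum>e\<in>interior_faces \<T>. f (kp e) + f (km e)) \<le> (\<Sum>K\<in>\<T>. \<Sum>a\<in>V K. f K)"
    using sum_faces[of "\<lambda>K e. f K"] by simp
  also have "\<dots> \<le> (\<Sum>K\<in>\<T>. 4 * f K)"
  proof (rule sum_mono)
    fix K assume K: "K \<in> \<T>"
    interpret simplex23 "V K" using element K by blast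
    have "card (V K) \<le> 4" using card_C card23 by auto
    then show "(\<Sum>a\<in>V K. f K) \<le> 4 * f K" using assms[OF K] by (simp add: mult_right_mono)
  qed
  finally show ?thesis by (simp add: sum_distrib_left)
qed

lemma pieces_uminus: "pieces v q \<Longrightarrow> pieces (\<lambda>x. - v x) (\<lambda>K x. - q K x)"
proof -
  assume q: "pieces v q"
  have "affine_fun (\<lambda>x. - q K x)" if "K \<in> \<T>" for K
    using affine_fun_diff[OF affine_fun_const[of 0] pieces_affine[OF q that]] by simp
  then show ?thesis using pieces_eq[OF q] by (simp add: pieces_def)
qed

text \<open>\<open>X\<close> disappears from the right-hand sides because it is tested with
  \<open>grad_h v\<close> and with its negative. As \<open>v\<close> and \<open>w\<close> have the
  same piecewise gradient, the volume term is a square and the \<open>\<delta>\<close> term is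
  \<open>\<i>\<close> times a nonnegative number, absent from the real part. For
  \<open>q = p\<close> the two products of average and jump are conjugate to each other, so they
  drop out of the imaginary part.\<close>

lemma
  assumes p: "pieces w p" and s: "pieces X s" and q: "pieces v q"
    and gq: "\<And>K. K \<in> \<T> \<Longrightarrow> gradc (q K) = gradc (p K)"
  defines "G \<equiv> \<lambda>K x. gradc (p K)"
  shows Re_A_h_grad: "Re (A_h \<Omega> \<T> k \<beta> \<delta> w X v (\<lambda>x. - grad_h v x)) =
      EI (\<lambda>K x. (norm (G K x))\<^sup>2) - k\<^sup>2 * EI (\<lambda>K x. p K x \<bullet> q K x) - k * BI (\<lambda>e x. Im (p (kp e) x * cnj (q (kp e) x)))
      - FI (\<lambda>e x. cdot (av G e x) (nv e) \<bullet> jp q e x) - \<beta> * FI (\<lambda>e x. Im (jp p e x * cnj (jp q e x)))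
      - FI (\<lambda>e x. cdot (av G e x) (nv e) \<bullet> jp p e x)"
    and Im_A_h_grad: "q = p \<Longrightarrow> Im (A_h \<Omega> \<T> k \<beta> \<delta> w X v (\<lambda>x. - grad_h v x)) =
      k * BI (\<lambda>e x. (norm (p (kp e) x))\<^sup>2) + \<beta> * FI (\<lambda>e x. (norm (jp p e x))\<^sup>2) + \<delta> * FI (\<lambda>e x. (norm (cdot (jp G e x) (nv e)))\<^sup>2)"
proof -
  have gp: "pieces (grad_h w) G" unfolding G_def by (rule pieces_grad[OF p])
  have "pieces (grad_h v) G" using pieces_grad[OF q] gq by (simp add: pieces_def G_def)
  then have t: "pieces (\<lambda>x. - grad_h v x) (\<lambda>K x. - G K x)" by (rule pieces_uminus)
  have Fmr: "FI (\<lambda>K x. - \<phi> K x) = - FI \<phi>" for \<phi> :: "(real^'n) set \<Rightarrow> real^'n \<Rightarrow> real"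
    by (simp add: FI_def sum_negf)
  have n2: "(norm z)\<^sup>2 = Re z * Re z + Im z * Im z" for z :: complex
    unfolding cmod_power2 by (simp add: power2_eq_square)
  have hm: "hip a (- b) = - hip a b" for a b :: "complex^'n" by (simp add: hip_def sum_negf)
  have cm: "cdot (- a) n = - cdot a n" for a :: "complex^'n" and n by (simp add: cdot_def sum_negf)
  have Em: "EI (\<lambda>K x. - \<phi> K x) = - EI \<phi>" for \<phi> :: "(real^'n) set \<Rightarrow> real^'n \<Rightarrow> complex"
    by (simp add: EI_def sum_negf)
  have Fm: "FI (\<lambda>K x. - \<phi> K x) = - FI \<phi>" for \<phi> :: "(real^'n) set \<Rightarrow> real^'n \<Rightarrow> complex"
    by (simp add: FI_def sum_negf)
  have jm: "jp (\<lambda>K x. - G K x) e x = - jp G e x" "av (\<lambda>K x. - G K x) e x = - av G e x" for e x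
    by (simp_all add: jp_def av_def scaleR_add_right scaleR_diff_right)
  have e1: "EI (\<lambda>K x. hip (s K x) (gradc (q K))) = EI (\<lambda>K x. hip (s K x) (G K x))"
    unfolding EI_def by (intro sum.cong refl) (simp add: gq G_def)
  have A: "A_h \<Omega> \<T> k \<beta> \<delta> w X v (\<lambda>x. - grad_h v x) =
     EI (\<lambda>K x. hip (G K x) (G K x)) - of_real (k\<^sup>2) * EI (\<lambda>K x. p K x * cnj (q K x))
     + \<i> * of_real k * BI (\<lambda>e x. p (kp e) x * cnj (q (kp e) x))
     - FI (\<lambda>e x. (cdot (av G e x) (nv e) - \<i> * of_real \<beta> * jp p e x) * cnj (jp q e x))
     + \<i> * of_real \<delta> * FI (\<lambda>e x. cdot (jp G e x) (nv e) * cnj (cdot (jp G e x) (nv e)))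
     - FI (\<lambda>e x. jp p e x * cnj (cdot (av G e x) (nv e)))"
    using A_h_eq[OF p s q t, of k \<beta> \<delta>, folded G_def]
    unfolding hm jm cm complex_cnj_minus mult_minus_right Em Fm e1 by (simp add: G_def)
  have cE: "continuous_on UNIV (p K)" "continuous_on UNIV (q K)" if "K \<in> \<T>" for K
    using pieces_continuous p q that by blast+
  note cF = continuous_av[OF gp] continuous_jp[OF p] continuous_jp[OF q] continuous_jp[OF gp]
  have cGK: "continuous_on S (G K)" for S K unfolding G_def by (rule continuous_on_const)
  note RI = EI_linear[OF bounded_linear_Re] EI_linear[OF bounded_linear_Im] BI_linear[OF bounded_linear_Re] BI_linear[OF bounded_linear_Im]
     FI_linear[OF bounded_linear_Re] FI_linear[OF bounded_linear_Im]
  have r1: "Re (EI (\<lambda>K x. hip (G K x) (G K x))) = EI (\<lambda>K x. (norm (G K x))\<^sup>2)" "Im (EI (\<lambda>K x. hip (G K x) (G K x))) = 0"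
    by (subst RI; (intro continuous_intros cGK)?; simp add: Re_hip Im_hip_self power2_norm_eq_inner EI_def)+
  have r2: "Re (EI (\<lambda>K x. p K x * cnj (q K x))) = EI (\<lambda>K x. p K x \<bullet> q K x)"
    by (subst RI; (intro continuous_intros cE)?; simp only: Re_mult_cnj)
  have r3: "Im (BI (\<lambda>e x. p (kp e) x * cnj (q (kp e) x))) = BI (\<lambda>e x. Im (p (kp e) x * cnj (q (kp e) x)))"
    by (subst RI; (intro continuous_intros cE boundary_faceD)?; simp)
  have r4: "Im (FI (\<lambda>e x. cdot (jp G e x) (nv e) * cnj (cdot (jp G e x) (nv e)))) = 0"
     "Re (FI (\<lambda>e x. cdot (jp G e x) (nv e) * cnj (cdot (jp G e x) (nv e)))) = FI (\<lambda>e x. (norm (cdot (jp G e x) (nv e)))\<^sup>2)"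
    by (subst RI; (intro continuous_intros cF)?; simp add: FI_def n2)+
  have r5: "Re (FI (\<lambda>e x. jp p e x * cnj (cdot (av G e x) (nv e)))) = FI (\<lambda>e x. cdot (av G e x) (nv e) \<bullet> jp p e x)"
    by (subst RI; (intro continuous_intros cF)?; simp only: Re_mult_cnj inner_commute)
  have r6: "Re (FI (\<lambda>e x. (cdot (av G e x) (nv e) - \<i> * of_real \<beta> * jp p e x) * cnj (jp q e x))) =
      FI (\<lambda>e x. cdot (av G e x) (nv e) \<bullet> jp q e x) + \<beta> * FI (\<lambda>e x. Im (jp p e x * cnj (jp q e x)))"
  proof -
    have "Re (FI (\<lambda>e x. (cdot (av G e x) (nv e) - \<i> * of_real \<beta> * jp p e x) * cnj (jp q e x))) =
       FI (\<lambda>e x. Re ((cdot (av G e x) (nv e) - \<i> * of_real \<beta> * jp p e x) * cnj (jp q e x)))"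
      by (rule RI) (intro continuous_intros cF)
    also have "\<dots> = FI (\<lambda>e x. cdot (av G e x) (nv e) \<bullet> jp q e x + \<beta> * Im (jp p e x * cnj (jp q e x)))"
      by (simp add: inner_complex_def algebra_simps)
    also have "\<dots> = FI (\<lambda>e x. cdot (av G e x) (nv e) \<bullet> jp q e x) + FI (\<lambda>e x. \<beta> * Im (jp p e x * cnj (jp q e x)))"
      by (rule FI_add) (intro continuous_intros cF; assumption)+
    finally show ?thesis by (simp add: FI_def sum_distrib_left)
  qed
  show "Re (A_h \<Omega> \<T> k \<beta> \<delta> w X v (\<lambda>x. - grad_h v x)) =
      EI (\<lambda>K x. (norm (G K x))\<^sup>2) - k\<^sup>2 * EI (\<lambda>K x. p K x \<bullet> q K x) - k * BI (\<lambda>e x. Im (p (kp e) x * cnj (q (kp e) x)))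
      - FI (\<lambda>e x. cdot (av G e x) (nv e) \<bullet> jp q e x) - \<beta> * FI (\<lambda>e x. Im (jp p e x * cnj (jp q e x)))
      - FI (\<lambda>e x. cdot (av G e x) (nv e) \<bullet> jp p e x)"
    unfolding A by (simp add: r1 r2 r3 r4 r5 r6 del: of_real_power)
  assume qp: "q = p"
  have i2: "Im (EI (\<lambda>K x. p K x * cnj (p K x))) = 0"
    by (subst RI; (intro continuous_intros cE)?; simp add: EI_def)
  have i3: "Re (BI (\<lambda>e x. p (kp e) x * cnj (p (kp e) x))) = BI (\<lambda>e x. (norm (p (kp e) x))\<^sup>2)"
    by (subst RI; (intro continuous_intros cE boundary_faceD)?; simp add: n2)
  have i6: "Im (FI (\<lambda>e x. (cdot (av G e x) (nv e) - \<i> * of_real \<beta> * jp p e x) * cnj (jp p e x))) =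
      - Im (FI (\<lambda>e x. jp p e x * cnj (cdot (av G e x) (nv e)))) - \<beta> * FI (\<lambda>e x. (norm (jp p e x))\<^sup>2)"
  proof -
    have "Im (FI (\<lambda>e x. (cdot (av G e x) (nv e) - \<i> * of_real \<beta> * jp p e x) * cnj (jp p e x))) =
       FI (\<lambda>e x. Im ((cdot (av G e x) (nv e) - \<i> * of_real \<beta> * jp p e x) * cnj (jp p e x)))"
      by (rule RI) (intro continuous_intros cF)
    also have "\<dots> = FI (\<lambda>e x. - Im (jp p e x * cnj (cdot (av G e x) (nv e))) + - \<beta> * (norm (jp p e x))\<^sup>2)"
      by (simp add: n2 algebra_simps)
    also have "\<dots> = FI (\<lambda>e x. - Im (jp p e x * cnj (cdot (av G e x) (nv e)))) + FI (\<lambda>e x. - \<beta> * (norm (jp p e x))\<^sup>2)"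
      by (rule FI_add) (intro continuous_intros cF; assumption)+
    also have "FI (\<lambda>e x. - Im (jp p e x * cnj (cdot (av G e x) (nv e)))) = - FI (\<lambda>e x. Im (jp p e x * cnj (cdot (av G e x) (nv e))))"
      by (rule Fmr)
    also have "FI (\<lambda>e x. Im (jp p e x * cnj (cdot (av G e x) (nv e)))) = Im (FI (\<lambda>e x. jp p e x * cnj (cdot (av G e x) (nv e))))"
      by (rule RI[symmetric]) (intro continuous_intros cF)
    finally show ?thesis by (simp add: FI_def sum_distrib_left sum_negf)
  qed
  show "Im (A_h \<Omega> \<T> k \<beta> \<delta> w X v (\<lambda>x. - grad_h v x)) =
      k * BI (\<lambda>e x. (norm (p (kp e) x))\<^sup>2) + \<beta> * FI (\<lambda>e x. (norm (jp p e x))\<^sup>2) + \<delta> * FI (\<lambda>e x. (norm (cdot (jp G e x) (nv e)))\<^sup>2)"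
    unfolding A qp by (simp add: r1 i2 i3 r4 i6 del: of_real_power)
qed

end

text \<open>The gradient of a barycentric coordinate has the reciprocal of the height over the opposite facet as its norm.\<close>

locale regular_mesh = simplicial_mesh \<Omega> \<T> for \<Omega> :: "(real^'n) set" and \<T> +
  fixes \<kappa> :: real
  assumes \<kappa>: "\<And>K a. K \<in> \<T> \<Longrightarrow> a \<in> V K \<Longrightarrow> norm (simplex_vertices.gr (V K) a) * diameter K \<le> \<kappa>"
    and \<kappa>_pos: "\<kappa> > 0"
begin

lemma diameter_pos: "bounded S \<Longrightarrow> x \<in> S \<Longrightarrow> y \<in> S \<Longrightarrow> x \<noteq> y \<Longrightarrow> diameter S > 0"
  using diameter_bounded_bound[of S x y] by (metis dist_pos_lt less_le_trans)

lemma facet_diameter: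
  assumes K: "K \<in> \<T>" "e facet_of K"
  shows "0 < diameter e" and "diameter e \<le> diameter K"
proof -
  interpret simplex23 "V K" using element K by blast
  obtain a where a: "a \<in> V K" "e = convex hull (V K - {a})" using facet_vertex[OF K] .
  obtain p where p: "p \<in> V K" "p \<noteq> a" using other_vertex[OF a(1)] by blast
  have "card (V K - {a}) \<ge> 2" using card_C card23 a by auto
  have "V K - {a} \<noteq> {p}"
  proof
    assume "V K - {a} = {p}"
    then have "card (V K - {a}) = 1" by simp
    then show False using \<open>card (V K - {a}) \<ge> 2\<close> by simp
  qed
  then obtain q where q: "q \<in> V K" "q \<noteq> a" "q \<noteq> p" using p by blast
  have eK: "e \<subseteq> K" using facet_of_imp_subset[OF K(2)] .
  have bK: "bounded K" using compact_element[OF K(1)] by (rule compact_imp_bounded)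
  show "0 < diameter e"
    by (rule diameter_pos[of e p q]) (use p q a eK bK bounded_subset in \<open>auto simp: hull_inc\<close>)
  show "diameter e \<le> diameter K" using eK bK by (rule diameter_subset)
qed

text \<open>The length \<open>r\<close> is left free below the diameter: it is the face diameter in
  the Rellich step, and for the flux also a length common to the whole mesh.\<close>

lemma trace_face:
  fixes P :: "real^'n \<Rightarrow> 'b::euclidean_space"
  assumes K: "K \<in> \<T>" "e facet_of K" and P: "affine_fun P" and r: "0 < r" "r \<le> diameter K"
  shows "(LINT x|surface_measure e. (norm (P x))\<^sup>2) \<le> 20 * \<kappa> / r * (LINT x|lebesgue_on K. (norm (P x))\<^sup>2)"
proof -
  interpret simplex23 "V K" using element K by blast
  obtain a where a: "a \<in> V K" "e = convex hull (V K - {a})" using facet_vertex[OF K] .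
  have "norm (gr a) * r \<le> norm (gr a) * diameter K" using r by (intro mult_left_mono) auto
  then have "norm (gr a) * r \<le> \<kappa>" using \<kappa>[OF K(1) a(1)] by linarith
  then have g: "norm (gr a) \<le> \<kappa> / r" using r by (simp add: pos_le_divide_eq)
  have "(LINT x|surface_measure e. (norm (P x))\<^sup>2) \<le> 20 * norm (gr a) * (LINT x|lebesgue_on K. (norm (P x))\<^sup>2)"
    using trace_inequality[OF a(1) P] a(2) element(2)[OF K(1)] by simp
  also have "\<dots> \<le> 20 * (\<kappa> / r) * (LINT x|lebesgue_on K. (norm (P x))\<^sup>2)"
    using g by (intro mult_right_mono Bochner_Integration.integral_nonneg) auto
  finally show ?thesis by simp
qed

text \<open>The jump is the difference of two affine functions on the whole space, so it may be
  viewed as an affine function on the one element \<open>kp e\<close>, where the inverse inequality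
  applies.\<close>

lemma inverse_face:
  assumes p: "pieces v p" and e: "e \<in> interior_faces \<T>"
  shows "(LINT x|surface_measure e. (norm (tang (nv e) (jp (\<lambda>K x. gradc (p K)) e x)))\<^sup>2)
     \<le> 36 * \<kappa>\<^sup>2 / (diameter e)\<^sup>2 * (LINT x|surface_measure e. (norm (jp p e x))\<^sup>2)"
proof -
  note D = interior_faceD[OF e]
  interpret simplex23 "V (kp e)" using element D by blast
  obtain a where a: "a \<in> V (kp e)" "e = convex hull (V (kp e) - {a})" using facet_vertex[OF D(1,4)] .
  note h = facet_diameter[OF D(1,4)]
  have n: "nv e = nrm a" using face_normal_eq[OF a(1)] a(2) element(2)[OF D(1)] by (simp add: nv_def)
  have B: "norm (gr j) \<le> \<kappa> / diameter e" if "j \<in> V (kp e)" for j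
  proof -
    have "norm (gr j) * diameter e \<le> norm (gr j) * diameter (kp e)" using h by (intro mult_left_mono) auto
    then have "norm (gr j) * diameter e \<le> \<kappa>" using \<kappa>[OF D(1) that] by linarith
    then show ?thesis using h by (simp add: pos_le_divide_eq)
  qed
  have aff: "affine_fun (\<lambda>x. p (kp e) x - p (km e) x)"
    by (intro affine_fun_diff pieces_affine[OF p] D)
  show ?thesis
    using inverse_inequality[OF a(1) aff B, folded a(2)]
    unfolding gradc_diff n jp_def by (simp add: power_divide)
qed

text \<open>The quantities with \<open>\<beta>\<close> and the square root are among the nonnegative
  summands of \<open>\<gamma>\<^sub>1\<close>. The quantity \<open>1 / diameter e\<close> is not,
  but 1/h <= 1 + 1/h^2.\<close>

lemma \<gamma>\<^sub>1_ge:
  assumes "k > 0" "\<beta> > 0" "\<delta> > 0"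
  shows "1 \<le> \<gamma>\<^sub>1 \<T> k \<beta> \<delta>" "k \<le> \<gamma>\<^sub>1 \<T> k \<beta> \<delta>"
    and "e \<in> interior_faces \<T> \<Longrightarrow> k\<^sup>2 / (\<beta> * diameter e) \<le> \<gamma>\<^sub>1 \<T> k \<beta> \<delta> \<and> 1 / (\<beta> * diameter e) \<le> \<gamma>\<^sub>1 \<T> k \<beta> \<delta> \<and>
       1 / diameter e \<le> \<gamma>\<^sub>1 \<T> k \<beta> \<delta> \<and> 1 / (\<beta> * diameter e ^ 3) \<le> \<gamma>\<^sub>1 \<T> k \<beta> \<delta> \<and> sqrt (\<beta> / \<delta>) \<le> \<gamma>\<^sub>1 \<T> k \<beta> \<delta>"
proof -
  let ?f = "\<lambda>e. (k\<^sup>2 + 1) / (\<beta> * diameter e) + 1 / (diameter e)\<^sup>2 + 1 / (\<beta> * (diameter e)^3)"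
  let ?M = "Max (insert 0 (?f ` interior_faces \<T>))"
  have fin: "finite (insert 0 (?f ` interior_faces \<T>))" using finite_interior_faces by simp
  have M0: "0 \<le> ?M" using fin by (intro Max_ge) auto
  have sq: "sqrt (\<beta> / \<delta>) \<ge> 0" using assms by simp
  have g: "\<gamma>\<^sub>1 \<T> k \<beta> \<delta> = 1 + k + sqrt (\<beta> / \<delta>) + ?M" by (simp add: \<gamma>\<^sub>1_def)
  show "1 \<le> \<gamma>\<^sub>1 \<T> k \<beta> \<delta>" "k \<le> \<gamma>\<^sub>1 \<T> k \<beta> \<delta>" using g M0 sq assms by linarith+
  assume e: "e \<in> interior_faces \<T>"
  let ?h = "diameter e"
  have h: "?h > 0" using facet_diameter interior_faceD[OF e] by blast
  have le: "?f e \<le> ?M" using fin e by (intro Max_ge) auto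
  have sp: "?f e = k\<^sup>2 / (\<beta> * ?h) + 1 / (\<beta> * ?h) + 1 / ?h\<^sup>2 + 1 / (\<beta> * ?h ^ 3)" by (simp add: add_divide_distrib)
  have pos: "k\<^sup>2 / (\<beta> * ?h) \<ge> 0" "1 / (\<beta> * ?h) \<ge> 0" "1 / ?h\<^sup>2 \<ge> 0" "1 / (\<beta> * ?h ^ 3) \<ge> 0" using assms h by auto
  have "1 / ?h \<le> 1 + 1 / ?h\<^sup>2"
  proof -
    have "(1 / ?h - 1)\<^sup>2 = 1 / ?h\<^sup>2 - 2 * (1 / ?h) + 1" by (simp add: power2_diff power_divide)
    moreover have "(1 / ?h - 1)\<^sup>2 \<ge> 0" "1 / ?h \<ge> 0" using h by auto
    ultimately show ?thesis by linarith
  qed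
  then show "k\<^sup>2 / (\<beta> * ?h) \<le> \<gamma>\<^sub>1 \<T> k \<beta> \<delta> \<and> 1 / (\<beta> * ?h) \<le> \<gamma>\<^sub>1 \<T> k \<beta> \<delta> \<and>
       1 / ?h \<le> \<gamma>\<^sub>1 \<T> k \<beta> \<delta> \<and> 1 / (\<beta> * ?h ^ 3) \<le> \<gamma>\<^sub>1 \<T> k \<beta> \<delta> \<and> sqrt (\<beta> / \<delta>) \<le> \<gamma>\<^sub>1 \<T> k \<beta> \<delta>"
    using g le sp pos sq assms by (intro conjI) linarith+
qed

text \<open>With this weight in Young's inequality the face terms cost a quarter of the element terms in the
  Rellich identity and a half of them in the flux estimate.\<close>

definition \<eta> :: real where "\<eta> = 1 / (320 * \<kappa>)"

lemma \<eta>_pos: "\<eta> > 0" using \<kappa>_pos by (simp add: \<eta>_def)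

text \<open>In this order, the coefficients in \<open>face_coefficient\<close> of k^2/(beta h), of
  1/(beta h), of \<open>sq\<close> and 1/h together, of 1/(beta h^3), and of the 1/h that stems from
  the inverse inequality.\<close>

definition C1 :: "real \<Rightarrow> real" where
  "C1 R = R\<^sup>2 / (2 * \<eta>) + (real CARD('n))\<^sup>2 / \<eta> + 2 * R + 144 * R\<^sup>2 * \<kappa>\<^sup>2 / \<eta> + 36 * \<kappa>\<^sup>2 * R"

text \<open>The complete coefficient of the squared jump once \<open>inverse_face\<close> has
  replaced the tangential gradient jump. With \<open>\<beta>\<close> factored out, only quantities
  bounded by \<open>\<gamma>\<^sub>1\<close> are left.\<close>

lemma face_coefficient:
  fixes g h sq :: real
  assumes R: "R \<ge> 0" and h: "h > 0" and \<beta>: "\<beta> > 0"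
    and g: "k\<^sup>2 / (\<beta> * h) \<le> g" "1 / (\<beta> * h) \<le> g" "1 / h \<le> g" "1 / (\<beta> * h ^ 3) \<le> g" "sq \<le> g"
  shows "(k\<^sup>2 * R\<^sup>2 / (2 * \<eta> * h) + (real CARD('n))\<^sup>2 / (\<eta> * h) + R * sq * \<beta> + \<beta> * R / h)
     + (4 * R\<^sup>2 / (\<eta> * h) + \<beta> * R * h) * (36 * \<kappa>\<^sup>2 / h\<^sup>2) \<le> C1 R * g * \<beta>"
proof -
  have "k\<^sup>2 * R\<^sup>2 / (2 * \<eta> * h) + (real CARD('n))\<^sup>2 / (\<eta> * h) + R * sq * \<beta> + \<beta> * R / h
     + (4 * R\<^sup>2 / (\<eta> * h) + \<beta> * R * h) * (36 * \<kappa>\<^sup>2 / h\<^sup>2) =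
     \<beta> * (R\<^sup>2 / (2 * \<eta>) * (k\<^sup>2 / (\<beta> * h)) + (real CARD('n))\<^sup>2 / \<eta> * (1 / (\<beta> * h)) + R * sq + R * (1 / h)
       + 144 * R\<^sup>2 * \<kappa>\<^sup>2 / \<eta> * (1 / (\<beta> * h ^ 3)) + 36 * \<kappa>\<^sup>2 * R * (1 / h))"
    using h \<beta> \<eta>_pos by (simp add: field_simps power2_eq_square power3_eq_cube)
  also have "\<dots> \<le> \<beta> * (R\<^sup>2 / (2 * \<eta>) * g + (real CARD('n))\<^sup>2 / \<eta> * g + R * g + R * g
       + 144 * R\<^sup>2 * \<kappa>\<^sup>2 / \<eta> * g + 36 * \<kappa>\<^sup>2 * R * g)"
    using R \<beta> \<eta>_pos g by (intro mult_left_mono add_mono) auto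
  also have "\<dots> = C1 R * g * \<beta>" unfolding C1_def by (simp add: algebra_simps)
  finally show ?thesis .
qed

text \<open>Integrate \<open>face_pointwise\<close> over each face. The trace inequality on both
  neighbours cancels the weight \<open>diameter e\<close>, so element terms appear with the factor
  \<open>20 * \<kappa> * \<eta>\<close> per face.\<close>

lemma face_sum_le:
  assumes p: "pieces w p" and k: "k > 0" and \<beta>: "\<beta> > 0" and \<delta>: "\<delta> > 0"
    and R: "\<And>x. x \<in> closure \<Omega> \<Longrightarrow> norm (x - x0) \<le> R" and R0: "R \<ge> 0"
  defines "G \<equiv> \<lambda>K x. gradc (p K)" and "d \<equiv> real CARD('n)"
  shows "FI (\<lambda>e x. k\<^sup>2 * (((x - x0) \<bullet> nv e) * ((norm (p (kp e) x))\<^sup>2 - (norm (p (km e) x))\<^sup>2)) + 2 * d * (cdot (av G e x) (nv e) \<bullet> jp p e x)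
       + 2 * \<beta> * Im (jp p e x * cnj (cdot (jp G e x) (x - x0)))
       + (2 * (cdot (av G e x) (nv e) \<bullet> cdot (jp G e x) (x - x0)) - ((x - x0) \<bullet> nv e) * ((norm (G (kp e) x))\<^sup>2 - (norm (G (km e) x))\<^sup>2)))
    \<le> (k\<^sup>2 * EI (\<lambda>K x. (norm (p K x))\<^sup>2) + EI (\<lambda>K x. (norm (G K x))\<^sup>2)) / 4
      + C1 R * \<gamma>\<^sub>1 \<T> k \<beta> \<delta> * (\<beta> * FI (\<lambda>e x. (norm (jp p e x))\<^sup>2) + \<delta> * FI (\<lambda>e x. (norm (cdot (jp G e x) (nv e)))\<^sup>2))"
    (is "FI ?I \<le> _")
proof -
  have gp: "pieces (grad_h w) G" unfolding G_def by (rule pieces_grad[OF p])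
  define Sp where "Sp K = (LINT x|lebesgue_on K. (norm (p K x))\<^sup>2)" for K
  define SG where "SG K = (LINT x|lebesgue_on K. (norm (G K x))\<^sup>2)" for K
  define JJ where "JJ e = (LINT x|surface_measure e. (norm (jp p e x))\<^sup>2)" for e
  define NN where "NN e = (LINT x|surface_measure e. (norm (cdot (jp G e x) (nv e)))\<^sup>2)" for e
  let ?g = "\<gamma>\<^sub>1 \<T> k \<beta> \<delta>"
  have nonneg: "Sp K \<ge> 0" "SG K \<ge> 0" "JJ K \<ge> 0" "NN K \<ge> 0" for K
    unfolding Sp_def SG_def JJ_def NN_def by (auto intro: Bochner_Integration.integral_nonneg)
  have face: "(LINT x|surface_measure e. ?I e x) \<le> 20 * \<kappa> * \<eta> * (k\<^sup>2 * (Sp (kp e) + Sp (km e)) + (SG (kp e) + SG (km e)))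
      + C1 R * ?g * (\<beta> * JJ e + \<delta> * NN e)" if e: "e \<in> interior_faces \<T>" for e
  proof -
    note D = interior_faceD[OF e]
    let ?h = "diameter e"
    note hk = facet_diameter[OF D(1,4)] and hm = facet_diameter[OF D(2,5)]
    have h: "?h > 0" using hk by simp
    let ?T = "\<lambda>x. tang (nv e) (jp G e x)"
    let ?a = "\<eta> * ?h * k\<^sup>2" and ?b = "\<eta> * ?h"
      and ?c = "k\<^sup>2 * R\<^sup>2 / (2 * \<eta> * ?h) + d\<^sup>2 / (\<eta> * ?h) + R * sqrt (\<beta> / \<delta>) * \<beta> + \<beta> * R / ?h"
      and ?d = "R * sqrt (\<beta> / \<delta>) * \<delta>" and ?f = "4 * R\<^sup>2 / (\<eta> * ?h) + \<beta> * R * ?h"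
    let ?B = "\<lambda>x. ?a * (norm (p (kp e) x))\<^sup>2 + (?a * (norm (p (km e) x))\<^sup>2 + (?b * (norm (G (kp e) x))\<^sup>2 + (?b * (norm (G (km e) x))\<^sup>2
         + (?c * (norm (jp p e x))\<^sup>2 + (?d * (norm (cdot (jp G e x) (nv e)))\<^sup>2 + ?f * (norm (?T x))\<^sup>2)))))"
    note cont = continuous_av[OF gp e] continuous_jp[OF p e] continuous_jp[OF gp e] pieces_continuous[OF p D(1)] pieces_continuous[OF p D(2)]
      pieces_continuous[OF gp D(1)] pieces_continuous[OF gp D(2)]
    have cT: "continuous_on UNIV ?T"
    proof -
      have "?T = (\<lambda>x. tang (nv e) (gradc (p (kp e)) - gradc (p (km e))))" by (simp add: G_def jp_def)
      then show ?thesis by (simp only: continuous_on_const)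
    qed
    have cI: "continuous_on UNIV (?I e)" by (intro continuous_intros cont)
    have cB: "continuous_on UNIV ?B" by (intro continuous_intros cont cT)
    have fi: "integrable (surface_measure e) \<phi>" if "continuous_on UNIV \<phi>" for \<phi> :: "real^'n \<Rightarrow> real"
      using facet_integrable_cont[of e \<phi>] e that by blast
    have "(LINT x|surface_measure e. ?I e x) \<le> (LINT x|surface_measure e. ?B x)"
    proof (rule facet_integral_mono[OF D(1,4) cI cB])
      fix x assume x: "x \<in> rel_interior e"
      have "x \<in> closure \<Omega>" using interior_face_mem[OF e x] element_subset_closure[OF D(1)] by blast
      then have v: "norm (x - x0) \<le> R" by (rule R)
      have n1: "norm (nv e) = 1" unfolding nv_def by (rule facet_normal(1)[OF D(1,4)])
      have d0: "0 \<le> d" by (simp add: d_def)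
      show "?I e x \<le> ?B x"
        using face_pointwise[OF n1 v h \<eta>_pos \<beta> \<delta> d0, of k "p (kp e) x" "p (km e) x" "G (kp e) x" "G (km e) x"]
        unfolding jp_def av_def by (simp add: distrib_left mult.assoc)
    qed
    also have "\<dots> = ?a * (LINT x|surface_measure e. (norm (p (kp e) x))\<^sup>2) + (?a * (LINT x|surface_measure e. (norm (p (km e) x))\<^sup>2)
        + (?b * (LINT x|surface_measure e. (norm (G (kp e) x))\<^sup>2) + (?b * (LINT x|surface_measure e. (norm (G (km e) x))\<^sup>2)
        + (?c * JJ e + (?d * NN e + ?f * (LINT x|surface_measure e. (norm (?T x))\<^sup>2))))))"
      unfolding JJ_def NN_def
      by (subst Bochner_Integration.integral_add; (rule fi, intro continuous_intros cont cT)?; simp only: integral_mult_right_zero)+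
    also have "\<dots> \<le> ?a * (20 * \<kappa> / ?h * Sp (kp e)) + (?a * (20 * \<kappa> / ?h * Sp (km e))
        + (?b * (20 * \<kappa> / ?h * SG (kp e)) + (?b * (20 * \<kappa> / ?h * SG (km e))
        + (?c * JJ e + (?d * NN e + ?f * (36 * \<kappa>\<^sup>2 / ?h\<^sup>2 * JJ e))))))"
      unfolding Sp_def SG_def JJ_def
      using h \<eta>_pos R0 \<beta> hk hm D inverse_face[OF p e, folded G_def]
        trace_face[OF D(1,4) pieces_affine[OF p D(1)] hk] trace_face[OF D(2,5) pieces_affine[OF p D(2)] hm]
        trace_face[OF D(1,4) pieces_affine[OF gp D(1)] hk] trace_face[OF D(2,5) pieces_affine[OF gp D(2)] hm]
      by (intro add_mono mult_left_mono order_refl) auto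
    also have "\<dots> = 20 * \<kappa> * \<eta> * (k\<^sup>2 * (Sp (kp e) + Sp (km e)) + (SG (kp e) + SG (km e))) + (?c + ?f * (36 * \<kappa>\<^sup>2 / ?h\<^sup>2)) * JJ e + ?d * NN e"
    proof -
      have e: "?a * (20 * \<kappa> / ?h * S) = 20 * \<kappa> * \<eta> * (k\<^sup>2 * S)" "?b * (20 * \<kappa> / ?h * S) = 20 * \<kappa> * \<eta> * S" for S
        using h by (simp_all add: field_simps)
      have alg: "A * (L * s1) + (A * (L * s2) + (A * s3 + (A * s4 + (c * j + (d' * N + f * (X * j)))))) =
          A * (L * (s1 + s2) + (s3 + s4)) + (c + f * X) * j + d' * N" for A L s1 s2 s3 s4 c j d' N f X :: real
        by (simp add: algebra_simps)
      show ?thesis unfolding e by (rule alg)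
    qed
    also have "\<dots> \<le> 20 * \<kappa> * \<eta> * (k\<^sup>2 * (Sp (kp e) + Sp (km e)) + (SG (kp e) + SG (km e))) + C1 R * ?g * \<beta> * JJ e + C1 R * ?g * \<delta> * NN e"
    proof -
      note ge = \<gamma>\<^sub>1_ge(3)[OF k \<beta> \<delta> e]
      have c1: "?c + ?f * (36 * \<kappa>\<^sup>2 / ?h\<^sup>2) \<le> C1 R * ?g * \<beta>"
        unfolding d_def using ge by (intro face_coefficient[OF R0 h \<beta>]) auto
      \<comment> \<open>The summand \<open>2 * R\<close> of \<open>C1\<close> suffices; the
        remaining ones are nonnegative.\<close>
      have "R \<le> C1 R" unfolding C1_def using R0 \<eta>_pos by (simp add: add_increasing add_increasing2)
      then have c2: "?d \<le> C1 R * ?g * \<delta>"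
        using ge \<delta> \<beta> R0 by (intro mult_right_mono mult_mono) auto
      show ?thesis by (intro add_mono order_refl mult_right_mono[OF c1] mult_right_mono[OF c2] nonneg)
    qed
    finally show ?thesis by (simp add: algebra_simps)
  qed
  have "FI ?I \<le> (\<Sum>e\<in>interior_faces \<T>. 20 * \<kappa> * \<eta> * (k\<^sup>2 * (Sp (kp e) + Sp (km e)) + (SG (kp e) + SG (km e))) + C1 R * ?g * (\<beta> * JJ e + \<delta> * NN e))"
    unfolding FI_def by (rule sum_mono) (rule face)
  also have "\<dots> = 20 * \<kappa> * \<eta> * (k\<^sup>2 * (\<Sum>e\<in>interior_faces \<T>. Sp (kp e) + Sp (km e)) + (\<Sum>e\<in>interior_faces \<T>. SG (kp e) + SG (km e)))
      + C1 R * ?g * (\<beta> * (\<Sum>e\<in>interior_faces \<T>. JJ e) + \<delta> * (\<Sum>e\<in>interior_faces \<T>. NN e))"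
    by (simp only: sum.distrib sum_distrib_left[symmetric])
  also have "\<dots> \<le> 20 * \<kappa> * \<eta> * (k\<^sup>2 * (4 * (\<Sum>K\<in>\<T>. Sp K)) + 4 * (\<Sum>K\<in>\<T>. SG K))
      + C1 R * ?g * (\<beta> * (\<Sum>e\<in>interior_faces \<T>. JJ e) + \<delta> * (\<Sum>e\<in>interior_faces \<T>. NN e))"
    using \<kappa>_pos \<eta>_pos by (intro add_mono mult_left_mono sum_faces_le nonneg order_refl) auto
  \<comment> \<open>Four facets per element give \<open>80 * \<kappa> * \<eta>\<close>, which is 1/4
    by the choice of \<open>\<eta>\<close>.\<close>
  also have "20 * \<kappa> * \<eta> * (k\<^sup>2 * (4 * (\<Sum>K\<in>\<T>. Sp K)) + 4 * (\<Sum>K\<in>\<T>. SG K)) = (k\<^sup>2 * (\<Sum>K\<in>\<T>. Sp K) + (\<Sum>K\<in>\<T>. SG K)) / 4"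
    using \<kappa>_pos by (simp add: \<eta>_def field_simps)
  finally show ?thesis unfolding Sp_def SG_def JJ_def NN_def EI_def FI_def .
qed

end

section \<open>Stability\<close>

text \<open>If \<open>N\<close> exceeded \<open>(C + 1) * t\<close>, then
  \<open>C * t \<le> N\<close>, so the right-hand side would be at most
  \<open>(C + 1) * t * N\<close>, which is below the square of \<open>N\<close>.\<close>

lemma quadratic_bound:
  fixes N t C :: real
  assumes "N\<^sup>2 \<le> C * (t\<^sup>2 + t * N)" "C \<ge> 0" "t \<ge> 0" "N \<ge> 0"
  shows "N \<le> (C + 1) * t"
proof (rule ccontr)
  assume "\<not> N \<le> (C + 1) * t"
  then have gt: "(C + 1) * t < N" by simp
  then have N: "N > 0" using assms by (meson add_nonneg_nonneg le_less_trans mult_nonneg_nonneg zero_le_one)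
  have "N\<^sup>2 \<le> C * t\<^sup>2 + C * (t * N)" using assms(1) by (simp add: distrib_left)
  also have "C * t\<^sup>2 = (C * t) * t" by (simp add: power2_eq_square)
  also have "(C * t) * t \<le> N * t" using gt assms by (intro mult_right_mono) (auto simp: algebra_simps)
  also have "N * t + C * (t * N) = ((C + 1) * t) * N" by (simp add: algebra_simps)
  also have "\<dots> < N * N" using gt N by (intro mult_strict_right_mono)
  finally show False by (simp add: power2_eq_square)
qed

context simplicial_mesh
begin

lemma BI_add: "(\<And>e. e \<in> boundary_faces \<Omega> \<T> \<Longrightarrow> continuous_on UNIV (\<phi> e)) \<Longrightarrow> (\<And>e. e \<in> boundary_faces \<Omega> \<T> \<Longrightarrow> continuous_on UNIV (\<psi> e)) \<Longrightarrow>
    BI (\<lambda>e x. \<phi> e x + \<psi> e x) = BI \<phi> + BI \<psi>"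
  by (simp add: BI_def Bochner_Integration.integral_add facet_integrable_cont sum.distrib)

lemma
  fixes c :: real
  shows EI_mult: "EI (\<lambda>K x. c * \<phi> K x) = c * EI \<phi>"
    and BI_mult: "BI (\<lambda>K x. c * \<phi> K x) = c * BI \<phi>"
    and FI_mult: "FI (\<lambda>K x. c * \<phi> K x) = c * FI \<phi>"
  by (simp_all add: EI_def BI_def FI_def sum_distrib_left)

lemma FI_cong: "(\<And>e x. e \<in> interior_faces \<T> \<Longrightarrow> \<phi> e x = \<psi> e x) \<Longrightarrow> FI \<phi> = FI \<psi>"
  unfolding FI_def by (intro sum.cong refl Bochner_Integration.integral_cong)

text \<open>Twice the real part tested with \<open>v\<close> plus d - 1 times the one tested with
  \<open>u\<close>. With these weights, after inserting the two divergence identities, the volume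
  terms combine to \<open>k\<^sup>2\<close> times the squared norm of \<open>u\<close> plus that of
  its gradient, each with coefficient 1.\<close>

lemma Rellich_identity:
  fixes x0 :: "real^'n"
  assumes sol: "LDG_solution \<Omega> \<T> k \<beta> \<delta> f g u \<sigma>" and p: "pieces u p"
  defines "G \<equiv> \<lambda>K x. gradc (p K)" and "d \<equiv> real CARD('n)" and "v \<equiv> \<lambda>x. cdot (grad_h u x) (x - x0)"
    and "q \<equiv> \<lambda>K x. p K x - p K x0"
  defines "F \<equiv> \<lambda>v. ip (lebesgue_on \<Omega>) f v + ip_\<Gamma> \<Omega> \<T> g (bdry_trace \<Omega> v)"
  shows "pieces v q"
    and "k\<^sup>2 * EI (\<lambda>K x. (norm (p K x))\<^sup>2) + EI (\<lambda>K x. (norm (G K x))\<^sup>2) + BI (\<lambda>e x. ((x - x0) \<bullet> nv e) * (norm (G (kp e) x))\<^sup>2) =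
      2 * Re (F v) + (d - 1) * Re (F u) + k\<^sup>2 * BI (\<lambda>e x. ((x - x0) \<bullet> nv e) * (norm (p (kp e) x))\<^sup>2)
      + 2 * k * BI (\<lambda>e x. Im (p (kp e) x * cnj (q (kp e) x)))
      + FI (\<lambda>e x. k\<^sup>2 * (((x - x0) \<bullet> nv e) * ((norm (p (kp e) x))\<^sup>2 - (norm (p (km e) x))\<^sup>2)) + 2 * d * (cdot (av G e x) (nv e) \<bullet> jp p e x)
       + 2 * \<beta> * Im (jp p e x * cnj (cdot (jp G e x) (x - x0)))
       + (2 * (cdot (av G e x) (nv e) \<bullet> cdot (jp G e x) (x - x0)) - ((x - x0) \<bullet> nv e) * ((norm (G (kp e) x))\<^sup>2 - (norm (G (km e) x))\<^sup>2)))"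
    and "Im (F u) = k * BI (\<lambda>e x. (norm (p (kp e) x))\<^sup>2) + \<beta> * FI (\<lambda>e x. (norm (jp p e x))\<^sup>2) + \<delta> * FI (\<lambda>e x. (norm (cdot (jp G e x) (nv e)))\<^sup>2)"
proof -
  have gp: "pieces (grad_h u) G" unfolding G_def by (rule pieces_grad[OF p])
  obtain s where s: "pieces \<sigma> s" using sol \<Sigma>_h_pieces unfolding LDG_solution_def by blast
  \<comment> \<open>On each element \<open>v\<close> is the affine piece of \<open>u\<close> minus
    its value extrapolated to \<open>x0\<close>, hence again affine with an unchanged
    gradient.\<close>
  have qG: "q K x = cdot (gradc (p K)) (x - x0)" if "K \<in> \<T>" for K x
    using affine_fun_gradc[OF pieces_affine[OF p that], of x x0] by (simp add: q_def)
  show q: "pieces v q" unfolding pieces_def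
  proof (intro ballI conjI)
    fix K assume K: "K \<in> \<T>"
    show "affine_fun (q K)" unfolding q_def by (intro affine_fun_diff affine_fun_const pieces_affine[OF p K])
    fix x assume "x \<in> interior K"
    then have "grad_h u x = gradc (p K)" using pieces_eq[OF gp K] by (simp add: G_def)
    then show "v x = q K x" unfolding v_def qG[OF K] by simp
  qed
  have gq: "gradc (q K) = gradc (p K)" for K by (simp add: q_def gradc_def)
  have "pieces (\<lambda>x. - grad_h w x) (\<lambda>K x. - gradc (r K))" if "pieces w r" for w r
    by (rule pieces_uminus[OF pieces_grad[OF that]])
  then have "A_h \<Omega> \<T> k \<beta> \<delta> u \<sigma> w (\<lambda>x. - grad_h w x) = F w" if "pieces w r" for w r
    using sol that V_h_pieces \<Sigma>_h_pieces unfolding LDG_solution_def F_def by blast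
  note A = this[OF p] this[OF q]
  let ?Y = "EI (\<lambda>K x. (norm (G K x))\<^sup>2)" and ?U = "EI (\<lambda>K x. (norm (p K x))\<^sup>2)"
  let ?c = "\<lambda>e x. cdot (av G e x) (nv e)"
  let ?FJ = "FI (\<lambda>e x. ?c e x \<bullet> jp p e x)"
  have E1: "Re (F u) = ?Y - k\<^sup>2 * ?U - 2 * ?FJ"
    using Re_A_h_grad[OF p s p refl, of k \<beta> \<delta>, folded G_def] unfolding A
    by (simp add: BI_def FI_def power2_norm_eq_inner mult.commute) (simp add: G_def)
  show "Im (F u) = k * BI (\<lambda>e x. (norm (p (kp e) x))\<^sup>2) + \<beta> * FI (\<lambda>e x. (norm (jp p e x))\<^sup>2) + \<delta> * FI (\<lambda>e x. (norm (cdot (jp G e x) (nv e)))\<^sup>2)"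
    using Im_A_h_grad[OF p s p refl refl, of k \<beta> \<delta>, folded G_def] unfolding A .
  have jq: "jp q e x = cdot (jp G e x) (x - x0)" if "e \<in> interior_faces \<T>" for e x
    using interior_faceD(1,2)[OF that] by (simp add: jp_def qG G_def cdot_diff_left)
  let ?Fq = "FI (\<lambda>e x. ?c e x \<bullet> cdot (jp G e x) (x - x0))" and ?Fm = "FI (\<lambda>e x. Im (jp p e x * cnj (cdot (jp G e x) (x - x0))))"
  let ?B = "BI (\<lambda>e x. Im (p (kp e) x * cnj (q (kp e) x)))"
  have E2: "Re (F v) = ?Y - k\<^sup>2 * EI (\<lambda>K x. p K x \<bullet> q K x) - k * ?B - ?Fq - \<beta> * ?Fm - ?FJ"
  proof -
    have "FI (\<lambda>e x. ?c e x \<bullet> jp q e x) = ?Fq" "FI (\<lambda>e x. Im (jp p e x * cnj (jp q e x))) = ?Fm"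
      by (rule FI_cong, simp only: jq)+
    then show ?thesis using Re_A_h_grad[OF p s q gq, of k \<beta> \<delta>, folded G_def] unfolding A by simp (simp add: G_def)
  qed
  let ?B1 = "BI (\<lambda>e x. ((x - x0) \<bullet> nv e) * (norm (p (kp e) x))\<^sup>2)" and ?B2 = "BI (\<lambda>e x. ((x - x0) \<bullet> nv e) * (norm (G (kp e) x))\<^sup>2)"
  let ?F1 = "FI (\<lambda>e x. ((x - x0) \<bullet> nv e) * ((norm (p (kp e) x))\<^sup>2 - (norm (p (km e) x))\<^sup>2))"
    and ?F2 = "FI (\<lambda>e x. ((x - x0) \<bullet> nv e) * ((norm (G (kp e) x))\<^sup>2 - (norm (G (km e) x))\<^sup>2))"
  have cE: "continuous_on UNIV (p K)" "continuous_on UNIV (q K)" "continuous_on UNIV (G K)" if "K \<in> \<T>" for K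
    using pieces_continuous p q gp that by blast+
  have D1: "d * ?U + 2 * EI (\<lambda>K x. p K x \<bullet> q K x) = ?B1 + ?F1"
  proof -
    have "EI (\<lambda>K x. d * (norm (p K x))\<^sup>2 + 2 * (p K x \<bullet> q K x)) = EI (\<lambda>K x. d * (norm (p K x))\<^sup>2) + EI (\<lambda>K x. 2 * (p K x \<bullet> q K x))"
      by (intro EI_add continuous_intros cE)
    then show ?thesis
      using mesh_divergence[of p x0, OF pieces_affine[OF p]] unfolding EI_mult by (simp add: q_def d_def)
  qed
  have D2: "d * ?Y = ?B2 + ?F2"
  proof -
    have "EI (\<lambda>K x. d * (norm (G K x))\<^sup>2 + 2 * (G K x \<bullet> (G K x - G K x0))) = d * ?Y"
      unfolding EI_mult[symmetric] by (simp add: G_def)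
    then show ?thesis using mesh_divergence[of G x0, OF pieces_affine[OF gp]] by (simp add: d_def)
  qed
  note cF = continuous_av[OF gp] continuous_jp[OF p] continuous_jp[OF gp] cE interior_faceD(1) interior_faceD(2)
  let ?a1 = "\<lambda>e x. k\<^sup>2 * (((x - x0) \<bullet> nv e) * ((norm (p (kp e) x))\<^sup>2 - (norm (p (km e) x))\<^sup>2))"
    and ?a2 = "\<lambda>e x. 2 * d * (?c e x \<bullet> jp p e x)" and ?a3 = "\<lambda>e x. 2 * \<beta> * Im (jp p e x * cnj (cdot (jp G e x) (x - x0)))"
    and ?a4 = "\<lambda>e x. 2 * (?c e x \<bullet> cdot (jp G e x) (x - x0))"
    and ?a5 = "\<lambda>e x. (-1) * (((x - x0) \<bullet> nv e) * ((norm (G (kp e) x))\<^sup>2 - (norm (G (km e) x))\<^sup>2))"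
  have "FI (\<lambda>e x. ?a1 e x + ?a2 e x + ?a3 e x + (?a4 e x + ?a5 e x)) = FI (\<lambda>e x. ?a1 e x + ?a2 e x + ?a3 e x) + FI (\<lambda>e x. ?a4 e x + ?a5 e x)"
    by (rule FI_add) (intro continuous_intros cF; assumption)+
  also have "FI (\<lambda>e x. ?a4 e x + ?a5 e x) = FI ?a4 + FI ?a5"
    by (rule FI_add) (intro continuous_intros cF; assumption)+
  also have "FI (\<lambda>e x. ?a1 e x + ?a2 e x + ?a3 e x) = FI (\<lambda>e x. ?a1 e x + ?a2 e x) + FI ?a3"
    by (rule FI_add) (intro continuous_intros cF; assumption)+
  also have "FI (\<lambda>e x. ?a1 e x + ?a2 e x) = FI ?a1 + FI ?a2"
    by (rule FI_add) (intro continuous_intros cF; assumption)+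
  finally have I: "FI (\<lambda>e x. ?a1 e x + ?a2 e x + ?a3 e x + (?a4 e x + ?a5 e x)) = k\<^sup>2 * ?F1 + 2 * d * ?FJ + 2 * \<beta> * ?Fm + (2 * ?Fq + (-1) * ?F2)"
    unfolding FI_mult .
  \<comment> \<open>\<open>D1\<close> eliminates the mixed product of \<open>u\<close> and
    \<open>v\<close>; \<open>D2\<close> trades d times the squared gradient norm for boundary and
    face terms. The rest is linear in \<open>E1\<close> and \<open>E2\<close>.\<close>
  have "k\<^sup>2 * (d * ?U + 2 * EI (\<lambda>K x. p K x \<bullet> q K x)) = k\<^sup>2 * (?B1 + ?F1)" unfolding D1 ..
  moreover have "(d - 1) * Re (F u) = (d - 1) * (?Y - k\<^sup>2 * ?U - 2 * ?FJ)" unfolding E1 ..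
  ultimately have "k\<^sup>2 * ?U + ?Y + ?B2 = 2 * Re (F v) + (d - 1) * Re (F u) + k\<^sup>2 * ?B1 + 2 * k * ?B + (k\<^sup>2 * ?F1 + 2 * d * ?FJ + 2 * \<beta> * ?Fm + (2 * ?Fq + (-1) * ?F2))"
    using E2 D2 by (simp add: algebra_simps)
  then show "k\<^sup>2 * ?U + ?Y + ?B2 = 2 * Re (F v) + (d - 1) * Re (F u) + k\<^sup>2 * ?B1 + 2 * k * ?B +
      FI (\<lambda>e x. ?a1 e x + ?a2 e x + ?a3 e x + (?a4 e x - ((x - x0) \<bullet> nv e) * ((norm (G (kp e) x))\<^sup>2 - (norm (G (km e) x))\<^sup>2)))"
    unfolding I[symmetric] by simp
qed

lemma functional_le:
  assumes q: "pieces v q" and f: "square_integrable (lebesgue_on \<Omega>) f" and g: "square_integrable_\<Gamma> \<Omega> \<T> g"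
  shows "norm (ip (lebesgue_on \<Omega>) f v + ip_\<Gamma> \<Omega> \<T> g (bdry_trace \<Omega> v)) \<le>
     l2_norm (lebesgue_on \<Omega>) f * sqrt (EI (\<lambda>K x. (norm (q K x))\<^sup>2)) + l2_norm_\<Gamma> \<Omega> \<T> g * sqrt (BI (\<lambda>e x. (norm (q (kp e) x))\<^sup>2))"
proof -
  have a: "sqrt (EI (\<lambda>K x. (norm (q K x))\<^sup>2)) = l2_norm (lebesgue_on \<Omega>) v"
    unfolding l2_norm_domain[OF q, symmetric] using l2_norm_nonneg[of "lebesgue_on \<Omega>" v] by simp
  have "l2_norm_\<Gamma> \<Omega> \<T> (bdry_trace \<Omega> v) \<ge> 0" by (simp add: l2_norm_\<Gamma>_def sum_nonneg)
  then have b: "sqrt (BI (\<lambda>e x. (norm (q (kp e) x))\<^sup>2)) = l2_norm_\<Gamma> \<Omega> \<T> (bdry_trace \<Omega> v)"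
    unfolding l2_norm_boundary[OF q, symmetric] by simp
  have "norm (ip (lebesgue_on \<Omega>) f v) \<le> l2_norm (lebesgue_on \<Omega>) f * l2_norm (lebesgue_on \<Omega>) v"
    using f integrable_domain[OF q] by (intro ip_le) (auto simp: square_integrable_def)
  moreover have "norm (ip_\<Gamma> \<Omega> \<T> g (bdry_trace \<Omega> v)) \<le> l2_norm_\<Gamma> \<Omega> \<T> g * l2_norm_\<Gamma> \<Omega> \<T> (bdry_trace \<Omega> v)"
    using g integrable_boundary[OF q] by (intro ip_\<Gamma>_le) (auto simp: square_integrable_\<Gamma>_def square_integrable_def)
  ultimately show ?thesis unfolding a b by (intro order_trans[OF norm_triangle_ineq add_mono])
qed

text \<open>With the test pair \<open>(0, \<sigma>)\<close> the data disappear; the real part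
  expresses the squared norm of the flux by gradient and jumps.\<close>

lemma flux_identity:
  assumes sol: "LDG_solution \<Omega> \<T> k \<beta> \<delta> f g u \<sigma>" and p: "pieces u p" and s: "pieces \<sigma> s"
    and f: "square_integrable (lebesgue_on \<Omega>) f" and g: "square_integrable_\<Gamma> \<Omega> \<T> g"
  defines "G \<equiv> \<lambda>K x. gradc (p K)"
  shows "EI (\<lambda>K x. (norm (s K x))\<^sup>2) = EI (\<lambda>K x. G K x \<bullet> s K x)
    + FI (\<lambda>e x. - (\<delta> * Im (cdot (jp G e x) (nv e) * cnj (cdot (jp s e x) (nv e)))) - jp p e x \<bullet> cdot (av s e x) (nv e))"
proof -
  have z: "pieces (\<lambda>x. 0) (\<lambda>K x. 0 :: complex)" by (simp add: pieces_def affine_fun_const)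
  have gz: "gradc (\<lambda>x. 0) = 0" by (simp add: gradc_def vec_eq_iff)
  have gp: "pieces (grad_h u) G" unfolding G_def by (rule pieces_grad[OF p])
  have "A_h \<Omega> \<T> k \<beta> \<delta> u \<sigma> (\<lambda>x. 0) \<sigma> = ip (lebesgue_on \<Omega>) f (\<lambda>x. 0) + ip_\<Gamma> \<Omega> \<T> g (bdry_trace \<Omega> (\<lambda>x. 0))"
    using sol V_h_pieces z unfolding LDG_solution_def by blast
  \<comment> \<open>The data functional at 0 is seen to vanish through its norm bound, which uses
    the zero pieces in place of the limits in \<open>bdry_trace\<close>.\<close>
  moreover have "norm (ip (lebesgue_on \<Omega>) f (\<lambda>x. 0) + ip_\<Gamma> \<Omega> \<T> g (bdry_trace \<Omega> (\<lambda>x. 0))) \<le> 0"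
    using functional_le[OF z f g] by (simp add: EI_def BI_def)
  ultimately have A: "A_h \<Omega> \<T> k \<beta> \<delta> u \<sigma> (\<lambda>x. 0) \<sigma> = 0" by simp
  note cont = continuous_av[OF gp] continuous_jp[OF p] continuous_jp[OF gp] continuous_av[OF s] continuous_jp[OF s]
    pieces_continuous[OF p] pieces_continuous[OF s] pieces_continuous[OF gp]
  let ?f = "\<lambda>e x. cdot (jp G e x) (nv e) * cnj (cdot (jp s e x) (nv e))" and ?j = "\<lambda>e x. jp p e x * cnj (cdot (av s e x) (nv e))"
  have E: "- (\<i> * of_real \<delta> * FI ?f - FI ?j) + EI (\<lambda>K x. hip (s K x) (s K x)) - EI (\<lambda>K x. hip (G K x) (s K x)) = 0"
    using A_h_eq[OF p s z s, of k \<beta> \<delta>, folded G_def] A unfolding gz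
    by (simp add: hip_def EI_def BI_def FI_def jp_def G_def)
  have re: "Re (- (\<i> * of_real \<delta> * a - b) + c - d) = \<delta> * Im a + Re b + Re c - Re d" for a b c d by simp
  have cF: "continuous_on UNIV (?f e)" "continuous_on UNIV (?j e)" if "e \<in> interior_faces \<T>" for e
    by (intro continuous_intros cont that)+
  have cE: "continuous_on UNIV (\<lambda>x. hip (s K x) (s K x))" "continuous_on UNIV (\<lambda>x. hip (G K x) (s K x))" if "K \<in> \<T>" for K
    by (intro continuous_intros cont that)+
  have F1: "Im (FI ?f) = FI (\<lambda>e x. Im (?f e x))" by (rule FI_linear[OF bounded_linear_Im cF(1)])
  have F2: "Re (FI ?j) = FI (\<lambda>e x. jp p e x \<bullet> cdot (av s e x) (nv e))"
    by (rule FI_linear[OF bounded_linear_Re cF(2), unfolded Re_mult_cnj])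
  have E1: "Re (EI (\<lambda>K x. hip (s K x) (s K x))) = EI (\<lambda>K x. (norm (s K x))\<^sup>2)"
    using EI_linear[OF bounded_linear_Re cE(1)] unfolding Re_hip power2_norm_eq_inner .
  have E2: "Re (EI (\<lambda>K x. hip (G K x) (s K x))) = EI (\<lambda>K x. G K x \<bullet> s K x)"
    using EI_linear[OF bounded_linear_Re cE(2)] unfolding Re_hip .
  have "FI (\<lambda>e x. (- \<delta>) * Im (?f e x) + (- 1) * (jp p e x \<bullet> cdot (av s e x) (nv e))) =
      FI (\<lambda>e x. (- \<delta>) * Im (?f e x)) + FI (\<lambda>e x. (- 1) * (jp p e x \<bullet> cdot (av s e x) (nv e)))"
    by (rule FI_add) (intro continuous_intros cont; assumption)+
  then have "FI (\<lambda>e x. - (\<delta> * Im (?f e x)) - jp p e x \<bullet> cdot (av s e x) (nv e)) =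
      - \<delta> * FI (\<lambda>e x. Im (?f e x)) - FI (\<lambda>e x. jp p e x \<bullet> cdot (av s e x) (nv e))"
    unfolding FI_mult by simp
  then show ?thesis using arg_cong[OF E, of Re] unfolding re F1 F2 E1 E2 by simp
qed

end

section \<open>Absorption in the Rellich identity and the flux bound\<close>

context regular_mesh
begin

text \<open>The first summand collects the data terms, the second the coefficients of
  \<open>\<gamma>\<^sub>1 \<T> k \<beta> \<delta> * norm F\<close>, each multiplied by the factor 4
  of the absorption. The 3 consists of 2 from the test with \<open>u\<close> and 1 from the boundary
  norm.\<close>

definition C2 :: "real \<Rightarrow> real \<Rightarrow> real" where
  "C2 R c = 16 * R\<^sup>2 * (1 + 1 / c) + 4 * (3 + R + 2 * R\<^sup>2 / c + C1 R)"

lemma C1_nonneg: "R \<ge> 0 \<Longrightarrow> C1 R \<ge> 0"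
  unfolding C1_def using \<eta>_pos by simp

text \<open>The Rellich identity yields all parts of the norm except the boundary norm of
  \<open>u\<close>, which comes from the imaginary part of the test with \<open>u\<close> at the
  price of a factor \<open>k\<close>. The other conclusions are recorded for the flux.\<close>

lemma DG_estimate:
  assumes sol: "LDG_solution \<Omega> \<T> k \<beta> \<delta> f g u \<sigma>" and k: "k > 0" and \<beta>: "\<beta> > 0" and \<delta>: "\<delta> > 0"
    and f: "square_integrable (lebesgue_on \<Omega>) f" and g: "square_integrable_\<Gamma> \<Omega> \<T> g"
    and star: "strictly_star_shaped \<Omega> x0 c" and R: "\<And>x. x \<in> closure \<Omega> \<Longrightarrow> norm (x - x0) \<le> R" and R0: "R \<ge> 0"
    and p: "pieces u p"
  defines "G \<equiv> \<lambda>K x. gradc (p K)"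
  defines "N \<equiv> DG_norm \<Omega> c \<T> k u" and "M \<equiv> data_norm \<Omega> \<T> f g" and "F \<equiv> ip (lebesgue_on \<Omega>) f u + ip_\<Gamma> \<Omega> \<T> g (bdry_trace \<Omega> u)"
  shows "N \<le> (C2 R c + 1) * (\<gamma>\<^sub>1 \<T> k \<beta> \<delta> * (1 / k) * M)"
    and "norm F \<le> M / k * N"
    and "EI (\<lambda>K x. (norm (G K x))\<^sup>2) \<le> N\<^sup>2"
    and "\<beta> * FI (\<lambda>e x. (norm (jp p e x))\<^sup>2) \<le> norm F"
    and "\<delta> * FI (\<lambda>e x. (norm (cdot (jp G e x) (nv e)))\<^sup>2) \<le> norm F"
    and "M \<ge> 0" and "N \<ge> 0"
proof -
  have c: "c > 0" using star by (simp add: strictly_star_shaped_def)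
  have gp: "pieces (grad_h u) G" unfolding G_def by (rule pieces_grad[OF p])
  define q where "q K x = p K x - p K x0" for K x
  define v where "v x = cdot (grad_h u x) (x - x0)" for x
  define U where "U = EI (\<lambda>K x. (norm (p K x))\<^sup>2)"
  define Y where "Y = EI (\<lambda>K x. (norm (G K x))\<^sup>2)"
  define Z where "Z = BI (\<lambda>e x. (norm (p (kp e) x))\<^sup>2)"
  define W where "W = BI (\<lambda>e x. (norm (G (kp e) x))\<^sup>2)"
  define JJ where "JJ = FI (\<lambda>e x. (norm (jp p e x))\<^sup>2)"
  define NN where "NN = FI (\<lambda>e x. (norm (cdot (jp G e x) (nv e)))\<^sup>2)"
  define a where "a = l2_norm (lebesgue_on \<Omega>) f"
  define b where "b = l2_norm_\<Gamma> \<Omega> \<T> g"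
  let ?g = "\<gamma>\<^sub>1 \<T> k \<beta> \<delta>"
  let ?Fv = "ip (lebesgue_on \<Omega>) f v + ip_\<Gamma> \<Omega> \<T> g (bdry_trace \<Omega> v)"
  have nn: "U \<ge> 0" "Y \<ge> 0" "Z \<ge> 0" "W \<ge> 0" "JJ \<ge> 0" "NN \<ge> 0"
    unfolding U_def Y_def Z_def W_def JJ_def NN_def by (auto intro!: EI_nonneg BI_nonneg FI_nonneg)
  have ab: "a \<ge> 0" "b \<ge> 0" "M = a + b"
    unfolding a_def b_def M_def data_norm_def by (auto simp: l2_norm_nonneg l2_norm_\<Gamma>_def sum_nonneg)
  then show "M \<ge> 0" by simp
  have N2: "N\<^sup>2 = k\<^sup>2 * U + k\<^sup>2 * Z + c * W + Y"
    unfolding N_def DG_norm_def using nn c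
    by (simp add: l2_norm_domain[OF p] l2_norm_boundary[OF p] l2_norm_boundary[OF gp] l2_norm_element[OF gp]
        U_def[symmetric] Y_def[symmetric] Z_def[symmetric] W_def[symmetric])
  show N0: "N \<ge> 0" unfolding N_def DG_norm_def using nn c
    by (simp add: l2_norm_domain[OF p] l2_norm_boundary[OF p] l2_norm_boundary[OF gp] l2_norm_element[OF gp]
        U_def[symmetric] Y_def[symmetric] Z_def[symmetric] W_def[symmetric])
  have pos4: "k\<^sup>2 * U \<ge> 0" "k\<^sup>2 * Z \<ge> 0" "c * W \<ge> 0" using nn c by auto
  show "EI (\<lambda>K x. (norm (G K x))\<^sup>2) \<le> N\<^sup>2" unfolding Y_def[symmetric] N2 using pos4 by linarith
  note rell = Rellich_identity(1,2)[where ?x0.0 = x0, OF sol p, folded G_def q_def v_def]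
  have q: "pieces v q" using rell(1) unfolding v_def q_def by simp
  have Im: "Im F = k * Z + \<beta> * JJ + \<delta> * NN"
    using Rellich_identity(3)[OF sol p, folded G_def] unfolding F_def Z_def JJ_def NN_def .
  have ImF: "Im F \<le> norm F" using abs_Im_le_cmod[of F] by linarith
  have pos3: "k * Z \<ge> 0" "\<beta> * JJ \<ge> 0" "\<delta> * NN \<ge> 0" using nn k \<beta> \<delta> by auto
  show JF: "\<beta> * FI (\<lambda>e x. (norm (jp p e x))\<^sup>2) \<le> norm F" "\<delta> * FI (\<lambda>e x. (norm (cdot (jp G e x) (nv e)))\<^sup>2) \<le> norm F"
    using Im ImF pos3 unfolding JJ_def NN_def by linarith+
  have bF: "norm F \<le> a * sqrt U + b * sqrt Z"
    unfolding F_def a_def b_def U_def Z_def by (rule functional_le[OF p f g])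
  have le1: "sqrt U \<le> N / k" "sqrt Z \<le> N / k"
  proof -
    have "(k * sqrt U)\<^sup>2 \<le> N\<^sup>2" "(k * sqrt Z)\<^sup>2 \<le> N\<^sup>2" using nn pos4 unfolding N2 by (simp_all add: power_mult_distrib)
    then have "k * sqrt U \<le> N" "k * sqrt Z \<le> N" using N0 by (auto intro: power2_le_imp_le)
    then show "sqrt U \<le> N / k" "sqrt Z \<le> N / k" using k by (simp_all add: pos_le_divide_eq mult.commute)
  qed
  have "a * sqrt U + b * sqrt Z \<le> a * (N / k) + b * (N / k)" using le1 ab by (intro add_mono mult_left_mono) auto
  also have "\<dots> = M / k * N" unfolding ab(3) by (simp add: algebra_simps add_divide_distrib)
  finally show FN: "norm F \<le> M / k * N" using bF by linarith
  have xe: "norm (x - x0) \<le> R" if "e \<in> boundary_faces \<Omega> \<T>" "x \<in> rel_interior e" for e x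
  proof -
    have "x \<in> kp e" using that rel_interior_subset facet_of_imp_subset[OF boundary_faceD(2)[OF that(1)]] by blast
    then show ?thesis using element_subset_closure[OF boundary_faceD(1)[OF that(1)]] R by blast
  qed
  have qle: "norm (q K x) \<le> norm (G K x) * R" if "K \<in> \<T>" "norm (x - x0) \<le> R" for K x
  proof -
    have "q K x = cdot (gradc (p K)) (x - x0)"
      using affine_fun_gradc[OF pieces_affine[OF p that(1)], of x x0] by (simp add: q_def)
    then have "norm (q K x) \<le> norm (G K x) * norm (x - x0)" using norm_cdot_le unfolding G_def by simp
    also have "\<dots> \<le> norm (G K x) * R" using that by (intro mult_left_mono) auto
    finally show ?thesis .
  qed
  have cE: "continuous_on UNIV (p K)" "continuous_on UNIV (q K)" "continuous_on UNIV (G K)" if "K \<in> \<T>" for K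
    using pieces_continuous p q gp that by blast+
  note cB = cE boundary_faceD(1)
  have EIq: "EI (\<lambda>K x. (norm (q K x))\<^sup>2) \<le> R\<^sup>2 * Y"
    unfolding Y_def EI_mult[symmetric]
  proof (rule EI_mono)
    fix K x assume K: "K \<in> \<T>" "x \<in> K"
    then have "norm (x - x0) \<le> R" using element_subset_closure R by blast
    then have "(norm (q K x))\<^sup>2 \<le> (norm (G K x) * R)\<^sup>2" using qle K by (intro power_mono) auto
    then show "(norm (q K x))\<^sup>2 \<le> R\<^sup>2 * (norm (G K x))\<^sup>2" by (simp add: power_mult_distrib mult.commute)
  qed (intro continuous_intros cE; assumption)+
  have BIq: "BI (\<lambda>e x. (norm (q (kp e) x))\<^sup>2) \<le> R\<^sup>2 * W"
    unfolding W_def BI_mult[symmetric]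
  proof (rule BI_mono)
    fix e x assume e: "e \<in> boundary_faces \<Omega> \<T>" "x \<in> rel_interior e"
    then have "(norm (q (kp e) x))\<^sup>2 \<le> (norm (G (kp e) x) * R)\<^sup>2"
      using qle xe boundary_faceD(1) by (intro power_mono) auto
    then show "(norm (q (kp e) x))\<^sup>2 \<le> R\<^sup>2 * (norm (G (kp e) x))\<^sup>2" by (simp add: power_mult_distrib mult.commute)
  qed (intro continuous_intros cB; assumption)+
  \<comment> \<open>The weights 1/2 and \<open>c / 2\<close> are chosen so that only a quarter of
    \<open>Y\<close> and of \<open>c * W\<close> has to be absorbed.\<close>
  have Fv: "2 * norm ?Fv \<le> Y / 4 + 4 * R\<^sup>2 * a\<^sup>2 + c * W / 4 + 4 * R\<^sup>2 * b\<^sup>2 / c"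
  proof -
    have s: "sqrt (EI (\<lambda>K x. (norm (q K x))\<^sup>2)) \<le> R * sqrt Y" "sqrt (BI (\<lambda>e x. (norm (q (kp e) x))\<^sup>2)) \<le> R * sqrt W"
      using real_sqrt_le_mono[OF EIq] real_sqrt_le_mono[OF BIq] R0 by (simp_all add: real_sqrt_mult)
    have "norm ?Fv \<le> a * sqrt (EI (\<lambda>K x. (norm (q K x))\<^sup>2)) + b * sqrt (BI (\<lambda>e x. (norm (q (kp e) x))\<^sup>2))"
      unfolding a_def b_def by (rule functional_le[OF q f g])
    also have "\<dots> \<le> a * (R * sqrt Y) + b * (R * sqrt W)" using s ab by (intro add_mono mult_left_mono) auto
    finally have "2 * norm ?Fv \<le> sqrt Y * (2 * R * a) + sqrt W * (2 * R * b)" by (simp add: algebra_simps)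
    also have "sqrt Y * (2 * R * a) \<le> (1 / 2) * (sqrt Y)\<^sup>2 / 2 + (2 * R * a)\<^sup>2 / (2 * (1 / 2))" by (rule Young) simp
    also have "\<dots> = Y / 4 + 4 * R\<^sup>2 * a\<^sup>2" using nn by (simp add: power_mult_distrib)
    also have "sqrt W * (2 * R * b) \<le> (c / 2) * (sqrt W)\<^sup>2 / 2 + (2 * R * b)\<^sup>2 / (2 * (c / 2))" using c by (intro Young) simp
    also have "\<dots> = c * W / 4 + 4 * R\<^sup>2 * b\<^sup>2 / c" using nn by (simp add: power_mult_distrib)
    finally show ?thesis by simp
  qed
  have B2: "c * W \<le> BI (\<lambda>e x. ((x - x0) \<bullet> nv e) * (norm (G (kp e) x))\<^sup>2)"
    unfolding W_def BI_mult[symmetric]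
  proof (rule BI_mono)
    fix e x assume e: "e \<in> boundary_faces \<Omega> \<T>" "x \<in> rel_interior e"
    have "c \<le> (x - x0) \<bullet> nv e" unfolding nv_def
      using star_shaped_normal[OF star boundary_faceD(1,2)[OF e(1)]] boundary_face_iff e rel_interior_subset by blast
    then show "c * (norm (G (kp e) x))\<^sup>2 \<le> (x - x0) \<bullet> nv e * (norm (G (kp e) x))\<^sup>2" by (intro mult_right_mono) auto
  qed (intro continuous_intros cB; assumption)+
  have B1: "BI (\<lambda>e x. ((x - x0) \<bullet> nv e) * (norm (p (kp e) x))\<^sup>2) \<le> R * Z"
    unfolding Z_def BI_mult[symmetric]
  proof (rule BI_mono)
    fix e x assume e: "e \<in> boundary_faces \<Omega> \<T>" "x \<in> rel_interior e"
    have "norm (nv e) = 1" unfolding nv_def using facet_normal(1) boundary_faceD e by blast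
    then have "(x - x0) \<bullet> nv e \<le> R" using norm_cauchy_schwarz[of "x - x0" "nv e"] xe[OF e] by simp
    then show "(x - x0) \<bullet> nv e * (norm (p (kp e) x))\<^sup>2 \<le> R * (norm (p (kp e) x))\<^sup>2" by (intro mult_right_mono) auto
  qed (intro continuous_intros cB; assumption)+
  have B3: "2 * k * BI (\<lambda>e x. Im (p (kp e) x * cnj (q (kp e) x))) \<le> c * W / 2 + 2 * R\<^sup>2 / c * (k\<^sup>2 * Z)"
  proof -
    have "BI (\<lambda>e x. 2 * k * Im (p (kp e) x * cnj (q (kp e) x))) \<le> BI (\<lambda>e x. (c / 2) * (norm (G (kp e) x))\<^sup>2 + (2 * R\<^sup>2 / c * k\<^sup>2) * (norm (p (kp e) x))\<^sup>2)"
    proof (rule BI_mono)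
      fix e x assume e: "e \<in> boundary_faces \<Omega> \<T>" "x \<in> rel_interior e"
      let ?p = "norm (p (kp e) x)" and ?G = "norm (G (kp e) x)"
      have "Im (p (kp e) x * cnj (q (kp e) x)) \<le> ?p * norm (q (kp e) x)"
        using abs_Im_le_cmod[of "p (kp e) x * cnj (q (kp e) x)"] by (simp add: norm_mult)
      also have "\<dots> \<le> ?p * (?G * R)" using qle xe[OF e] boundary_faceD(1)[OF e(1)] by (intro mult_left_mono) auto
      finally have "2 * k * Im (p (kp e) x * cnj (q (kp e) x)) \<le> 2 * k * (?p * (?G * R))" using k by (intro mult_left_mono) auto
      also have "\<dots> = ?G * (2 * R * k * ?p)" by simp
      also have "\<dots> \<le> c * ?G\<^sup>2 / 2 + (2 * R * k * ?p)\<^sup>2 / (2 * c)" using c by (rule Young)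
      also have "\<dots> = (c / 2) * ?G\<^sup>2 + (2 * R\<^sup>2 / c * k\<^sup>2) * ?p\<^sup>2" by (simp add: power_mult_distrib)
      finally show "2 * k * Im (p (kp e) x * cnj (q (kp e) x)) \<le> (c / 2) * ?G\<^sup>2 + (2 * R\<^sup>2 / c * k\<^sup>2) * ?p\<^sup>2" .
    qed (intro continuous_intros cB; assumption)+
    also have "\<dots> = BI (\<lambda>e x. (c / 2) * (norm (G (kp e) x))\<^sup>2) + BI (\<lambda>e x. (2 * R\<^sup>2 / c * k\<^sup>2) * (norm (p (kp e) x))\<^sup>2)"
      by (rule BI_add) (intro continuous_intros cB; assumption)+
    finally show ?thesis unfolding BI_mult W_def[symmetric] Z_def[symmetric] by simp
  qed
  note face = face_sum_le[OF p k \<beta> \<delta> R R0, folded G_def, folded U_def Y_def JJ_def NN_def]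
  note id = rell(2)[folded U_def Y_def F_def]
  have ge: "1 \<le> ?g" "k \<le> ?g" using \<gamma>\<^sub>1_ge(1,2)[OF k \<beta> \<delta>] by auto
  have dRe: "(real CARD('n) - 1) * Re F \<le> 2 * norm F"
  proof -
    have "(real CARD('n) - 1) * Re F \<le> (real CARD('n) - 1) * norm F" using complex_Re_le_cmod[of F] card23 by (intro mult_left_mono) auto
    also have "\<dots> \<le> 2 * norm F" using card23 by (intro mult_right_mono) auto
    finally show ?thesis .
  qed
  \<comment> \<open>The imaginary part offers only one power of \<open>k\<close>; the other is paid
    by \<open>k \<le> \<gamma>\<^sub>1\<close>.\<close>
  have k2Z: "k\<^sup>2 * Z \<le> ?g * norm F"
  proof -
    have "k\<^sup>2 * Z = k * (k * Z)" by (simp add: power2_eq_square)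
    also have "\<dots> \<le> ?g * norm F" using ge Im ImF pos3 k by (intro mult_mono) auto
    finally show ?thesis .
  qed
  have gF: "norm F \<le> ?g * norm F" using mult_right_mono[OF ge(1), of "norm F"] by simp
  \<comment> \<open>To be absorbed are \<open>Y / 4\<close> and \<open>c * W / 4\<close> from the
    data, \<open>c * W / 2\<close> from the boundary and a quarter of
    \<open>k\<^sup>2 * U + Y\<close> from the faces. This leaves 3/4, 1/2 and 1/4 of the three terms
    on the left, so a factor 4 recovers them.\<close>
  have I: "k\<^sup>2 * U + Y + c * W \<le> (Y / 4 + 4 * R\<^sup>2 * a\<^sup>2 + c * W / 4 + 4 * R\<^sup>2 * b\<^sup>2 / c) + 2 * norm F + k\<^sup>2 * (R * Z)
      + (c * W / 2 + 2 * R\<^sup>2 / c * (k\<^sup>2 * Z)) + ((k\<^sup>2 * U + Y) / 4 + C1 R * ?g * (\<beta> * JJ + \<delta> * NN))"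
  proof -
    have "2 * Re ?Fv \<le> 2 * norm ?Fv" using complex_Re_le_cmod[of ?Fv] by simp
    moreover have "k\<^sup>2 * BI (\<lambda>e x. ((x - x0) \<bullet> nv e) * (norm (p (kp e) x))\<^sup>2) \<le> k\<^sup>2 * (R * Z)" using B1 by (intro mult_left_mono) auto
    ultimately show ?thesis using id B2 B3 Fv dRe face unfolding v_def q_def U_def Y_def W_def G_def by linarith
  qed
  have alg2: "u + z + w + y \<le> 4 * (A + 2 * g + r1 + r2 + r3 + g)"
    if "3 / 4 * u + y / 2 + w / 4 \<le> A + 2 * n + r1 + r2 + r3" "z \<le> g" "n \<le> g" "u \<ge> 0" "y \<ge> 0" "z \<ge> 0"
    for u z w y A g n r1 r2 r3 :: real
    using that by (simp add: field_simps)
  have alg: "3 / 4 * u + y / 2 + w / 4 \<le> A + 2 * n + r1 + r2 + r3"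
    if "u + y + w \<le> (y / 4 + a1 + w / 4 + a2) + 2 * n + z1 + (w / 2 + z2) + ((u + y) / 4 + z3)"
      "z3 \<le> r3" "z1 \<le> r1" "z2 \<le> r2" "a1 + a2 \<le> A" for u y w A n r1 r2 r3 a1 a2 z1 z2 z3 :: real
    using that by (simp add: field_simps)
  have "C1 R * ?g * (\<beta> * JJ + \<delta> * NN) \<le> C1 R * ?g * norm F"
    using C1_nonneg[OF R0] ge Im ImF pos3 by (intro mult_left_mono) auto
  moreover have "k\<^sup>2 * (R * Z) \<le> R * (?g * norm F)" "2 * R\<^sup>2 / c * (k\<^sup>2 * Z) \<le> 2 * R\<^sup>2 / c * (?g * norm F)"
    using mult_left_mono[OF k2Z R0] mult_left_mono[OF k2Z, of "2 * R\<^sup>2 / c"] c by (simp_all add: mult_ac)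
  moreover have "4 * R\<^sup>2 * a\<^sup>2 + 4 * R\<^sup>2 * b\<^sup>2 / c \<le> 4 * R\<^sup>2 * (1 + 1 / c) * M\<^sup>2"
  proof -
    have "a\<^sup>2 \<le> M\<^sup>2" "b\<^sup>2 \<le> M\<^sup>2" using ab by (auto intro!: power_mono)
    then have "4 * R\<^sup>2 * a\<^sup>2 \<le> 4 * R\<^sup>2 * M\<^sup>2" "(4 * R\<^sup>2 / c) * b\<^sup>2 \<le> (4 * R\<^sup>2 / c) * M\<^sup>2"
      using c mult_left_mono[of _ _ "4 * R\<^sup>2"] mult_left_mono[of _ _ "4 * R\<^sup>2 / c"] by auto
    then show ?thesis by (simp add: algebra_simps)
  qed
  ultimately have "3 / 4 * (k\<^sup>2 * U) + Y / 2 + c * W / 4 \<le> 4 * R\<^sup>2 * (1 + 1 / c) * M\<^sup>2 + 2 * norm F + R * (?g * norm F) + 2 * R\<^sup>2 / c * (?g * norm F) + C1 R * ?g * norm F"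
    by (intro alg[OF I])
  then have "N\<^sup>2 \<le> 4 * (4 * R\<^sup>2 * (1 + 1 / c) * M\<^sup>2 + 2 * (?g * norm F) + R * (?g * norm F) + 2 * R\<^sup>2 / c * (?g * norm F) + C1 R * ?g * norm F + ?g * norm F)"
    unfolding N2 by (rule alg2[OF _ k2Z gF pos4(1) nn(2) pos4(2)])
  also have "\<dots> = 16 * R\<^sup>2 * (1 + 1 / c) * M\<^sup>2 + 4 * (3 + R + 2 * R\<^sup>2 / c + C1 R) * (?g * norm F)"
    by (simp add: algebra_simps)
  also have "\<dots> \<le> C2 R c * M\<^sup>2 + C2 R c * (?g * norm F)"
    unfolding C2_def using c R0 C1_nonneg[OF R0] ge by (intro add_mono mult_right_mono) auto
  finally have N2le: "N\<^sup>2 \<le> C2 R c * (M\<^sup>2 + ?g * norm F)" by (simp add: distrib_left)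
  have C20: "C2 R c \<ge> 0" unfolding C2_def using c R0 C1_nonneg[OF R0] by simp
  let ?t = "?g * (1 / k) * M"
  have "M\<^sup>2 \<le> ?t\<^sup>2"
  proof (rule power_mono)
    \<comment> \<open>The summand \<open>k\<close> of \<open>\<gamma>\<^sub>1\<close> makes the data
      norm itself at most \<open>?t\<close>, so both terms have the form required by
      \<open>quadratic_bound\<close>.\<close>
    have "1 \<le> ?g * (1 / k)" using ge k by simp
    then show "M \<le> ?t" using mult_right_mono[of 1 "?g * (1 / k)" M] \<open>M \<ge> 0\<close> by simp
  qed (use \<open>M \<ge> 0\<close> in simp)
  moreover have "?g * norm F \<le> ?t * N" using mult_left_mono[OF FN, of ?g] ge by (simp add: mult_ac)
  ultimately have "N\<^sup>2 \<le> C2 R c * (?t\<^sup>2 + ?t * N)" using N2le C20 by (meson add_mono mult_left_mono order_trans)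
  then show "N \<le> (C2 R c + 1) * ?t"
    using C20 N0 \<open>M \<ge> 0\<close> ge k by (intro quadratic_bound) auto
qed

text \<open>The two face terms need different Young weights. The jump of \<open>u\<close> is
  weighted with the face diameter, so that 1/(beta h) is left and goes into
  \<open>\<gamma>\<^sub>1\<close>. The gradient jump is weighted with the mesh-wide length
  \<open>1 / m\<close>, which leaves the factor \<open>\<delta> * m\<close>.\<close>

lemma flux_estimate:
  assumes sol: "LDG_solution \<Omega> \<T> k \<beta> \<delta> f g u \<sigma>" and k: "k > 0" and \<beta>: "\<beta> > 0" and \<delta>: "\<delta> > 0"
    and f: "square_integrable (lebesgue_on \<Omega>) f" and g: "square_integrable_\<Gamma> \<Omega> \<T> g"
    and p: "pieces u p" and s: "pieces \<sigma> s"
  defines "G \<equiv> \<lambda>K x. gradc (p K)" and "m \<equiv> Max ((\<lambda>K. 1 / diameter K) ` \<T>)"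
  shows "EI (\<lambda>K x. (norm (s K x))\<^sup>2) \<le> 4 * (EI (\<lambda>K x. (norm (G K x))\<^sup>2)
    + 160 * \<kappa> * (\<delta> * m * (\<delta> * FI (\<lambda>e x. (norm (cdot (jp G e x) (nv e)))\<^sup>2)) + \<gamma>\<^sub>1 \<T> k \<beta> \<delta> * (\<beta> * FI (\<lambda>e x. (norm (jp p e x))\<^sup>2))))"
proof -
  have gp: "pieces (grad_h u) G" unfolding G_def by (rule pieces_grad[OF p])
  define S where "S K = (LINT x|lebesgue_on K. (norm (s K x))\<^sup>2)" for K
  define JJ where "JJ e = (LINT x|surface_measure e. (norm (jp p e x))\<^sup>2)" for e
  define NN where "NN e = (LINT x|surface_measure e. (norm (cdot (jp G e x) (nv e)))\<^sup>2)" for e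
  let ?g = "\<gamma>\<^sub>1 \<T> k \<beta> \<delta>"
  let ?I = "\<lambda>e x. - (\<delta> * Im (cdot (jp G e x) (nv e) * cnj (cdot (jp s e x) (nv e)))) - jp p e x \<bullet> cdot (av s e x) (nv e)"
  have nonneg: "S K \<ge> 0" "JJ K \<ge> 0" "NN K \<ge> 0" for K
    unfolding S_def JJ_def NN_def by (auto intro: Bochner_Integration.integral_nonneg)
  note cE = pieces_continuous[OF s] pieces_continuous[OF gp]
  have face: "(LINT x|surface_measure e. ?I e x) \<le> 40 * \<kappa> * \<eta> * (S (kp e) + S (km e))
      + (160 * \<kappa> * (\<delta> * m * \<delta>) * NN e + 160 * \<kappa> * (?g * \<beta>) * JJ e)" if e: "e \<in> interior_faces \<T>" for e
  proof -
    note D = interior_faceD[OF e]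
    let ?h = "diameter e"
    note hk = facet_diameter[OF D(1,4)] and hm = facet_diameter[OF D(2,5)]
    have h: "?h > 0" using hk by simp
    have dm: "1 / diameter K \<le> m" if "K \<in> \<T>" for K
      unfolding m_def using that finite_\<T> by (intro Max_ge) auto
    have m: "m > 0" using dm[OF D(1)] hk by (meson le_less_trans less_le_trans not_le zero_less_divide_1_iff)
    \<comment> \<open>\<open>1 / m\<close> is at most every element diameter, so it is an admissible
      length in \<open>trace_face\<close> on both sides of the face.\<close>
    have r: "1 / m \<le> diameter (kp e)" "1 / m \<le> diameter (km e)" "0 < 1 / m"
      using dm[OF D(1)] dm[OF D(2)] hk hm m by (auto simp: field_simps)
    let ?a = "\<eta> / m + \<eta> * ?h" and ?b = "\<delta>\<^sup>2 * m / (2 * \<eta>)" and ?c = "1 / (2 * \<eta> * ?h)"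
    let ?B = "\<lambda>x. ?a * (norm (s (kp e) x))\<^sup>2 + (?a * (norm (s (km e) x))\<^sup>2
         + (?b * (norm (cdot (jp G e x) (nv e)))\<^sup>2 + ?c * (norm (jp p e x))\<^sup>2))"
    note cont = continuous_av[OF s e] continuous_jp[OF s e] continuous_jp[OF p e] continuous_jp[OF gp e]
      pieces_continuous[OF s D(1)] pieces_continuous[OF s D(2)]
    have cI: "continuous_on UNIV (?I e)" by (intro continuous_intros cont)
    have cB: "continuous_on UNIV ?B" by (intro continuous_intros cont)
    have fi: "integrable (surface_measure e) \<phi>" if "continuous_on UNIV \<phi>" for \<phi> :: "real^'n \<Rightarrow> real"
      using facet_integrable_cont[of e \<phi>] e that by blast
    have "(LINT x|surface_measure e. ?I e x) \<le> (LINT x|surface_measure e. ?B x)"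
    proof (rule facet_integral_mono[OF D(1,4) cI cB])
      fix x assume x: "x \<in> rel_interior e"
      let ?s = "norm (s (kp e) x) + norm (s (km e) x)" and ?N = "norm (cdot (jp G e x) (nv e))" and ?J = "norm (jp p e x)"
      have n1: "norm (nv e) = 1" unfolding nv_def by (rule facet_normal(1)[OF D(1,4)])
      have "norm (cdot (jp s e x) (nv e)) \<le> norm (jp s e x)" using norm_cdot_le[of "jp s e x" "nv e"] n1 by simp
      also have "\<dots> \<le> ?s" unfolding jp_def by (rule norm_triangle_ineq4)
      finally have js: "norm (cdot (jp s e x) (nv e)) \<le> ?s" .
      have "norm (cdot (av s e x) (nv e)) \<le> norm (av s e x)" using norm_cdot_le[of "av s e x" "nv e"] n1 by simp
      also have "\<dots> = norm (s (kp e) x + s (km e) x) / 2" by (simp add: av_def)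
      also have "\<dots> \<le> ?s" using norm_triangle_ineq[of "s (kp e) x" "s (km e) x"] norm_ge_zero[of "s (kp e) x + s (km e) x"] by linarith
      finally have as: "norm (cdot (av s e x) (nv e)) \<le> ?s" .
      have "- Im (cdot (jp G e x) (nv e) * cnj (cdot (jp s e x) (nv e))) \<le> norm (cdot (jp G e x) (nv e) * cnj (cdot (jp s e x) (nv e)))"
        using abs_Im_le_cmod[of "cdot (jp G e x) (nv e) * cnj (cdot (jp s e x) (nv e))"] by linarith
      from mult_left_mono[OF this, of \<delta>]
      have "- (\<delta> * Im (cdot (jp G e x) (nv e) * cnj (cdot (jp s e x) (nv e)))) \<le> \<delta> * norm (cdot (jp G e x) (nv e) * cnj (cdot (jp s e x) (nv e)))"
        using \<delta> by (simp only: mult_minus_right less_imp_le)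
      also have "\<dots> = \<delta> * ?N * norm (cdot (jp s e x) (nv e))" by (simp add: norm_mult)
      also have "\<dots> \<le> \<delta> * ?N * ?s" using \<delta> by (intro mult_left_mono[OF js]) simp
      also have "\<dots> = ?s * (\<delta> * ?N)" by simp
      also have "\<dots> \<le> \<eta> / m * ?s\<^sup>2 / 2 + (\<delta> * ?N)\<^sup>2 / (2 * (\<eta> / m))" using \<eta>_pos m by (intro Young) simp
      finally have 1: "- (\<delta> * Im (cdot (jp G e x) (nv e) * cnj (cdot (jp s e x) (nv e)))) \<le> \<eta> / m * ?s\<^sup>2 / 2 + ?b * ?N\<^sup>2"
        by (simp add: power_mult_distrib mult_ac)
      have "- (jp p e x \<bullet> cdot (av s e x) (nv e)) \<le> ?J * norm (cdot (av s e x) (nv e))"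
        using Cauchy_Schwarz_ineq2[of "jp p e x" "cdot (av s e x) (nv e)"] by linarith
      also have "\<dots> \<le> ?J * ?s" by (intro mult_left_mono[OF as]) simp
      also have "\<dots> = ?s * ?J" by simp
      also have "\<dots> \<le> \<eta> * ?h * ?s\<^sup>2 / 2 + ?J\<^sup>2 / (2 * (\<eta> * ?h))" using \<eta>_pos h by (intro Young) simp
      finally have 2: "- (jp p e x \<bullet> cdot (av s e x) (nv e)) \<le> \<eta> * ?h * ?s\<^sup>2 / 2 + ?c * ?J\<^sup>2" by (simp add: mult.assoc)
      have "?a * ?s\<^sup>2 \<le> ?a * (2 * ((norm (s (kp e) x))\<^sup>2 + (norm (s (km e) x))\<^sup>2))"
        using \<eta>_pos h m by (intro mult_left_mono sum_power2_le) simp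
      moreover have "c * q / 2 \<le> c * y + c * z" if "c * q \<le> c * (2 * (y + z))" for c q y z :: real
        using that by (simp add: algebra_simps)
      ultimately have "?a * ?s\<^sup>2 / 2 \<le> ?a * (norm (s (kp e) x))\<^sup>2 + ?a * (norm (s (km e) x))\<^sup>2" by blast
      then have "\<eta> / m * ?s\<^sup>2 / 2 + \<eta> * ?h * ?s\<^sup>2 / 2 \<le> ?a * (norm (s (kp e) x))\<^sup>2 + ?a * (norm (s (km e) x))\<^sup>2"
        by (simp only: distrib_right add_divide_distrib)
      with 1 2 show "?I e x \<le> ?B x" by linarith
    qed
    also have "\<dots> = ?a * (LINT x|surface_measure e. (norm (s (kp e) x))\<^sup>2) + (?a * (LINT x|surface_measure e. (norm (s (km e) x))\<^sup>2)
        + (?b * NN e + ?c * JJ e))"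
      unfolding JJ_def NN_def
      by (subst Bochner_Integration.integral_add; (rule fi, intro continuous_intros cont)?; simp only: integral_mult_right_zero)+
    also have "\<dots> \<le> 40 * \<kappa> * \<eta> * S (kp e) + (40 * \<kappa> * \<eta> * S (km e) + (160 * \<kappa> * (\<delta> * m * \<delta>) * NN e + 160 * \<kappa> * (?g * \<beta>) * JJ e))"
    proof -
      have T: "?a * I \<le> 40 * \<kappa> * \<eta> * S" if "I \<le> 20 * \<kappa> / (1 / m) * S" "I \<le> 20 * \<kappa> / ?h * S" for I S
      proof -
        have "\<eta> / m * I \<le> \<eta> / m * (20 * \<kappa> / (1 / m) * S)" "\<eta> * ?h * I \<le> \<eta> * ?h * (20 * \<kappa> / ?h * S)"
          using that \<eta>_pos m h by (auto intro!: mult_left_mono simp del: times_divide_eq_right times_divide_eq_left)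
        moreover have "\<eta> / m * (20 * \<kappa> / (1 / m) * S) = 20 * \<kappa> * \<eta> * S" "\<eta> * ?h * (20 * \<kappa> / ?h * S) = 20 * \<kappa> * \<eta> * S"
          using m h by simp_all
        ultimately show ?thesis unfolding distrib_right by linarith
      qed
      have b: "?b = 160 * \<kappa> * (\<delta> * m * \<delta>)" using \<kappa>_pos by (simp add: \<eta>_def power2_eq_square)
      have "1 / (\<beta> * ?h) \<le> ?g" using \<gamma>\<^sub>1_ge(3)[OF k \<beta> \<delta> e] by simp
      then have "160 * \<kappa> * \<beta> * (1 / (\<beta> * ?h)) \<le> 160 * \<kappa> * \<beta> * ?g" using \<kappa>_pos \<beta> by (intro mult_left_mono) auto
      moreover have "160 * \<kappa> * \<beta> * (1 / (\<beta> * ?h)) = ?c" using \<beta> h \<kappa>_pos by (simp add: \<eta>_def)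
      ultimately have c: "?c \<le> 160 * \<kappa> * (?g * \<beta>)" by (simp add: mult_ac)
      show ?thesis
        unfolding b S_def
        by (intro add_mono T order_refl mult_right_mono[OF c] nonneg
            trace_face[OF D(1,4) pieces_affine[OF s D(1)] hk] trace_face[OF D(2,5) pieces_affine[OF s D(2)] hm]
            trace_face[OF D(1,4) pieces_affine[OF s D(1)] r(3,1)] trace_face[OF D(2,5) pieces_affine[OF s D(2)] r(3,2)])
    qed
    finally show ?thesis by (simp add: algebra_simps)
  qed
  have "FI ?I \<le> (\<Sum>e\<in>interior_faces \<T>. 40 * \<kappa> * \<eta> * (S (kp e) + S (km e)) + (160 * \<kappa> * (\<delta> * m * \<delta>) * NN e + 160 * \<kappa> * (?g * \<beta>) * JJ e))"
    unfolding FI_def by (rule sum_mono) (rule face)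
  also have "\<dots> = 40 * \<kappa> * \<eta> * (\<Sum>e\<in>interior_faces \<T>. S (kp e) + S (km e))
      + (160 * \<kappa> * (\<delta> * m * \<delta>) * (\<Sum>e\<in>interior_faces \<T>. NN e) + 160 * \<kappa> * (?g * \<beta>) * (\<Sum>e\<in>interior_faces \<T>. JJ e))"
    by (simp only: sum.distrib sum_distrib_left[symmetric])
  also have "\<dots> \<le> 40 * \<kappa> * \<eta> * (4 * (\<Sum>K\<in>\<T>. S K))
      + (160 * \<kappa> * (\<delta> * m * \<delta>) * (\<Sum>e\<in>interior_faces \<T>. NN e) + 160 * \<kappa> * (?g * \<beta>) * (\<Sum>e\<in>interior_faces \<T>. JJ e))"
    using \<kappa>_pos \<eta>_pos by (intro add_mono mult_left_mono sum_faces_le nonneg order_refl) auto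
  also have "40 * \<kappa> * \<eta> * (4 * (\<Sum>K\<in>\<T>. S K)) = EI (\<lambda>K x. (norm (s K x))\<^sup>2) / 2"
    using \<kappa>_pos by (simp add: \<eta>_def EI_def S_def)
  finally have F: "FI ?I \<le> EI (\<lambda>K x. (norm (s K x))\<^sup>2) / 2 + (160 * \<kappa> * (\<delta> * m * \<delta>) * (\<Sum>e\<in>interior_faces \<T>. NN e) + 160 * \<kappa> * (?g * \<beta>) * (\<Sum>e\<in>interior_faces \<T>. JJ e))" .
  have "EI (\<lambda>K x. G K x \<bullet> s K x) \<le> EI (\<lambda>K x. (norm (G K x))\<^sup>2 + (1 / 4) * (norm (s K x))\<^sup>2)"
  proof (rule EI_mono)
    fix K x
    have "0 \<le> (norm (G K x) - norm (s K x) / 2)\<^sup>2" by simp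
    then have "norm (G K x) * norm (s K x) \<le> (norm (G K x))\<^sup>2 + (1 / 4) * (norm (s K x))\<^sup>2"
      by (simp add: power2_eq_square algebra_simps)
    then show "G K x \<bullet> s K x \<le> (norm (G K x))\<^sup>2 + (1 / 4) * (norm (s K x))\<^sup>2"
      using norm_cauchy_schwarz[of "G K x" "s K x"] by linarith
  qed (intro continuous_intros cE; assumption)+
  also have "\<dots> = EI (\<lambda>K x. (norm (G K x))\<^sup>2) + EI (\<lambda>K x. (1 / 4) * (norm (s K x))\<^sup>2)"
    by (rule EI_add) (intro continuous_intros cE; assumption)+
  also have "\<dots> = EI (\<lambda>K x. (norm (G K x))\<^sup>2) + (1 / 4) * EI (\<lambda>K x. (norm (s K x))\<^sup>2)" unfolding EI_mult ..
  finally have E: "EI (\<lambda>K x. G K x \<bullet> s K x) \<le> EI (\<lambda>K x. (norm (G K x))\<^sup>2) + EI (\<lambda>K x. (norm (s K x))\<^sup>2) / 4" by simp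
  have I: "EI (\<lambda>K x. (norm (s K x))\<^sup>2) = EI (\<lambda>K x. G K x \<bullet> s K x) + FI ?I"
    using flux_identity[OF sol p s f g] unfolding G_def .
  have q: "160 * \<kappa> * (\<delta> * m * \<delta>) * a + 160 * \<kappa> * (?g * \<beta>) * b = 160 * \<kappa> * (\<delta> * m * (\<delta> * a) + ?g * (\<beta> * b))" for a b
    by (simp add: algebra_simps)
  \<comment> \<open>The gradient term costs a quarter and the face terms a half of the squared flux
    norm; the remaining quarter explains the factor 4.\<close>
  have alg: "t \<le> 4 * (y + q)" if "t = z + i" "i \<le> t / 2 + q" "z \<le> y + t / 4" for t y z i q :: real
    using that by (simp add: field_simps)
  show ?thesis
    using alg[OF I F E] unfolding q JJ_def NN_def FI_def .
qed

text \<open>The root of the constant in \<open>flux_estimate\<close> after inserting the bounds of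
  \<open>DG_estimate\<close>; \<open>C2 R c + 1\<close> bounds the norm of \<open>u\<close> relative
  to \<open>\<gamma>\<^sub>1\<close> M / k, and 160 \<open>\<kappa>\<close> is
  \<open>1 / (2 * \<eta>)\<close>.\<close>

definition C3 :: "real \<Rightarrow> real \<Rightarrow> real" where
  "C3 R c = sqrt (4 * ((C2 R c + 1)\<^sup>2 + 160 * \<kappa> * (C2 R c + 1)))"

lemma C2_nonneg: "R \<ge> 0 \<Longrightarrow> c > 0 \<Longrightarrow> C2 R c \<ge> 0"
  unfolding C2_def using C1_nonneg by simp

lemma C3_pos: "R \<ge> 0 \<Longrightarrow> c > 0 \<Longrightarrow> C3 R c > 0"
  unfolding C3_def using C2_nonneg[of R c] \<kappa>_pos by (simp add: add_pos_nonneg)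

text \<open>The data functional is bounded by M / k times the norm of \<open>u\<close>. Either
  \<open>1 \<le> \<gamma>\<^sub>1\<close> or the explicit factor \<open>\<gamma>\<^sub>1\<close>
  turns M / k into \<open>?t\<close>, so every term of \<open>flux_estimate\<close> becomes a
  multiple of the square of \<open>?t\<close>.\<close>

lemma flux_bound:
  assumes sol: "LDG_solution \<Omega> \<T> k \<beta> \<delta> f g u \<sigma>" and k: "k > 0" and \<beta>: "\<beta> > 0" and \<delta>: "\<delta> > 0"
    and f: "square_integrable (lebesgue_on \<Omega>) f" and g: "square_integrable_\<Gamma> \<Omega> \<T> g"
    and star: "strictly_star_shaped \<Omega> x0 c" and R: "\<And>x. x \<in> closure \<Omega> \<Longrightarrow> norm (x - x0) \<le> R" and R0: "R \<ge> 0"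
  shows "l2_norm (lebesgue_on \<Omega>) \<sigma> \<le> C3 R c * (\<gamma>\<^sub>1 \<T> k \<beta> \<delta> * (1/k)
      * (1 + (\<delta> + 1/k) * Max ((\<lambda>K. 1 / diameter K) ` \<T>)) * data_norm \<Omega> \<T> f g)"
proof -
  obtain p s where p: "pieces u p" and s: "pieces \<sigma> s"
    using sol V_h_pieces \<Sigma>_h_pieces unfolding LDG_solution_def by blast
  have c: "c > 0" and x0: "x0 \<in> \<Omega>" using star by (simp_all add: strictly_star_shaped_def)
  let ?m = "Max ((\<lambda>K. 1 / diameter K) ` \<T>)" and ?g = "\<gamma>\<^sub>1 \<T> k \<beta> \<delta>" and ?M = "data_norm \<Omega> \<T> f g"
  let ?t = "?g * (1 / k) * ?M" and ?D = "C2 R c + 1" and ?N = "DG_norm \<Omega> c \<T> k u"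
  let ?F = "norm (ip (lebesgue_on \<Omega>) f u + ip_\<Gamma> \<Omega> \<T> g (bdry_trace \<Omega> u))"
  note DG = DG_estimate[OF sol k \<beta> \<delta> f g star R R0 p]
  have D: "?D > 0" using C2_nonneg[OF R0 c] by simp
  \<comment> \<open>The maximum is over a nonempty set because the centre \<open>x0\<close> lies in
    some element.\<close>
  have m: "?m \<ge> 0"
  proof -
    have "x0 \<in> \<Union>\<T>" using x0 mesh interior_subset unfolding mesh_of_def by blast
    then obtain K where K: "K \<in> \<T>" by blast
    have "0 \<le> 1 / diameter K" by (simp add: diameter_ge_0 compact_imp_bounded[OF compact_element[OF K]])
    also have "\<dots> \<le> ?m" using K finite_\<T> by (intro Max_ge) auto
    finally show ?thesis .
  qed
  have g1: "?g \<ge> 1" by (rule \<gamma>\<^sub>1_ge(1)[OF k \<beta> \<delta>])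
  have t: "?t \<ge> 0" using g1 k DG(6) by simp
  have Mk: "?M / k \<le> ?t" using mult_right_mono[OF g1, of "1 / k * ?M"] k DG(6) by simp
  have F: "?F \<le> ?M / k * (?D * ?t)"
    using DG(2) mult_left_mono[OF DG(1), of "?M / k"] DG(6) k by simp
  have "EI (\<lambda>K x. (norm (s K x))\<^sup>2) \<le> 4 * (?N\<^sup>2 + 160 * \<kappa> * (\<delta> * ?m * ?F + ?g * ?F))"
    using \<kappa>_pos \<delta> m g1 DG(3-5)
    by (intro order_trans[OF flux_estimate[OF sol k \<beta> \<delta> f g p s]] mult_left_mono add_mono) auto
  also have "\<dots> \<le> 4 * ((?D * ?t)\<^sup>2 + 160 * \<kappa> * (\<delta> * ?m * (?t * (?D * ?t)) + ?t * (?D * ?t)))"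
  proof -
    have 1: "?N\<^sup>2 \<le> (?D * ?t)\<^sup>2" by (intro power_mono DG)
    have "?M / k * (?D * ?t) \<le> ?t * (?D * ?t)" by (rule mult_right_mono[OF Mk mult_nonneg_nonneg[OF less_imp_le[OF D] t]])
    then have 2: "?F \<le> ?t * (?D * ?t)" using F by linarith
    have "?g * ?F \<le> ?g * (?M / k * (?D * ?t))" using g1 F by (intro mult_left_mono) auto
    then have 3: "?g * ?F \<le> ?t * (?D * ?t)" by simp
    show ?thesis using 1 2 3 \<kappa>_pos \<delta> m by (intro mult_left_mono add_mono) auto
  qed
  also have "\<dots> = 4 * (?D\<^sup>2 + 160 * \<kappa> * ?D * (1 + \<delta> * ?m)) * ?t\<^sup>2"
  proof -
    have "4 * ((D * t)\<^sup>2 + 160 * \<kappa> * (m * (t * (D * t)) + t * (D * t))) = 4 * (D\<^sup>2 + 160 * \<kappa> * D * (1 + m)) * t\<^sup>2" for D t m :: real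
      by (simp add: algebra_simps power2_eq_square)
    then show ?thesis .
  qed
  also have "\<dots> \<le> 4 * (?D\<^sup>2 * (1 + \<delta> * ?m) + 160 * \<kappa> * ?D * (1 + \<delta> * ?m)) * ?t\<^sup>2"
  proof -
    have "?D\<^sup>2 * 1 \<le> ?D\<^sup>2 * (1 + \<delta> * ?m)" using \<delta> m by (intro mult_left_mono) auto
    then show ?thesis by (intro mult_right_mono) auto
  qed
  also have "\<dots> = 4 * (?D\<^sup>2 + 160 * \<kappa> * ?D) * ((1 + \<delta> * ?m) * ?t\<^sup>2)" by (simp add: algebra_simps)
  \<comment> \<open>Squares are compared, so \<open>1 + \<delta> * ?m\<close> is enlarged to
    \<open>?w\<close> and then to its square, using \<open>1 \<le> ?w\<close>.\<close>
  also have "\<dots> \<le> 4 * (?D\<^sup>2 + 160 * \<kappa> * ?D) * ((1 + (\<delta> + 1/k) * ?m)\<^sup>2 * ?t\<^sup>2)"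
  proof -
    let ?w = "1 + (\<delta> + 1/k) * ?m"
    have "0 \<le> 1 / k * ?m" using k m by simp
    then have le: "1 + \<delta> * ?m \<le> ?w" by (simp add: distrib_right)
    have "1 \<le> ?w" using \<delta> k m by simp
    then have "?w * 1 \<le> ?w * ?w" by (intro mult_left_mono) auto
    then have "1 + \<delta> * ?m \<le> ?w\<^sup>2" using le by (simp add: power2_eq_square)
    then show ?thesis using D \<kappa>_pos by (intro mult_left_mono mult_right_mono) auto
  qed
  also have "\<dots> = (C3 R c * (?t * (1 + (\<delta> + 1/k) * ?m)))\<^sup>2"
  proof -
    have "(C3 R c)\<^sup>2 = 4 * (?D\<^sup>2 + 160 * \<kappa> * ?D)" unfolding C3_def using D \<kappa>_pos by simp
    then show ?thesis by (simp only: power_mult_distrib mult_ac)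
  qed
  finally have "(l2_norm (lebesgue_on \<Omega>) \<sigma>)\<^sup>2 \<le> (C3 R c * (?t * (1 + (\<delta> + 1/k) * ?m)))\<^sup>2"
    unfolding l2_norm_domain[OF s] .
  moreover have "0 \<le> C3 R c * (?t * (1 + (\<delta> + 1/k) * ?m))"
    unfolding C3_def using D \<kappa>_pos g1 DG(6) \<delta> k m by (intro mult_nonneg_nonneg) auto
  ultimately have "l2_norm (lebesgue_on \<Omega>) \<sigma> \<le> C3 R c * (?t * (1 + (\<delta> + 1/k) * ?m))" by (rule power2_le_imp_le)
  then show ?thesis by (simp only: mult_ac)
qed

end

lemma regular_mesh_of_min_angle:
  fixes \<Omega> :: "(real^'n) set"
  assumes "CARD('n) = 2 \<or> CARD('n) = 3" "mesh_of \<Omega> \<T>" and \<theta>: "0 < \<theta>" "\<theta> \<le> pi / 2" and angle: "\<And>K. K \<in> \<T> \<Longrightarrow> min_angle_ge \<theta> K"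
  shows "regular_mesh \<Omega> \<T> (1 / sin \<theta> ^ 4)"
proof -
  interpret simplicial_mesh \<Omega> \<T> by unfold_locales (use assms in auto)
  have sin: "sin \<theta> > 0" using \<theta> by (intro sin_gt_zero) auto
  show ?thesis
  proof
    show "1 / sin \<theta> ^ 4 > 0" using sin by simp
    fix K a assume K: "K \<in> \<T>" and a: "a \<in> V K"
    interpret simplex23 "V K" using element K by blast
    have "norm (gr a) * (sin \<theta> ^ 4 * diameter K) \<le> 1"
      using gr_norm_diameter[OF _ \<theta> a] angle[OF K] element(2)[OF K] by simp
    then show "norm (gr a) * diameter K \<le> 1 / sin \<theta> ^ 4" using sin by (simp add: pos_le_divide_eq mult_ac)
  qed
qed

text \<open>The constant is built from the angle bound (through \<open>\<kappa>\<close>), a radius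
  \<open>R\<close> of the domain about the star centre, the constant of star-shapedness and the
  dimension; none of these varies with the mesh or the parameters.\<close>

theorem theorem3p1:
  fixes \<Omega> :: "(real^'n) set" and x\<^sub>\<Omega> :: "real^'n" and c\<^sub>\<Omega> :: real
    and H :: "real set" and \<T> :: "real \<Rightarrow> (real^'n) set set"
  assumes "CARD('n) = 2 \<or> CARD('n) = 3"
    and "open \<Omega>" and "connected \<Omega>" and "bounded \<Omega>"
    and "strictly_star_shaped \<Omega> x\<^sub>\<Omega> c\<^sub>\<Omega>"
    and "H \<subseteq> {0<..}"
    and "\<forall>h\<in>H. mesh_of \<Omega> (\<T> h) \<and> mesh_size (\<T> h) = h"
    and "minimal_angle_condition (\<T> ` H)"
  shows "\<exists>C>0. \<forall>h\<in>H. \<forall>k>0. \<forall>\<beta>>0. \<forall>\<delta>>0. \<forall>f g u \<sigma>.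
      square_integrable (lebesgue_on \<Omega>) f \<longrightarrow>
      square_integrable_\<Gamma> \<Omega> (\<T> h) g \<longrightarrow>
      LDG_solution \<Omega> (\<T> h) k \<beta> \<delta> f g u \<sigma> \<longrightarrow>
        DG_norm \<Omega> c\<^sub>\<Omega> (\<T> h) k u \<le> C * (\<gamma>\<^sub>1 (\<T> h) k \<beta> \<delta> * (1/k) * data_norm \<Omega> (\<T> h) f g)
      \<and> l2_norm (lebesgue_on \<Omega>) \<sigma> \<le> C * (\<gamma>\<^sub>1 (\<T> h) k \<beta> \<delta> * (1/k)
           * (1 + (\<delta> + 1/k) * Max ((\<lambda>K. 1 / diameter K) ` \<T> h)) * data_norm \<Omega> (\<T> h) f g)"
proof -
  obtain \<theta>0 where \<theta>0: "\<theta>0 > 0" "\<And>h K. h \<in> H \<Longrightarrow> K \<in> \<T> h \<Longrightarrow> min_angle_ge \<theta>0 K"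
    using assms(8) unfolding minimal_angle_condition_def by blast
  \<comment> \<open>The bound is capped at a right angle, where the cosine is still nonnegative, as
    the height estimates require.\<close>
  define \<theta> where "\<theta> = min \<theta>0 (pi / 2)"
  have \<theta>: "0 < \<theta>" "\<theta> \<le> pi / 2" "\<theta> \<le> \<theta>0" using \<theta>0(1) by (auto simp: \<theta>_def)
  define \<kappa> where "\<kappa> = 1 / sin \<theta> ^ 4"
  have reg: "regular_mesh \<Omega> (\<T> h) \<kappa>" if "h \<in> H" for h
    unfolding \<kappa>_def using assms(1,7) that min_angle_ge_mono[OF \<theta>0(2) \<theta>(3)] \<theta>
    by (intro regular_mesh_of_min_angle) auto
  obtain R where R: "\<And>x. x \<in> closure \<Omega> \<Longrightarrow> dist x\<^sub>\<Omega> x \<le> R"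
    using bounded_closure[OF assms(4)] bounded_any_center[of "closure \<Omega>" x\<^sub>\<Omega>] by blast
  have x0: "x\<^sub>\<Omega> \<in> \<Omega>" and c: "c\<^sub>\<Omega> > 0" using assms(5) by (simp_all add: strictly_star_shaped_def)
  have R0: "R \<ge> 0" using R[of x\<^sub>\<Omega>] x0 closure_subset by fastforce
  have R: "norm (x - x\<^sub>\<Omega>) \<le> R" if "x \<in> closure \<Omega>" for x using R[OF that] by (simp add: dist_norm norm_minus_commute)
  \<comment> \<open>Outside the locale these constants depend on \<open>\<kappa>\<close>, the
    dimension and their two real arguments but not on the mesh, so one value serves all
    \<open>h\<close>.\<close>
  let ?D1 = "regular_mesh.C2 TYPE('n) \<kappa> R c\<^sub>\<Omega> + 1" and ?D2 = "regular_mesh.C3 TYPE('n) \<kappa> R c\<^sub>\<Omega>"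
  have mono: "y \<le> max 1 (max ?D1 ?D2) * x" if "0 \<le> y" "y \<le> D * x" "0 < D" "D \<le> max ?D1 ?D2" for x y D :: real
  proof -
    have "0 \<le> D * x" using that by linarith
    then have "0 \<le> x" using that by (simp add: zero_le_mult_iff)
    then have "D * x \<le> max 1 (max ?D1 ?D2) * x" using that by (intro mult_right_mono) auto
    then show ?thesis using that by linarith
  qed
  show ?thesis
  proof (intro exI[of _ "max 1 (max ?D1 ?D2)"] conjI ballI allI impI)
    show "max 1 (max ?D1 ?D2) > 0" by simp
    fix h k \<beta> \<delta> f g u \<sigma>
    assume h: "h \<in> H" and k: "(k::real) > 0" and \<beta>: "(\<beta>::real) > 0" and \<delta>: "(\<delta>::real) > 0"
      and f: "square_integrable (lebesgue_on \<Omega>) f" and g: "square_integrable_\<Gamma> \<Omega> (\<T> h) g"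
      and sol: "LDG_solution \<Omega> (\<T> h) k \<beta> \<delta> f g u \<sigma>"
    interpret regular_mesh \<Omega> "\<T> h" \<kappa> by (rule reg[OF h])
    obtain p where p: "pieces u p" using sol V_h_pieces unfolding LDG_solution_def by blast
    note DG = DG_estimate[OF sol k \<beta> \<delta> f g assms(5) R R0 p]
    show "DG_norm \<Omega> c\<^sub>\<Omega> (\<T> h) k u \<le> max 1 (max ?D1 ?D2) * (\<gamma>\<^sub>1 (\<T> h) k \<beta> \<delta> * (1/k) * data_norm \<Omega> (\<T> h) f g)"
      using C2_nonneg[OF R0 c] by (intro mono[OF DG(7,1)]) auto
    show "l2_norm (lebesgue_on \<Omega>) \<sigma> \<le> max 1 (max ?D1 ?D2) * (\<gamma>\<^sub>1 (\<T> h) k \<beta> \<delta> * (1/k)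
           * (1 + (\<delta> + 1/k) * Max ((\<lambda>K. 1 / diameter K) ` \<T> h)) * data_norm \<Omega> (\<T> h) f g)"
      using C3_pos[OF R0 c] by (intro mono[OF l2_norm_nonneg flux_bound[OF sol k \<beta> \<delta> f g assms(5) R R0]]) auto
  qed
qed

end
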